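(* Let $\Omega\subset\mathbb{C}$ be an open set. Then the following are equivalent: (1) $\bar\partial$ has closed range in $L^{2}(\Omega)$. (2) The Poincaré–Dirichlet inequality holds on $\Omega$, i.e., there exists a constant $C>0$ such that $\|v\|_{L^{2}(\Omega)}\leq C\|\nabla v\|_{L^{2}(\Omega)}$ for all $v\in H^{1}_{0}(\Omega)$. (3) $\rho_{\operatorname{cap}}(\Omega)<\infty$, where $\rho_{\operatorname{cap}}(\Omega)$ is the capacity inradius of $\Omega$. (4) There exist a bounded function $\varphi\in\mathcal{C}^{\infty}(\Omega)$ and a constant $c>0$ such that $\triangle\varphi(z)>c$ holds for all $z\in\Omega$.
   Context: All $L^2$ spaces are with respect to Lebesgue measure on $\mathbb{C}\cong\mathbb{R}^2$. The operator $\bar\partial$ on $\Omega$ is the maximal $L^2$-extension of $\partial/\partial\bar z$ (identifying $(0,1)$-forms with functions): its domain is $\operatorname{Dom}(\bar\partial)=\{u\in L^{2}(\Omega): u_{\bar z}\in L^{2}(\Omega)\text{ in the sense of distributions}\}$ and $\bar\partial u=u_{\bar z}$. "$\bar\partial$ has closed range in $L^2(\Omega)$" means that the set $\{\bar\partial u:u\in\operatorname{Dom}(\bar\partial)\}$ is closed in $L^2(\Omega)$. $H^{1}_{0}(\Omega)$ is the closure of $\mathcal{C}^{\infty}_{c}(\Omega)$ with respect to the norm $\|f\|_{H^{1}(\Omega)}=(\|f\|_{L^{2}(\Omega)}^{2}+\|\nabla f\|_{L^{2}(\Omega)}^{2})^{1/2}$. For a finite Borel measure $\mu$ with compact support in $\mathbb{C}$,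 the energy is $I_{\mu}=\int_{\mathbb{C}}\int_{\mathbb{C}}\ln|z-w|\,d\mu(w)\,d\mu(z)\in[-\infty,\infty)$. The logarithmic capacity of a set $E\subset\mathbb{C}$ is $\operatorname{cap}(E)=\sup_{\mu}e^{I_{\mu}}$, the supremum being over all Borel probability measures $\mu$ with compact support contained in $E$ (with $e^{-\infty}=0$ and $\operatorname{cap}(\emptyset)=0$). Write $\mathbb{D}(z,R)$ for the open disc with center $z$ and radius $R$, and $\Omega^{c}=\mathbb{C}\setminus\Omega$. The capacity inradius of $\Omega$ is $$\rho_{\operatorname{cap}}(\Omega)=\sup\{R\geq0:\ \forall\,\delta>0\ \exists\, z\in\mathbb{C}\text{ such that }\operatorname{cap}(\mathbb{D}(z,R)\cap\Omega^{c})<\delta\}.$$ *)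

theory Defs
  imports "HOL-Analysis.Analysis" "HOL-Probability.Probability_Measure"
begin

section \<open>Smooth functions and test functions\<close>

definition partial_deriv ::
    "'a::real_normed_vector \<Rightarrow> ('a \<Rightarrow> 'b::real_normed_vector) \<Rightarrow> 'a \<Rightarrow> 'b" where
  "partial_deriv v f = (\<lambda>x. frechet_derivative f (at x) v)"

text \<open>For an open subset \<open>S\<close> of a finite-dimensional space this is the class of \<open>k\<close> times
  continuously differentiable functions on \<open>S\<close>.\<close>

primrec C_k_on ::
    "nat \<Rightarrow> ('a::real_normed_vector \<Rightarrow> 'b::real_normed_vector) \<Rightarrow> 'a set \<Rightarrow> bool" where
  "C_k_on 0 f S \<longleftrightarrow> continuous_on S f"
| "C_k_on (Suc k) f S \<longleftrightarrow>
     (\<forall>x\<in>S. f differentiable (at x)) \<and> (\<forall>v. C_k_on k (partial_deriv v f) S)"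

definition smooth_on ::
    "('a::real_normed_vector \<Rightarrow> 'b::real_normed_vector) \<Rightarrow> 'a set \<Rightarrow> bool" where
  "smooth_on f S \<longleftrightarrow> (\<forall>k. C_k_on k f S)"

definition laplacian :: "(complex \<Rightarrow> 'b::real_normed_vector) \<Rightarrow> complex \<Rightarrow> 'b" where
  "laplacian f z =
     partial_deriv 1 (partial_deriv 1 f) z + partial_deriv \<i> (partial_deriv \<i> f) z"

text \<open>The space \<open>C\<^sub>c\<^sup>\<infinity>(\<Omega>)\<close>; its elements are regarded as functions on the whole plane, extended
  by zero.\<close>

definition test_functions :: "complex set \<Rightarrow> (complex \<Rightarrow> complex) set" where
  "test_functions \<Omega> = {\<phi>. smooth_on \<phi> UNIV \<and>
     compact (closure {z. \<phi> z \<noteq> 0}) \<and> closure {z. \<phi> z \<noteq> 0} \<subseteq> \<Omega>}"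


section \<open>Function spaces\<close>

text \<open>Elements of \<open>L\<^sup>2(\<Omega>)\<close> are represented by functions instead of classes modulo equality almost
  everywhere on \<open>\<Omega>\<close> (values outside \<open>\<Omega>\<close> are irrelevant), so the norms below are seminorms
  on the representatives. A set of representatives that is saturated, i.e. a union of
  classes, is closed in the topology below iff the set of classes is closed in the
  quotient.\<close>

definition seminorm_open ::
    "('a \<Rightarrow> complex) set \<Rightarrow> (('a \<Rightarrow> complex) \<Rightarrow> real) \<Rightarrow> ('a \<Rightarrow> complex) set \<Rightarrow> bool" where
  "seminorm_open V N U \<longleftrightarrow>
     U \<subseteq> V \<and> (\<forall>f\<in>U. \<exists>\<epsilon>>0. \<forall>g\<in>V. N (\<lambda>z. g z - f z) < \<epsilon> \<longrightarrow> g \<in> U)"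

definition seminorm_topology ::
    "('a \<Rightarrow> complex) set \<Rightarrow> (('a \<Rightarrow> complex) \<Rightarrow> real) \<Rightarrow> ('a \<Rightarrow> complex) topology" where
  "seminorm_topology V N = topology (seminorm_open V N)"

lemma istopology_seminorm_open: "istopology (seminorm_open V N)"
  unfolding istopology_def
proof (intro conjI allI impI)
  fix S T
  assume S: "seminorm_open V N S" and T: "seminorm_open V N T"
  show "seminorm_open V N (S \<inter> T)"
    unfolding seminorm_open_def
  proof (intro conjI ballI)
    show "S \<inter> T \<subseteq> V"
      using S by (auto simp: seminorm_open_def)
  next
    fix f assume f: "f \<in> S \<inter> T"
    from S f obtain a where a: "a > 0" "\<And>g. g \<in> V \<Longrightarrow> N (\<lambda>z. g z - f z) < a \<Longrightarrow> g \<in> S"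
      unfolding seminorm_open_def by blast
    from T f obtain b where b: "b > 0" "\<And>g. g \<in> V \<Longrightarrow> N (\<lambda>z. g z - f z) < b \<Longrightarrow> g \<in> T"
      unfolding seminorm_open_def by blast
    show "\<exists>\<epsilon>>0. \<forall>g\<in>V. N (\<lambda>z. g z - f z) < \<epsilon> \<longrightarrow> g \<in> S \<inter> T"
      by (rule exI[of _ "min a b"]) (use a b in auto)
  qed
next
  fix \<K> assume "\<forall>K\<in>\<K>. seminorm_open V N K"
  then show "seminorm_open V N (\<Union>\<K>)"
    unfolding seminorm_open_def by (safe; meson UnionI in_mono)
qed

lemma openin_seminorm_topology: "openin (seminorm_topology V N) = seminorm_open V N"
  unfolding seminorm_topology_def by (rule topology_inverse'[OF istopology_seminorm_open])

lemma topspace_seminorm_topology: "topspace (seminorm_topology V N) = V"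
proof -
  have "seminorm_open V N V"
    unfolding seminorm_open_def by (auto intro: exI[of _ 1])
  then show ?thesis
    unfolding topspace_def openin_seminorm_topology
    by (metis (no_types, lifting) Sup_eqI mem_Collect_eq seminorm_open_def)
qed

definition L2 :: "complex set \<Rightarrow> (complex \<Rightarrow> complex) set" where
  "L2 \<Omega> = {u. u \<in> borel_measurable (lebesgue_on \<Omega>) \<and>
              integrable (lebesgue_on \<Omega>) (\<lambda>z. (norm (u z))\<^sup>2)}"

definition L2_norm :: "complex set \<Rightarrow> (complex \<Rightarrow> complex) \<Rightarrow> real" where
  "L2_norm \<Omega> u = sqrt (integral\<^sup>L (lebesgue_on \<Omega>) (\<lambda>z. (norm (u z))\<^sup>2))"

abbreviation L2_topology :: "complex set \<Rightarrow> (complex \<Rightarrow> complex) topology" where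
  "L2_topology \<Omega> \<equiv> seminorm_topology (L2 \<Omega>) (L2_norm \<Omega>)"

text \<open>Distributional derivatives. The two predicates below are only meaningful for locally
  integrable \<open>u\<close> and \<open>g\<close>, and are only used for members of \<open>L2 \<Omega>\<close>.\<close>

definition has_weak_partial ::
    "complex set \<Rightarrow> complex \<Rightarrow> (complex \<Rightarrow> complex) \<Rightarrow> (complex \<Rightarrow> complex) \<Rightarrow> bool" where
  "has_weak_partial \<Omega> b u g \<longleftrightarrow> (\<forall>\<phi>\<in>test_functions \<Omega>.
     integral\<^sup>L (lebesgue_on \<Omega>) (\<lambda>z. u z * partial_deriv b \<phi> z) =
     - integral\<^sup>L (lebesgue_on \<Omega>) (\<lambda>z. g z * \<phi> z))"

text \<open>The weak partial derivative is unique up to equality almost everywhere on \<open>\<Omega>\<close>.\<close>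

definition weak_partial ::
    "complex set \<Rightarrow> complex \<Rightarrow> (complex \<Rightarrow> complex) \<Rightarrow> complex \<Rightarrow> complex" where
  "weak_partial \<Omega> b u = (SOME g. g \<in> L2 \<Omega> \<and> has_weak_partial \<Omega> b u g)"

definition H1 :: "complex set \<Rightarrow> (complex \<Rightarrow> complex) set" where
  "H1 \<Omega> = {u \<in> L2 \<Omega>. \<forall>b\<in>{1, \<i>}. \<exists>g\<in>L2 \<Omega>. has_weak_partial \<Omega> b u g}"

definition grad_norm :: "complex set \<Rightarrow> (complex \<Rightarrow> complex) \<Rightarrow> real" where
  "grad_norm \<Omega> u =
     sqrt ((L2_norm \<Omega> (weak_partial \<Omega> 1 u))\<^sup>2 + (L2_norm \<Omega> (weak_partial \<Omega> \<i> u))\<^sup>2)"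

definition H1_norm :: "complex set \<Rightarrow> (complex \<Rightarrow> complex) \<Rightarrow> real" where
  "H1_norm \<Omega> u = sqrt ((L2_norm \<Omega> u)\<^sup>2 + (grad_norm \<Omega> u)\<^sup>2)"

definition H10 :: "complex set \<Rightarrow> (complex \<Rightarrow> complex) set" where
  "H10 \<Omega> = seminorm_topology (H1 \<Omega>) (H1_norm \<Omega>) closure_of test_functions \<Omega>"


section \<open>The Cauchy-Riemann operator\<close>

definition dbar :: "(complex \<Rightarrow> complex) \<Rightarrow> complex \<Rightarrow> complex" where
  "dbar \<phi> z = (partial_deriv 1 \<phi> z + \<i> * partial_deriv \<i> \<phi> z) / 2"

definition has_weak_dbar ::
    "complex set \<Rightarrow> (complex \<Rightarrow> complex) \<Rightarrow> (complex \<Rightarrow> complex) \<Rightarrow> bool" where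
  "has_weak_dbar \<Omega> u g \<longleftrightarrow> (\<forall>\<phi>\<in>test_functions \<Omega>.
     integral\<^sup>L (lebesgue_on \<Omega>) (\<lambda>z. u z * dbar \<phi> z) =
     - integral\<^sup>L (lebesgue_on \<Omega>) (\<lambda>z. g z * \<phi> z))"

definition Dom_dbar :: "complex set \<Rightarrow> (complex \<Rightarrow> complex) set" where
  "Dom_dbar \<Omega> = {u \<in> L2 \<Omega>. \<exists>g\<in>L2 \<Omega>. has_weak_dbar \<Omega> u g}"

definition range_dbar :: "complex set \<Rightarrow> (complex \<Rightarrow> complex) set" where
  "range_dbar \<Omega> = {g \<in> L2 \<Omega>. \<exists>u\<in>Dom_dbar \<Omega>. has_weak_dbar \<Omega> u g}"

definition dbar_closed_range :: "complex set \<Rightarrow> bool" where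
  "dbar_closed_range \<Omega> \<longleftrightarrow> closedin (L2_topology \<Omega>) (range_dbar \<Omega>)"

definition poincare_dirichlet :: "complex set \<Rightarrow> bool" where
  "poincare_dirichlet \<Omega> \<longleftrightarrow> (\<exists>C>0. \<forall>v\<in>H10 \<Omega>. L2_norm \<Omega> v \<le> C * grad_norm \<Omega> v)"


section \<open>Logarithmic capacity\<close>

text \<open>The library has \<open>ln 0 = 0\<close> on the reals, but the energy needs \<open>ln 0 = -\<infinity>\<close>.
  Only used for nonnegative arguments.\<close>

definition ext_ln :: "real \<Rightarrow> ereal" where
  "ext_ln x = (if x = 0 then -\<infinity> else ereal (ln x))"

definition ext_exp :: "ereal \<Rightarrow> ennreal" where
  "ext_exp x = (if x = \<infinity> then \<infinity> else if x = -\<infinity> then 0 else ennreal (exp (real_of_ereal x)))"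

text \<open>Positive part minus negative part; note that \<open>e2ennreal\<close> sends negative numbers to \<open>0\<close>.
  In the energy of a finite measure with compact support, the integrands are bounded above
  on the support, so that the indeterminate form \<open>\<infinity> - \<infinity>\<close> does not arise.\<close>

definition ext_integral :: "'a measure \<Rightarrow> ('a \<Rightarrow> ereal) \<Rightarrow> ereal" where
  "ext_integral \<mu> f =
     enn2ereal (\<integral>\<^sup>+ x. e2ennreal (f x) \<partial>\<mu>) - enn2ereal (\<integral>\<^sup>+ x. e2ennreal (- f x) \<partial>\<mu>)"

definition log_energy :: "complex measure \<Rightarrow> ereal" where
  "log_energy \<mu> = ext_integral \<mu> (\<lambda>z. ext_integral \<mu> (\<lambda>w. ext_ln (cmod (z - w))))"

definition measure_support :: "'a::topological_space measure \<Rightarrow> 'a set" where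
  "measure_support \<mu> = {x. \<forall>U. open U \<and> x \<in> U \<longrightarrow> emeasure \<mu> U > 0}"

definition compact_prob_measures :: "complex set \<Rightarrow> complex measure set" where
  "compact_prob_measures E = {\<mu>. prob_space \<mu> \<and> sets \<mu> = sets borel \<and>
     compact (measure_support \<mu>) \<and> measure_support \<mu> \<subseteq> E}"

text \<open>The capacity of an unbounded set may be infinite. In \<^typ>\<open>ennreal\<close>, the supremum of
  the empty set is \<open>0\<close>.\<close>

definition log_cap :: "complex set \<Rightarrow> ennreal" where
  "log_cap E = (SUP \<mu>\<in>compact_prob_measures E. ext_exp (log_energy \<mu>))"

definition capacity_inradius :: "complex set \<Rightarrow> ennreal" where
  "capacity_inradius \<Omega> =
     (SUP R\<in>{R::real. R \<ge> 0 \<and> (\<forall>\<delta>::real>0. \<exists>z. log_cap (ball z R \<inter> - \<Omega>) < ennreal \<delta>)}. ennreal R)"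

end

theory Submission
  imports Defs "HOL-Probability.Probability" "HOL-Complex_Analysis.Complex_Analysis" "HOL-Real_Asymp.Real_Asymp"
begin

text \<open>All conditions are compared with the Poincare inequality on test functions.
  If it holds, minimizing \<open>\<parallel>dbar \<phi>\<parallel>\<^sup>2 - 2 Re \<integral> g \<phi>\<close> solves \<open>dbar u = g\<close> weakly for every \<open>g \<in> L\<^sup>2\<close>, as
  \<open>dbar\<close> and the gradient have proportional norms on test functions. Conversely, by Cauchy
  transforms the range contains enough test functions for a gliding hump argument.
  A bounded \<open>\<phi>\<close> with \<open>\<triangle>\<phi> > c\<close> gives the inequality by integrating the divergence of \<open>exp \<phi> |v|\<^sup>2 grad \<phi>\<close>.
  If the capacity inradius is finite, every disc of some fixed radius \<open>R\<close> meets the complement in a set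
  carrying a measure of bounded energy; its potential yields a bounded subharmonic bump on \<open>\<Omega>\<close>, strictly
  subharmonic near the disc and supported in a larger one, and these bumps are summed over a lattice.
  If the complement has tiny capacity in a large disc, Leja points provide a monic polynomial that is tiny on
  it; cutting off with a function of \<open>ln |p|\<close> gives a test function of bounded Dirichlet energy and
  large \<open>L\<^sup>2\<close> norm.\<close>

section \<open>Calculus of the classes \<open>C_k_on\<close>\<close>

text \<open>Three features shape the argument. In the plane the Dirichlet integral is scale
  invariant, while the squared L2 norm gains a factor R^2 under dilation by R. Cut-offs on large
  discs thus have bounded energy, and an obstacle inside the disc is harmless only if the Dirichlet
  integral hardly sees it, which is what small logarithmic capacity means. Next, a Cauchy transform
  decays in general only like 1/|z|, which just fails to be square integrable at infinity; this
  forces the correction to mean zero when \<Omega> has infinite area. Finally, capacity is used only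
  through the existence or absence of measures of bounded energy, and potentials only off the
  supports, where they are harmonic. One profile b, \<open>exp (- 1 / t)\<close> for positive t,
  serves every cut-off. It is flat at 0; it is increasing and convex up to t = 1/2, so composition
  preserves a nonnegative Laplacian; and b'^2 <= 4 b'' up to t = 3/8, which closes the energy
  estimate for the polynomial cut-off. In that estimate R is fixed by the Poincare constant before
  the logarithmic smallness L of the polynomial is chosen.\<close>

lemma partial_deriv_eq: "(f has_derivative D) (at x) \<Longrightarrow> partial_deriv v f x = D v"
  unfolding partial_deriv_def by (metis frechet_derivative_at)

lemma has_derivative_partial_deriv:
  "f differentiable (at x) \<Longrightarrow> (f has_derivative (\<lambda>v. partial_deriv v f x)) (at x)"
  unfolding partial_deriv_def by (simp add: frechet_derivative_works)

lemma has_derivative_cong_open: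
  assumes "open S" "x \<in> S" "\<And>y. y \<in> S \<Longrightarrow> f y = g y"
  shows "(f has_derivative D) (at x) \<longleftrightarrow> (g has_derivative D) (at x)"
  using assms by (metis has_derivative_transform_within_open)

lemma partial_deriv_cong_open:
  assumes "open S" "x \<in> S" "\<And>y. y \<in> S \<Longrightarrow> f y = g y"
  shows "partial_deriv v f x = partial_deriv v g x"
  unfolding partial_deriv_def frechet_derivative_def
  using has_derivative_cong_open[OF assms] by simp

lemma partial_deriv_const [simp]: "partial_deriv v (\<lambda>x. c) = (\<lambda>x. 0)"
  by (rule ext, subst partial_deriv_eq[OF has_derivative_const]) simp

lemma C_k_on_cong:
  assumes "open S" "\<And>x. x \<in> S \<Longrightarrow> f x = g x" "C_k_on k f S"
  shows "C_k_on k g S"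
  using assms
proof (induction k arbitrary: f g)
  case 0
  then show ?case by (simp cong: continuous_on_cong)
next
  case (Suc k)
  have "g differentiable at x" if x: "x \<in> S" for x
  proof -
    obtain D where "(f has_derivative D) (at x)"
      using Suc.prems(3) x by (auto simp: differentiable_def)
    then have "(g has_derivative D) (at x)"
      using has_derivative_cong_open[of S x f g D] Suc.prems(1,2) x by simp
    then show ?thesis by (auto simp: differentiable_def)
  qed
  moreover have "C_k_on k (partial_deriv v g) S" for v
    by (rule Suc.IH[of "partial_deriv v f"])
      (use Suc.prems in \<open>auto intro: partial_deriv_cong_open\<close>)
  ultimately show ?case by simp
qed

lemma C_k_on_subset: "C_k_on k f S \<Longrightarrow> T \<subseteq> S \<Longrightarrow> C_k_on k f T"
  by (induction k arbitrary: f) (auto intro: continuous_on_subset)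

lemma C_k_on_Suc_D: "C_k_on (Suc k) f S \<Longrightarrow> C_k_on k f S"
proof (induction k arbitrary: f)
  case 0
  then show ?case
    by (auto intro!: continuous_at_imp_continuous_on differentiable_imp_continuous_within)
qed auto

lemma C_k_on_mono: "C_k_on m f S \<Longrightarrow> k \<le> m \<Longrightarrow> C_k_on k f S"
  by (induction m rule: nat.induct) (auto simp: le_Suc_eq dest: C_k_on_Suc_D simp del: C_k_on.simps)

lemma C_k_on_imp_continuous_on: "C_k_on k f S \<Longrightarrow> continuous_on S f"
  using C_k_on_mono[of k f S 0] by simp

text \<open>Differentiability and continuity are local. This glues functions given by different
  formulas on overlapping open sets, such as a field extended by zero across the boundary of its
  support.\<close>

lemma C_k_on_local:
  assumes "\<And>x. x \<in> S \<Longrightarrow> \<exists>T. open T \<and> x \<in> T \<and> C_k_on k f T"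
  shows "C_k_on k f S"
  using assms
proof (induction k arbitrary: f)
  case 0
  then show ?case
    unfolding C_k_on.simps by (meson continuous_at_imp_continuous_on continuous_on_eq_continuous_at)
next
  case (Suc k)
  have "f differentiable at x" if "x \<in> S" for x
    using Suc.prems[OF that] by auto
  moreover have "C_k_on k (partial_deriv v f) S" for v
    by (rule Suc.IH) (use Suc.prems in fastforce)
  ultimately show ?case by simp
qed

lemma C_k_on_SucI:
  assumes "open S" "\<And>x. x \<in> S \<Longrightarrow> (f has_derivative D x) (at x)" "\<And>v. C_k_on k (\<lambda>x. D x v) S"
  shows "C_k_on (Suc k) f S"
proof -
  have "C_k_on k (partial_deriv v f) S" for v
    by (rule C_k_on_cong[OF assms(1) _ assms(3)]) (simp add: partial_deriv_eq[OF assms(2)])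
  then show ?thesis using assms(2) by (auto simp: differentiable_def)
qed

lemma C_k_on_const: "C_k_on k (\<lambda>x. c) S"
  by (induction k arbitrary: c) auto

lemma C_k_on_bounded_linear:
  assumes L: "bounded_linear L" and S: "open S" and f: "C_k_on k f S"
  shows "C_k_on k (\<lambda>x. L (f x)) S"
  using f
proof (induction k arbitrary: f)
  case 0
  then show ?case by (simp add: bounded_linear.continuous_on[OF L])
next
  case (Suc k)
  have d: "((\<lambda>x. L (f x)) has_derivative (\<lambda>v. L (partial_deriv v f x))) (at x)" if "x \<in> S" for x
    using Suc.prems that
    by (intro bounded_linear.has_derivative[OF L] has_derivative_partial_deriv) auto
  show ?case
    by (rule C_k_on_SucI[OF S d]) (use Suc in auto)
qed

lemma C_k_on_add:
  assumes S: "open S" and "C_k_on k f S" "C_k_on k g S"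
  shows "C_k_on k (\<lambda>x. f x + g x) S"
  using assms(2,3)
proof (induction k arbitrary: f g)
  case 0
  then show ?case by (simp add: continuous_on_add)
next
  case (Suc k)
  have d: "((\<lambda>x. f x + g x) has_derivative (\<lambda>v. partial_deriv v f x + partial_deriv v g x)) (at x)"
    if "x \<in> S" for x
    using Suc.prems that
    by (intro has_derivative_add has_derivative_partial_deriv) auto
  show ?case
    by (rule C_k_on_SucI[OF S d]) (use Suc in auto)
qed

lemma C_k_on_bilinear:
  assumes B: "bounded_bilinear B" and S: "open S" and "C_k_on k f S" "C_k_on k g S"
  shows "C_k_on k (\<lambda>x. B (f x) (g x)) S"
  using assms(3,4)
proof (induction k arbitrary: f g)
  case 0
  then show ?case by (simp add: bounded_bilinear.continuous_on[OF B])
next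
  case (Suc k)
  have d: "((\<lambda>x. B (f x) (g x)) has_derivative
      (\<lambda>v. B (f x) (partial_deriv v g x) + B (partial_deriv v f x) (g x))) (at x)"
    if "x \<in> S" for x
    using Suc.prems that
    by (intro bounded_bilinear.FDERIV[OF B] has_derivative_partial_deriv) auto
  have "C_k_on k f S" "C_k_on k g S"
    using Suc.prems by (blast dest: C_k_on_Suc_D)+
  with Suc show ?case
    by (intro C_k_on_SucI[OF S d] C_k_on_add[OF S]) auto
qed

lemmas C_k_on_mult = C_k_on_bilinear[OF bounded_bilinear_mult]
lemmas C_k_on_scaleR = C_k_on_bilinear[OF bounded_bilinear_scaleR]
lemmas C_k_on_of_real = C_k_on_bounded_linear[OF bounded_linear_of_real]

lemma C_k_on_cmult:
  fixes c :: "'b::real_normed_algebra"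
  shows "open S \<Longrightarrow> C_k_on k f S \<Longrightarrow> C_k_on k (\<lambda>x. c * f x) S"
  by (intro C_k_on_mult C_k_on_const)

lemma C_k_on_diff:
  assumes "open S" "C_k_on k f S" "C_k_on k g S"
  shows "C_k_on k (\<lambda>x. f x - g x) S"
  using C_k_on_add[OF assms(1,2) C_k_on_bounded_linear[OF bounded_linear_minus[OF bounded_linear_ident]
      assms(1,3)]] by simp

lemma C_k_on_sum:
  assumes "open S" "\<And>i. i \<in> I \<Longrightarrow> C_k_on k (f i) S"
  shows "C_k_on k (\<lambda>x. \<Sum>i\<in>I. f i x) S"
  using assms(2) by (induction I rule: infinite_finite_induct)
    (auto intro!: C_k_on_add C_k_on_const assms(1))

lemma C_k_on_id: "C_k_on k (\<lambda>x. x) S"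
proof (cases k)
  case (Suc m)
  have "partial_deriv v (\<lambda>x::'a. x) = (\<lambda>x. v)" for v
    by (rule ext, rule partial_deriv_eq[OF has_derivative_ident])
  with Suc show ?thesis by (auto intro: C_k_on_const)
qed (simp add: continuous_on_id)

lemma partial_deriv_comp_real:
  fixes f :: "'a::real_normed_vector \<Rightarrow> real" and b :: "real \<Rightarrow> real"
  assumes "f differentiable (at x)" "(b has_real_derivative d) (at (f x))"
  shows "((\<lambda>x. b (f x)) has_derivative (\<lambda>v. d * partial_deriv v f x)) (at x)"
  using has_derivative_compose[OF has_derivative_partial_deriv[OF assms(1)]
      assms(2)[unfolded has_field_derivative_def]] by simp

lemma partial_deriv_real:
  fixes b :: "real \<Rightarrow> real"
  assumes "(b has_real_derivative d) (at t)"
  shows "partial_deriv v b t = d * v"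
  using partial_deriv_eq[OF assms[unfolded has_field_derivative_def]] by simp

text \<open>The induction runs over all outer functions at once, because the chain rule replaces
  \<open>b\<close> by its derivative and keeps \<open>f\<close>. As the argument of \<open>b\<close>
  is real, \<open>partial_deriv 1 b\<close> determines the whole derivative.\<close>

lemma C_k_on_real_comp:
  fixes f :: "'a::real_normed_vector \<Rightarrow> real" and b :: "real \<Rightarrow> real"
  assumes S: "open S" and f: "C_k_on k f S" and b: "C_k_on k b T" and fT: "f ` S \<subseteq> T"
  shows "C_k_on k (\<lambda>x. b (f x)) S"
  using b f
proof (induction k arbitrary: b)
  case 0
  then show ?case using fT by (auto intro: continuous_on_compose2)
next
  case (Suc k)
  have br: "(b has_real_derivative partial_deriv 1 b t) (at t)" if "t \<in> T" for t
  proof -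
    have "(b has_derivative (\<lambda>v. partial_deriv v b t)) (at t)"
      using Suc.prems that by (intro has_derivative_partial_deriv) auto
    moreover have "(\<lambda>v. partial_deriv v b t) = (*) (partial_deriv 1 b t)"
    proof
      fix v
      show "partial_deriv v b t = partial_deriv 1 b t * v"
        using linear_cmul[OF has_derivative_linear[OF calculation], of v 1]
        by (simp add: mult.commute)
    qed
    ultimately show ?thesis by (simp add: has_field_derivative_def)
  qed
  have d: "((\<lambda>x. b (f x)) has_derivative
      (\<lambda>v. partial_deriv 1 b (f x) * partial_deriv v f x)) (at x)" if "x \<in> S" for x
    using Suc.prems that fT by (intro partial_deriv_comp_real br) auto
  have "C_k_on k f S"
    using Suc.prems by (blast dest: C_k_on_Suc_D)
  with Suc show ?case
    by (intro C_k_on_SucI[OF S d] C_k_on_mult[OF S]) auto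
qed

lemma C_k_on_holomorphic:
  assumes S: "open S" and f: "f holomorphic_on S"
  shows "C_k_on k f S"
  using f
proof (induction k arbitrary: f)
  case 0
  then show ?case by (simp add: holomorphic_on_imp_continuous_on)
next
  case (Suc k)
  have d: "(f has_derivative (\<lambda>v. deriv f x * v)) (at x)" if "x \<in> S" for x
    using holomorphic_derivI[OF Suc.prems S that] by (simp add: has_field_derivative_def)
  show ?case
    by (rule C_k_on_SucI[OF S d])
      (use Suc S in \<open>auto intro!: C_k_on_mult C_k_on_const holomorphic_deriv\<close>)
qed

lemma C_k_on_cmod_power2: "C_k_on k (\<lambda>w. (cmod (w - z))\<^sup>2) S"
proof (rule C_k_on_subset[of _ _ UNIV])
  have "C_k_on k (\<lambda>w. Re (w - z) * Re (w - z) + Im (w - z) * Im (w - z)) UNIV"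
    by (intro C_k_on_add C_k_on_mult C_k_on_bounded_linear[OF bounded_linear_Re]
        C_k_on_bounded_linear[OF bounded_linear_Im] C_k_on_diff C_k_on_id C_k_on_const open_UNIV)
  then show "C_k_on k (\<lambda>w. (cmod (w - z))\<^sup>2) UNIV"
    by (simp add: cmod_def power2_eq_square)
qed simp


section \<open>A flat exponential\<close>

text \<open>Differentiation stays inside the span of this family, so smoothness can be proved for
  all \<open>n\<close> simultaneously. For b = \<open>flat_exp 0\<close> one has b' =
  \<open>flat_exp 2\<close>, and b'' is \<open>flat_exp 4\<close> minus twice
  \<open>flat_exp 3\<close>.\<close>

definition flat_exp :: "nat \<Rightarrow> real \<Rightarrow> real" where
  "flat_exp n t = (if t \<le> 0 then 0 else exp (- inverse t) * inverse t ^ n)"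

lemma flat_exp_nonneg: "0 \<le> flat_exp n t"
  by (simp add: flat_exp_def)

lemma flat_exp_tendsto_0: "((\<lambda>t. flat_exp n t) \<longlongrightarrow> 0) (at_right 0)"
proof -
  have "((\<lambda>t::real. inverse t ^ n / exp (inverse t)) \<longlongrightarrow> 0) (at_right 0)"
    by (rule filterlim_compose[OF tendsto_power_div_exp_0 filterlim_inverse_at_top_right])
  then show ?thesis
    by (rule Lim_transform_eventually)
      (auto simp: eventually_at_right_less flat_exp_def exp_minus field_simps
        intro!: eventually_mono[OF eventually_at_right_less])
qed

lemma flat_exp_has_derivative:
  "(flat_exp n has_real_derivative flat_exp (n + 2) t - real n * flat_exp (n + 1) t) (at t)"
proof -
  consider "t < 0" | "t = 0" | "t > 0" by linarith
  then show ?thesis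
  proof cases
    case 1
    have "((\<lambda>_. 0) has_real_derivative 0) (at t)" by simp
    then have "(flat_exp n has_real_derivative 0) (at t)"
      by (rule has_field_derivative_transform_within_open[of _ _ _ "{..<0}"])
        (use 1 in \<open>auto simp: flat_exp_def\<close>)
    with 1 show ?thesis by (simp add: flat_exp_def)
  next
    case 3
    have "((\<lambda>t. exp (- inverse t) * inverse t ^ n) has_real_derivative
        exp (- inverse t) * (inverse t * inverse t) * inverse t ^ n +
        real n * (- (inverse t * inverse t) * inverse t ^ (n - 1)) * exp (- inverse t)) (at t)"
      using 3 by (auto intro!: derivative_eq_intros)
    also have "real n * (- (inverse t * inverse t) * inverse t ^ (n - 1)) =
        - real n * (inverse t * inverse t ^ n)"
      by (cases n) (auto simp: algebra_simps)
    also have "exp (- inverse t) * (inverse t * inverse t) * inverse t ^ n +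
        - real n * (inverse t * inverse t ^ n) * exp (- inverse t) =
        flat_exp (n + 2) t - real n * flat_exp (n + 1) t"
      using 3 by (simp add: flat_exp_def algebra_simps power_add power2_eq_square)
    finally have "((\<lambda>t. exp (- inverse t) * inverse t ^ n) has_real_derivative
        flat_exp (n + 2) t - real n * flat_exp (n + 1) t) (at t)" .
    then show ?thesis
      by (rule has_field_derivative_transform_within_open[of _ _ _ "{0<..}"])
        (use 3 in \<open>auto simp: flat_exp_def\<close>)
  next
    case 2
    have "((\<lambda>h. flat_exp n h / h) \<longlongrightarrow> 0) (at_left 0)"
      by (rule Lim_transform_eventually[OF tendsto_const])
        (auto simp: flat_exp_def eventually_at_filter)
    \<comment> \<open>For positive \<open>h\<close> the difference quotient at 0 is again a member
      of the family, \<open>flat_exp (Suc n) h\<close>.\<close>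
    moreover have "((\<lambda>h. flat_exp n h / h) \<longlongrightarrow> 0) (at_right 0)"
      by (rule Lim_transform_eventually[OF flat_exp_tendsto_0[of "Suc n"]])
        (auto simp: flat_exp_def field_simps intro!: eventually_mono[OF eventually_at_right_less])
    ultimately have "((\<lambda>h. flat_exp n h / h) \<longlongrightarrow> 0) (at 0)"
      by (simp add: filterlim_split_at)
    with 2 show ?thesis by (simp add: DERIV_def flat_exp_def)
  qed
qed

lemma C_k_on_flat_exp: "C_k_on k (flat_exp n) S"
proof (rule C_k_on_subset[of _ _ UNIV])
  show "C_k_on k (flat_exp n) UNIV"
  proof (induction k arbitrary: n)
    case 0
    then show ?case
      by (auto intro!: continuous_at_imp_continuous_on DERIV_isCont[OF flat_exp_has_derivative])
  next
    case (Suc k)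
    have "C_k_on k (\<lambda>t. (flat_exp (n + 2) t - real n * flat_exp (n + 1) t) * v) UNIV" for v
      by (intro C_k_on_mult C_k_on_diff C_k_on_const Suc open_UNIV)
    moreover have "partial_deriv v (flat_exp n) =
        (\<lambda>t. (flat_exp (n + 2) t - real n * flat_exp (n + 1) t) * v)" for v
      by (rule ext, rule partial_deriv_real[OF flat_exp_has_derivative])
    moreover have "flat_exp n differentiable at t" for t
      using flat_exp_has_derivative[of n t]
      unfolding differentiable_def has_field_derivative_def by blast
    ultimately show ?case by simp
  qed
qed simp


section \<open>Integration by parts\<close>

text \<open>Compact support is recorded here and below as vanishing beyond a radius
  \<open>r\<close>; continuity is then exploited on the compact set
  \<open>cball 0 r\<close>.\<close>

lemma integrable_continuous_compact_support:
  fixes f :: "'a::euclidean_space \<Rightarrow> 'b::{banach, second_countable_topology}"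
  assumes "continuous_on UNIV f" "\<And>x. r < norm x \<Longrightarrow> f x = 0"
  shows "integrable lborel f"
proof -
  have "integrable lborel (\<lambda>x. indicator (cball 0 r) x *\<^sub>R f x)"
    by (intro borel_integrable_compact continuous_on_subset[OF assms(1)]) auto
  also have "(\<lambda>x. indicator (cball 0 r) x *\<^sub>R f x) = f"
    using assms(2) by (auto simp: indicator_def fun_eq_iff not_le)
  finally show ?thesis .
qed

lemma continuous_compact_support_bounded:
  fixes f :: "'a::euclidean_space \<Rightarrow> 'b::real_normed_vector"
  assumes "continuous_on UNIV f" "\<And>x. r < norm x \<Longrightarrow> f x = 0"
  shows "\<exists>B\<ge>0. \<forall>x. norm (f x) \<le> B"
proof -
  have "compact (f ` cball 0 r)"
    by (intro compact_continuous_image continuous_on_subset[OF assms(1)]) auto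
  then obtain B where B: "\<And>y. y \<in> f ` cball 0 r \<Longrightarrow> norm y \<le> B"
    using compact_imp_bounded bounded_iff by metis
  show ?thesis
  proof (intro exI[of _ "\<bar>B\<bar>"] conjI allI)
    fix x show "norm (f x) \<le> \<bar>B\<bar>"
      using B[of "f x"] assms(2)[of x] by (cases "norm x \<le> r") (auto simp: not_le)
  qed simp
qed

lemma partial_deriv_compact_support:
  assumes "\<And>x. r < norm x \<Longrightarrow> f x = 0" "r < norm x"
  shows "partial_deriv v f x = 0"
proof -
  have "partial_deriv v f x = partial_deriv v (\<lambda>_. 0) x"
    by (rule partial_deriv_cong_open[of "- cball 0 r"]) (use assms in auto)
  then show ?thesis by simp
qed

lemma integrable_lborel_shift:
  fixes f :: "'a::euclidean_space \<Rightarrow> 'b::{banach, second_countable_topology}"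
  assumes "integrable lborel f"
  shows "integrable lborel (\<lambda>x. f (x + c))" "integral\<^sup>L lborel (\<lambda>x. f (x + c)) = integral\<^sup>L lborel f"
proof -
  have m: "f \<in> borel_measurable borel" using assms by (simp add: borel_measurable_integrable)
  have "integrable (distr lborel borel ((+) c)) f" using assms by (simp add: lborel_distr_plus)
  then show "integrable lborel (\<lambda>x. f (x + c))"
    by (subst (asm) integrable_distr_eq) (auto simp: m add.commute)
  have "integral\<^sup>L lborel f = integral\<^sup>L (distr lborel borel ((+) c)) f" by (simp add: lborel_distr_plus)
  also have "\<dots> = integral\<^sup>L lborel (\<lambda>x. f (x + c))"
    by (subst integral_distr) (auto simp: m add.commute)
  finally show "integral\<^sup>L lborel (\<lambda>x. f (x + c)) = integral\<^sup>L lborel f" ..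
qed

text \<open>Integrals are invariant under translation, so the difference quotients have integral zero.\<close>

lemma integral_partial_deriv_eq_0:
  fixes f :: "'a::euclidean_space \<Rightarrow> 'b::{banach, second_countable_topology}"
  assumes C1: "C_k_on (Suc 0) f UNIV" and supp: "\<And>x. r < norm x \<Longrightarrow> f x = 0"
  shows "integral\<^sup>L lborel (partial_deriv v f) = 0"
proof -
  let ?g = "partial_deriv v f"
  have dif: "f differentiable (at x)" and cg: "continuous_on UNIV ?g" for x
    using C1 by auto
  have cf: "continuous_on UNIV f" using C_k_on_imp_continuous_on[OF C1] .
  have g0: "?g x = 0" if "r < norm x" for x
    by (rule partial_deriv_compact_support[OF supp that])
  obtain B where B: "B \<ge> 0" "\<And>x. norm (?g x) \<le> B"
    using continuous_compact_support_bounded[of ?g r, OF cg g0] by auto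
  define h where "h n = inverse (real (Suc n))" for n
  have h: "h n > 0" "h n \<le> 1" for n by (auto simp: h_def field_simps)
  define q where "q n x = (f (x + h n *\<^sub>R v) - f x) /\<^sub>R h n" for n x
  have line: "((\<lambda>s. f (x + s *\<^sub>R v)) has_derivative (\<lambda>t. t *\<^sub>R ?g (x + s *\<^sub>R v))) (at s within T)" for x s T
  proof -
    have "((\<lambda>s. f (x + s *\<^sub>R v)) has_derivative (\<lambda>t. partial_deriv (t *\<^sub>R v) f (x + s *\<^sub>R v))) (at s within T)"
      by (rule has_derivative_compose[OF _ has_derivative_partial_deriv[OF dif]])
        (auto intro!: derivative_eq_intros)
    moreover have "partial_deriv (t *\<^sub>R v) f y = t *\<^sub>R ?g y" for t y
      using linear_cmul[OF has_derivative_linear[OF has_derivative_partial_deriv[OF dif]]] by blast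
    ultimately show ?thesis by simp
  qed
  have qB: "norm (q n x) \<le> B" for n x
  proof -
    have on: "onorm (\<lambda>t. t *\<^sub>R ?g (x + s *\<^sub>R v)) \<le> B" for s
      by (rule onorm_bound) (use B in \<open>auto simp: mult.commute[of _ "norm (?g _)"] intro: mult_right_mono\<close>)
    have "norm (f (x + h n *\<^sub>R v) - f (x + 0 *\<^sub>R v)) \<le> B * norm (h n - 0)"
      by (rule differentiable_bound[OF convex_UNIV line[of x _ UNIV] on]) auto
    then have "norm (f (x + h n *\<^sub>R v) - f x) \<le> B * h n"
      using h(1)[of n] by simp
    then show ?thesis using h(1)[of n] by (simp add: q_def pos_divide_le_eq flip: divide_inverse_commute)
  qed
  \<comment> \<open>The steps \<open>h n\<close> are at most 1, so all difference quotients vanish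
    outside one common ball. This provides the integrable majorant.\<close>
  have q0: "q n x = 0" if "r + norm v < norm x" for n x
  proof -
    have "norm (h n *\<^sub>R v) \<le> norm v"
      using mult_right_mono[OF h(2)[of n], of "norm v"] h(1)[of n] by simp
    moreover have "norm x \<le> norm (x + h n *\<^sub>R v) + norm (h n *\<^sub>R v)"
      using norm_triangle_ineq4[of "x + h n *\<^sub>R v" "h n *\<^sub>R v"] by simp
    ultimately have "r < norm (x + h n *\<^sub>R v)" "r < norm x"
      using that norm_ge_zero[of v] by linarith+
    then have "f (x + h n *\<^sub>R v) = 0" "f x = 0" using supp by blast+
    then show ?thesis by (simp add: q_def)
  qed
  have intf: "integrable lborel f"
    by (rule integrable_continuous_compact_support[of f r, OF cf]) (use supp in auto)
  note transl = integrable_lborel_shift[OF intf]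
  have iq: "integral\<^sup>L lborel (q n) = 0" for n
    unfolding q_def by (simp add: transl intf)
  have "(\<lambda>n. integral\<^sup>L lborel (q n)) \<longlonglongrightarrow> integral\<^sup>L lborel ?g"
  proof (rule integral_dominated_convergence[where w="\<lambda>x. B * indicator (cball 0 (r + norm v)) x"])
    show "?g \<in> borel_measurable lborel" using cg by (simp add: borel_measurable_continuous_onI)
    show "q n \<in> borel_measurable lborel" for n
      unfolding q_def using transl(1) intf by (intro borel_measurable_integrable) simp
    show "integrable lborel (\<lambda>x::'a. B * indicator (cball 0 (r + norm v)) x)"
      using emeasure_bounded_finite[OF bounded_cball, of "0::'a" "r + norm v"]
      by (intro integrable_mult_right integrable_real_indicator) auto
    show "AE x in lborel. norm (q n x) \<le> B * indicator (cball 0 (r + norm v)) x" for n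
    proof (rule AE_I2)
      fix x
      show "norm (q n x) \<le> B * indicator (cball 0 (r + norm v)) x"
        using qB[of n x] q0[of x n] by (cases "r + norm v < norm x") (simp_all add: indicator_def)
    qed
    show "AE x in lborel. (\<lambda>n. q n x) \<longlonglongrightarrow> ?g x"
    proof (rule AE_I2)
      fix x
      have "((\<lambda>s. norm (f (x + s *\<^sub>R v) - f x - s *\<^sub>R ?g x) / norm s) \<longlongrightarrow> 0) (at 0)"
        using line[of x 0 UNIV] by (simp add: has_derivative_at)
      moreover have "norm (f (x + s *\<^sub>R v) - f x - s *\<^sub>R ?g x) / norm s =
          norm ((f (x + s *\<^sub>R v) - f x) /\<^sub>R s - ?g x)" if "s \<noteq> 0" for s
      proof -
        have "(f (x + s *\<^sub>R v) - f x) /\<^sub>R s - ?g x = (f (x + s *\<^sub>R v) - f x - s *\<^sub>R ?g x) /\<^sub>R s"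
          using that by (simp add: scaleR_diff_right)
        then show ?thesis by (simp add: divide_inverse mult.commute)
      qed
      ultimately have "((\<lambda>s. norm ((f (x + s *\<^sub>R v) - f x) /\<^sub>R s - ?g x)) \<longlongrightarrow> 0) (at 0)"
        by (simp cong: LIM_cong)
      then have lim: "((\<lambda>s. (f (x + s *\<^sub>R v) - f x) /\<^sub>R s) \<longlongrightarrow> ?g x) (at 0)"
        by (rule LIM_zero_cancel[OF tendsto_norm_zero_cancel])
      have "h \<longlonglongrightarrow> 0"
        using LIMSEQ_inverse_real_of_nat by (simp add: h_def[abs_def])
      moreover have "\<forall>\<^sub>F n in sequentially. h n \<noteq> 0"
        using h(1) by (auto intro!: always_eventually simp: less_imp_neq[symmetric])
      ultimately have h0: "filterlim h (at 0) sequentially"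
        by (simp add: filterlim_at)
      show "(\<lambda>n. q n x) \<longlonglongrightarrow> ?g x"
        using filterlim_compose[OF lim h0] by (simp only: q_def)
    qed
  qed
  then have "(\<lambda>n::nat. 0) \<longlonglongrightarrow> integral\<^sup>L lborel ?g" by (simp only: iq)
  from LIMSEQ_unique[OF this tendsto_const] show ?thesis .
qed


section \<open>The space \<open>L2\<close>\<close>

lemma power2_norm_add_le: "(norm (a + b))\<^sup>2 \<le> 2 * (norm a)\<^sup>2 + 2 * (norm (b::'a::real_normed_vector))\<^sup>2"
proof -
  have "(norm (a + b))\<^sup>2 \<le> (norm a + norm b)\<^sup>2"
    by (intro power_mono norm_triangle_ineq) simp
  also have "\<dots> \<le> 2 * (norm a)\<^sup>2 + 2 * (norm b)\<^sup>2"
    using sum_squares_bound[of "norm a" "norm b"] by (simp add: power2_sum)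
  finally show ?thesis .
qed

lemma L2_measurable: "u \<in> L2 \<Omega> \<Longrightarrow> u \<in> borel_measurable (lebesgue_on \<Omega>)"
  by (simp add: L2_def)

lemma L2_integrable: "u \<in> L2 \<Omega> \<Longrightarrow> integrable (lebesgue_on \<Omega>) (\<lambda>z. (norm (u z))\<^sup>2)"
  by (simp add: L2_def)

lemma L2_zero [simp]: "(\<lambda>z. 0) \<in> L2 \<Omega>"
  by (simp add: L2_def)

lemma L2_add:
  assumes "u \<in> L2 \<Omega>" "v \<in> L2 \<Omega>"
  shows "(\<lambda>z. u z + v z) \<in> L2 \<Omega>"
proof -
  note [measurable] = assms[THEN L2_measurable]
  have "integrable (lebesgue_on \<Omega>) (\<lambda>z. (norm (u z + v z))\<^sup>2)"
  proof (rule Bochner_Integration.integrable_bound)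
    show "integrable (lebesgue_on \<Omega>) (\<lambda>z. 2 * (norm (u z))\<^sup>2 + 2 * (norm (v z))\<^sup>2)"
      using assms[THEN L2_integrable] by simp
    show "(\<lambda>z. (norm (u z + v z))\<^sup>2) \<in> borel_measurable (lebesgue_on \<Omega>)" by measurable
  qed (auto intro!: power2_norm_add_le)
  then show ?thesis by (simp add: L2_def)
qed

lemma L2_cmult: "u \<in> L2 \<Omega> \<Longrightarrow> (\<lambda>z. c * u z) \<in> L2 \<Omega>"
  by (auto simp: L2_def norm_mult power_mult_distrib intro: borel_measurable_times)

lemma L2_diff: "u \<in> L2 \<Omega> \<Longrightarrow> v \<in> L2 \<Omega> \<Longrightarrow> (\<lambda>z. u z - v z) \<in> L2 \<Omega>"
  using L2_add[of u \<Omega> "\<lambda>z. (-1) * v z"] L2_cmult[of v \<Omega> "-1"] by simp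

lemma L2_cnj: "u \<in> L2 \<Omega> \<Longrightarrow> (\<lambda>z. cnj (u z)) \<in> L2 \<Omega>"
  using borel_measurable_continuous_on[OF continuous_on_cnj[OF continuous_on_id], of u]
  by (simp add: L2_def)

lemma L2_norm_nonneg [simp]: "0 \<le> L2_norm \<Omega> u"
  by (simp add: L2_norm_def)

lemma L2_norm_power2: "(L2_norm \<Omega> u)\<^sup>2 = integral\<^sup>L (lebesgue_on \<Omega>) (\<lambda>z. (norm (u z))\<^sup>2)"
  by (simp add: L2_norm_def)

lemma L2_norm_zero [simp]: "L2_norm \<Omega> (\<lambda>z. 0) = 0"
  by (simp add: L2_norm_def)

lemma L2_norm_cmult: "L2_norm \<Omega> (\<lambda>z. c * u z) = norm c * L2_norm \<Omega> u"
  by (simp add: L2_norm_def norm_mult power_mult_distrib real_sqrt_mult)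

lemma L2_norm_cnj [simp]: "L2_norm \<Omega> (\<lambda>z. cnj (u z)) = L2_norm \<Omega> u"
  by (simp add: L2_norm_def)

lemma L2_norm_minus_commute: "L2_norm \<Omega> (\<lambda>z. u z - v z) = L2_norm \<Omega> (\<lambda>z. v z - u z)"
  by (simp add: L2_norm_def norm_minus_commute)

lemma L2_norm_cong_AE:
  assumes "AE z in lebesgue_on \<Omega>. u z = v z" "u \<in> L2 \<Omega>" "v \<in> L2 \<Omega>"
  shows "L2_norm \<Omega> u = L2_norm \<Omega> v"
  unfolding L2_norm_def
  using assms by (intro arg_cong[of _ _ sqrt] integral_cong_AE) (auto intro!: borel_measurable_power
      borel_measurable_norm dest: L2_measurable)

lemma L2_mult_integrable:
  assumes "u \<in> L2 \<Omega>" "v \<in> L2 \<Omega>"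
  shows "integrable (lebesgue_on \<Omega>) (\<lambda>z. u z * v z)"
proof (rule Bochner_Integration.integrable_bound)
  note [measurable] = assms[THEN L2_measurable]
  show "integrable (lebesgue_on \<Omega>) (\<lambda>z. (norm (u z))\<^sup>2 + (norm (v z))\<^sup>2)"
    using assms[THEN L2_integrable] by simp
  show "(\<lambda>z. u z * v z) \<in> borel_measurable (lebesgue_on \<Omega>)" by measurable
  have "norm (u z * v z) \<le> norm ((norm (u z))\<^sup>2 + (norm (v z))\<^sup>2)" for z
  proof -
    have "norm (u z) * norm (v z) \<le> (norm (u z))\<^sup>2 + (norm (v z))\<^sup>2"
      using sum_squares_bound[of "norm (u z)" "norm (v z)"]
        mult_nonneg_nonneg[OF norm_ge_zero[of "u z"] norm_ge_zero[of "v z"]] by linarith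
    then show ?thesis by (simp add: norm_mult)
  qed
  then show "AE z in lebesgue_on \<Omega>. norm (u z * v z) \<le> norm ((norm (u z))\<^sup>2 + (norm (v z))\<^sup>2)"
    by simp
qed

text \<open>The optimal weight is \<open>t = b / a\<close>. If \<open>a\<close> or \<open>b\<close>
  vanishes the optimum is only approached, as t tends to infinity or to 0. This derives
  Cauchy-Schwarz from a pointwise inequality.\<close>

lemma le_mult_of_AM_GM:
  fixes x a b :: real
  assumes *: "\<And>t. t > 0 \<Longrightarrow> x \<le> (t * a\<^sup>2 + b\<^sup>2 / t) / 2" and "a \<ge> 0" "b \<ge> 0"
  shows "x \<le> a * b"
proof -
  consider "a > 0" "b > 0" | "a = 0" | "b = 0" using assms by linarith
  then show ?thesis
  proof cases
    case 1
    then show ?thesis using *[of "b / a"] by (simp add: power2_eq_square)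
  next
    case 2
    have "((\<lambda>t. b\<^sup>2 / t / 2) \<longlongrightarrow> 0) at_top" by real_asymp
    then have "x \<le> 0"
      by (rule tendsto_lowerbound) (use * 2 in \<open>auto simp: eventually_at_top_dense intro!: exI[of _ 0]\<close>)
    with 2 show ?thesis by simp
  next
    case 3
    have "((\<lambda>t. t * a\<^sup>2 / 2) \<longlongrightarrow> 0) (at_right 0)" by (auto intro!: tendsto_eq_intros)
    then have "x \<le> 0"
      by (rule tendsto_lowerbound)
        (use * 3 in \<open>auto intro!: eventually_mono[OF eventually_at_right_less]\<close>)
    with 3 show ?thesis by simp
  qed
qed

lemma L2_Cauchy_Schwarz_norm:
  assumes u: "u \<in> L2 \<Omega>" and v: "v \<in> L2 \<Omega>"
  shows "integral\<^sup>L (lebesgue_on \<Omega>) (\<lambda>z. norm (u z * v z)) \<le> L2_norm \<Omega> u * L2_norm \<Omega> v"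
proof (rule le_mult_of_AM_GM)
  fix t :: real assume t: "t > 0"
  note int = u[THEN L2_integrable] v[THEN L2_integrable]
  have "norm (u z * v z) \<le> (t * (norm (u z))\<^sup>2 + (norm (v z))\<^sup>2 / t) / 2" for z
  proof -
    have "2 * ((sqrt t * norm (u z)) * (norm (v z) / sqrt t)) \<le>
        (sqrt t * norm (u z))\<^sup>2 + (norm (v z) / sqrt t)\<^sup>2"
      using sum_squares_bound[of "sqrt t * norm (u z)" "norm (v z) / sqrt t"] by (simp only: mult.assoc)
    moreover have "(sqrt t * norm (u z)) * (norm (v z) / sqrt t) = norm (u z * v z)"
      using t by (simp add: norm_mult)
    ultimately show ?thesis using t by (simp add: power_mult_distrib power_divide)
  qed
  then have "integral\<^sup>L (lebesgue_on \<Omega>) (\<lambda>z. norm (u z * v z)) \<le>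
      integral\<^sup>L (lebesgue_on \<Omega>) (\<lambda>z. (t * (norm (u z))\<^sup>2 + (norm (v z))\<^sup>2 / t) / 2)"
    using int L2_mult_integrable[OF u v] by (intro integral_mono) auto
  also have "\<dots> = (t * (L2_norm \<Omega> u)\<^sup>2 + (L2_norm \<Omega> v)\<^sup>2 / t) / 2"
    using int by (simp add: L2_norm_power2)
  finally show "integral\<^sup>L (lebesgue_on \<Omega>) (\<lambda>z. norm (u z * v z)) \<le>
      (t * (L2_norm \<Omega> u)\<^sup>2 + (L2_norm \<Omega> v)\<^sup>2 / t) / 2" .
qed auto

lemma L2_Cauchy_Schwarz:
  assumes "u \<in> L2 \<Omega>" "v \<in> L2 \<Omega>"
  shows "norm (integral\<^sup>L (lebesgue_on \<Omega>) (\<lambda>z. u z * v z)) \<le> L2_norm \<Omega> u * L2_norm \<Omega> v"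
  using L2_Cauchy_Schwarz_norm[OF assms] integral_norm_bound[of "lebesgue_on \<Omega>" "\<lambda>z. u z * v z"]
  by linarith

lemma L2_norm_triangle:
  assumes u: "u \<in> L2 \<Omega>" and v: "v \<in> L2 \<Omega>"
  shows "L2_norm \<Omega> (\<lambda>z. u z + v z) \<le> L2_norm \<Omega> u + L2_norm \<Omega> v"
proof (rule power2_le_imp_le)
  note int = u[THEN L2_integrable] v[THEN L2_integrable] L2_mult_integrable[OF u v]
  have "(norm (u z + v z))\<^sup>2 \<le> (norm (u z))\<^sup>2 + 2 * norm (u z * v z) + (norm (v z))\<^sup>2" for z
    using power_mono[OF norm_triangle_ineq[of "u z" "v z"] norm_ge_zero, of 2]
    by (simp add: norm_mult power2_sum)
  then have "(L2_norm \<Omega> (\<lambda>z. u z + v z))\<^sup>2 \<le> integral\<^sup>L (lebesgue_on \<Omega>)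
      (\<lambda>z. (norm (u z))\<^sup>2 + 2 * norm (u z * v z) + (norm (v z))\<^sup>2)"
    unfolding L2_norm_power2 using int L2_integrable[OF L2_add[OF u v]]
    by (intro integral_mono) auto
  also have "\<dots> = (L2_norm \<Omega> u)\<^sup>2 + 2 * integral\<^sup>L (lebesgue_on \<Omega>) (\<lambda>z. norm (u z * v z)) + (L2_norm \<Omega> v)\<^sup>2"
    using int by (simp add: L2_norm_power2)
  also have "\<dots> \<le> (L2_norm \<Omega> u + L2_norm \<Omega> v)\<^sup>2"
    using L2_Cauchy_Schwarz_norm[OF u v] by (simp add: power2_sum)
  finally show "(L2_norm \<Omega> (\<lambda>z. u z + v z))\<^sup>2 \<le> (L2_norm \<Omega> u + L2_norm \<Omega> v)\<^sup>2" .
qed simp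

lemma L2_norm_triangle_diff:
  assumes "u \<in> L2 \<Omega>" "v \<in> L2 \<Omega>" "w \<in> L2 \<Omega>"
  shows "L2_norm \<Omega> (\<lambda>z. u z - w z) \<le> L2_norm \<Omega> (\<lambda>z. u z - v z) + L2_norm \<Omega> (\<lambda>z. v z - w z)"
  using L2_norm_triangle[OF L2_diff[OF assms(1,2)] L2_diff[OF assms(2,3)]] by simp

lemma L2_norm_triangle_sub:
  assumes "u \<in> L2 \<Omega>" "v \<in> L2 \<Omega>"
  shows "L2_norm \<Omega> u \<le> L2_norm \<Omega> v + L2_norm \<Omega> (\<lambda>z. u z - v z)"
  using L2_norm_triangle[OF assms(2) L2_diff[OF assms]] by simp

lemma L2_integral_tendsto:
  assumes f: "\<And>n. f n \<in> L2 \<Omega>" and g: "g \<in> L2 \<Omega>" and v: "v \<in> L2 \<Omega>"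
    and lim: "(\<lambda>n. L2_norm \<Omega> (\<lambda>z. f n z - g z)) \<longlonglongrightarrow> 0"
  shows "(\<lambda>n. integral\<^sup>L (lebesgue_on \<Omega>) (\<lambda>z. f n z * v z)) \<longlonglongrightarrow> integral\<^sup>L (lebesgue_on \<Omega>) (\<lambda>z. g z * v z)"
proof (rule LIM_zero_cancel, rule Lim_null_comparison)
  show "(\<lambda>n. L2_norm \<Omega> (\<lambda>z. f n z - g z) * L2_norm \<Omega> v) \<longlonglongrightarrow> 0"
    using tendsto_mult_right[OF lim] by simp
  have "norm (integral\<^sup>L (lebesgue_on \<Omega>) (\<lambda>z. f n z * v z) - integral\<^sup>L (lebesgue_on \<Omega>) (\<lambda>z. g z * v z))
      \<le> L2_norm \<Omega> (\<lambda>z. f n z - g z) * L2_norm \<Omega> v" for n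
    using L2_Cauchy_Schwarz[OF L2_diff[OF f g] v, of n]
      L2_mult_integrable[OF f v, of n] L2_mult_integrable[OF g v]
    by (simp add: left_diff_distrib)
  then show "\<forall>\<^sub>F n in sequentially. norm (integral\<^sup>L (lebesgue_on \<Omega>) (\<lambda>z. f n z * v z) -
      integral\<^sup>L (lebesgue_on \<Omega>) (\<lambda>z. g z * v z)) \<le> L2_norm \<Omega> (\<lambda>z. f n z - g z) * L2_norm \<Omega> v"
    by simp
qed

section \<open>Completeness of L2 along geometric sequences\<close>

lemma L2_norm_telescope:
  assumes f: "\<And>n. f n \<in> L2 \<Omega>"
    and rate: "\<And>n. L2_norm \<Omega> (\<lambda>z. f (Suc n) z - f n z) \<le> C / 3 ^ n" and C: "C \<ge> 0"
  shows "L2_norm \<Omega> (\<lambda>z. f (n + j) z - f n z) \<le> (3 * C / 2) / 3 ^ n"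
proof -
  have "L2_norm \<Omega> (\<lambda>z. f (n + j) z - f n z) \<le> (3 * C / 2) * (1 / 3 ^ n - 1 / 3 ^ (n + j))"
  proof (induction j)
    case (Suc j)
    have "L2_norm \<Omega> (\<lambda>z. f (n + Suc j) z - f n z) \<le>
        L2_norm \<Omega> (\<lambda>z. f (Suc (n + j)) z - f (n + j) z) + L2_norm \<Omega> (\<lambda>z. f (n + j) z - f n z)"
      using L2_norm_triangle_diff[of "f (Suc (n + j))" \<Omega> "f (n + j)" "f n"] f by simp
    also have "\<dots> \<le> C / 3 ^ (n + j) + (3 * C / 2) * (1 / 3 ^ n - 1 / 3 ^ (n + j))"
      by (intro add_mono Suc rate)
    also have "\<dots> = (3 * C / 2) * (1 / 3 ^ n - 1 / 3 ^ (n + Suc j))"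
      by (simp add: field_simps)
    finally show ?case .
  qed simp
  also have "\<dots> \<le> (3 * C / 2) / 3 ^ n"
    using C by (simp add: right_diff_distrib)
  finally show ?thesis .
qed

text \<open>Riesz-Fischer for sequences with increments of size \<open>C / 3 ^ n\<close>; the error
  is the tail of the geometric series. Such a rate is arranged both for the minimizing sequence and
  for the gliding hump.\<close>

lemma L2_complete:
  assumes f: "\<And>n. f n \<in> L2 \<Omega>"
    and rate: "\<And>n. L2_norm \<Omega> (\<lambda>z. f (Suc n) z - f n z) \<le> C / 3 ^ n" and C: "C \<ge> 0"
  shows "\<exists>g\<in>L2 \<Omega>. \<forall>n. L2_norm \<Omega> (\<lambda>z. f n z - g z) \<le> (3 * C / 2) / 3 ^ n"
proof -
  let ?M = "lebesgue_on \<Omega>"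
  note [measurable] = L2_measurable[OF f]
  define d where "d k z = norm (f (Suc k) z - f k z)" for k z
  have dm [measurable]: "d k \<in> borel_measurable ?M" for k unfolding d_def by measurable
  have d0: "d k z \<ge> 0" for k z by (simp add: d_def)
  define g where "g z = lim (\<lambda>n. f n z)" for z
  have gm [measurable]: "g \<in> borel_measurable ?M" unfolding g_def by measurable
  have sq: "(\<integral>\<^sup>+z. ennreal ((norm (u z))\<^sup>2) \<partial>?M) = ennreal ((L2_norm \<Omega> u)\<^sup>2)" if "u \<in> L2 \<Omega>" for u
    unfolding L2_norm_power2 using L2_integrable[OF that] by (intro nn_integral_eq_integral) auto
  \<comment> \<open>The weight \<open>2 ^ k\<close> is small enough for the integrals to be
    summable, with ratio 2/9, and large enough that finiteness of the weighted sum forces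
    \<open>d k z\<close> to be summable: \<open>d k z\<close> is at most 2^-k + 2^k (d k
    z)^2.\<close>
  have "(\<integral>\<^sup>+z. (\<Sum>k. ennreal (2 ^ k * (d k z)\<^sup>2)) \<partial>?M) = (\<Sum>k. \<integral>\<^sup>+z. ennreal (2 ^ k * (d k z)\<^sup>2) \<partial>?M)"
    by (intro nn_integral_suminf) measurable
  also have "\<dots> \<le> (\<Sum>k. ennreal (C\<^sup>2 * (2 / 9) ^ k))"
  proof (intro suminf_le)
    fix k
    have "(\<integral>\<^sup>+z. ennreal (2 ^ k * (d k z)\<^sup>2) \<partial>?M) = ennreal (2 ^ k) * (\<integral>\<^sup>+z. ennreal ((d k z)\<^sup>2) \<partial>?M)"
      by (subst nn_integral_cmult[symmetric]) (auto simp: ennreal_mult)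
    also have "\<dots> = ennreal (2 ^ k) * ennreal ((L2_norm \<Omega> (\<lambda>z. f (Suc k) z - f k z))\<^sup>2)"
      unfolding d_def by (subst sq) (auto intro: L2_diff f)
    also have "\<dots> \<le> ennreal (2 ^ k) * ennreal ((C / 3 ^ k)\<^sup>2)"
      by (intro mult_left_mono ennreal_leI power_mono rate) auto
    also have "\<dots> = ennreal (C\<^sup>2 * (2 / 9) ^ k)"
    proof -
      have "(3::real) ^ k * 3 ^ k = 9 ^ k" by (simp flip: power_mult_distrib)
      then have "2 ^ k * (C / 3 ^ k)\<^sup>2 = C\<^sup>2 * (2 / 9) ^ k"
        by (simp add: power2_eq_square power_divide)
      then show ?thesis by (simp flip: ennreal_mult)
    qed
    finally show "(\<integral>\<^sup>+z. ennreal (2 ^ k * (d k z)\<^sup>2) \<partial>?M) \<le> ennreal (C\<^sup>2 * (2 / 9) ^ k)" .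
  qed auto
  also have "\<dots> = ennreal (\<Sum>k. C\<^sup>2 * (2 / 9) ^ k)"
    by (intro suminf_ennreal2) (auto intro!: summable_mult summable_geometric)
  finally have "(\<integral>\<^sup>+z. (\<Sum>k. ennreal (2 ^ k * (d k z)\<^sup>2)) \<partial>?M) \<noteq> \<infinity>"
    by (auto simp: top_unique)
  then have "AE z in ?M. (\<Sum>k. ennreal (2 ^ k * (d k z)\<^sup>2)) \<noteq> \<infinity>"
    by (intro nn_integral_PInf_AE) auto
  then have conv: "AE z in ?M. (\<lambda>n. f n z) \<longlonglongrightarrow> g z"
  proof eventually_elim
    case (elim z)
    then have "summable (\<lambda>k. 2 ^ k * (d k z)\<^sup>2)"
      by (intro summable_suminf_not_top) auto
    then have s: "summable (\<lambda>k. (1 / 2) ^ k + 2 ^ k * (d k z)\<^sup>2)"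
      by (intro summable_add summable_geometric) auto
    have "d k z \<le> (1 / 2) ^ k + 2 ^ k * (d k z)\<^sup>2" for k
    proof -
      have "2 * (1 * (2 ^ k * d k z)) \<le> 1 + (2 ^ k * d k z)\<^sup>2"
        using sum_squares_bound[of 1 "2 ^ k * d k z"] by simp
      then have "2 ^ k * d k z \<le> 1 + (2 ^ k * d k z)\<^sup>2"
        using d0[of k z] by (auto intro: order_trans[of _ "2 * (1 * (2 ^ k * d k z))"])
      also have "\<dots> = 2 ^ k * ((1 / 2) ^ k + 2 ^ k * (d k z)\<^sup>2)"
        by (simp add: field_simps power2_eq_square)
      finally show ?thesis by simp
    qed
    then have "summable (\<lambda>k. norm (f (Suc k) z - f k z))"
      using summable_comparison_test'[OF s, of 0 "\<lambda>k. d k z"] d0 by (simp add: d_def)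
    then have "summable (\<lambda>k. f (Suc k) z - f k z)"
      by (rule summable_norm_cancel)
    then have "convergent (\<lambda>n. \<Sum>k<n. f (Suc k) z - f k z)"
      by (simp add: summable_iff_convergent)
    moreover have "(\<lambda>n. \<Sum>k<n. f (Suc k) z - f k z) = (\<lambda>n. f n z - f 0 z)"
      by (rule ext) (rule sum_lessThan_telescope[of "\<lambda>k. f k z"])
    ultimately have "convergent (\<lambda>n. f n z - f 0 z)" by simp
    then have "convergent (\<lambda>n. f n z)"
      using convergent_add[OF _ convergent_const, of "\<lambda>n. f n z - f 0 z" "f 0 z"] by simp
    then show ?case unfolding g_def by (simp add: convergent_LIMSEQ_iff)
  qed
  \<comment> \<open>Fatou's lemma in the second index carries the telescoped bound over to the
    limit.\<close>
  have bound: "(\<integral>\<^sup>+z. ennreal ((norm (f n z - g z))\<^sup>2) \<partial>?M) \<le> ennreal (((3 * C / 2) / 3 ^ n)\<^sup>2)" for n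
  proof -
    have "(\<integral>\<^sup>+z. ennreal ((norm (f n z - g z))\<^sup>2) \<partial>?M) =
        (\<integral>\<^sup>+z. liminf (\<lambda>j. ennreal ((norm (f (n + j) z - f n z))\<^sup>2)) \<partial>?M)"
    proof (rule nn_integral_cong_AE, use conv in eventually_elim)
      case (elim z)
      have "(\<lambda>j. f (n + j) z) \<longlonglongrightarrow> g z"
        using LIMSEQ_ignore_initial_segment[OF elim, of n] by (simp add: add.commute)
      then have "(\<lambda>j. ennreal ((norm (f (n + j) z - f n z))\<^sup>2)) \<longlonglongrightarrow> ennreal ((norm (g z - f n z))\<^sup>2)"
        by (intro tendsto_intros)
      then show ?case
        using lim_imp_Liminf[OF sequentially_bot] norm_minus_commute[of "g z"] by fastforce
    qed
    also have "\<dots> \<le> liminf (\<lambda>j. \<integral>\<^sup>+z. ennreal ((norm (f (n + j) z - f n z))\<^sup>2) \<partial>?M)"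
      by (intro nn_integral_liminf) measurable
    also have "\<dots> \<le> liminf (\<lambda>j::nat. ennreal (((3 * C / 2) / 3 ^ n)\<^sup>2))"
    proof (intro Liminf_mono always_eventually allI)
      fix j
      have "(\<integral>\<^sup>+z. ennreal ((norm (f (n + j) z - f n z))\<^sup>2) \<partial>?M) = ennreal ((L2_norm \<Omega> (\<lambda>z. f (n + j) z - f n z))\<^sup>2)"
        by (intro sq L2_diff f)
      also have "\<dots> \<le> ennreal (((3 * C / 2) / 3 ^ n)\<^sup>2)"
        by (intro ennreal_leI power_mono L2_norm_telescope[OF f rate C]) auto
      finally show "(\<integral>\<^sup>+z. ennreal ((norm (f (n + j) z - f n z))\<^sup>2) \<partial>?M) \<le> ennreal (((3 * C / 2) / 3 ^ n)\<^sup>2)" .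
    qed
    also have "\<dots> = ennreal (((3 * C / 2) / 3 ^ n)\<^sup>2)" by (simp add: Liminf_const)
    finally show ?thesis .
  qed
  have dL2: "(\<lambda>z. f n z - g z) \<in> L2 \<Omega>" for n
    unfolding L2_def
  proof (intro CollectI conjI integrableI_nonneg)
    show "(\<integral>\<^sup>+z. ennreal ((norm (f n z - g z))\<^sup>2) \<partial>?M) < \<infinity>"
      using bound[of n] by (rule order.strict_trans1) simp
  qed auto
  have "g \<in> L2 \<Omega>"
    using L2_diff[OF f[of 0] dL2[of 0]] by simp
  moreover have "L2_norm \<Omega> (\<lambda>z. f n z - g z) \<le> (3 * C / 2) / 3 ^ n" for n
  proof -
    have "ennreal ((L2_norm \<Omega> (\<lambda>z. f n z - g z))\<^sup>2) \<le> ennreal (((3 * C / 2) / 3 ^ n)\<^sup>2)"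
      using bound[of n] sq[OF dL2[of n]] by simp
    then have "(L2_norm \<Omega> (\<lambda>z. f n z - g z))\<^sup>2 \<le> ((3 * C / 2) / 3 ^ n)\<^sup>2"
      by (simp add: ennreal_le_iff)
    then show ?thesis by (rule power2_le_imp_le) (use C in simp)
  qed
  ultimately show ?thesis by blast
qed


section \<open>Test functions and weak derivatives\<close>

declare C_k_on.simps(2) [simp del]

lemma C_k_on_Suc_differentiable: "C_k_on (Suc k) f S \<Longrightarrow> x \<in> S \<Longrightarrow> f differentiable (at x)"
  by (simp add: C_k_on.simps)

lemma C_k_on_Suc_partial: "C_k_on (Suc k) f S \<Longrightarrow> C_k_on k (partial_deriv v f) S"
  by (simp add: C_k_on.simps)

lemma C_k_on_smooth: "smooth_on f S \<Longrightarrow> C_k_on k f S"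
  by (simp add: smooth_on_def)

lemma test_functionsI:
  assumes "smooth_on \<phi> UNIV" "compact K" "K \<subseteq> \<Omega>" "\<And>z. z \<notin> K \<Longrightarrow> \<phi> z = 0"
  shows "\<phi> \<in> test_functions \<Omega>"
proof -
  have "closure {z. \<phi> z \<noteq> 0} \<subseteq> K"
    using assms(2,4) by (intro closure_minimal compact_imp_closed) auto
  moreover from this have "compact (closure {z. \<phi> z \<noteq> 0})"
    using assms(2) by (metis closed_closure compact_Int_closed inf.absorb_iff2)
  ultimately show ?thesis using assms(1,3) by (auto simp: test_functions_def)
qed

lemma test_functions_smooth: "\<phi> \<in> test_functions \<Omega> \<Longrightarrow> C_k_on k \<phi> UNIV"
  by (simp add: test_functions_def C_k_on_smooth)

lemma test_functions_support:
  assumes "\<phi> \<in> test_functions \<Omega>"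
  obtains r K where "compact K" "K \<subseteq> \<Omega>" "\<And>z. z \<notin> K \<Longrightarrow> \<phi> z = 0" "\<And>z. r < norm z \<Longrightarrow> \<phi> z = 0"
proof -
  let ?K = "closure {z. \<phi> z \<noteq> 0}"
  have K: "compact ?K" "?K \<subseteq> \<Omega>" using assms by (auto simp: test_functions_def)
  have 0: "\<phi> z = 0" if "z \<notin> ?K" for z
    using that closure_subset[of "{z. \<phi> z \<noteq> 0}"] by auto
  obtain r where "\<And>z. z \<in> ?K \<Longrightarrow> norm z \<le> r"
    using compact_imp_bounded[OF K(1)] unfolding bounded_iff by blast
  then have "\<phi> z = 0" if "r < norm z" for z
    using that 0[of z] by force
  with K 0 show ?thesis using that by blast
qed

lemma test_functions_bounded_support:
  assumes "\<phi> \<in> test_functions \<Omega>"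
  obtains r where "\<And>z. r < norm z \<Longrightarrow> \<phi> z = 0"
  using test_functions_support[OF assms] by metis

lemma test_functions_outside: "\<phi> \<in> test_functions \<Omega> \<Longrightarrow> z \<notin> \<Omega> \<Longrightarrow> \<phi> z = 0"
  by (erule test_functions_support) blast

text \<open>A point outside \<Omega>, even on its boundary, has a whole neighbourhood off the
  compact support.\<close>

lemma test_functions_partial_outside:
  assumes "\<phi> \<in> test_functions \<Omega>" "z \<notin> \<Omega>"
  shows "partial_deriv v \<phi> z = 0"
proof -
  obtain r K where K: "compact K" "K \<subseteq> \<Omega>" "\<And>z. z \<notin> K \<Longrightarrow> \<phi> z = 0"
    using test_functions_support[OF assms(1)] by metis
  have "partial_deriv v \<phi> z = partial_deriv v (\<lambda>_. 0) z"
    by (rule partial_deriv_cong_open[of "- K"]) (use K assms(2) in \<open>auto simp: compact_imp_closed\<close>)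
  then show ?thesis by simp
qed

lemma test_functions_add:
  assumes "\<phi> \<in> test_functions \<Omega>" "\<psi> \<in> test_functions \<Omega>"
  shows "(\<lambda>z. \<phi> z + \<psi> z) \<in> test_functions \<Omega>"
proof -
  obtain r K where K: "compact K" "K \<subseteq> \<Omega>" "\<And>z. z \<notin> K \<Longrightarrow> \<phi> z = 0"
    using test_functions_support[OF assms(1)] by metis
  obtain r' K' where K': "compact K'" "K' \<subseteq> \<Omega>" "\<And>z. z \<notin> K' \<Longrightarrow> \<psi> z = 0"
    using test_functions_support[OF assms(2)] by metis
  show ?thesis
    by (rule test_functionsI[of _ "K \<union> K'"])
      (use K K' assms[THEN test_functions_smooth] in \<open>auto simp: smooth_on_def intro!: C_k_on_add\<close>)
qed

lemma test_functions_bounded_linear: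
  assumes "bounded_linear L" "\<phi> \<in> test_functions \<Omega>"
  shows "(\<lambda>z. L (\<phi> z)) \<in> test_functions \<Omega>"
proof -
  obtain r K where K: "compact K" "K \<subseteq> \<Omega>" "\<And>z. z \<notin> K \<Longrightarrow> \<phi> z = 0"
    using test_functions_support[OF assms(2)] by metis
  show ?thesis
    by (rule test_functionsI[of _ K])
      (use K C_k_on_bounded_linear[OF assms(1) open_UNIV test_functions_smooth[OF assms(2)]]
        linear_0[OF bounded_linear.linear[OF assms(1)]] in \<open>auto simp: smooth_on_def\<close>)
qed

lemma test_functions_cmult: "\<phi> \<in> test_functions \<Omega> \<Longrightarrow> (\<lambda>z. c * \<phi> z) \<in> test_functions \<Omega>"
  using test_functions_bounded_linear[OF bounded_linear_mult_right[of c], of \<phi> \<Omega>] by simp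

lemma test_functions_cnj: "\<phi> \<in> test_functions \<Omega> \<Longrightarrow> (\<lambda>z. cnj (\<phi> z)) \<in> test_functions \<Omega>"
  using test_functions_bounded_linear[OF bounded_linear_cnj, of \<phi> \<Omega>] by simp

lemma partial_deriv_add:
  assumes "f differentiable (at x)" "g differentiable (at x)"
  shows "partial_deriv v (\<lambda>x. f x + g x) x = partial_deriv v f x + partial_deriv v g x"
  by (rule partial_deriv_eq[OF has_derivative_add]) (rule has_derivative_partial_deriv assms)+

lemma partial_deriv_bounded_linear:
  assumes "bounded_linear L" "f differentiable (at x)"
  shows "partial_deriv v (\<lambda>x. L (f x)) x = L (partial_deriv v f x)"
  by (rule partial_deriv_eq[OF bounded_linear.has_derivative[OF assms(1)]])
    (rule has_derivative_partial_deriv assms)+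

lemma partial_deriv_mult:
  fixes f g :: "'a::real_normed_vector \<Rightarrow> 'b::real_normed_algebra"
  assumes "f differentiable (at x)" "g differentiable (at x)"
  shows "partial_deriv v (\<lambda>x. f x * g x) x = f x * partial_deriv v g x + partial_deriv v f x * g x"
  by (rule partial_deriv_eq[OF has_derivative_mult]) (rule has_derivative_partial_deriv assms)+

lemma integral_by_parts:
  fixes f g :: "'a::euclidean_space \<Rightarrow> 'b::{real_normed_algebra, banach, second_countable_topology}"
  assumes f: "C_k_on (Suc 0) f UNIV" and g: "C_k_on (Suc 0) g UNIV"
    and supp: "\<And>x. r < norm x \<Longrightarrow> g x = 0"
  shows "integral\<^sup>L lborel (\<lambda>x. f x * partial_deriv v g x) = - integral\<^sup>L lborel (\<lambda>x. partial_deriv v f x * g x)"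
proof -
  have c: "continuous_on UNIV f" "continuous_on UNIV g" "continuous_on UNIV (partial_deriv v f)"
    "continuous_on UNIV (partial_deriv v g)"
    using C_k_on_imp_continuous_on[OF f] C_k_on_imp_continuous_on[OF g]
      C_k_on_Suc_partial[OF f, of v] C_k_on_Suc_partial[OF g, of v] by auto
  have g0: "partial_deriv v g x = 0" if "r < norm x" for x
    by (rule partial_deriv_compact_support[OF supp that])
  have "integral\<^sup>L lborel (partial_deriv v (\<lambda>x. f x * g x)) = 0"
    by (rule integral_partial_deriv_eq_0[of _ r]) (use supp in \<open>auto intro!: C_k_on_mult f g\<close>)
  moreover have "partial_deriv v (\<lambda>x. f x * g x) =
      (\<lambda>x. f x * partial_deriv v g x + partial_deriv v f x * g x)"
    using f g by (intro ext partial_deriv_mult) (auto intro: C_k_on_Suc_differentiable)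
  moreover have "integrable lborel (\<lambda>x. f x * partial_deriv v g x)"
    by (rule integrable_continuous_compact_support[of _ r]) (use g0 in \<open>auto intro!: continuous_intros c\<close>)
  moreover have "integrable lborel (\<lambda>x. partial_deriv v f x * g x)"
    by (rule integrable_continuous_compact_support[of _ r]) (use supp in \<open>auto intro!: continuous_intros c\<close>)
  ultimately show ?thesis by (simp add: eq_neg_iff_add_eq_0)
qed

text \<open>The spaces are defined through \<open>lebesgue_on \<Omega>\<close>, while translations,
  integration by parts and Fubini are carried out in \<open>lborel\<close>. Borel functions
  vanishing off \<Omega> pass freely between the two.\<close>

lemma lebesgue_on_eq_lborel:
  fixes h :: "complex \<Rightarrow> 'b::{banach, second_countable_topology}"
  assumes "open \<Omega>" "h \<in> borel_measurable borel" "\<And>z. z \<notin> \<Omega> \<Longrightarrow> h z = 0"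
  shows "integral\<^sup>L (lebesgue_on \<Omega>) h = integral\<^sup>L lborel h"
    and "integrable (lebesgue_on \<Omega>) h \<longleftrightarrow> integrable lborel h"
proof -
  have \<Omega>: "\<Omega> \<inter> space lebesgue \<in> sets lebesgue" using assms(1) by (simp add: borel_open)
  have "(\<lambda>z. indicator \<Omega> z *\<^sub>R h z) = h" using assms(3) by (auto simp: fun_eq_iff indicator_def)
  then show "integral\<^sup>L (lebesgue_on \<Omega>) h = integral\<^sup>L lborel h"
    "integrable (lebesgue_on \<Omega>) h \<longleftrightarrow> integrable lborel h"
    using assms(2) by (simp_all add: integral_restrict_space[OF \<Omega>] integrable_restrict_space[OF \<Omega>]
        integral_completion integrable_completion)
qed

lemma borel_measurable_lebesgue_on:
  "h \<in> borel_measurable borel \<Longrightarrow> h \<in> borel_measurable (lebesgue_on \<Omega>)"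
  by (intro measurable_restrict_space1 measurable_completion) simp

lemma integrable_lebesgue_on_lborel:
  fixes h :: "complex \<Rightarrow> 'b::{banach, second_countable_topology}"
  assumes "open \<Omega>" "integrable lborel h"
  shows "integrable (lebesgue_on \<Omega>) h"
proof -
  have \<Omega>: "\<Omega> \<inter> space lebesgue \<in> sets lebesgue" using assms(1) by (simp add: borel_open)
  have "integrable lebesgue h"
    using assms(2) by (simp add: integrable_completion borel_measurable_integrable)
  then show ?thesis unfolding integrable_restrict_space[OF \<Omega>]
    using \<Omega> by (intro integrable_mult_indicator) auto
qed

lemma L2_continuous_compact_support:
  assumes "open \<Omega>" "continuous_on UNIV h" "\<And>z. r < norm z \<Longrightarrow> h z = 0"
  shows "h \<in> L2 \<Omega>"
proof -
  have "integrable lborel (\<lambda>z. (norm (h z))\<^sup>2)"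
    by (rule integrable_continuous_compact_support[of _ r])
      (use assms in \<open>auto intro!: continuous_intros\<close>)
  then show ?thesis
    unfolding L2_def using assms(1,2)
    by (auto intro!: integrable_lebesgue_on_lborel borel_measurable_lebesgue_on borel_measurable_continuous_onI)
qed

lemma test_functions_continuous: "\<phi> \<in> test_functions \<Omega> \<Longrightarrow> continuous_on UNIV \<phi>"
  using C_k_on_imp_continuous_on[OF test_functions_smooth] .

lemma test_functions_partial_continuous:
  "\<phi> \<in> test_functions \<Omega> \<Longrightarrow> continuous_on UNIV (partial_deriv v \<phi>)"
  using C_k_on_Suc_partial[OF test_functions_smooth, of \<phi> \<Omega> 0] by simp

lemma test_functions_differentiable: "\<phi> \<in> test_functions \<Omega> \<Longrightarrow> \<phi> differentiable (at z)"
  using C_k_on_Suc_differentiable[OF test_functions_smooth, of \<phi> \<Omega> z] by simp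

lemma test_functions_L2: "open \<Omega> \<Longrightarrow> \<phi> \<in> test_functions \<Omega> \<Longrightarrow> \<phi> \<in> L2 \<Omega>"
  by (metis L2_continuous_compact_support test_functions_continuous test_functions_bounded_support)

lemma test_functions_partial_L2:
  assumes "open \<Omega>" "\<phi> \<in> test_functions \<Omega>"
  shows "partial_deriv v \<phi> \<in> L2 \<Omega>"
proof -
  obtain r where r: "\<And>z. r < norm z \<Longrightarrow> \<phi> z = 0"
    using test_functions_bounded_support[OF assms(2)] by blast
  show ?thesis
    by (rule L2_continuous_compact_support[OF assms(1) test_functions_partial_continuous[OF assms(2)]])
      (rule partial_deriv_compact_support[OF r])
qed

lemma test_functions_has_weak_partial:
  assumes \<Omega>: "open \<Omega>" and v: "v \<in> test_functions \<Omega>"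
  shows "has_weak_partial \<Omega> b v (partial_deriv b v)"
  unfolding has_weak_partial_def
proof
  fix \<phi> assume \<phi>: "\<phi> \<in> test_functions \<Omega>"
  obtain r where r: "\<And>z. r < norm z \<Longrightarrow> \<phi> z = 0"
    using test_functions_bounded_support[OF \<phi>] by blast
  note [measurable] = test_functions_continuous[THEN borel_measurable_continuous_onI]
    test_functions_partial_continuous[THEN borel_measurable_continuous_onI]
  have "integral\<^sup>L (lebesgue_on \<Omega>) (\<lambda>z. v z * partial_deriv b \<phi> z) = integral\<^sup>L lborel (\<lambda>z. v z * partial_deriv b \<phi> z)"
    using \<Omega> v \<phi> by (intro lebesgue_on_eq_lborel) (auto simp: test_functions_outside)
  also have "\<dots> = - integral\<^sup>L lborel (\<lambda>z. partial_deriv b v z * \<phi> z)"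
    by (rule integral_by_parts[OF test_functions_smooth[OF v] test_functions_smooth[OF \<phi>] r])
  also have "integral\<^sup>L lborel (\<lambda>z. partial_deriv b v z * \<phi> z) = integral\<^sup>L (lebesgue_on \<Omega>) (\<lambda>z. partial_deriv b v z * \<phi> z)"
    using \<Omega> v \<phi> by (intro lebesgue_on_eq_lborel[symmetric]) (auto simp: test_functions_outside)
  finally show "integral\<^sup>L (lebesgue_on \<Omega>) (\<lambda>z. v z * partial_deriv b \<phi> z) =
      - integral\<^sup>L (lebesgue_on \<Omega>) (\<lambda>z. partial_deriv b v z * \<phi> z)" .
qed


section \<open>The fundamental lemma of the calculus of variations\<close>

text \<open>Open boxes form an intersection-stable generator of the Borel sets. For complements the
  integral over the whole space must also vanish, which follows by exhausting the space with growing
  boxes.\<close>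

lemma AE_eq_0_if_integral_box_eq_0:
  fixes f :: "'a::euclidean_space \<Rightarrow> 'b::{banach, second_countable_topology}"
  assumes f: "integrable lborel f" and box: "\<And>a b. (LINT x:box a b|lborel. f x) = 0"
  shows "AE x in lborel. f x = 0"
proof (rule sigma_finite_measure.density_zero[OF sigma_finite_lborel f])
  have si: "set_integrable lborel A f" if "A \<in> sets borel" for A
    using f that unfolding set_integrable_def by (intro integrable_mult_indicator) auto
  let ?A = "\<lambda>n::nat. box (- (real n *\<^sub>R One)) (real n *\<^sub>R One) :: 'a set"
  have "(\<lambda>n. LINT x:?A n|lborel. f x) \<longlonglongrightarrow> (LINT x:(\<Union>n. ?A n)|lborel. f x)"
    by (intro set_integral_cont_up si) (auto intro!: incseq_SucI subset_box_imp simp: algebra_simps)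
  then have "(\<lambda>n::nat. 0) \<longlonglongrightarrow> integral\<^sup>L lborel f"
    by (simp only: box UN_box_eq_UNIV) (simp add: set_lebesgue_integral_def)
  then have all: "integral\<^sup>L lborel f = 0"
    using LIMSEQ_unique tendsto_const by blast
  fix A :: "'a set" assume "A \<in> sets lborel"
  then have A: "A \<in> sigma_sets UNIV (range (\<lambda>(a, b). box a b))"
    by (simp add: borel_eq_box)
  have "Int_stable (range (\<lambda>(a, b). box a b :: 'a set))"
    by (auto simp: Int_stable_def box_Int_box)
  moreover have "range (\<lambda>(a, b). box a b :: 'a set) \<subseteq> Pow UNIV" by simp
  moreover note A
  ultimately show "(LINT x:A|lborel. f x) = 0"
  proof (induction rule: sigma_sets_induct_disjoint)
    case (basic A)
    then show ?case using box by auto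
  next
    case empty
    show ?case by (simp add: set_lebesgue_integral_def)
  next
    case (compl A)
    then have A: "A \<in> sets borel" by (simp add: borel_eq_box)
    have "(LINT x:A|lborel. f x) + (LINT x:UNIV - A|lborel. f x) = (LINT x:A \<union> (UNIV - A)|lborel. f x)"
      using A by (intro set_integral_Un[symmetric] si) auto
    then show ?case using compl.IH all by (simp add: set_lebesgue_integral_def)
  next
    case (union A)
    then have A: "A i \<in> sets borel" for i by (auto simp: borel_eq_box)
    have "(LINT x:(\<Union>i. A i)|lborel. f x) = (\<Sum>i. (LINT x:A i|lborel. f x))"
      using union A by (intro lebesgue_integral_countable_add si) (auto simp: disjoint_family_on_def)
    then show ?case using union by simp
  qed
qed

section \<open>Smooth approximation of box indicators\<close>

lemma box_complex_iff: "z \<in> box a b \<longleftrightarrow> Re a < Re z \<and> Re z < Re b \<and> Im a < Im z \<and> Im z < Im b"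
  by (auto simp: mem_box Basis_complex_def)

lemma flat_exp_le_1: "flat_exp 0 t \<le> 1"
  by (simp add: flat_exp_def)

lemma flat_exp_scaled_tendsto:
  "(\<lambda>n. flat_exp 0 (real n * t)) \<longlonglongrightarrow> (if t > 0 then 1 else 0)"
proof (cases "t > 0")
  case True
  have "(\<lambda>n. exp (- inverse (real n * t))) \<longlonglongrightarrow> 1" using True by real_asymp
  moreover have "\<forall>\<^sub>F n in sequentially. exp (- inverse (real n * t)) = flat_exp 0 (real n * t)"
    using eventually_gt_at_top[of 0] by eventually_elim (use True in \<open>auto simp: flat_exp_def mult_le_0_iff\<close>)
  ultimately show ?thesis using True by (simp add: Lim_transform_eventually)
next
  case False
  then have "flat_exp 0 (real n * t) = 0" for n by (simp add: flat_exp_def mult_nonneg_nonpos)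
  with False show ?thesis by simp
qed

text \<open>Explicit smooth approximations of the indicator of an open box, vanishing off the box,
  take the place of a mollification.\<close>

definition box_bump :: "complex \<Rightarrow> complex \<Rightarrow> nat \<Rightarrow> complex \<Rightarrow> real" where
  "box_bump a b n z = flat_exp 0 (real n * (Re z - Re a)) * flat_exp 0 (real n * (Re b - Re z)) *
     (flat_exp 0 (real n * (Im z - Im a)) * flat_exp 0 (real n * (Im b - Im z)))"

lemma box_bump_bounds: "0 \<le> box_bump a b n z" "box_bump a b n z \<le> 1"
  unfolding box_bump_def
  by (auto intro!: mult_nonneg_nonneg mult_le_one simp: flat_exp_nonneg flat_exp_le_1)

lemma box_bump_outside: "z \<notin> box a b \<Longrightarrow> box_bump a b n z = 0"
  by (auto simp: box_complex_iff box_bump_def flat_exp_def mult_nonneg_nonpos not_less)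

lemma box_bump_tendsto: "(\<lambda>n. box_bump a b n z) \<longlonglongrightarrow> (indicator (box a b) z :: real)"
proof -
  have "(\<lambda>n. box_bump a b n z) \<longlonglongrightarrow> (if Re z - Re a > 0 then 1 else 0) * (if Re b - Re z > 0 then 1 else 0) *
     ((if Im z - Im a > 0 then 1 else 0) * (if Im b - Im z > 0 then 1 else 0))"
    unfolding box_bump_def by (intro tendsto_mult flat_exp_scaled_tendsto)
  moreover have "(if Re z - Re a > 0 then 1 else 0) * (if Re b - Re z > 0 then 1 else 0) *
     ((if Im z - Im a > 0 then 1 else 0) * (if Im b - Im z > 0 then 1 else 0)) = (indicator (box a b) z :: real)"
    by (auto simp: indicator_def box_complex_iff)
  ultimately show ?thesis by simp
qed

lemma box_bump_test:
  assumes "cbox a b \<subseteq> \<Omega>"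
  shows "(\<lambda>z. of_real (box_bump a b n z)) \<in> test_functions \<Omega>"
proof (rule test_functionsI[of _ "cbox a b"])
  show "smooth_on (\<lambda>z. of_real (box_bump a b n z) :: complex) UNIV"
    unfolding smooth_on_def box_bump_def
    by (intro allI C_k_on_of_real C_k_on_mult C_k_on_real_comp[OF _ _ C_k_on_flat_exp] C_k_on_diff C_k_on_const
        C_k_on_bounded_linear[OF bounded_linear_Re] C_k_on_bounded_linear[OF bounded_linear_Im] C_k_on_id)
      auto
  show "of_real (box_bump a b n z) = (0::complex)" if "z \<notin> cbox a b" for z
    using that box_subset_cbox[of a b] by (auto intro: box_bump_outside)
qed (use assms in auto)

text \<open>Approximating boxes by test functions shows that \<open>g\<close> has integral zero over
  boxes with closure in \<Omega>. The generator argument then gives vanishing almost everywhere, one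
  box of a countable cover at a time.\<close>

lemma fundamental_lemma_calculus_of_variations:
  assumes \<Omega>: "open \<Omega>" and g: "g \<in> L2 \<Omega>"
    and 0: "\<And>\<phi>. \<phi> \<in> test_functions \<Omega> \<Longrightarrow> integral\<^sup>L (lebesgue_on \<Omega>) (\<lambda>z. g z * \<phi> z) = 0"
  shows "AE z in lebesgue_on \<Omega>. g z = 0"
proof -
  have \<Omega>s: "\<Omega> \<inter> space lebesgue \<in> sets lebesgue" using \<Omega> by (simp add: borel_open)
  note gm [measurable] = L2_measurable[OF g]
  have box: "AE z in lebesgue. z \<in> box p q \<longrightarrow> g z = 0" if pq: "cbox p q \<subseteq> \<Omega>" for p q
  proof -
    have pq': "box p q \<subseteq> \<Omega>" using pq box_subset_cbox by blast
    \<comment> \<open>A square integrable function becomes integrable after restriction to a bounded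
      box, as the generator argument requires.\<close>
    define G where "G z = indicator (box p q) z *\<^sub>R g z" for z
    have "(\<lambda>z. indicator (box p q) z :: complex) \<in> L2 \<Omega>"
    proof -
      have "integrable lborel (\<lambda>z. indicator (box p q) z :: real)"
        using emeasure_bounded_finite[OF bounded_box, of p q] by (intro integrable_real_indicator) auto
      then have "integrable (lebesgue_on \<Omega>) (\<lambda>z. indicator (box p q) z :: real)"
        by (rule integrable_lebesgue_on_lborel[OF \<Omega>])
      moreover have "(norm (indicator (box p q) z :: complex))\<^sup>2 = indicator (box p q) z" for z
        by (simp add: indicator_def)
      ultimately show ?thesis
        unfolding L2_def by (auto intro!: borel_measurable_lebesgue_on)
    qed
    moreover have "G = (\<lambda>z. indicator (box p q) z * g z)"
      by (auto simp: G_def fun_eq_iff indicator_def)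
    ultimately have iG: "integrable (lebesgue_on \<Omega>) G"
      using L2_mult_integrable[OF _ g] by simp
    have GO: "(\<lambda>z. indicator \<Omega> z *\<^sub>R G z) = G"
      using pq' by (auto simp: G_def fun_eq_iff indicator_def)
    have iG': "integrable lebesgue G"
      using iG unfolding integrable_restrict_space[OF \<Omega>s] GO .
    \<comment> \<open>Intersecting with the fixed box reduces an arbitrary box to one whose closure
      lies in \<Omega>. An empty intersection is treated apart because \<open>cbox c d\<close> need
      not then lie in \<open>cbox p q\<close>.\<close>
    have zero: "integral\<^sup>L lebesgue (\<lambda>z. indicator (box a b) z *\<^sub>R G z) = 0" for a b
    proof -
      obtain c d where cd: "box a b \<inter> box p q = box c d" by (rule that[OF box_Int_box])
      show ?thesis
      proof (cases "box c d = {}")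
        case True
        then have "(\<lambda>z. indicator (box a b) z *\<^sub>R G z) = (\<lambda>z. 0)"
          using cd by (auto simp: G_def indicator_def fun_eq_iff)
        then show ?thesis by (simp only: integral_zero)
      next
        case False
        have "closure (box c d) \<subseteq> closure (box p q)"
          using cd by (intro closure_mono) auto
        then have sub: "cbox c d \<subseteq> cbox p q"
          using False cd by (metis Int_empty_right closure_box)
        have "(\<lambda>n. integral\<^sup>L (lebesgue_on \<Omega>) (\<lambda>z. g z * of_real (box_bump c d n z)))
            \<longlonglongrightarrow> integral\<^sup>L (lebesgue_on \<Omega>) (\<lambda>z. indicator (box c d) z *\<^sub>R g z)"
        proof (rule integral_dominated_convergence[where w="\<lambda>z. norm (G z)"])
          have test: "(\<lambda>z. of_real (box_bump c d n z)) \<in> L2 \<Omega>" for n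
            by (intro test_functions_L2 box_bump_test \<Omega>) (use sub pq in auto)
          show "(\<lambda>z. g z * of_real (box_bump c d n z)) \<in> borel_measurable (lebesgue_on \<Omega>)" for n
            using L2_measurable[OF test] by measurable
          show "(\<lambda>z. indicator (box c d) z *\<^sub>R g z) \<in> borel_measurable (lebesgue_on \<Omega>)"
            by (rule borel_measurable_scaleR[OF borel_measurable_lebesgue_on gm]) auto
          show "AE z in lebesgue_on \<Omega>. (\<lambda>n. g z * of_real (box_bump c d n z)) \<longlonglongrightarrow> indicator (box c d) z *\<^sub>R g z"
          proof (rule AE_I2)
            fix z
            have "(\<lambda>n. g z * of_real (box_bump c d n z)) \<longlonglongrightarrow> g z * of_real (indicator (box c d) z)"
              by (intro tendsto_intros box_bump_tendsto)
            then show "(\<lambda>n. g z * of_real (box_bump c d n z)) \<longlonglongrightarrow> indicator (box c d) z *\<^sub>R g z"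
              by (simp add: scaleR_conv_of_real mult.commute)
          qed
          show "AE z in lebesgue_on \<Omega>. norm (g z * of_real (box_bump c d n z)) \<le> norm (G z)" for n
          proof (rule AE_I2)
            fix z
            show "norm (g z * of_real (box_bump c d n z)) \<le> norm (G z)"
            proof (cases "z \<in> box c d")
              case True
              then have "z \<in> box p q" using cd by auto
              then show ?thesis using box_bump_bounds[of c d n z]
                by (simp add: G_def norm_mult mult_left_le)
            qed (simp add: box_bump_outside)
          qed
          show "integrable (lebesgue_on \<Omega>) (\<lambda>z. norm (G z))" using iG by simp
        qed
        moreover have "integral\<^sup>L (lebesgue_on \<Omega>) (\<lambda>z. g z * of_real (box_bump c d n z)) = 0" for n
          by (intro 0 box_bump_test) (use sub pq in auto)
        ultimately have "(\<lambda>n::nat. 0) \<longlonglongrightarrow> integral\<^sup>L (lebesgue_on \<Omega>) (\<lambda>z. indicator (box c d) z *\<^sub>R g z)"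
          by (simp only:)
        from LIMSEQ_unique[OF this tendsto_const]
        have "integral\<^sup>L (lebesgue_on \<Omega>) (\<lambda>z. indicator (box c d) z *\<^sub>R g z) = 0" .
        then have "integral\<^sup>L lebesgue (\<lambda>z. indicator \<Omega> z *\<^sub>R indicator (box c d) z *\<^sub>R g z) = 0"
          by (simp add: integral_restrict_space[OF \<Omega>s])
        moreover have "indicator \<Omega> z *\<^sub>R indicator (box c d) z *\<^sub>R g z = indicator (box a b) z *\<^sub>R G z" for z
          using pq' by (auto simp: G_def indicator_def cd[symmetric])
        ultimately show ?thesis by simp
      qed
    qed
    \<comment> \<open>The generator argument concerns Borel functions, whereas \<open>G\<close> is
      Lebesgue measurable. Real functionals of \<open>G\<close> have Borel representatives, and the
      real and imaginary parts suffice.\<close>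
    have part: "AE z in lebesgue. L (G z) = 0" if L: "bounded_linear L" for L :: "complex \<Rightarrow> real"
    proof -
      have iL: "integrable lebesgue (\<lambda>z. L (G z))"
        by (rule integrable_bounded_linear[OF L iG'])
      then obtain h where h: "h \<in> borel_measurable lborel" "AE z in lborel. L (G z) = h z"
        using completion_ex_borel_measurable_real[OF borel_measurable_integrable[OF iL]] by blast
      have ae: "AE z in lebesgue. L (G z) = h z" using h(2) by (rule AE_completion)
      have hm: "h \<in> borel_measurable lebesgue" using h(1) by (rule measurable_completion)
      have "integrable lebesgue h"
        using iL integrable_cong_AE[OF borel_measurable_integrable[OF iL] hm ae] by blast
      then have ih: "integrable lborel h" using integrable_completion[OF h(1)] by blast
      have "(LINT z:box a b|lborel. h z) = 0" for a b
      proof -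
        have "(LINT z:box a b|lborel. h z) = integral\<^sup>L lebesgue (\<lambda>z. indicator (box a b) z *\<^sub>R h z)"
          unfolding set_lebesgue_integral_def
          by (rule integral_completion[symmetric]) (rule borel_measurable_scaleR[OF borel_measurable_indicator h(1)], simp)
        also have "\<dots> = integral\<^sup>L lebesgue (\<lambda>z. L (indicator (box a b) z *\<^sub>R G z))"
        proof (rule integral_cong_AE)
          show "AE z in lebesgue. indicator (box a b) z *\<^sub>R h z = L (indicator (box a b) z *\<^sub>R G z)"
            using ae by eventually_elim (simp add: linear_simps[OF L])
          show "(\<lambda>z. indicator (box a b) z *\<^sub>R h z) \<in> borel_measurable lebesgue"
            using hm by (intro borel_measurable_scaleR) (auto intro: measurable_completion)
          show "(\<lambda>z. L (indicator (box a b) z *\<^sub>R G z)) \<in> borel_measurable lebesgue"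
            by (intro borel_measurable_integrable integrable_bounded_linear[OF L] integrable_mult_indicator iG') auto
        qed
        also have "\<dots> = L (integral\<^sup>L lebesgue (\<lambda>z. indicator (box a b) z *\<^sub>R G z))"
          by (intro integral_bounded_linear L integrable_mult_indicator iG') auto
        also have "\<dots> = 0" by (simp add: zero linear_simps[OF L])
        finally show ?thesis .
      qed
      then have "AE z in lborel. h z = 0"
        by (rule AE_eq_0_if_integral_box_eq_0[OF ih])
      then have "AE z in lebesgue. h z = 0" by (rule AE_completion)
      with ae show ?thesis by eventually_elim simp
    qed
    show ?thesis
      using part[OF bounded_linear_Re] part[OF bounded_linear_Im]
      by eventually_elim (auto simp: G_def complex_eq_iff)
  qed
  obtain D where D: "countable D" "D \<subseteq> Pow \<Omega>" "\<And>X. X \<in> D \<Longrightarrow> \<exists>a b. X = cbox a b" "\<Union>D = \<Omega>"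
    using open_countable_Union_open_cbox[OF \<Omega>] by metis
  have "AE z in lebesgue. z \<in> X \<longrightarrow> g z = 0" if "X \<in> D" for X
  proof -
    obtain a b where X: "X = cbox a b" using D(3) \<open>X \<in> D\<close> by blast
    \<comment> \<open>The cover consists of closed boxes, but vanishing is known on open ones; the
      boundaries are null.\<close>
    have "cbox a b - box a b \<in> null_sets lebesgue"
      using negligible_frontier_interval by (simp add: negligible_iff_null_sets)
    then have "AE z in lebesgue. z \<notin> cbox a b - box a b" by (rule AE_not_in)
    moreover have "AE z in lebesgue. z \<in> box a b \<longrightarrow> g z = 0"
      using D(2) \<open>X \<in> D\<close> X by (intro box) auto
    ultimately show ?thesis unfolding X by eventually_elim auto
  qed
  then have "AE z in lebesgue. \<forall>X\<in>D. z \<in> X \<longrightarrow> g z = 0"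
    using D(1) by (intro iffD2[OF AE_ball_countable] ballI)
  then have "AE z in lebesgue. z \<in> \<Omega> \<longrightarrow> g z = 0"
    by eventually_elim (use D(4) in blast)
  then show ?thesis by (simp add: AE_restrict_space_iff[OF \<Omega>s])
qed


section \<open>The Poincare inequality for test functions\<close>

text \<open>The gradient norm with classical derivatives, in contrast to \<open>grad_norm\<close>,
  whose \<open>weak_partial\<close> is an arbitrary choice in an almost everywhere class.\<close>

definition test_grad_norm :: "complex set \<Rightarrow> (complex \<Rightarrow> complex) \<Rightarrow> real" where
  "test_grad_norm \<Omega> v =
     sqrt ((L2_norm \<Omega> (partial_deriv 1 v))\<^sup>2 + (L2_norm \<Omega> (partial_deriv \<i> v))\<^sup>2)"

definition poincare_test :: "complex set \<Rightarrow> bool" where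
  "poincare_test \<Omega> \<longleftrightarrow> (\<exists>C>0. \<forall>v\<in>test_functions \<Omega>. L2_norm \<Omega> v \<le> C * test_grad_norm \<Omega> v)"

lemma has_weak_partial_unique:
  assumes \<Omega>: "open \<Omega>" and g: "g \<in> L2 \<Omega>" "has_weak_partial \<Omega> b u g"
    and h: "h \<in> L2 \<Omega>" "has_weak_partial \<Omega> b u h"
  shows "AE z in lebesgue_on \<Omega>. g z = h z"
proof -
  have "AE z in lebesgue_on \<Omega>. g z - h z = 0"
  proof (rule fundamental_lemma_calculus_of_variations[OF \<Omega> L2_diff[OF g(1) h(1)]])
    fix \<phi> assume \<phi>: "\<phi> \<in> test_functions \<Omega>"
    have "integral\<^sup>L (lebesgue_on \<Omega>) (\<lambda>z. g z * \<phi> z) = integral\<^sup>L (lebesgue_on \<Omega>) (\<lambda>z. h z * \<phi> z)"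
      using bspec[OF g(2)[unfolded has_weak_partial_def] \<phi>] bspec[OF h(2)[unfolded has_weak_partial_def] \<phi>]
      by simp
    then show "integral\<^sup>L (lebesgue_on \<Omega>) (\<lambda>z. (g z - h z) * \<phi> z) = 0"
      using L2_mult_integrable[OF g(1) test_functions_L2[OF \<Omega> \<phi>]]
        L2_mult_integrable[OF h(1) test_functions_L2[OF \<Omega> \<phi>]]
      by (simp add: left_diff_distrib)
  qed
  then show ?thesis by eventually_elim simp
qed

lemma weak_partial_L2:
  assumes "u \<in> H1 \<Omega>" "b \<in> {1, \<i>}"
  shows "weak_partial \<Omega> b u \<in> L2 \<Omega>" "has_weak_partial \<Omega> b u (weak_partial \<Omega> b u)"
proof -
  have "\<exists>g. g \<in> L2 \<Omega> \<and> has_weak_partial \<Omega> b u g"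
    using assms by (auto simp: H1_def)
  from someI_ex[OF this]
  show "weak_partial \<Omega> b u \<in> L2 \<Omega>" "has_weak_partial \<Omega> b u (weak_partial \<Omega> b u)"
    by (simp_all add: weak_partial_def)
qed

lemma has_weak_partial_diff:
  assumes \<Omega>: "open \<Omega>" and u: "u \<in> L2 \<Omega>" "g \<in> L2 \<Omega>" "has_weak_partial \<Omega> b u g"
    and v: "v \<in> L2 \<Omega>" "h \<in> L2 \<Omega>" "has_weak_partial \<Omega> b v h"
  shows "has_weak_partial \<Omega> b (\<lambda>z. u z - v z) (\<lambda>z. g z - h z)"
  unfolding has_weak_partial_def
proof
  fix \<phi> assume \<phi>: "\<phi> \<in> test_functions \<Omega>"
  note i = L2_mult_integrable[OF _ test_functions_L2[OF \<Omega> \<phi>]]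
    L2_mult_integrable[OF _ test_functions_partial_L2[OF \<Omega> \<phi>]]
  show "integral\<^sup>L (lebesgue_on \<Omega>) (\<lambda>z. (u z - v z) * partial_deriv b \<phi> z) =
     - integral\<^sup>L (lebesgue_on \<Omega>) (\<lambda>z. (g z - h z) * \<phi> z)"
    using u v \<phi> i by (simp add: has_weak_partial_def left_diff_distrib)
qed

lemma H1_diff:
  assumes "open \<Omega>" "u \<in> H1 \<Omega>" "v \<in> H1 \<Omega>"
  shows "(\<lambda>z. u z - v z) \<in> H1 \<Omega>"
proof -
  have uv: "u \<in> L2 \<Omega>" "v \<in> L2 \<Omega>" using assms by (auto simp: H1_def)
  have "\<exists>g\<in>L2 \<Omega>. has_weak_partial \<Omega> b (\<lambda>z. u z - v z) g" if b: "b \<in> {1, \<i>}" for b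
    using has_weak_partial_diff[OF assms(1) uv(1) weak_partial_L2[OF assms(2) b] uv(2) weak_partial_L2[OF assms(3) b]]
      L2_diff[OF weak_partial_L2(1)[OF assms(2) b] weak_partial_L2(1)[OF assms(3) b]] by blast
  then show ?thesis using L2_diff[OF uv] by (simp add: H1_def)
qed

text \<open>The choice made by \<open>weak_partial\<close> need not be additive pointwise;
  uniqueness almost everywhere restores additivity inside the norm.\<close>

lemma L2_norm_weak_partial_diff:
  assumes \<Omega>: "open \<Omega>" and u: "u \<in> H1 \<Omega>" and v: "v \<in> H1 \<Omega>" and b: "b \<in> {1, \<i>}"
  shows "L2_norm \<Omega> (weak_partial \<Omega> b (\<lambda>z. u z - v z)) =
    L2_norm \<Omega> (\<lambda>z. weak_partial \<Omega> b u z - weak_partial \<Omega> b v z)"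
proof -
  have uv: "u \<in> L2 \<Omega>" "v \<in> L2 \<Omega>" using u v by (auto simp: H1_def)
  note wu = weak_partial_L2[OF u b] and wv = weak_partial_L2[OF v b]
    and wd = weak_partial_L2[OF H1_diff[OF \<Omega> u v] b]
  note hd = has_weak_partial_diff[OF \<Omega> uv(1) wu uv(2) wv]
  show ?thesis
    by (rule L2_norm_cong_AE[OF has_weak_partial_unique[OF \<Omega> wd L2_diff[OF wu(1) wv(1)] hd] wd(1)
          L2_diff[OF wu(1) wv(1)]])
qed

lemma test_functions_H1:
  assumes "open \<Omega>" "v \<in> test_functions \<Omega>"
  shows "v \<in> H1 \<Omega>"
  using test_functions_L2[OF assms] test_functions_partial_L2[OF assms] test_functions_has_weak_partial[OF assms]
  by (auto simp: H1_def)

lemma L2_norm_weak_partial_test: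
  assumes \<Omega>: "open \<Omega>" and v: "v \<in> test_functions \<Omega>" and b: "b \<in> {1, \<i>}"
  shows "L2_norm \<Omega> (weak_partial \<Omega> b v) = L2_norm \<Omega> (partial_deriv b v)"
proof -
  note w = weak_partial_L2[OF test_functions_H1[OF \<Omega> v] b]
  show ?thesis
    by (rule L2_norm_cong_AE[OF has_weak_partial_unique[OF \<Omega> w test_functions_partial_L2[OF \<Omega> v]
          test_functions_has_weak_partial[OF \<Omega> v]] w(1) test_functions_partial_L2[OF \<Omega> v]])
qed

lemma grad_norm_test:
  assumes "open \<Omega>" "v \<in> test_functions \<Omega>"
  shows "grad_norm \<Omega> v = test_grad_norm \<Omega> v"
  unfolding grad_norm_def test_grad_norm_def using assms by (simp add: L2_norm_weak_partial_test)

lemma H1_norm_ge: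
  "L2_norm \<Omega> u \<le> H1_norm \<Omega> u"
  "L2_norm \<Omega> (weak_partial \<Omega> 1 u) \<le> H1_norm \<Omega> u"
  "L2_norm \<Omega> (weak_partial \<Omega> \<i> u) \<le> H1_norm \<Omega> u"
  unfolding H1_norm_def grad_norm_def by (auto intro!: real_le_rsqrt)

lemma H10_subset_H1: "H10 \<Omega> \<subseteq> H1 \<Omega>"
  unfolding H10_def by (metis closure_of_subset_topspace topspace_seminorm_topology)

lemma test_functions_H10:
  assumes "open \<Omega>" shows "test_functions \<Omega> \<subseteq> H10 \<Omega>"
  unfolding H10_def
  by (rule closure_of_subset) (auto simp: topspace_seminorm_topology intro: test_functions_H1 assms)

text \<open>A point of a closure meets every open neighbourhood. The set \<open>U\<close> is such a
  neighbourhood: strict bounds on the function and both weak derivatives survive small perturbations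
  in the H1 seminorm.\<close>

lemma H10_approx:
  assumes \<Omega>: "open \<Omega>" and v: "v \<in> H10 \<Omega>" and e: "e > 0"
  obtains \<phi> where "\<phi> \<in> test_functions \<Omega>" "L2_norm \<Omega> (\<lambda>z. \<phi> z - v z) < e"
    "L2_norm \<Omega> (\<lambda>z. weak_partial \<Omega> 1 \<phi> z - weak_partial \<Omega> 1 v z) < e"
    "L2_norm \<Omega> (\<lambda>z. weak_partial \<Omega> \<i> \<phi> z - weak_partial \<Omega> \<i> v z) < e"
proof -
  have v1: "v \<in> H1 \<Omega>" using v H10_subset_H1 by blast
  define U where "U = {g \<in> H1 \<Omega>. L2_norm \<Omega> (\<lambda>z. g z - v z) < e \<and>
    L2_norm \<Omega> (\<lambda>z. weak_partial \<Omega> 1 g z - weak_partial \<Omega> 1 v z) < e \<and>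
    L2_norm \<Omega> (\<lambda>z. weak_partial \<Omega> \<i> g z - weak_partial \<Omega> \<i> v z) < e}"
  have "seminorm_open (H1 \<Omega>) (H1_norm \<Omega>) U"
    unfolding seminorm_open_def
  proof (intro conjI ballI)
    fix f assume f: "f \<in> U"
    then have f1: "f \<in> H1 \<Omega>" by (simp add: U_def)
    define r where "r = min (e - L2_norm \<Omega> (\<lambda>z. f z - v z))
      (min (e - L2_norm \<Omega> (\<lambda>z. weak_partial \<Omega> 1 f z - weak_partial \<Omega> 1 v z))
        (e - L2_norm \<Omega> (\<lambda>z. weak_partial \<Omega> \<i> f z - weak_partial \<Omega> \<i> v z)))"
    have "r > 0" using f by (auto simp: r_def U_def)
    moreover have "g \<in> U" if g: "g \<in> H1 \<Omega>" "H1_norm \<Omega> (\<lambda>z. g z - f z) < r" for g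
    proof -
      have L: "g \<in> L2 \<Omega>" "f \<in> L2 \<Omega>" "v \<in> L2 \<Omega>" using g f1 v1 by (auto simp: H1_def)
      have "L2_norm \<Omega> (\<lambda>z. g z - v z) < e"
        using L2_norm_triangle_diff[OF L] g(2) H1_norm_ge(1)[of \<Omega> "\<lambda>z. g z - f z"] unfolding r_def by linarith
      moreover have "L2_norm \<Omega> (\<lambda>z. weak_partial \<Omega> b g z - weak_partial \<Omega> b v z) < e" if b: "b \<in> {1, \<i>}" for b
        using L2_norm_triangle_diff[OF weak_partial_L2(1)[OF g(1) b] weak_partial_L2(1)[OF f1 b] weak_partial_L2(1)[OF v1 b]]
          g(2) H1_norm_ge(2,3)[of \<Omega> "\<lambda>z. g z - f z"] b L2_norm_weak_partial_diff[OF \<Omega> g(1) f1 b]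
        unfolding r_def by auto
      ultimately show ?thesis using g by (simp add: U_def)
    qed
    ultimately show "\<exists>\<epsilon>>0. \<forall>g\<in>H1 \<Omega>. H1_norm \<Omega> (\<lambda>z. g z - f z) < \<epsilon> \<longrightarrow> g \<in> U" by blast
  qed (auto simp: U_def)
  moreover have "v \<in> U" using v1 e by (simp add: U_def)
  ultimately have "\<exists>\<phi>. \<phi> \<in> test_functions \<Omega> \<and> \<phi> \<in> U"
    using v unfolding H10_def in_closure_of openin_seminorm_topology by blast
  then show ?thesis using that by (auto simp: U_def)
qed

lemma poincare_dirichlet_iff_test:
  assumes \<Omega>: "open \<Omega>"
  shows "poincare_dirichlet \<Omega> \<longleftrightarrow> poincare_test \<Omega>"
proof
  assume "poincare_dirichlet \<Omega>"
  then obtain C where C: "C > 0" "\<And>v. v \<in> H10 \<Omega> \<Longrightarrow> L2_norm \<Omega> v \<le> C * grad_norm \<Omega> v"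
    unfolding poincare_dirichlet_def by blast
  have "L2_norm \<Omega> v \<le> C * test_grad_norm \<Omega> v" if "v \<in> test_functions \<Omega>" for v
    using C(2)[of v] that test_functions_H10[OF \<Omega>] grad_norm_test[OF \<Omega> that] by auto
  with C(1) show "poincare_test \<Omega>" unfolding poincare_test_def by blast
next
  assume "poincare_test \<Omega>"
  then obtain C where C: "C > 0" "\<And>v. v \<in> test_functions \<Omega> \<Longrightarrow> L2_norm \<Omega> v \<le> C * test_grad_norm \<Omega> v"
    unfolding poincare_test_def by blast
  have "L2_norm \<Omega> v \<le> C * grad_norm \<Omega> v" if v: "v \<in> H10 \<Omega>" for v
  proof (rule field_le_epsilon)
    fix e :: real assume "e > 0"
    \<comment> \<open>This solves \<open>C * (2 * d) + d = e\<close>, the total error of replacing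
      \<open>v\<close> by a test function below.\<close>
    define d where "d = e / (2 * C + 1)"
    have d: "d > 0" using \<open>e > 0\<close> C(1) by (simp add: d_def)
    have v1: "v \<in> H1 \<Omega>" using v H10_subset_H1 by blast
    obtain \<phi> where \<phi>: "\<phi> \<in> test_functions \<Omega>" "L2_norm \<Omega> (\<lambda>z. \<phi> z - v z) < d"
      "L2_norm \<Omega> (\<lambda>z. weak_partial \<Omega> 1 \<phi> z - weak_partial \<Omega> 1 v z) < d"
      "L2_norm \<Omega> (\<lambda>z. weak_partial \<Omega> \<i> \<phi> z - weak_partial \<Omega> \<i> v z) < d"
      using H10_approx[OF \<Omega> v d] by blast
    note \<phi>1 = test_functions_H1[OF \<Omega> \<phi>(1)]
    have L: "\<phi> \<in> L2 \<Omega>" "v \<in> L2 \<Omega>" using \<phi>1 v1 by (auto simp: H1_def)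
    let ?a = "L2_norm \<Omega> (weak_partial \<Omega> 1 v)" and ?b = "L2_norm \<Omega> (weak_partial \<Omega> \<i> v)"
    have tri: "L2_norm \<Omega> (weak_partial \<Omega> b \<phi>) \<le> L2_norm \<Omega> (weak_partial \<Omega> b v) +
        L2_norm \<Omega> (\<lambda>z. weak_partial \<Omega> b \<phi> z - weak_partial \<Omega> b v z)" if b: "b \<in> {1, \<i>}" for b
      by (rule L2_norm_triangle_sub[OF weak_partial_L2(1)[OF \<phi>1 b] weak_partial_L2(1)[OF v1 b]])
    have ab: "L2_norm \<Omega> (weak_partial \<Omega> 1 \<phi>) \<le> ?a + d" "L2_norm \<Omega> (weak_partial \<Omega> \<i> \<phi>) \<le> ?b + d"
      using tri[of 1] tri[of \<i>] \<phi>(3,4) by simp_all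
    have "grad_norm \<Omega> \<phi> \<le> sqrt ((?a + d)\<^sup>2 + (?b + d)\<^sup>2)"
      unfolding grad_norm_def using ab by (intro real_sqrt_le_mono add_mono power_mono) auto
    also have "\<dots> \<le> sqrt (?a\<^sup>2 + ?b\<^sup>2) + sqrt (d\<^sup>2 + d\<^sup>2)"
      by (rule real_sqrt_sum_squares_triangle_ineq)
    also have "sqrt (d\<^sup>2 + d\<^sup>2) \<le> 2 * d"
      using d by (intro real_le_lsqrt) (auto simp: power2_eq_square)
    finally have g: "grad_norm \<Omega> \<phi> \<le> grad_norm \<Omega> v + 2 * d" by (simp add: grad_norm_def)
    have "L2_norm \<Omega> v \<le> L2_norm \<Omega> \<phi> + L2_norm \<Omega> (\<lambda>z. v z - \<phi> z)"
      by (rule L2_norm_triangle_sub[OF L(2,1)])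
    also have "\<dots> \<le> L2_norm \<Omega> \<phi> + d"
      using \<phi>(2) by (simp add: L2_norm_minus_commute[of \<Omega> v])
    also have "\<dots> \<le> C * (grad_norm \<Omega> v + 2 * d) + d"
      using C(2)[OF \<phi>(1), folded grad_norm_test[OF \<Omega> \<phi>(1)]] mult_left_mono[OF g less_imp_le[OF C(1)]]
      by linarith
    also have "\<dots> = C * grad_norm \<Omega> v + e"
    proof -
      have "d * (2 * C + 1) = e" using C(1) by (simp add: d_def)
      then show ?thesis by (simp add: algebra_simps)
    qed
    finally show "L2_norm \<Omega> v \<le> C * grad_norm \<Omega> v + e" .
  qed
  with C(1) show "poincare_dirichlet \<Omega>" unfolding poincare_dirichlet_def by blast
qed


section \<open>Bounded strictly subharmonic functions yield the Poincare inequality\<close>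

lemma L2_norm_power2_lborel:
  assumes "open \<Omega>" "continuous_on UNIV h" "\<And>z. z \<notin> \<Omega> \<Longrightarrow> h z = 0"
  shows "(L2_norm \<Omega> h)\<^sup>2 = integral\<^sup>L lborel (\<lambda>z. (norm (h z))\<^sup>2)"
  unfolding L2_norm_power2
  by (rule lebesgue_on_eq_lborel(1)[OF assms(1)])
    (use assms in \<open>auto intro!: borel_measurable_continuous_onI continuous_intros\<close>)

lemma test_functions_power2_integrable:
  assumes "\<phi> \<in> test_functions \<Omega>"
  shows "integrable lborel (\<lambda>z. (norm (\<phi> z))\<^sup>2)" "integrable lborel (\<lambda>z. (norm (partial_deriv b \<phi> z))\<^sup>2)"
proof -
  obtain r where r: "\<And>z. r < norm z \<Longrightarrow> \<phi> z = 0"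
    using test_functions_bounded_support[OF assms] by blast
  have r': "partial_deriv b \<phi> z = 0" if "r < norm z" for z
    by (rule partial_deriv_compact_support[OF r that])
  show "integrable lborel (\<lambda>z. (norm (\<phi> z))\<^sup>2)"
    by (rule integrable_continuous_compact_support[of _ r])
      (use r test_functions_continuous[OF assms] in \<open>auto intro!: continuous_intros\<close>)
  show "integrable lborel (\<lambda>z. (norm (partial_deriv b \<phi> z))\<^sup>2)"
    by (rule integrable_continuous_compact_support[of _ r])
      (use r' test_functions_partial_continuous[OF assms] in \<open>auto intro!: continuous_intros\<close>)
qed

lemma test_grad_norm_power2:
  assumes "open \<Omega>" "v \<in> test_functions \<Omega>"
  shows "(test_grad_norm \<Omega> v)\<^sup>2 =
    integral\<^sup>L lborel (\<lambda>z. (norm (partial_deriv 1 v z))\<^sup>2 + (norm (partial_deriv \<i> v z))\<^sup>2)"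
  using assms test_functions_power2_integrable[OF assms(2)]
  by (simp add: test_grad_norm_def L2_norm_power2_lborel test_functions_partial_continuous
      test_functions_partial_outside)

text \<open>For a test function \<open>v\<close> the field \<open>exp \<phi> |v|\<^sup>2 grad \<phi>\<close> has compact support, so its
  divergence has integral zero.\<close>

lemma poincare_test_if_bounded_subharmonic:
  fixes \<phi> :: "complex \<Rightarrow> real"
  assumes \<Omega>: "open \<Omega>" and \<phi>: "smooth_on \<phi> \<Omega>" and bdd: "bounded (\<phi> ` \<Omega>)" and c: "c > 0"
    and lap: "\<And>z. z \<in> \<Omega> \<Longrightarrow> laplacian \<phi> z > c"
  shows "poincare_test \<Omega>"
proof -
  obtain M where M: "\<And>z. z \<in> \<Omega> \<Longrightarrow> \<bar>\<phi> z\<bar> \<le> M"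
    using bdd by (auto simp: bounded_iff)
  have \<phi>C: "C_k_on k \<phi> \<Omega>" for k using \<phi> by (rule C_k_on_smooth)
  have \<phi>C': "C_k_on k (partial_deriv b \<phi>) \<Omega>" for k b using C_k_on_Suc_partial[OF \<phi>C] .
  have key: "c * exp (- M) * (L2_norm \<Omega> v)\<^sup>2 \<le> exp M * (test_grad_norm \<Omega> v)\<^sup>2" if v: "v \<in> test_functions \<Omega>" for v
  proof -
    obtain r K where K: "compact K" "K \<subseteq> \<Omega>" "\<And>z. z \<notin> K \<Longrightarrow> v z = 0" "\<And>z. r < norm z \<Longrightarrow> v z = 0"
      using test_functions_support[OF v] by metis
    define F where "F b z = (if z \<in> \<Omega> then exp (\<phi> z) * (v z \<bullet> v z) * partial_deriv b \<phi> z else 0)" for b z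
    have expC: "C_k_on k (exp :: real \<Rightarrow> real) UNIV" for k
    proof (induction k)
      case (Suc k)
      have "((exp::real\<Rightarrow>real) has_derivative (\<lambda>v. exp x * v)) (at x)" for x
        by (auto intro!: derivative_eq_intros)
      then show ?case by (rule C_k_on_SucI[OF open_UNIV]) (intro C_k_on_mult Suc C_k_on_const open_UNIV)
    qed (simp add: continuous_intros)
    have FC: "C_k_on (Suc 0) (F b) UNIV" for b
    proof (rule C_k_on_local)
      fix x :: complex
      show "\<exists>T. open T \<and> x \<in> T \<and> C_k_on (Suc 0) (F b) T"
      proof (cases "x \<in> \<Omega>")
        case True
        have "C_k_on (Suc 0) (\<lambda>z. exp (\<phi> z) * (v z \<bullet> v z) * partial_deriv b \<phi> z) \<Omega>"
          using C_k_on_subset[OF test_functions_smooth[OF v]]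
          by (intro C_k_on_mult C_k_on_bilinear[OF bounded_bilinear_inner] C_k_on_real_comp[OF \<Omega> \<phi>C expC] \<phi>C' \<Omega>) auto
        then have "C_k_on (Suc 0) (F b) \<Omega>"
          by (rule C_k_on_cong[OF \<Omega>, rotated]) (simp add: F_def)
        with True \<Omega> show ?thesis by blast
      next
        case False
        have "C_k_on (Suc 0) (F b) (- K)"
          by (rule C_k_on_cong[OF _ _ C_k_on_const[of _ 0]])
            (use K in \<open>auto simp: F_def compact_imp_closed\<close>)
        with False K show ?thesis by (intro exI[of _ "- K"]) (auto simp: compact_imp_closed)
      qed
    qed
    have F0: "F b z = 0" if "r < norm z" for b z using K(4)[OF that] by (simp add: F_def)
    have dF: "partial_deriv b (F b) z = exp (\<phi> z) * ((v z \<bullet> v z) * ((partial_deriv b \<phi> z)\<^sup>2 + partial_deriv b (partial_deriv b \<phi>) z)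
        + 2 * (v z \<bullet> partial_deriv b v z) * partial_deriv b \<phi> z)" if z: "z \<in> \<Omega>" for b z
    proof -
      have d: "(\<phi> has_derivative (\<lambda>w. partial_deriv w \<phi> z)) (at z)"
        "(partial_deriv b \<phi> has_derivative (\<lambda>w. partial_deriv w (partial_deriv b \<phi>) z)) (at z)"
        "(v has_derivative (\<lambda>w. partial_deriv w v z)) (at z)"
        using C_k_on_Suc_differentiable[OF \<phi>C z] C_k_on_Suc_differentiable[OF \<phi>C' z] test_functions_differentiable[OF v]
        by (auto intro!: has_derivative_partial_deriv)
      have "partial_deriv b (F b) z = partial_deriv b (\<lambda>z. exp (\<phi> z) * (v z \<bullet> v z) * partial_deriv b \<phi> z) z"
        by (rule partial_deriv_cong_open[OF \<Omega> z]) (simp add: F_def)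
      also have "\<dots> = exp (\<phi> z) * (v z \<bullet> v z) * partial_deriv b (partial_deriv b \<phi>) z +
          (exp (\<phi> z) * (v z \<bullet> partial_deriv b v z + partial_deriv b v z \<bullet> v z) +
            exp (\<phi> z) * partial_deriv b \<phi> z * (v z \<bullet> v z)) * partial_deriv b \<phi> z"
        by (rule partial_deriv_eq) (intro has_derivative_mult has_derivative_inner d
            has_derivative_compose[OF d(1) DERIV_exp[unfolded has_field_derivative_def]])
      finally show ?thesis by (simp add: inner_commute[of "partial_deriv b v z"] power2_eq_square algebra_simps)
    qed
    \<comment> \<open>The factor \<open>exp \<phi>\<close> in the field produces the term |v|^2
      times the square of the derivative of \<open>\<phi>\<close>. It absorbs the cross term, at the
      price of the squared derivative of \<open>v\<close>.\<close>
    have pt: "exp (\<phi> z) * ((v z \<bullet> v z) * partial_deriv b (partial_deriv b \<phi>) z - (norm (partial_deriv b v z))\<^sup>2)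
        \<le> partial_deriv b (F b) z" if z: "z \<in> \<Omega>" for b z
    proof -
      have "\<bar>(v z \<bullet> partial_deriv b v z) * partial_deriv b \<phi> z\<bar> \<le> (norm (v z) * norm (partial_deriv b v z)) * \<bar>partial_deriv b \<phi> z\<bar>"
        unfolding abs_mult by (intro mult_right_mono Cauchy_Schwarz_ineq2) auto
      also have "2 * \<dots> \<le> (norm (v z) * \<bar>partial_deriv b \<phi> z\<bar>)\<^sup>2 + (norm (partial_deriv b v z))\<^sup>2"
        using sum_squares_bound[of "norm (v z) * \<bar>partial_deriv b \<phi> z\<bar>" "norm (partial_deriv b v z)"]
        by (simp add: mult_ac)
      also have "(norm (v z) * \<bar>partial_deriv b \<phi> z\<bar>)\<^sup>2 = (v z \<bullet> v z) * (partial_deriv b \<phi> z)\<^sup>2"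
        by (simp add: power_mult_distrib power2_norm_eq_inner)
      finally have "- (norm (partial_deriv b v z))\<^sup>2 \<le> (v z \<bullet> v z) * (partial_deriv b \<phi> z)\<^sup>2 +
          2 * (v z \<bullet> partial_deriv b v z) * partial_deriv b \<phi> z" by (simp add: abs_le_iff)
      then show ?thesis unfolding dF[OF z] by (intro mult_left_mono) (simp_all add: algebra_simps)
    qed
    have le: "c * exp (- M) * (norm (v z))\<^sup>2 - exp M * ((norm (partial_deriv 1 v z))\<^sup>2 + (norm (partial_deriv \<i> v z))\<^sup>2)
      \<le> partial_deriv 1 (F 1) z + partial_deriv \<i> (F \<i>) z" for z
    proof (cases "z \<in> \<Omega>")
      case True
      let ?g = "(norm (partial_deriv 1 v z))\<^sup>2 + (norm (partial_deriv \<i> v z))\<^sup>2"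
      have "exp (- M) * (c * (norm (v z))\<^sup>2) \<le> exp (\<phi> z) * (c * (norm (v z))\<^sup>2)"
        using M[OF True] c by (intro mult_right_mono) auto
      moreover have "exp (\<phi> z) * (c * (norm (v z))\<^sup>2) \<le> exp (\<phi> z) * ((v z \<bullet> v z) * laplacian \<phi> z)"
        using lap[OF True] by (simp add: power2_norm_eq_inner mult.commute[of c] mult_left_mono)
      moreover have "exp (\<phi> z) * ?g \<le> exp M * ?g"
        using M[OF True] by (intro mult_right_mono) auto
      ultimately show ?thesis
        using pt[OF True, of 1] pt[OF True, of \<i>] by (simp add: laplacian_def algebra_simps)
    next
      case False
      have "partial_deriv b (F b) z = partial_deriv b (\<lambda>z. 0) z" for b
        by (rule partial_deriv_cong_open[of "- K"])
          (use False K in \<open>auto simp: F_def compact_imp_closed\<close>)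
      with False v show ?thesis by (simp add: test_functions_outside test_functions_partial_outside)
    qed
    have iF: "integrable lborel (partial_deriv b (F b))" for b
    proof (rule integrable_continuous_compact_support)
      show "continuous_on UNIV (partial_deriv b (F b))" using C_k_on_Suc_partial[OF FC] by simp
      show "partial_deriv b (F b) x = 0" if "r < norm x" for x
        by (rule partial_deriv_compact_support[OF F0 that])
    qed
    have zero: "integral\<^sup>L lborel (partial_deriv b (F b)) = 0" for b
      by (rule integral_partial_deriv_eq_0[of "F b" r, OF FC F0])
    note i = test_functions_power2_integrable[OF v]
    have "integral\<^sup>L lborel (\<lambda>z. c * exp (- M) * (norm (v z))\<^sup>2 -
        exp M * ((norm (partial_deriv 1 v z))\<^sup>2 + (norm (partial_deriv \<i> v z))\<^sup>2))
      \<le> integral\<^sup>L lborel (\<lambda>z. partial_deriv 1 (F 1) z + partial_deriv \<i> (F \<i>) z)"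
      by (intro integral_mono) (use i iF le in auto)
    also have "\<dots> = 0"
      using zero iF by simp
    finally have "c * exp (- M) * integral\<^sup>L lborel (\<lambda>z. (norm (v z))\<^sup>2) \<le>
        exp M * integral\<^sup>L lborel (\<lambda>z. (norm (partial_deriv 1 v z))\<^sup>2 + (norm (partial_deriv \<i> v z))\<^sup>2)"
      using i by simp
    then show ?thesis
      using v by (simp add: test_grad_norm_power2[OF \<Omega> v] L2_norm_power2_lborel[OF \<Omega>]
          test_functions_continuous test_functions_outside)
  qed
  \<comment> \<open>The weight \<open>exp \<phi>\<close> lies between \<open>exp (- M)\<close> and
    \<open>exp M\<close>; the constant is the square root of the resulting ratio.\<close>
  define C where "C = sqrt (exp M / (c * exp (- M)))"
  have C: "C > 0" using c by (simp add: C_def)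
  have "L2_norm \<Omega> v \<le> C * test_grad_norm \<Omega> v" if v: "v \<in> test_functions \<Omega>" for v
  proof (rule power2_le_imp_le)
    have "(L2_norm \<Omega> v)\<^sup>2 \<le> exp M / (c * exp (- M)) * (test_grad_norm \<Omega> v)\<^sup>2"
      using key[OF v] c by (simp add: pos_le_divide_eq mult_ac)
    then show "(L2_norm \<Omega> v)\<^sup>2 \<le> (C * test_grad_norm \<Omega> v)\<^sup>2"
      using c by (simp add: C_def power_mult_distrib)
  qed (use C in \<open>simp add: test_grad_norm_def\<close>)
  with C show ?thesis unfolding poincare_test_def by blast
qed


section \<open>Surjectivity of the Cauchy-Riemann operator\<close>

lemma second_partials_commute_real:
  fixes f :: "'a::real_normed_vector \<Rightarrow> real"
  assumes f: "C_k_on (Suc (Suc 0)) f UNIV"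
  shows "partial_deriv a (partial_deriv b f) x = partial_deriv b (partial_deriv a f) x"
proof -
  have line: "((\<lambda>s. g (y + s *\<^sub>R w)) has_real_derivative partial_deriv w g (y + s *\<^sub>R w)) (at s)"
    if "C_k_on (Suc 0) g UNIV" for g :: "'a \<Rightarrow> real" and y w s
  proof -
    have D: "(g has_derivative (\<lambda>v. partial_deriv v g (y + s *\<^sub>R w))) (at (y + s *\<^sub>R w))"
      by (intro has_derivative_partial_deriv C_k_on_Suc_differentiable[OF that]) simp
    have "((\<lambda>s. g (y + s *\<^sub>R w)) has_derivative (\<lambda>t. partial_deriv (t *\<^sub>R w) g (y + s *\<^sub>R w))) (at s)"
      by (rule has_derivative_compose[of "\<lambda>s. y + s *\<^sub>R w" _ s UNIV g, OF _ D]) (auto intro!: derivative_eq_intros)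
    moreover have "(\<lambda>t. partial_deriv (t *\<^sub>R w) g (y + s *\<^sub>R w)) = (*) (partial_deriv w g (y + s *\<^sub>R w))"
      using linear_cmul[OF has_derivative_linear[OF D]] by (auto simp: fun_eq_iff)
    ultimately show ?thesis by (simp add: has_field_derivative_def)
  qed
  have f1: "C_k_on (Suc 0) f UNIV" using f by (rule C_k_on_Suc_D)
  have df: "C_k_on (Suc 0) (partial_deriv v f) UNIV" for v using f by (rule C_k_on_Suc_partial)
  have cont: "continuous_on UNIV (partial_deriv v (partial_deriv w f))" for v w
    using C_k_on_Suc_partial[OF df] by simp
  define Q where "Q t = f (x + t *\<^sub>R a + t *\<^sub>R b) - f (x + t *\<^sub>R a) - f (x + t *\<^sub>R b) + f x" for t
  \<comment> \<open>The second difference quotient does not depend on the order of the two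
    directions. Applying the mean value theorem in either order represents it by either mixed
    derivative at a point near \<open>x\<close>.\<close>
  have mv: "\<exists>p. norm (p - x) \<le> t * (norm v + norm w) \<and>
      f (x + t *\<^sub>R v + t *\<^sub>R w) - f (x + t *\<^sub>R v) - f (x + t *\<^sub>R w) + f x = t * t * partial_deriv w (partial_deriv v f) p"
    if t: "t > 0" for t v w
  proof -
    have "((\<lambda>s. f ((x + t *\<^sub>R w) + s *\<^sub>R v) - f (x + s *\<^sub>R v)) has_real_derivative
        partial_deriv v f ((x + t *\<^sub>R w) + s *\<^sub>R v) - partial_deriv v f (x + s *\<^sub>R v)) (at s)" for s
      by (intro DERIV_diff line f1)
    from MVT2[OF t this] obtain s where s: "0 < s" "s < t"
      "f ((x + t *\<^sub>R w) + t *\<^sub>R v) - f (x + t *\<^sub>R v) - (f (x + t *\<^sub>R w) - f x) =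
        t * (partial_deriv v f ((x + t *\<^sub>R w) + s *\<^sub>R v) - partial_deriv v f (x + s *\<^sub>R v))" by auto
    from MVT2[OF t line[OF df[of v], of "x + s *\<^sub>R v" w]] obtain q where q: "0 < q" "q < t"
      "partial_deriv v f ((x + s *\<^sub>R v) + t *\<^sub>R w) - partial_deriv v f (x + s *\<^sub>R v) =
        t * partial_deriv w (partial_deriv v f) ((x + s *\<^sub>R v) + q *\<^sub>R w)" by auto
    have "norm (s *\<^sub>R v + q *\<^sub>R w) \<le> s * norm v + q * norm w"
      using norm_triangle_ineq[of "s *\<^sub>R v" "q *\<^sub>R w"] s q by simp
    also have "\<dots> \<le> t * (norm v + norm w)"
      using s q by (simp add: distrib_left add_mono mult_right_mono)
    finally show ?thesis
      using s(3) q(3) by (intro exI[of _ "(x + s *\<^sub>R v) + q *\<^sub>R w"]) (simp add: algebra_simps)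
  qed
  define h where "h n = inverse (real (Suc n))" for n
  have h: "h n > 0" for n by (simp add: h_def)
  have h0: "h \<longlonglongrightarrow> 0" using LIMSEQ_inverse_real_of_nat by (simp add: h_def[abs_def])
  have "\<exists>p. norm (p - x) \<le> h n * (norm a + norm b) \<and> Q (h n) = h n * h n * partial_deriv b (partial_deriv a f) p" for n
    using mv[OF h[of n], of a b] by (auto simp: Q_def)
  then obtain p where p: "\<And>n. norm (p n - x) \<le> h n * (norm a + norm b)"
    "\<And>n. Q (h n) = h n * h n * partial_deriv b (partial_deriv a f) (p n)" by metis
  have "\<exists>p. norm (p - x) \<le> h n * (norm b + norm a) \<and> Q (h n) = h n * h n * partial_deriv a (partial_deriv b f) p" for n
    using mv[OF h[of n], of b a] by (auto simp: Q_def algebra_simps)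
  then obtain q where q: "\<And>n. norm (q n - x) \<le> h n * (norm b + norm a)"
    "\<And>n. Q (h n) = h n * h n * partial_deriv a (partial_deriv b f) (q n)" by metis
  have lim: "r \<longlonglongrightarrow> x" if "\<And>n. norm (r n - x) \<le> h n * k" for r k
  proof (rule LIM_zero_cancel, rule Lim_null_comparison)
    show "\<forall>\<^sub>F n in sequentially. norm (r n - x) \<le> h n * k" using that by simp
    show "(\<lambda>n. h n * k) \<longlonglongrightarrow> 0" using tendsto_mult_right[OF h0, of k] by simp
  qed
  have "(\<lambda>n. partial_deriv b (partial_deriv a f) (p n)) \<longlonglongrightarrow> partial_deriv b (partial_deriv a f) x"
    by (rule continuous_on_tendsto_compose[OF cont lim[OF p(1)]]) auto
  moreover have "(\<lambda>n. partial_deriv a (partial_deriv b f) (q n)) \<longlonglongrightarrow> partial_deriv a (partial_deriv b f) x"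
    by (rule continuous_on_tendsto_compose[OF cont lim[OF q(1)]]) auto
  moreover have "partial_deriv b (partial_deriv a f) (p n) = partial_deriv a (partial_deriv b f) (q n)" for n
    using p(2)[of n] q(2)[of n] h[of n] by simp
  ultimately show ?thesis using LIMSEQ_unique by simp
qed

lemma second_partials_commute:
  fixes f :: "'a::real_normed_vector \<Rightarrow> complex"
  assumes f: "C_k_on (Suc (Suc 0)) f UNIV"
  shows "partial_deriv a (partial_deriv b f) x = partial_deriv b (partial_deriv a f) x"
proof -
  have L: "L (partial_deriv v (partial_deriv w f) x) = partial_deriv v (partial_deriv w (\<lambda>x. L (f x))) x"
    if "bounded_linear L" for L :: "complex \<Rightarrow> real" and v w
  proof -
    have "partial_deriv w (\<lambda>x. L (f x)) = (\<lambda>x. L (partial_deriv w f x))"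
      using that f by (auto intro!: ext partial_deriv_bounded_linear C_k_on_Suc_differentiable)
    then show ?thesis
      using partial_deriv_bounded_linear[OF that, of "partial_deriv w f" x v]
        C_k_on_Suc_differentiable[OF C_k_on_Suc_partial[OF f]] by simp
  qed
  have "L (partial_deriv a (partial_deriv b f) x) = L (partial_deriv b (partial_deriv a f) x)"
    if "bounded_linear L" for L :: "complex \<Rightarrow> real"
    unfolding L[OF that] by (rule second_partials_commute_real[OF C_k_on_bounded_linear[OF that open_UNIV f]])
  from this[OF bounded_linear_Re] this[OF bounded_linear_Im] show ?thesis
    by (simp add: complex_eq_iff)
qed

lemma dbar_continuous: "\<phi> \<in> test_functions \<Omega> \<Longrightarrow> continuous_on UNIV (dbar \<phi>)"
  unfolding dbar_def[abs_def] by (auto intro!: continuous_intros test_functions_partial_continuous)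

lemma dbar_outside: "\<phi> \<in> test_functions \<Omega> \<Longrightarrow> z \<notin> \<Omega> \<Longrightarrow> dbar \<phi> z = 0"
  by (simp add: dbar_def test_functions_partial_outside)

lemma dbar_compact_support:
  assumes "\<And>z. r < norm z \<Longrightarrow> \<phi> z = 0" "r < norm z"
  shows "dbar \<phi> z = 0"
  using partial_deriv_compact_support[OF assms] by (simp add: dbar_def)

lemma dbar_L2:
  assumes "open \<Omega>" "\<phi> \<in> test_functions \<Omega>"
  shows "dbar \<phi> \<in> L2 \<Omega>"
proof -
  obtain r where r: "\<And>z. r < norm z \<Longrightarrow> \<phi> z = 0"
    using test_functions_bounded_support[OF assms(2)] by blast
  show ?thesis
    by (rule L2_continuous_compact_support[OF assms(1) dbar_continuous[OF assms(2)]])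
      (rule dbar_compact_support[OF r])
qed

lemma dbar_add:
  assumes "\<phi> \<in> test_functions \<Omega>" "\<psi> \<in> test_functions \<Omega>"
  shows "dbar (\<lambda>z. \<phi> z + \<psi> z) = (\<lambda>z. dbar \<phi> z + dbar \<psi> z)"
  using assms[THEN test_functions_differentiable]
  by (simp add: dbar_def partial_deriv_add fun_eq_iff algebra_simps add_divide_distrib)

lemma dbar_cmult:
  assumes "\<phi> \<in> test_functions \<Omega>"
  shows "dbar (\<lambda>z. c * \<phi> z) = (\<lambda>z. c * dbar \<phi> z)"
  using partial_deriv_bounded_linear[OF bounded_linear_mult_right[of c] test_functions_differentiable[OF assms]]
  by (simp add: dbar_def fun_eq_iff algebra_simps)

text \<open>Expanding |v_x + i v_y|^2 leaves a cross term that is odd under exchange of x and y. Two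
  integrations by parts and the symmetry of second derivatives make its integral zero; the factor 2
  is the one in \<open>dbar\<close>.\<close>

lemma L2_norm_dbar:
  assumes \<Omega>: "open \<Omega>" and v: "v \<in> test_functions \<Omega>"
  shows "test_grad_norm \<Omega> v = 2 * L2_norm \<Omega> (dbar v)"
proof -
  let ?x = "partial_deriv 1 v" and ?y = "partial_deriv \<i> v"
  define w where "w z = cnj (v z)" for z
  have w: "w \<in> test_functions \<Omega>" unfolding w_def by (rule test_functions_cnj[OF v])
  have wd: "partial_deriv b w z = cnj (partial_deriv b v z)" for b z
    unfolding w_def by (rule partial_deriv_bounded_linear[OF bounded_linear_cnj test_functions_differentiable[OF v]])
  obtain r where r: "\<And>z. r < norm z \<Longrightarrow> v z = 0"
    using test_functions_bounded_support[OF v] by blast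
  have r': "partial_deriv b v z = 0" if "r < norm z" for b z
    by (rule partial_deriv_compact_support[OF r that])
  have c: "continuous_on UNIV (partial_deriv b v)" for b by (rule test_functions_partial_continuous[OF v])
  have wC: "C_k_on (Suc 0) (partial_deriv b w) UNIV" for b
    using C_k_on_Suc_partial[OF test_functions_smooth[OF w]] .
  have parts: "integral\<^sup>L lborel (\<lambda>z. partial_deriv a w z * partial_deriv b v z) =
      - integral\<^sup>L lborel (\<lambda>z. partial_deriv b (partial_deriv a w) z * v z)" for a b
    by (rule integral_by_parts[OF wC test_functions_smooth[OF v] r])
  have "integral\<^sup>L lborel (\<lambda>z. partial_deriv 1 w z * ?y z) = integral\<^sup>L lborel (\<lambda>z. partial_deriv \<i> w z * ?x z)"
    unfolding parts by (simp add: second_partials_commute[OF test_functions_smooth[OF w], of 1 \<i>])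
  then have cross: "integral\<^sup>L lborel (\<lambda>z. cnj (?x z) * ?y z) = integral\<^sup>L lborel (\<lambda>z. cnj (?y z) * ?x z)"
    by (simp add: wd)
  have i: "integrable lborel (\<lambda>z. cnj (partial_deriv a v z) * partial_deriv b v z)" for a b
    by (rule integrable_continuous_compact_support[of _ r]) (auto intro!: continuous_intros c simp: r')
  have pt: "4 * (norm (dbar v z))\<^sup>2 = (norm (?x z))\<^sup>2 + (norm (?y z))\<^sup>2 +
      Re (\<i> * (cnj (?x z) * ?y z - cnj (?y z) * ?x z))" for z
  proof -
    have "4 * (norm (dbar v z))\<^sup>2 = (norm (?x z + \<i> * ?y z))\<^sup>2"
      by (simp add: dbar_def norm_divide power_divide)
    also have "\<dots> = (norm (?x z))\<^sup>2 + (norm (?y z))\<^sup>2 + Re (\<i> * (cnj (?x z) * ?y z - cnj (?y z) * ?x z))"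
      unfolding cmod_power2 by (simp add: power2_eq_square algebra_simps)
    finally show ?thesis .
  qed
  have nd: "(L2_norm \<Omega> (dbar v))\<^sup>2 = integral\<^sup>L lborel (\<lambda>z. (norm (dbar v z))\<^sup>2)"
    by (rule L2_norm_power2_lborel[OF \<Omega> dbar_continuous[OF v] dbar_outside[OF v]])
  have "4 * integral\<^sup>L lborel (\<lambda>z. (norm (dbar v z))\<^sup>2) = integral\<^sup>L lborel (\<lambda>z. 4 * (norm (dbar v z))\<^sup>2)" by simp
  also have "\<dots> = integral\<^sup>L lborel (\<lambda>z. (norm (?x z))\<^sup>2 + (norm (?y z))\<^sup>2) +
      integral\<^sup>L lborel (\<lambda>z. Re (\<i> * (cnj (?x z) * ?y z - cnj (?y z) * ?x z)))"
    unfolding pt using test_functions_power2_integrable[OF v] i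
    by (intro Bochner_Integration.integral_add Bochner_Integration.integrable_add integrable_bounded_linear[OF bounded_linear_Re]
        integrable_mult_right Bochner_Integration.integrable_diff) auto
  also have "integral\<^sup>L lborel (\<lambda>z. Re (\<i> * (cnj (?x z) * ?y z - cnj (?y z) * ?x z))) =
      Re (integral\<^sup>L lborel (\<lambda>z. \<i> * (cnj (?x z) * ?y z - cnj (?y z) * ?x z)))"
    by (intro integral_bounded_linear[OF bounded_linear_Re] integrable_mult_right Bochner_Integration.integrable_diff i)
  also have "integral\<^sup>L lborel (\<lambda>z. \<i> * (cnj (?x z) * ?y z - cnj (?y z) * ?x z)) = 0"
    using i cross by simp
  finally have "(test_grad_norm \<Omega> v)\<^sup>2 = (2 * L2_norm \<Omega> (dbar v))\<^sup>2"
    by (simp add: power_mult_distrib test_grad_norm_power2[OF \<Omega> v] nd)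
  then show ?thesis by (rule power2_eq_imp_eq) (simp_all add: test_grad_norm_def)
qed

lemma L2_norm_add_power2:
  assumes u: "u \<in> L2 \<Omega>" and v: "v \<in> L2 \<Omega>"
  shows "(L2_norm \<Omega> (\<lambda>z. u z + v z))\<^sup>2 = (L2_norm \<Omega> u)\<^sup>2 +
    2 * Re (integral\<^sup>L (lebesgue_on \<Omega>) (\<lambda>z. cnj (u z) * v z)) + (L2_norm \<Omega> v)\<^sup>2"
proof -
  note i = L2_integrable[OF u] L2_integrable[OF v] L2_mult_integrable[OF L2_cnj[OF u] v]
  have "(norm (u z + v z))\<^sup>2 = (norm (u z))\<^sup>2 + 2 * Re (cnj (u z) * v z) + (norm (v z))\<^sup>2" for z
    unfolding cmod_power2 by (simp add: power2_eq_square algebra_simps)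
  then have "(L2_norm \<Omega> (\<lambda>z. u z + v z))\<^sup>2 = integral\<^sup>L (lebesgue_on \<Omega>)
      (\<lambda>z. (norm (u z))\<^sup>2 + 2 * Re (cnj (u z) * v z) + (norm (v z))\<^sup>2)"
    by (simp add: L2_norm_power2)
  also have "\<dots> = (L2_norm \<Omega> u)\<^sup>2 + 2 * integral\<^sup>L (lebesgue_on \<Omega>) (\<lambda>z. Re (cnj (u z) * v z)) + (L2_norm \<Omega> v)\<^sup>2"
    unfolding L2_norm_power2 using i integrable_bounded_linear[OF bounded_linear_Re i(3)]
    by (simp del: complex_Re_le_cmod times_complex.sel)
  also have "integral\<^sup>L (lebesgue_on \<Omega>) (\<lambda>z. Re (cnj (u z) * v z)) = Re (integral\<^sup>L (lebesgue_on \<Omega>) (\<lambda>z. cnj (u z) * v z))"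
    by (rule integral_bounded_linear[OF bounded_linear_Re i(3)])
  finally show ?thesis .
qed

text \<open>A polynomial with minimum at 0 has no linear term. The test value
  \<open>- a / (b + 1)\<close> has \<open>b + 1\<close> instead of \<open>b\<close> in the
  denominator so that \<open>b = 0\<close> is included.\<close>

lemma eq_0_if_quadratic_nonneg:
  fixes a b :: real
  assumes "\<And>t. 0 \<le> 2 * t * a + t\<^sup>2 * b"
  shows "a = 0"
proof (rule ccontr)
  assume a: "a \<noteq> 0"
  have "b \<ge> 0" using assms[of 1] assms[of "-1"] by simp
  define t where "t = - a / (b + 1)"
  have tb: "t * (b + 1) = - a" using \<open>b \<ge> 0\<close> by (simp add: t_def)
  have "0 \<le> (2 * t * a + t\<^sup>2 * b) * (b + 1)\<^sup>2" using assms[of t] by simp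
  also have "\<dots> = 2 * (t * (b + 1)) * a * (b + 1) + (t * (b + 1))\<^sup>2 * b"
    by (simp add: power2_eq_square algebra_simps)
  also have "\<dots> = - (a\<^sup>2 * (b + 2))" unfolding tb by (simp add: power2_eq_square algebra_simps)
  also have "\<dots> < 0" using a \<open>b \<ge> 0\<close> by simp
  finally show False by simp
qed

text \<open>The solution is obtained from a minimizing sequence of \<open>J(\<phi>) = \<parallel>dbar \<phi>\<parallel>\<^sup>2 - 2 Re \<integral> g \<phi>\<close>.\<close>

lemma weak_dbar_solvable:
  assumes \<Omega>: "open \<Omega>" and C: "C > 0" and poinc: "\<And>\<phi>. \<phi> \<in> test_functions \<Omega> \<Longrightarrow> L2_norm \<Omega> \<phi> \<le> C * L2_norm \<Omega> (dbar \<phi>)"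
    and g: "g \<in> L2 \<Omega>"
  shows "\<exists>u\<in>L2 \<Omega>. has_weak_dbar \<Omega> u g"
proof -
  let ?T = "test_functions \<Omega>"
  let ?I = "\<lambda>f. integral\<^sup>L (lebesgue_on \<Omega>) f"
  define J where "J \<phi> = (L2_norm \<Omega> (dbar \<phi>))\<^sup>2 - 2 * Re (?I (\<lambda>z. g z * \<phi> z))" for \<phi>
  have T0: "(\<lambda>z. 0) \<in> ?T" by (rule test_functionsI[of _ "{}"]) (auto simp: smooth_on_def C_k_on_const)
  have low: "- ((C * L2_norm \<Omega> g)\<^sup>2) \<le> J \<phi>" if \<phi>: "\<phi> \<in> ?T" for \<phi>
  proof -
    have "Re (?I (\<lambda>z. g z * \<phi> z)) \<le> L2_norm \<Omega> g * L2_norm \<Omega> \<phi>"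
      using L2_Cauchy_Schwarz[OF g test_functions_L2[OF \<Omega> \<phi>]] complex_Re_le_cmod order_trans by blast
    also have "\<dots> \<le> L2_norm \<Omega> g * (C * L2_norm \<Omega> (dbar \<phi>))"
      by (intro mult_left_mono poinc \<phi>) simp
    finally show ?thesis
      using sum_squares_bound[of "C * L2_norm \<Omega> g" "L2_norm \<Omega> (dbar \<phi>)"] by (simp add: J_def mult_ac)
  qed
  define m where "m = Inf (J ` ?T)"
  have bdd: "bdd_below (J ` ?T)" using low by (auto intro!: bdd_belowI)
  have mle: "m \<le> J \<phi>" if "\<phi> \<in> ?T" for \<phi>
    unfolding m_def using bdd that by (auto intro!: cInf_lower)
  have "\<exists>\<phi>\<in>?T. J \<phi> < m + (1 / 3 ^ n)\<^sup>2 / 4" for n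
  proof -
    have "Inf (J ` ?T) < m + (1 / 3 ^ n)\<^sup>2 / 4" by (simp add: m_def)
    then show ?thesis using T0 by (subst (asm) cInf_less_iff) (auto simp: bdd)
  qed
  then obtain \<phi> where \<phi>: "\<And>n. \<phi> n \<in> ?T" "\<And>n. J (\<phi> n) < m + (1 / 3 ^ n)\<^sup>2 / 4" by metis
  define f where "f n = dbar (\<phi> n)" for n
  have fL: "f n \<in> L2 \<Omega>" for n unfolding f_def by (rule dbar_L2[OF \<Omega> \<phi>(1)])
  have Jadd: "J (\<lambda>z. \<alpha> z + of_real t * \<psi> z) = J \<alpha> +
      2 * t * Re (?I (\<lambda>z. cnj (dbar \<alpha> z) * dbar \<psi> z) - ?I (\<lambda>z. g z * \<psi> z)) + t\<^sup>2 * (L2_norm \<Omega> (dbar \<psi>))\<^sup>2"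
    if \<alpha>: "\<alpha> \<in> ?T" and \<psi>: "\<psi> \<in> ?T" for \<alpha> \<psi> t
  proof -
    note t\<psi> = test_functions_cmult[OF \<psi>, of "of_real t"]
    have d: "dbar (\<lambda>z. \<alpha> z + of_real t * \<psi> z) = (\<lambda>z. dbar \<alpha> z + of_real t * dbar \<psi> z)"
      by (simp add: dbar_add[OF \<alpha> t\<psi>] dbar_cmult[OF \<psi>])
    have "(L2_norm \<Omega> (dbar (\<lambda>z. \<alpha> z + of_real t * \<psi> z)))\<^sup>2 = (L2_norm \<Omega> (dbar \<alpha>))\<^sup>2 +
        2 * t * Re (?I (\<lambda>z. cnj (dbar \<alpha> z) * dbar \<psi> z)) + t\<^sup>2 * (L2_norm \<Omega> (dbar \<psi>))\<^sup>2"
      unfolding d L2_norm_add_power2[OF dbar_L2[OF \<Omega> \<alpha>] L2_cmult[OF dbar_L2[OF \<Omega> \<psi>]]]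
      by (simp add: L2_norm_cmult power_mult_distrib mult.left_commute[of _ "of_real t"])
    moreover have "?I (\<lambda>z. g z * (\<alpha> z + of_real t * \<psi> z)) = ?I (\<lambda>z. g z * \<alpha> z) + of_real t * ?I (\<lambda>z. g z * \<psi> z)"
      using L2_mult_integrable[OF g test_functions_L2[OF \<Omega> \<alpha>]] L2_mult_integrable[OF g test_functions_L2[OF \<Omega> \<psi>]]
      by (simp add: distrib_left mult.left_commute[of _ "of_real t"])
    ultimately show ?thesis by (simp add: J_def algebra_simps)
  qed
  have rate: "L2_norm \<Omega> (\<lambda>z. f (Suc n) z - f n z) \<le> 1 / 3 ^ n" for n
  proof -
    define \<delta> where "\<delta> z = \<phi> (Suc n) z + of_real (-1) * \<phi> n z" for z
    have \<delta>: "\<delta> \<in> ?T" unfolding \<delta>_def by (intro test_functions_add test_functions_cmult \<phi>)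
    have "(\<lambda>z. \<phi> n z + of_real t * \<delta> z) \<in> ?T" for t by (intro test_functions_add test_functions_cmult \<phi> \<delta>)
    then have half: "m \<le> J (\<lambda>z. \<phi> n z + of_real (1/2) * \<delta> z)" by (rule mle)
    have full: "J (\<lambda>z. \<phi> n z + of_real 1 * \<delta> z) = J (\<phi> (Suc n))" by (simp add: \<delta>_def)
    \<comment> \<open>Parallelogram identity: the midpoint costs at least \<open>m\<close>, so two
      nearly minimal functions have nearly equal \<open>dbar\<close> derivatives.\<close>
    have "1 / 4 * (L2_norm \<Omega> (dbar \<delta>))\<^sup>2 = (J (\<phi> n) + J (\<phi> (Suc n))) / 2 - J (\<lambda>z. \<phi> n z + of_real (1/2) * \<delta> z)"
      using Jadd[OF \<phi>(1) \<delta>, of n 1, unfolded full] Jadd[OF \<phi>(1) \<delta>, of n "1/2"]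
      by (simp add: power2_eq_square field_simps)
    also have "\<dots> \<le> (1 / 3 ^ n)\<^sup>2 / 4"
    proof -
      have le: "(1 / 3 ^ Suc n :: real)\<^sup>2 \<le> (1 / 3 ^ n)\<^sup>2" by (intro power_mono) (auto simp: field_simps)
      have gen: "(x + y) / 2 - h \<le> e / 4"
        if "e' \<le> e" "m \<le> h" "x < m + e / 4" "y < m + e' / 4" for x y h e e' :: real
        using that by (simp add: field_simps)
      show ?thesis by (rule gen[OF le half \<phi>(2)[of n] \<phi>(2)[of "Suc n"]])
    qed
    finally have "(L2_norm \<Omega> (dbar \<delta>))\<^sup>2 \<le> (1 / 3 ^ n)\<^sup>2" by simp
    then have "L2_norm \<Omega> (dbar \<delta>) \<le> 1 / 3 ^ n" by (rule power2_le_imp_le) simp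
    moreover have "dbar \<delta> = (\<lambda>z. f (Suc n) z - f n z)"
      unfolding \<delta>_def f_def
      using dbar_add[OF \<phi>(1)[of "Suc n"] test_functions_cmult[OF \<phi>(1)[of n], of "of_real (-1)"]]
        dbar_cmult[OF \<phi>(1)[of n], of "of_real (-1)"] by simp
    ultimately show ?thesis by simp
  qed
  obtain w where w: "w \<in> L2 \<Omega>" "\<And>n. L2_norm \<Omega> (\<lambda>z. f n z - w z) \<le> (3 * 1 / 2) / 3 ^ n"
    using L2_complete[OF fL rate] by auto
  have lim0: "(\<lambda>n. L2_norm \<Omega> (\<lambda>z. cnj (f n z) - cnj (w z))) \<longlonglongrightarrow> 0"
  proof (rule Lim_null_comparison)
    have "L2_norm \<Omega> (\<lambda>z. cnj (f n z) - cnj (w z)) = L2_norm \<Omega> (\<lambda>z. f n z - w z)" for n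
      using L2_norm_cnj[of \<Omega> "\<lambda>z. f n z - w z"] by simp
    then show "\<forall>\<^sub>F n in sequentially. norm (L2_norm \<Omega> (\<lambda>z. cnj (f n z) - cnj (w z))) \<le> (3 * 1 / 2) / 3 ^ n"
      using w(2) by simp
    show "(\<lambda>n. (3 * 1 / 2) / 3 ^ n :: real) \<longlonglongrightarrow> 0" by real_asymp
  qed
  have re: "Re (?I (\<lambda>z. cnj (w z) * dbar \<psi> z) - ?I (\<lambda>z. g z * \<psi> z)) = 0" if \<psi>: "\<psi> \<in> ?T" for \<psi>
  proof (rule eq_0_if_quadratic_nonneg)
    fix t :: real
    have conv: "(\<lambda>n. (1 / 3 ^ n)\<^sup>2 / 4 + 2 * t * Re (?I (\<lambda>z. cnj (f n z) * dbar \<psi> z) - ?I (\<lambda>z. g z * \<psi> z)) + t\<^sup>2 * (L2_norm \<Omega> (dbar \<psi>))\<^sup>2)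
      \<longlonglongrightarrow> 0 + 2 * t * Re (?I (\<lambda>z. cnj (w z) * dbar \<psi> z) - ?I (\<lambda>z. g z * \<psi> z)) + t\<^sup>2 * (L2_norm \<Omega> (dbar \<psi>))\<^sup>2"
    proof (intro tendsto_add tendsto_mult tendsto_Re tendsto_diff tendsto_const)
      show "(\<lambda>n. (1 / 3 ^ n)\<^sup>2 / 4 :: real) \<longlonglongrightarrow> 0" by real_asymp
      show "(\<lambda>n. ?I (\<lambda>z. cnj (f n z) * dbar \<psi> z)) \<longlonglongrightarrow> ?I (\<lambda>z. cnj (w z) * dbar \<psi> z)"
        by (rule L2_integral_tendsto[OF L2_cnj[OF fL] L2_cnj[OF w(1)] dbar_L2[OF \<Omega> \<psi>] lim0])
    qed
    have nn: "0 \<le> (1 / 3 ^ n)\<^sup>2 / 4 + 2 * t * Re (?I (\<lambda>z. cnj (f n z) * dbar \<psi> z) - ?I (\<lambda>z. g z * \<psi> z)) + t\<^sup>2 * (L2_norm \<Omega> (dbar \<psi>))\<^sup>2" for n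
    proof -
      have "(\<lambda>z. \<phi> n z + of_real t * \<psi> z) \<in> ?T" by (intro test_functions_add test_functions_cmult \<phi> \<psi>)
      from mle[OF this, unfolded Jadd[OF \<phi>(1) \<psi>]] \<phi>(2)[of n] show ?thesis by (simp add: f_def)
    qed
    have "0 \<le> 0 + 2 * t * Re (?I (\<lambda>z. cnj (w z) * dbar \<psi> z) - ?I (\<lambda>z. g z * \<psi> z)) + t\<^sup>2 * (L2_norm \<Omega> (dbar \<psi>))\<^sup>2"
      by (rule tendsto_lowerbound[OF conv always_eventually]) (use nn in auto)
    then show "0 \<le> 2 * t * Re (?I (\<lambda>z. cnj (w z) * dbar \<psi> z) - ?I (\<lambda>z. g z * \<psi> z)) + t\<^sup>2 * (L2_norm \<Omega> (dbar \<psi>))\<^sup>2"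
      by simp
  qed
  \<comment> \<open>The real first variation gives the real part of the equation; testing with
    \<open>\<i>\<close> times \<psi> gives the imaginary part.\<close>
  have eq: "?I (\<lambda>z. cnj (w z) * dbar \<psi> z) = ?I (\<lambda>z. g z * \<psi> z)" if \<psi>: "\<psi> \<in> ?T" for \<psi>
  proof -
    have "Re (\<i> * (?I (\<lambda>z. cnj (w z) * dbar \<psi> z) - ?I (\<lambda>z. g z * \<psi> z))) = 0"
      using re[OF test_functions_cmult[OF \<psi>, of \<i>]]
      by (simp add: dbar_cmult[OF \<psi>] mult.left_commute[of _ \<i>] right_diff_distrib del: times_complex.sel)
    with re[OF \<psi>] show ?thesis by (simp add: complex_eq_iff)
  qed
  \<comment> \<open>The conjugate comes from the sesquilinear inner product, and the sign from the
    minus in the weak formulation.\<close>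
  have "has_weak_dbar \<Omega> (\<lambda>z. (-1) * cnj (w z)) g"
    unfolding has_weak_dbar_def using eq by simp
  moreover have "(\<lambda>z. (-1) * cnj (w z)) \<in> L2 \<Omega>" by (intro L2_cmult L2_cnj w)
  ultimately show ?thesis by blast
qed

text \<open>The equation is solvable for every datum, so the range is the entire space, which is
  closed.\<close>

lemma dbar_closed_range_if_poincare_test:
  assumes \<Omega>: "open \<Omega>" and P: "poincare_test \<Omega>"
  shows "dbar_closed_range \<Omega>"
proof -
  obtain C where C: "C > 0" "\<And>v. v \<in> test_functions \<Omega> \<Longrightarrow> L2_norm \<Omega> v \<le> C * test_grad_norm \<Omega> v"
    using P unfolding poincare_test_def by blast
  have "L2_norm \<Omega> v \<le> (2 * C) * L2_norm \<Omega> (dbar v)" if "v \<in> test_functions \<Omega>" for v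
    using C(2)[OF that] by (simp add: L2_norm_dbar[OF \<Omega> that])
  from weak_dbar_solvable[OF \<Omega> _ this] have "\<exists>u\<in>L2 \<Omega>. has_weak_dbar \<Omega> u g" if "g \<in> L2 \<Omega>" for g
    using C(1) that by simp
  then have "range_dbar \<Omega> = L2 \<Omega>" by (fastforce simp: range_dbar_def Dom_dbar_def)
  then show ?thesis
    unfolding dbar_closed_range_def by (metis closedin_topspace topspace_seminorm_topology)
qed


section \<open>The Cauchy transform\<close>

lemma emeasure_ball_complex: "r \<ge> 0 \<Longrightarrow> emeasure lborel (ball (c::complex) r) = ennreal (unit_ball_vol 2 * r ^ 2)"
  using emeasure_ball[of r c] by simp

text \<open>Covering by discs replaces polar coordinates: a disc of radius r has area proportional
  to r^2, so \<open>f\<close> is dominated by a convergent series. Shrinking discs handle 1/|z| at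
  the origin, growing discs handle decay at infinity.\<close>

lemma integrable_if_dyadic_bound:
  fixes f :: "complex \<Rightarrow> real"
  assumes f: "f \<in> borel_measurable borel" "\<And>z. 0 \<le> f z"
    and bound: "\<And>z. f z \<noteq> 0 \<Longrightarrow> \<exists>n. z \<in> ball 0 (r n) \<and> f z \<le> a n"
    and a: "\<And>n. a n \<ge> 0" and r: "\<And>n. r n \<ge> 0" and s: "summable (\<lambda>n. a n * (r n)\<^sup>2)"
  shows "integrable lborel f"
proof (rule integrableI_nonneg)
  have "(\<integral>\<^sup>+z. ennreal (f z) \<partial>lborel) \<le> (\<integral>\<^sup>+(z::complex). (\<Sum>n. ennreal (a n) * indicator (ball 0 (r n)) z) \<partial>lborel)"
  proof (rule nn_integral_mono)
    fix z
    show "ennreal (f z) \<le> (\<Sum>n. ennreal (a n) * indicator (ball 0 (r n)) z)"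
    proof (cases "f z = 0")
      case False
      then obtain n where n: "z \<in> ball 0 (r n)" "f z \<le> a n" using bound by blast
      then have "ennreal (f z) \<le> ennreal (a n) * indicator (ball 0 (r n)) z" by (simp add: ennreal_leI)
      also have "\<dots> = (\<Sum>k\<in>{n}. ennreal (a k) * indicator (ball 0 (r k)) z)" by (subst sum.insert) auto
      also have "\<dots> \<le> (\<Sum>n. ennreal (a n) * indicator (ball 0 (r n)) z)"
        by (rule sum_le_suminf) auto
      finally show ?thesis .
    qed simp
  qed
  also have "\<dots> = (\<Sum>n. \<integral>\<^sup>+(z::complex). ennreal (a n) * indicator (ball 0 (r n)) z \<partial>lborel)"
    by (rule nn_integral_suminf) (auto intro!: borel_measurable_times_ennreal borel_measurable_indicator)
  also have "\<dots> = (\<Sum>n. ennreal (unit_ball_vol 2 * (a n * (r n)\<^sup>2)))"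
  proof (rule suminf_cong)
    fix n
    have "(\<integral>\<^sup>+(z::complex). ennreal (a n) * indicator (ball 0 (r n)) z \<partial>lborel) = ennreal (a n) * emeasure lborel (ball (0::complex) (r n))"
      by (subst nn_integral_cmult_indicator) auto
    also have "\<dots> = ennreal (unit_ball_vol 2 * (a n * (r n)\<^sup>2))"
      by (simp add: emeasure_ball_complex[OF r] a ennreal_mult'[symmetric] mult_ac)
    finally show "(\<integral>\<^sup>+(z::complex). ennreal (a n) * indicator (ball 0 (r n)) z \<partial>lborel) = ennreal (unit_ball_vol 2 * (a n * (r n)\<^sup>2))" .
  qed
  also have "\<dots> < \<infinity>"
    by (subst suminf_ennreal2) (auto intro!: mult_nonneg_nonneg a unit_ball_vol_nonneg summable_mult s)
  finally show "(\<integral>\<^sup>+z. ennreal (f z) \<partial>lborel) < \<infinity>" .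
qed (use f in auto)

lemma integrable_inverse_norm_unit_ball: "integrable lborel (\<lambda>z::complex. indicator (ball 0 1) z * inverse (norm z))"
proof (rule integrable_if_dyadic_bound[where r="\<lambda>n. 2 * (1/2) ^ n" and a="\<lambda>n. 2 ^ n"])
  show "(\<lambda>z::complex. indicator (ball 0 1) z * inverse (norm z)) \<in> borel_measurable borel"
    by (auto intro!: borel_measurable_times borel_measurable_indicator borel_measurable_inverse)
  show "\<exists>n. z \<in> ball 0 (2 * (1/2) ^ n) \<and> indicator (ball 0 1) z * inverse (norm z) \<le> 2 ^ n"
    if "indicator (ball 0 1) z * inverse (norm z) \<noteq> 0" for z :: complex
  proof -
    have z: "0 < norm z" "norm z < 1" using that by (auto simp: indicator_def split: if_splits)
    have "\<exists>n. (1/2::real) ^ n \<le> norm z"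
      using real_arch_pow_inv[OF z(1), of "1/2"] by (auto intro: less_imp_le)
    define n where "n = (LEAST n. (1/2::real) ^ n \<le> norm z)"
    have n: "(1/2::real) ^ n \<le> norm z" unfolding n_def by (rule LeastI_ex) fact
    have "n \<noteq> 0" using n z by (cases n) auto
    then obtain m where m: "n = Suc m" by (cases n) auto
    have "\<not> (1/2::real) ^ m \<le> norm z" using not_less_Least[of m] m unfolding n_def by (metis lessI)
    then have "norm z < 2 * (1/2) ^ n" by (simp add: m)
    moreover have "inverse (norm z) \<le> 2 ^ n"
      using n z by (simp add: field_simps power_one_over)
    ultimately show ?thesis using z by (intro exI[of _ n]) (auto simp: indicator_def)
  qed
  have "summable (\<lambda>n. 4 * (1/2::real) ^ n)" by (intro summable_mult summable_geometric) simp
  moreover have "2 ^ n * (2 * (1/2) ^ n)\<^sup>2 = 4 * (1/2::real) ^ n" for n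
    by (simp add: power2_eq_square power_one_over field_simps)
  ultimately show "summable (\<lambda>n. 2 ^ n * (2 * (1/2::real) ^ n)\<^sup>2)" by (simp only:)
qed auto

lemma integrable_inverse_norm: "integrable lborel (\<lambda>z::complex. indicator (ball 0 r) z * inverse (norm z))"
proof (rule Bochner_Integration.integrable_bound)
  show "integrable lborel (\<lambda>z::complex. indicator (ball 0 1) z * inverse (norm z) + indicator (ball 0 r) z)"
    using emeasure_bounded_finite[OF bounded_ball, of "0::complex" r]
    by (intro Bochner_Integration.integrable_add integrable_inverse_norm_unit_ball integrable_real_indicator) auto
  show "AE z::complex in lborel. norm (indicator (ball 0 r) z * inverse (norm z)) \<le>
      norm (indicator (ball 0 1) z * inverse (norm z) + indicator (ball 0 r) z)"
    by (rule AE_I2) (auto simp: indicator_def not_less inverse_le_1_iff)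
qed (auto intro!: borel_measurable_times borel_measurable_indicator borel_measurable_inverse)

text \<open>This integral is the number \<pi> of the Cauchy-Pompeiu formula; it is divided out when
  the equation is solved.\<close>

definition cauchy_const :: real where
  "cauchy_const = integral\<^sup>L lborel (\<lambda>z::complex. inverse ((1 + (norm z)\<^sup>2)\<^sup>2))"

lemma integrable_cauchy_kernel: "integrable lborel (\<lambda>z::complex. inverse ((1 + (norm z)\<^sup>2)\<^sup>2))"
proof (rule integrable_if_dyadic_bound[where r="\<lambda>n. 2 ^ n" and a="\<lambda>n. 16 * (1/16) ^ n"])
  show "(\<lambda>z::complex. inverse ((1 + (norm z)\<^sup>2)\<^sup>2)) \<in> borel_measurable borel" by measurable
  show "\<exists>n. z \<in> ball 0 (2 ^ n) \<and> inverse ((1 + (norm z)\<^sup>2)\<^sup>2) \<le> 16 * (1/16) ^ n" for z :: complex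
  proof -
    have ex: "\<exists>n. norm z < 2 ^ n" using real_arch_pow[of 2 "norm z"] by simp
    define n where "n = (LEAST n. norm z < 2 ^ n)"
    have n: "norm z < 2 ^ n" unfolding n_def by (rule LeastI_ex[OF ex])
    have "inverse ((1 + (norm z)\<^sup>2)\<^sup>2) \<le> 16 * (1/16) ^ n"
    proof (cases n)
      case 0
      have "1 \<le> (1 + (norm z)\<^sup>2)\<^sup>2" by (simp add: one_le_power)
      from le_imp_inverse_le[OF this] 0 show ?thesis by simp
    next
      case (Suc m)
      have "\<not> norm z < 2 ^ m" using not_less_Least[of m] Suc unfolding n_def by (metis lessI)
      then have "((2 ^ m)\<^sup>2)\<^sup>2 \<le> ((norm z)\<^sup>2)\<^sup>2" by (intro power_mono) auto
      also have "\<dots> \<le> (1 + (norm z)\<^sup>2)\<^sup>2" by (intro power_mono) auto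
      also have "((2 ^ m)\<^sup>2)\<^sup>2 = (16::real) ^ m"
        by (simp add: power2_eq_square flip: power_mult_distrib)
      finally have "inverse ((1 + (norm z)\<^sup>2)\<^sup>2) \<le> inverse (16 ^ m)" by (intro le_imp_inverse_le) auto
      with Suc show ?thesis by (simp add: power_one_over inverse_eq_divide)
    qed
    with n show ?thesis by (intro exI[of _ n]) auto
  qed
  have "summable (\<lambda>n. 16 * (1/4::real) ^ n)" by (intro summable_mult summable_geometric) simp
  moreover have "16 * (1/16) ^ n * (2 ^ n)\<^sup>2 = 16 * (1/4::real) ^ n" for n
    by (simp add: power2_eq_square flip: power_mult_distrib)
  ultimately show "summable (\<lambda>n. 16 * (1/16::real) ^ n * (2 ^ n)\<^sup>2)" by (simp only:)
qed auto

lemma cauchy_const_pos: "cauchy_const > 0"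
proof -
  have "cauchy_const \<ge> 0" unfolding cauchy_const_def by (intro Bochner_Integration.integral_nonneg) auto
  moreover have "cauchy_const \<noteq> 0"
  proof
    assume "cauchy_const = 0"
    then have "AE z::complex in lborel. inverse ((1 + (norm z)\<^sup>2)\<^sup>2) = 0"
      unfolding cauchy_const_def by (subst (asm) integral_nonneg_eq_0_iff_AE[OF integrable_cauchy_kernel]) auto
    moreover have ne: "inverse ((1 + (norm z)\<^sup>2)\<^sup>2) \<noteq> 0" for z :: complex
      using zero_le_power2[of "norm z"] by (simp add: add_nonneg_eq_0_iff)
    ultimately have "AE z::complex in lborel. False" by (simp only: ne)
    then have "emeasure lborel (UNIV :: complex set) = 0" using AE_iff_measurable[of UNIV lborel "\<lambda>_::complex. False"] by simp
    then show False by simp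
  qed
  ultimately show ?thesis by simp
qed

text \<open>Substituting \<open>e *\<^sub>R z\<close>, with Jacobian e^2 in real dimension two,
  fixes the kernel and moves the parameter into the argument of \<open>f\<close>. The limit e to 0
  then becomes dominated convergence.\<close>

lemma cauchy_kernel_rescale:
  fixes f :: "complex \<Rightarrow> complex"
  assumes f: "f \<in> borel_measurable borel" and e: "e > 0"
  shows "integral\<^sup>L lborel (\<lambda>z. f z * of_real (e\<^sup>2 * inverse (((norm z)\<^sup>2 + e\<^sup>2)\<^sup>2))) =
    integral\<^sup>L lborel (\<lambda>z. f (e *\<^sub>R z) * of_real (inverse ((1 + (norm z)\<^sup>2)\<^sup>2)))"
proof -
  let ?g = "\<lambda>z. f z * of_real (e\<^sup>2 * inverse (((norm z)\<^sup>2 + e\<^sup>2)\<^sup>2))"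
  have g: "?g \<in> borel_measurable borel" using f by measurable
  have "integral\<^sup>L lborel ?g = integral\<^sup>L (density (distr lborel borel (\<lambda>x. 0 + e *\<^sub>R x)) (\<lambda>_. \<bar>e\<bar>^DIM(complex))) ?g"
    using lborel_affine[of e "0::complex"] e by simp
  also have "\<dots> = integral\<^sup>L (density (distr lborel borel (\<lambda>x::complex. 0 + e *\<^sub>R x)) (\<lambda>_. ennreal (e\<^sup>2))) ?g"
    using e by simp
  also have "\<dots> = integral\<^sup>L (distr lborel borel (\<lambda>x::complex. 0 + e *\<^sub>R x)) (\<lambda>z. e\<^sup>2 *\<^sub>R ?g z)"
    by (rule integral_density) (use g in auto)
  also have "\<dots> = integral\<^sup>L lborel (\<lambda>z. e\<^sup>2 *\<^sub>R ?g (0 + e *\<^sub>R z))"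
    by (rule integral_distr) (use g in auto)
  also have "\<dots> = integral\<^sup>L lborel (\<lambda>z. f (e *\<^sub>R z) * of_real (inverse ((1 + (norm z)\<^sup>2)\<^sup>2)))"
  proof (rule Bochner_Integration.integral_cong[OF refl])
    fix z :: complex
    have "(norm (e *\<^sub>R z))\<^sup>2 + e\<^sup>2 = e\<^sup>2 * (1 + (norm z)\<^sup>2)" by (simp add: power_mult_distrib algebra_simps)
    moreover have "e\<^sup>2 * (e\<^sup>2 * inverse ((e\<^sup>2 * Y)\<^sup>2)) = inverse (Y\<^sup>2)" if "Y \<noteq> 0" for Y
      using e that by (simp add: field_simps power2_eq_square)
    moreover have "1 + (norm z)\<^sup>2 \<noteq> 0" using zero_le_power2[of "norm z"] by linarith
    ultimately have "e\<^sup>2 * (e\<^sup>2 * inverse (((norm (e *\<^sub>R z))\<^sup>2 + e\<^sup>2)\<^sup>2)) = inverse ((1 + (norm z)\<^sup>2)\<^sup>2)"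
      by simp
    then have "of_real (e\<^sup>2) * of_real (e\<^sup>2 * inverse (((norm (e *\<^sub>R z))\<^sup>2 + e\<^sup>2)\<^sup>2)) =
        (of_real (inverse ((1 + (norm z)\<^sup>2)\<^sup>2)) :: complex)"
      by (simp only: of_real_mult[symmetric])
    then show "e\<^sup>2 *\<^sub>R ?g (0 + e *\<^sub>R z) = f (e *\<^sub>R z) * of_real (inverse ((1 + (norm z)\<^sup>2)\<^sup>2))"
      by (simp only: add_0 scaleR_conv_of_real mult.left_commute[of "of_real (e\<^sup>2)"])
  qed
  finally show ?thesis .
qed

text \<open>The regularised kernel \<open>cnj z / (|z|\<^sup>2 + e\<^sup>2)\<close> has the \<open>dbar\<close> derivative
  \<open>e\<^sup>2 / (|z|\<^sup>2 + e\<^sup>2)\<^sup>2\<close>, an approximate identity up to the factor \<open>cauchy_const\<close>.\<close>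

lemma dbar_regularised_kernel:
  fixes \<phi> :: "complex \<Rightarrow> complex"
  assumes \<phi>: "C_k_on (Suc 0) \<phi> UNIV" and supp: "\<And>z. r < norm z \<Longrightarrow> \<phi> z = 0" and e: "e > 0"
  shows "integral\<^sup>L lborel (\<lambda>z. dbar \<phi> z * (cnj z * of_real (inverse ((norm z)\<^sup>2 + e\<^sup>2)))) =
    - integral\<^sup>L lborel (\<lambda>z. \<phi> z * of_real (e\<^sup>2 * inverse (((norm z)\<^sup>2 + e\<^sup>2)\<^sup>2)))"
proof -
  define q where "q z = (norm z)\<^sup>2 + e\<^sup>2" for z :: complex
  have q: "q z > 0" for z using e by (simp add: q_def add_nonneg_pos)
  define D where "D z v = - (2 * (z \<bullet> v)) * (inverse (q z))\<^sup>2" for z v :: complex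
  define c where "c z = cnj z * of_real (inverse (q z))" for z
  have qd: "(q has_derivative (\<lambda>v. 2 * (z \<bullet> v))) (at z)" for z
    unfolding q_def[abs_def] power2_norm_eq_inner
    by (auto intro!: derivative_eq_intros simp: inner_commute)
  have "((\<lambda>z. inverse (q z)) has_derivative (\<lambda>v. - (inverse (q z) * (2 * (z \<bullet> v)) * inverse (q z)))) (at z)" for z
    by (rule Deriv.has_derivative_inverse[OF _ qd]) (use q[of z] in simp)
  then have sd: "((\<lambda>z. inverse (q z)) has_derivative D z) (at z)" for z
    by (simp add: D_def[abs_def] power2_eq_square mult_ac)
  have cd: "(c has_derivative (\<lambda>v. cnj z * of_real (D z v) + cnj v * of_real (inverse (q z)))) (at z)" for z
    unfolding c_def[abs_def]
    by (rule has_derivative_mult[OF bounded_linear_imp_has_derivative[OF bounded_linear_cnj]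
          bounded_linear.has_derivative[OF bounded_linear_of_real sd]])
  have qc: "continuous_on UNIV q" unfolding q_def by (intro continuous_intros)
  have c1: "C_k_on (Suc 0) c UNIV"
  proof (rule C_k_on_SucI[OF open_UNIV cd])
    fix v
    show "C_k_on 0 (\<lambda>z. cnj z * of_real (D z v) + cnj v * of_real (inverse (q z))) UNIV"
      unfolding D_def C_k_on.simps using q
      by (intro continuous_intros qc) (auto simp: less_imp_neq[symmetric])
  qed
  have cc: "continuous_on UNIV c" "continuous_on UNIV (partial_deriv v c)" for v
    using C_k_on_imp_continuous_on[OF c1] C_k_on_Suc_partial[OF c1] by auto
  have dc: "partial_deriv 1 c z + \<i> * partial_deriv \<i> c z = of_real (2 * (e\<^sup>2 * inverse ((q z)\<^sup>2)))" for z
  proof -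
    have "partial_deriv 1 c z + \<i> * partial_deriv \<i> c z =
        2 * of_real (inverse (q z)) + cnj z * (of_real (D z 1) + \<i> * of_real (D z \<i>))"
      unfolding partial_deriv_eq[OF cd] by (simp add: algebra_simps)
    also have "of_real (D z 1) + \<i> * of_real (D z \<i>) = - 2 * of_real ((inverse (q z))\<^sup>2) * z"
      by (simp add: D_def complex_eq_iff inner_complex_def)
    also have "cnj z * (- 2 * of_real ((inverse (q z))\<^sup>2) * z) = of_real (- 2 * (inverse (q z))\<^sup>2 * (norm z)\<^sup>2)"
      by (simp add: complex_norm_square mult_ac del: of_real_power)
    also have "2 * of_real (inverse (q z)) + of_real (- 2 * (inverse (q z))\<^sup>2 * (norm z)\<^sup>2) =
        (of_real (2 * inverse (q z) - 2 * (inverse (q z))\<^sup>2 * (norm z)\<^sup>2) :: complex)" by simp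
    also have "2 * inverse (q z) - 2 * (inverse (q z))\<^sup>2 * (norm z)\<^sup>2 = 2 * (inverse (q z))\<^sup>2 * (q z - (norm z)\<^sup>2)"
      using q[of z] by (simp add: power2_eq_square algebra_simps)
    also have "\<dots> = 2 * (e\<^sup>2 * inverse ((q z)\<^sup>2))" by (simp add: q_def power_inverse)
    finally show ?thesis .
  qed
  have \<phi>c: "continuous_on UNIV \<phi>" "continuous_on UNIV (partial_deriv v \<phi>)" for v
    using C_k_on_imp_continuous_on[OF \<phi>] C_k_on_Suc_partial[OF \<phi>] by auto
  have pd0: "partial_deriv v \<phi> z = 0" if "r < norm z" for z v
    by (rule partial_deriv_compact_support[OF supp that])
  have i: "integrable lborel (\<lambda>z. c z * partial_deriv v \<phi> z)" "integrable lborel (\<lambda>z. partial_deriv v c z * \<phi> z)" for v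
    by (rule integrable_continuous_compact_support[of _ r]; use supp pd0 in \<open>auto intro!: continuous_intros cc \<phi>c\<close>)+
  have parts: "integral\<^sup>L lborel (\<lambda>z. c z * partial_deriv v \<phi> z) = - integral\<^sup>L lborel (\<lambda>z. partial_deriv v c z * \<phi> z)" for v
    by (rule integral_by_parts[OF c1 \<phi> supp])
  have "integral\<^sup>L lborel (\<lambda>z. dbar \<phi> z * c z) =
      integral\<^sup>L lborel (\<lambda>z. (c z * partial_deriv 1 \<phi> z + \<i> * (c z * partial_deriv \<i> \<phi> z)) / 2)"
    by (simp add: dbar_def algebra_simps)
  also have "\<dots> = - integral\<^sup>L lborel (\<lambda>z. (partial_deriv 1 c z * \<phi> z + \<i> * (partial_deriv \<i> c z * \<phi> z)) / 2)"
    using i by (simp add: parts field_simps)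
  also have "(\<lambda>z. (partial_deriv 1 c z * \<phi> z + \<i> * (partial_deriv \<i> c z * \<phi> z)) / 2) =
      (\<lambda>z. \<phi> z * of_real (e\<^sup>2 * inverse ((q z)\<^sup>2)))"
  proof
    fix z
    have "(partial_deriv 1 c z * \<phi> z + \<i> * (partial_deriv \<i> c z * \<phi> z)) / 2 =
        \<phi> z * (partial_deriv 1 c z + \<i> * partial_deriv \<i> c z) / 2" by (simp add: algebra_simps)
    then show "(partial_deriv 1 c z * \<phi> z + \<i> * (partial_deriv \<i> c z * \<phi> z)) / 2 =
        \<phi> z * of_real (e\<^sup>2 * inverse ((q z)\<^sup>2))" unfolding dc by simp
  qed
  finally show ?thesis by (simp only: c_def q_def)
qed

text \<open>Let the regularisation parameter tend to 0. On one side the kernels converge to 1/z and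
  are dominated by 1/|z|; on the other the rescaled integrals converge because \<open>\<phi>\<close>
  is bounded and continuous at 0.\<close>

lemma Cauchy_Pompeiu:
  fixes \<phi> :: "complex \<Rightarrow> complex"
  assumes \<phi>: "C_k_on (Suc 0) \<phi> UNIV" and supp: "\<And>z. r < norm z \<Longrightarrow> \<phi> z = 0"
  shows "integrable lborel (\<lambda>z. dbar \<phi> z / z)"
    and "integral\<^sup>L lborel (\<lambda>z. dbar \<phi> z / z) = - of_real cauchy_const * \<phi> 0"
proof -
  have \<phi>c: "continuous_on UNIV \<phi>" "continuous_on UNIV (partial_deriv v \<phi>)" for v
    using C_k_on_imp_continuous_on[OF \<phi>] C_k_on_Suc_partial[OF \<phi>] by auto
  have dc: "continuous_on UNIV (dbar \<phi>)"
    unfolding dbar_def[abs_def] by (auto intro!: continuous_intros \<phi>c)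
  have d0: "dbar \<phi> z = 0" if "r < norm z" for z
    by (rule dbar_compact_support[OF supp that])
  have [measurable]: "cnj \<in> borel_measurable borel"
    by (intro borel_measurable_continuous_onI continuous_on_cnj continuous_on_id)
  have [measurable]: "(\<lambda>z::complex. complex_of_real (inverse ((norm z)\<^sup>2 + t\<^sup>2))) \<in> borel_measurable borel" for t
    by (rule measurable_compose[OF _ borel_measurable_of_real]) measurable
  note [measurable] = borel_measurable_continuous_onI[OF dc] borel_measurable_continuous_onI[OF \<phi>c(1)]
  obtain B where B: "B \<ge> 0" "\<And>z. norm (dbar \<phi> z) \<le> B"
    using continuous_compact_support_bounded[of "dbar \<phi>" r, OF dc d0] by auto
  obtain A where A: "A \<ge> 0" "\<And>z. norm (\<phi> z) \<le> A"
    using continuous_compact_support_bounded[of \<phi> r, OF \<phi>c(1) supp] by auto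
  let ?w = "\<lambda>z::complex. B * (indicator (ball 0 (r + 1)) z * inverse (norm z))"
  have iw: "integrable lborel ?w" by (intro integrable_mult_right integrable_inverse_norm)
  have dw: "norm (dbar \<phi> z) * inverse (norm z) \<le> ?w z" for z
  proof (cases "r < norm z")
    case False
    then have "indicator (ball 0 (r + 1)) z = (1::real)" by (simp add: indicator_def)
    with B show ?thesis by (simp add: mult_right_mono)
  qed (use d0 B in auto)
  show "integrable lborel (\<lambda>z. dbar \<phi> z / z)"
  proof (rule Bochner_Integration.integrable_bound[OF iw])
    show "AE z in lborel. norm (dbar \<phi> z / z) \<le> norm (?w z)"
      using dw B by (intro AE_I2) (auto simp: norm_mult norm_inverse divide_inverse intro: order_trans)
  qed measurable
  define h where "h n = inverse (real (Suc n))" for n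
  have h: "h n > 0" for n by (simp add: h_def)
  have h0: "h \<longlonglongrightarrow> 0" using LIMSEQ_inverse_real_of_nat by (simp add: h_def[abs_def])
  have lhs: "(\<lambda>n. integral\<^sup>L lborel (\<lambda>z. dbar \<phi> z * (cnj z * of_real (inverse ((norm z)\<^sup>2 + (h n)\<^sup>2)))))
      \<longlonglongrightarrow> integral\<^sup>L lborel (\<lambda>z. dbar \<phi> z / z)"
  proof (rule integral_dominated_convergence[where w="?w", OF _ _ iw])
    show "AE z in lborel. (\<lambda>n. dbar \<phi> z * (cnj z * of_real (inverse ((norm z)\<^sup>2 + (h n)\<^sup>2)))) \<longlonglongrightarrow> dbar \<phi> z / z"
    proof (rule AE_I2)
      fix z :: complex
      show "(\<lambda>n. dbar \<phi> z * (cnj z * of_real (inverse ((norm z)\<^sup>2 + (h n)\<^sup>2)))) \<longlonglongrightarrow> dbar \<phi> z / z"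
      proof (cases "z = 0")
        case False
        have "(\<lambda>n. dbar \<phi> z * (cnj z * of_real (inverse ((norm z)\<^sup>2 + (h n)\<^sup>2)))) \<longlonglongrightarrow>
            dbar \<phi> z * (cnj z * of_real (inverse ((norm z)\<^sup>2 + 0\<^sup>2)))"
          using False by (intro tendsto_intros h0) auto
        also have "cnj z * of_real (inverse ((norm z)\<^sup>2 + 0\<^sup>2)) = 1 / z"
          using False complex_norm_square[of z] by (simp add: field_simps)
        finally show ?thesis by simp
      qed simp
    qed
    show "AE z in lborel. norm (dbar \<phi> z * (cnj z * of_real (inverse ((norm z)\<^sup>2 + (h n)\<^sup>2)))) \<le> ?w z" for n
    proof (rule AE_I2)
      fix z :: complex
      have "norm z * inverse ((norm z)\<^sup>2 + (h n)\<^sup>2) \<le> inverse (norm z)"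
      proof (cases "z = 0")
        case False
        have "norm z * inverse ((norm z)\<^sup>2 + (h n)\<^sup>2) \<le> norm z * inverse ((norm z)\<^sup>2)"
          using False by (intro mult_left_mono le_imp_inverse_le) auto
        also have "\<dots> = inverse (norm z)" using False by (simp add: power2_eq_square)
        finally show ?thesis .
      qed simp
      then have "norm (dbar \<phi> z) * (norm z * inverse ((norm z)\<^sup>2 + (h n)\<^sup>2)) \<le> ?w z"
        using dw[of z] mult_left_mono[OF _ norm_ge_zero[of "dbar \<phi> z"]] by (meson order_trans)
      then show "norm (dbar \<phi> z * (cnj z * of_real (inverse ((norm z)\<^sup>2 + (h n)\<^sup>2)))) \<le> ?w z"
        by (simp add: norm_mult norm_inverse flip: of_real_power of_real_add of_real_inverse)
    qed
  qed measurable
  have rhs: "(\<lambda>n. integral\<^sup>L lborel (\<lambda>z. \<phi> (h n *\<^sub>R z) * of_real (inverse ((1 + (norm z)\<^sup>2)\<^sup>2))))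
      \<longlonglongrightarrow> integral\<^sup>L lborel (\<lambda>z::complex. \<phi> 0 * of_real (inverse ((1 + (norm z)\<^sup>2)\<^sup>2)))"
  proof (rule integral_dominated_convergence[where w="\<lambda>z. A * inverse ((1 + (norm z)\<^sup>2)\<^sup>2)"])
    show "integrable lborel (\<lambda>z::complex. A * inverse ((1 + (norm z)\<^sup>2)\<^sup>2))"
      by (intro integrable_mult_right integrable_cauchy_kernel)
    show "AE z in lborel. (\<lambda>n. \<phi> (h n *\<^sub>R z) * of_real (inverse ((1 + (norm z)\<^sup>2)\<^sup>2))) \<longlonglongrightarrow>
        \<phi> 0 * of_real (inverse ((1 + (norm z)\<^sup>2)\<^sup>2))"
    proof (rule AE_I2)
      fix z :: complex
      have "(\<lambda>n. h n *\<^sub>R z) \<longlonglongrightarrow> 0" using tendsto_scaleR[OF h0 tendsto_const[of z]] by simp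
      then have "(\<lambda>n. \<phi> (h n *\<^sub>R z)) \<longlonglongrightarrow> \<phi> 0"
        by (rule continuous_on_tendsto_compose[OF \<phi>c(1)]) auto
      then show "(\<lambda>n. \<phi> (h n *\<^sub>R z) * of_real (inverse ((1 + (norm z)\<^sup>2)\<^sup>2))) \<longlonglongrightarrow> \<phi> 0 * of_real (inverse ((1 + (norm z)\<^sup>2)\<^sup>2))"
        by (intro tendsto_mult tendsto_const)
    qed
    show "AE z in lborel. norm (\<phi> (h n *\<^sub>R z) * of_real (inverse ((1 + (norm z)\<^sup>2)\<^sup>2))) \<le> A * inverse ((1 + (norm z)\<^sup>2)\<^sup>2)" for n
    proof (rule AE_I2)
      fix z :: complex
      show "norm (\<phi> (h n *\<^sub>R z) * of_real (inverse ((1 + (norm z)\<^sup>2)\<^sup>2))) \<le> A * inverse ((1 + (norm z)\<^sup>2)\<^sup>2)"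
      proof -
        have "norm (complex_of_real (inverse ((1 + (norm z)\<^sup>2)\<^sup>2))) = inverse ((1 + (norm z)\<^sup>2)\<^sup>2)"
          by (simp only: norm_of_real abs_of_nonneg[OF inverse_nonnegative_iff_nonnegative[THEN iffD2, OF zero_le_power2]])
        then show ?thesis
          using mult_right_mono[OF A(2)[of "h n *\<^sub>R z"], of "inverse ((1 + (norm z)\<^sup>2)\<^sup>2)"]
          by (simp only: norm_mult) simp
      qed
    qed
  qed measurable
  have "integral\<^sup>L lborel (\<lambda>z. dbar \<phi> z * (cnj z * of_real (inverse ((norm z)\<^sup>2 + (h n)\<^sup>2)))) =
      - integral\<^sup>L lborel (\<lambda>z. \<phi> (h n *\<^sub>R z) * of_real (inverse ((1 + (norm z)\<^sup>2)\<^sup>2)))" for n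
    using dbar_regularised_kernel[of \<phi> r, OF \<phi> supp h[of n]] cauchy_kernel_rescale[of \<phi>, OF _ h[of n]] by simp
  then have "(\<lambda>n. integral\<^sup>L lborel (\<lambda>z. dbar \<phi> z * (cnj z * of_real (inverse ((norm z)\<^sup>2 + (h n)\<^sup>2)))))
      \<longlonglongrightarrow> - integral\<^sup>L lborel (\<lambda>z::complex. \<phi> 0 * of_real (inverse ((1 + (norm z)\<^sup>2)\<^sup>2)))"
    using tendsto_minus[OF rhs] by simp
  from LIMSEQ_unique[OF lhs this]
  have "integral\<^sup>L lborel (\<lambda>z. dbar \<phi> z / z) = - (\<phi> 0 * integral\<^sup>L lborel (\<lambda>z::complex. of_real (inverse ((1 + (norm z)\<^sup>2)\<^sup>2))))"
    by simp
  also have "integral\<^sup>L lborel (\<lambda>z::complex. of_real (inverse ((1 + (norm z)\<^sup>2)\<^sup>2))) = (of_real cauchy_const :: complex)"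
    unfolding cauchy_const_def by (rule integral_bounded_linear[OF bounded_linear_of_real integrable_cauchy_kernel])
  finally show "integral\<^sup>L lborel (\<lambda>z. dbar \<phi> z / z) = - of_real cauchy_const * \<phi> 0" by simp
qed


section \<open>Closed range implies the Poincare inequality\<close>

definition cauchy_transform :: "(complex \<Rightarrow> complex) \<Rightarrow> complex \<Rightarrow> complex" where
  "cauchy_transform g z = integral\<^sup>L lborel (\<lambda>w. g w / (z - w))"

text \<open>Only boundedness and measurability are assumed, no continuity, so that test functions
  corrected by multiples of an indicator are also covered.\<close>

locale bounded_compact_density =
  fixes g :: "complex \<Rightarrow> complex" and B r :: real
  assumes g_borel [measurable]: "g \<in> borel_measurable borel"
    and g_bound: "\<And>z. norm (g z) \<le> B"
    and g_support: "\<And>z. r < norm z \<Longrightarrow> g z = 0"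
begin

lemma B_nonneg: "B \<ge> 0"
  using g_bound[of 0] norm_ge_zero[of "g 0"] by linarith

lemma g_integrable: "integrable lborel g"
proof (rule Bochner_Integration.integrable_bound)
  show "integrable lborel (\<lambda>z::complex. B * indicator (cball 0 r) z)"
    using emeasure_bounded_finite[OF bounded_cball, of "0::complex" r]
    by (intro integrable_mult_right integrable_real_indicator) auto
  show "AE z in lborel. norm (g z) \<le> norm (B * indicator (cball 0 r) z :: real)"
  proof (rule AE_I2)
    fix z show "norm (g z) \<le> norm (B * indicator (cball 0 r) z :: real)"
      using g_bound[of z] g_support[of z] B_nonneg by (cases "r < norm z") (simp_all add: indicator_def)
  qed
qed simp

definition transform_bound :: real where
  "transform_bound = B * integral\<^sup>L lborel (\<lambda>z::complex. indicator (ball 0 1) z * inverse (norm z)) +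
    integral\<^sup>L lborel (\<lambda>z. norm (g z))"

text \<open>The kernel is split at distance 1 from its pole: inside, \<open>g\<close> is bounded and
  1/|z| integrable; outside, the kernel is at most 1. The resulting bound does not depend on
  \<open>z\<close>.\<close>

lemma kernel_integrable:
  "integrable lborel (\<lambda>w. g w / (z - w))"
  "integral\<^sup>L lborel (\<lambda>w. norm (g w / (z - w))) \<le> transform_bound"
proof -
  define k where "k w = indicator (ball 0 1) w * inverse (norm w)" for w :: complex
  have ik: "integrable lborel (\<lambda>w. k (w + - z))" "integral\<^sup>L lborel (\<lambda>w. k (w + - z)) = integral\<^sup>L lborel k"
    using integrable_lborel_shift[of k "- z"] integrable_inverse_norm_unit_ball unfolding k_def by auto
  have le: "norm (g w / (z - w)) \<le> B * k (w + - z) + norm (g w)" for w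
  proof (cases "norm (w - z) < 1")
    case True
    then have "norm (g w / (z - w)) \<le> B * k (w + - z)"
      using g_bound[of w] by (simp add: k_def norm_mult norm_inverse norm_minus_commute divide_inverse mult_right_mono)
    then show ?thesis using norm_ge_zero[of "g w"] by linarith
  next
    case False
    then have "norm (g w / (z - w)) \<le> norm (g w)"
      by (simp add: norm_divide norm_minus_commute divide_le_eq mult_left_le not_less)
        (metis mult.right_neutral mult_left_mono norm_ge_zero norm_minus_commute)
    moreover have "0 \<le> B * k (w + - z)" using B_nonneg by (simp add: k_def)
    ultimately show ?thesis by linarith
  qed
  have ib: "integrable lborel (\<lambda>w. B * k (w + - z) + norm (g w))"
    using ik g_integrable by simp
  show i: "integrable lborel (\<lambda>w. g w / (z - w))"
  proof (rule Bochner_Integration.integrable_bound[OF ib])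
    show "AE w in lborel. norm (g w / (z - w)) \<le> norm (B * k (w + - z) + norm (g w))"
      by (intro AE_I2) (simp only: real_norm_def, rule order_trans[OF le abs_ge_self])
  qed measurable
  have "integral\<^sup>L lborel (\<lambda>w. norm (g w / (z - w))) \<le> integral\<^sup>L lborel (\<lambda>w. B * k (w + - z) + norm (g w))"
    by (rule integral_mono[OF integrable_norm[OF i] ib le])
  also have "\<dots> = transform_bound"
  proof -
    have "transform_bound = B * integral\<^sup>L lborel k + integral\<^sup>L lborel (\<lambda>z. norm (g z))"
      unfolding transform_bound_def k_def[abs_def] ..
    then show ?thesis using ik g_integrable by simp
  qed
  finally show "integral\<^sup>L lborel (\<lambda>w. norm (g w / (z - w))) \<le> transform_bound" .
qed

lemma transform_norm_le: "norm (cauchy_transform g z) \<le> transform_bound"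
  using integral_norm_bound[of lborel "\<lambda>w. g w / (z - w)"] kernel_integrable(2)[of z]
  unfolding cauchy_transform_def by linarith

lemma transform_borel [measurable]: "cauchy_transform g \<in> borel_measurable borel"
  unfolding cauchy_transform_def[abs_def] by measurable

text \<open>Fubini moves \<open>dbar \<phi>\<close> into the inner integral, where Cauchy-Pompeiu,
  translated to the pole \<open>w\<close>, evaluates it as a multiple of
  \<open>\<phi> w\<close>.\<close>

lemma transform_weak_dbar:
  assumes \<Omega>: "open \<Omega>" and out: "\<And>z. z \<notin> \<Omega> \<Longrightarrow> g z = 0"
  shows "has_weak_dbar \<Omega> (\<lambda>z. inverse (of_real cauchy_const) * cauchy_transform g z) g"
  unfolding has_weak_dbar_def
proof
  fix \<phi> assume \<phi>: "\<phi> \<in> test_functions \<Omega>"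
  obtain s where s: "\<And>z. s < norm z \<Longrightarrow> \<phi> z = 0"
    using test_functions_bounded_support[OF \<phi>] by blast
  note dc = dbar_continuous[OF \<phi>] and \<phi>c = test_functions_continuous[OF \<phi>]
  note [measurable] = borel_measurable_continuous_onI[OF dc] borel_measurable_continuous_onI[OF \<phi>c]
  have idb: "integrable lborel (dbar \<phi>)"
    by (rule integrable_continuous_compact_support[OF dc]) (rule dbar_compact_support[OF s])
  define F where "F z w = g w / (z - w) * dbar \<phi> z" for z w
  have Fm: "case_prod F \<in> borel_measurable (lborel \<Otimes>\<^sub>M lborel)"
    unfolding F_def by measurable
  have iF: "integrable (lborel \<Otimes>\<^sub>M lborel) (case_prod F)"
  proof (rule lborel_pair.Fubini_integrable[OF Fm])
    have eq: "integral\<^sup>L lborel (\<lambda>w. norm (case_prod F (z, w))) = integral\<^sup>L lborel (\<lambda>w. norm (g w / (z - w))) * norm (dbar \<phi> z)" for z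
    proof -
      have "(\<lambda>w. norm (case_prod F (z, w))) = (\<lambda>w. norm (g w / (z - w)) * norm (dbar \<phi> z))"
        by (simp only: F_def case_prod_conv norm_mult)
      then show ?thesis by (simp only: integral_mult_left_zero)
    qed
    show "integrable lborel (\<lambda>z. integral\<^sup>L lborel (\<lambda>w. norm (case_prod F (z, w))))"
      unfolding eq
    proof (rule Bochner_Integration.integrable_bound)
      show "integrable lborel (\<lambda>z. transform_bound * norm (dbar \<phi> z))" using idb by simp
      show "AE z in lborel. norm (integral\<^sup>L lborel (\<lambda>w. norm (g w / (z - w))) * norm (dbar \<phi> z))
          \<le> norm (transform_bound * norm (dbar \<phi> z))"
      proof (rule AE_I2)
        fix z
        have "0 \<le> integral\<^sup>L lborel (\<lambda>w. norm (g w / (z - w)))" by (rule Bochner_Integration.integral_nonneg) simp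
        then show "norm (integral\<^sup>L lborel (\<lambda>w. norm (g w / (z - w))) * norm (dbar \<phi> z)) \<le> norm (transform_bound * norm (dbar \<phi> z))"
          using kernel_integrable(2)[of z] by (simp add: abs_mult mult_right_mono)
      qed
    qed measurable
    show "AE z in lborel. integrable lborel (\<lambda>w. case_prod F (z, w))"
    proof (rule AE_I2)
      fix z
      have "(\<lambda>w. case_prod F (z, w)) = (\<lambda>w. g w / (z - w) * dbar \<phi> z)"
        by (simp only: F_def case_prod_conv)
      then show "integrable lborel (\<lambda>w. case_prod F (z, w))"
        by (simp only: integrable_mult_left[OF kernel_integrable(1)])
    qed
  qed
  have inner: "integral\<^sup>L lborel (\<lambda>z. F z w) = g w * (- of_real cauchy_const * \<phi> w)" for w
  proof -
    define \<psi> where "\<psi> z = \<phi> (z + w)" for z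
    have \<psi>d: "(\<psi> has_derivative (\<lambda>v. partial_deriv v \<phi> (z + w))) (at z)" for z
    proof -
      have D: "(\<phi> has_derivative (\<lambda>v. partial_deriv v \<phi> (z + w))) (at (z + w))"
        by (rule has_derivative_partial_deriv[OF test_functions_differentiable[OF \<phi>]])
      have "((\<lambda>z. z + w) has_derivative (\<lambda>v. v)) (at z)" by (auto intro!: derivative_eq_intros)
      from has_derivative_compose[of "\<lambda>z. z + w" "\<lambda>v. v" z UNIV \<phi>, OF this D] show ?thesis
        by (simp add: \<psi>_def[abs_def])
    qed
    have \<psi>1: "C_k_on (Suc 0) \<psi> UNIV"
    proof (rule C_k_on_SucI[OF open_UNIV \<psi>d])
      show "C_k_on 0 (\<lambda>x. partial_deriv v \<phi> (x + w)) UNIV" for v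
        unfolding C_k_on.simps
        by (rule continuous_on_compose2[OF test_functions_partial_continuous[OF \<phi>]]) (auto intro!: continuous_intros)
    qed
    have \<psi>s: "\<psi> z = 0" if "s + norm w < norm z" for z
    proof -
      have "norm z \<le> norm (z + w) + norm w" using norm_triangle_ineq4[of "z + w" w] by simp
      with that have "s < norm (z + w)" by linarith
      then show ?thesis by (simp add: \<psi>_def s)
    qed
    have \<psi>db: "dbar \<psi> z = dbar \<phi> (z + w)" for z
      by (simp add: dbar_def partial_deriv_eq[OF \<psi>d])
    note CP = Cauchy_Pompeiu[of \<psi> "s + norm w", OF \<psi>1 \<psi>s]
    have "integral\<^sup>L lborel (\<lambda>z. dbar \<phi> z / (z - w)) = integral\<^sup>L lborel (\<lambda>z. dbar \<psi> (z + - w) / (z + - w))"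
      by (simp add: \<psi>db)
    also have "\<dots> = integral\<^sup>L lborel (\<lambda>z. dbar \<psi> z / z)"
      by (rule integrable_lborel_shift(2)[OF CP(1)])
    also have "\<dots> = - of_real cauchy_const * \<phi> w" using CP(2) by (simp add: \<psi>_def)
    finally have "integral\<^sup>L lborel (\<lambda>z. dbar \<phi> z / (z - w)) = - of_real cauchy_const * \<phi> w" .
    moreover have "(\<lambda>z. F z w) = (\<lambda>z. g w * (dbar \<phi> z / (z - w)))" by (simp add: F_def fun_eq_iff)
    ultimately show ?thesis by (simp only: integral_mult_right_zero)
  qed
  have "integral\<^sup>L lborel (\<lambda>z. cauchy_transform g z * dbar \<phi> z) = integral\<^sup>L lborel (\<lambda>z. integral\<^sup>L lborel (\<lambda>w. F z w))"
    by (simp only: F_def cauchy_transform_def integral_mult_left_zero)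
  also have "\<dots> = integral\<^sup>L lborel (\<lambda>w. integral\<^sup>L lborel (\<lambda>z. F z w))"
    using lborel_pair.Fubini_integral[OF iF] by simp
  also have "\<dots> = - of_real cauchy_const * integral\<^sup>L lborel (\<lambda>w. g w * \<phi> w)"
    unfolding inner by (simp add: mult.left_commute[of "g _"])
  finally have main: "integral\<^sup>L lborel (\<lambda>z. cauchy_transform g z * dbar \<phi> z) = - of_real cauchy_const * integral\<^sup>L lborel (\<lambda>w. g w * \<phi> w)" .
  have "integral\<^sup>L (lebesgue_on \<Omega>) (\<lambda>z. inverse (of_real cauchy_const) * cauchy_transform g z * dbar \<phi> z) =
      integral\<^sup>L lborel (\<lambda>z. inverse (of_real cauchy_const) * cauchy_transform g z * dbar \<phi> z)"
    by (rule lebesgue_on_eq_lborel(1)[OF \<Omega>]) (auto simp: dbar_outside[OF \<phi>])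
  also have "\<dots> = inverse (of_real cauchy_const) * integral\<^sup>L lborel (\<lambda>z. cauchy_transform g z * dbar \<phi> z)"
    by (simp add: mult.assoc)
  also have "\<dots> = - integral\<^sup>L lborel (\<lambda>w. g w * \<phi> w)"
    using cauchy_const_pos unfolding main by simp
  also have "integral\<^sup>L lborel (\<lambda>w. g w * \<phi> w) = integral\<^sup>L (lebesgue_on \<Omega>) (\<lambda>w. g w * \<phi> w)"
    by (rule lebesgue_on_eq_lborel(1)[OF \<Omega>, symmetric]) (auto simp: out)
  finally show "integral\<^sup>L (lebesgue_on \<Omega>) (\<lambda>z. inverse (of_real cauchy_const) * cauchy_transform g z * dbar \<phi> z) =
      - integral\<^sup>L (lebesgue_on \<Omega>) (\<lambda>w. g w * \<phi> w)" .
qed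

lemma g_L2: "open \<Omega> \<Longrightarrow> g \<in> L2 \<Omega>"
proof -
  assume \<Omega>: "open \<Omega>"
  have "integrable lborel (\<lambda>z. (norm (g z))\<^sup>2)"
  proof (rule Bochner_Integration.integrable_bound)
    show "integrable lborel (\<lambda>z. B * norm (g z))" using g_integrable by simp
    show "AE z in lborel. norm ((norm (g z))\<^sup>2) \<le> norm (B * norm (g z))"
      using g_bound B_nonneg by (intro AE_I2) (auto simp: power2_eq_square intro!: mult_right_mono)
  qed measurable
  then show ?thesis
    unfolding L2_def using \<Omega> by (auto intro!: integrable_lebesgue_on_lborel borel_measurable_lebesgue_on)
qed

lemma in_range_dbar:
  assumes \<Omega>: "open \<Omega>" and out: "\<And>z. z \<notin> \<Omega> \<Longrightarrow> g z = 0" and "cauchy_transform g \<in> L2 \<Omega>"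
  shows "g \<in> range_dbar \<Omega>"
proof -
  have "(\<lambda>z. inverse (of_real cauchy_const) * cauchy_transform g z) \<in> Dom_dbar \<Omega>"
    using transform_weak_dbar[OF \<Omega> out] g_L2[OF \<Omega>] L2_cmult[OF assms(3)] by (auto simp: Dom_dbar_def)
  then show ?thesis
    using transform_weak_dbar[OF \<Omega> out] g_L2[OF \<Omega>] by (auto simp: range_dbar_def)
qed

text \<open>The transform is bounded, and bounded functions are square integrable on a set of finite
  measure.\<close>

lemma in_range_dbar_finite_measure:
  assumes \<Omega>: "open \<Omega>" and out: "\<And>z. z \<notin> \<Omega> \<Longrightarrow> g z = 0" and fin: "emeasure lborel \<Omega> < \<infinity>"
  shows "g \<in> range_dbar \<Omega>"
proof (rule in_range_dbar[OF \<Omega> out])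
  have "integrable lborel (\<lambda>z. transform_bound\<^sup>2 * indicator \<Omega> z)"
    using fin \<Omega> by (intro integrable_mult_right integrable_real_indicator) auto
  then have "integrable (lebesgue_on \<Omega>) (\<lambda>z. transform_bound\<^sup>2 * indicator \<Omega> z)"
    by (rule integrable_lebesgue_on_lborel[OF \<Omega>])
  then have "integrable (lebesgue_on \<Omega>) (\<lambda>z. (norm (cauchy_transform g z))\<^sup>2)"
  proof (rule Bochner_Integration.integrable_bound)
    show "(\<lambda>z. (norm (cauchy_transform g z))\<^sup>2) \<in> borel_measurable (lebesgue_on \<Omega>)"
      by (rule borel_measurable_lebesgue_on) measurable
    show "AE z in lebesgue_on \<Omega>. norm ((norm (cauchy_transform g z))\<^sup>2) \<le> norm (transform_bound\<^sup>2 * indicator \<Omega> z)"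
      using transform_norm_le by (intro AE_I2) (auto intro!: power_mono)
  qed
  then show "cauchy_transform g \<in> L2 \<Omega>"
    by (simp add: L2_def borel_measurable_lebesgue_on)
qed

text \<open>For a density of mean zero the transform is \<open>O(|z|\<^sup>-\<^sup>2)\<close> at infinity.\<close>

lemma in_range_dbar_mean_zero:
  assumes \<Omega>: "open \<Omega>" and out: "\<And>z. z \<notin> \<Omega> \<Longrightarrow> g z = 0" and mean: "integral\<^sup>L lborel g = 0"
  shows "g \<in> range_dbar \<Omega>"
proof (rule in_range_dbar[OF \<Omega> out])
  define s where "s = max r 1"
  define N where "N = integral\<^sup>L lborel (\<lambda>w. norm (g w))"
  define K where "K = transform_bound * (1 + (2 * s)\<^sup>2) + 4 * s * N"
  have N: "N \<ge> 0" unfolding N_def by (intro Bochner_Integration.integral_nonneg) auto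
  have T: "transform_bound \<ge> 0" using transform_norm_le[of 0] norm_ge_zero[of "cauchy_transform g 0"] by linarith
  have s: "s \<ge> 1" "r \<le> s" by (auto simp: s_def)
  have bound: "norm (cauchy_transform g z) \<le> K * inverse (1 + (norm z)\<^sup>2)" for z
  proof (cases "norm z < 2 * s")
    case True
    then have "(norm z)\<^sup>2 \<le> (2 * s)\<^sup>2" by (intro power_mono) auto
    then have "norm (cauchy_transform g z) * (1 + (norm z)\<^sup>2) \<le> transform_bound * (1 + (2 * s)\<^sup>2)"
      using transform_norm_le T by (intro mult_mono) auto
    also have "\<dots> \<le> K" using N s by (simp add: K_def)
    finally show ?thesis by (simp add: inverse_eq_divide pos_le_divide_eq add_pos_nonneg)
  next
    case False
    then have z: "norm z \<ge> 2 * s" "norm z > 0" "z \<noteq> 0" using s by auto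
    \<comment> \<open>Since \<open>g\<close> has mean zero, \<open>g w / z\<close> may be subtracted
      under the integral. What remains is of order |w| / |z|^2, because |z - w| is at least |z| /
      2.\<close>
    have pt: "norm (g w / (z - w) - g w / z) \<le> norm (g w) * (2 * s / (norm z)\<^sup>2)" for w
    proof (cases "s < norm w")
      case True
      then show ?thesis using g_support[of w] s by simp
    next
      case False
      have "norm z \<le> norm (z - w) + norm w" using norm_triangle_sub[of z w] by (simp add: add.commute)
      then have zw: "norm z / 2 \<le> norm (z - w)" using False z by linarith
      then have zw0: "z - w \<noteq> 0" using z by auto
      have "g w / (z - w) - g w / z = g w * (w / ((z - w) * z))"
        using zw0 z by (simp add: field_simps)
      then have "norm (g w / (z - w) - g w / z) = norm (g w) * (norm w / (norm (z - w) * norm z))"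
        by (simp add: norm_mult norm_divide)
      also have "\<dots> \<le> norm (g w) * (s / (norm z / 2 * norm z))"
        using zw z False s by (intro mult_left_mono frac_le mult_right_mono mult_pos_pos) auto
      finally show ?thesis by (simp add: power2_eq_square mult.commute)
    qed
    have i2: "integrable lborel (\<lambda>w. g w / z)" using g_integrable by simp
    have "cauchy_transform g z = integral\<^sup>L lborel (\<lambda>w. g w / (z - w) - g w / z)"
      unfolding cauchy_transform_def using kernel_integrable(1)[of z] i2 mean by simp
    then have "norm (cauchy_transform g z) \<le> integral\<^sup>L lborel (\<lambda>w. norm (g w / (z - w) - g w / z))"
      using integral_norm_bound by metis
    also have "\<dots> \<le> integral\<^sup>L lborel (\<lambda>w. norm (g w) * (2 * s / (norm z)\<^sup>2))"
      by (rule integral_mono) (use pt kernel_integrable(1)[of z] i2 g_integrable in auto)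
    also have "\<dots> = N * (2 * s / (norm z)\<^sup>2)" by (simp add: N_def)
    finally have "norm (cauchy_transform g z) \<le> N * (2 * s / (norm z)\<^sup>2)" .
    moreover have "1 + (norm z)\<^sup>2 \<le> 2 * (norm z)\<^sup>2"
      using power_mono[of 1 "norm z" 2] z s by simp
    ultimately have "norm (cauchy_transform g z) * (1 + (norm z)\<^sup>2) \<le> N * (2 * s / (norm z)\<^sup>2) * (2 * (norm z)\<^sup>2)"
      by (intro mult_mono) (use N s in auto)
    also have "\<dots> = 4 * s * N" using z by simp
    also have "\<dots> \<le> K" using T by (simp add: K_def)
    finally show ?thesis by (simp add: inverse_eq_divide pos_le_divide_eq add_pos_nonneg)
  qed
  have "integrable lborel (\<lambda>z. (norm (cauchy_transform g z))\<^sup>2)"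
  proof (rule Bochner_Integration.integrable_bound)
    show "integrable lborel (\<lambda>z::complex. K\<^sup>2 * inverse ((1 + (norm z)\<^sup>2)\<^sup>2))"
      by (intro integrable_mult_right integrable_cauchy_kernel)
    show "AE z in lborel. norm ((norm (cauchy_transform g z))\<^sup>2) \<le> norm (K\<^sup>2 * inverse ((1 + (norm z)\<^sup>2)\<^sup>2))"
    proof (rule AE_I2)
      fix z
      have "(norm (cauchy_transform g z))\<^sup>2 \<le> (K * inverse (1 + (norm z)\<^sup>2))\<^sup>2"
        by (intro power_mono bound) simp
      also have "\<dots> = K\<^sup>2 * inverse ((1 + (norm z)\<^sup>2)\<^sup>2)" by (simp add: power_mult_distrib power_inverse)
      finally show "norm ((norm (cauchy_transform g z))\<^sup>2) \<le> norm (K\<^sup>2 * inverse ((1 + (norm z)\<^sup>2)\<^sup>2))" by simp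
    qed
  qed measurable
  then show "cauchy_transform g \<in> L2 \<Omega>"
    unfolding L2_def using \<Omega> by (auto intro!: integrable_lebesgue_on_lborel borel_measurable_lebesgue_on)
qed

end

section \<open>From closed range to an inequality\<close>

lemma range_dbar_limit:
  assumes closed: "dbar_closed_range \<Omega>" and f: "\<And>n. f n \<in> range_dbar \<Omega>" and g: "g \<in> L2 \<Omega>"
    and lim: "(\<lambda>n. L2_norm \<Omega> (\<lambda>z. f n z - g z)) \<longlonglongrightarrow> 0"
  shows "g \<in> range_dbar \<Omega>"
proof (rule ccontr)
  assume "g \<notin> range_dbar \<Omega>"
  moreover have "seminorm_open (L2 \<Omega>) (L2_norm \<Omega>) (L2 \<Omega> - range_dbar \<Omega>)"
    using closed unfolding dbar_closed_range_def closedin_def topspace_seminorm_topology openin_seminorm_topology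
    by blast
  ultimately obtain e where e: "e > 0" "\<And>h. h \<in> L2 \<Omega> \<Longrightarrow> L2_norm \<Omega> (\<lambda>z. h z - g z) < e \<Longrightarrow> h \<notin> range_dbar \<Omega>"
    using g unfolding seminorm_open_def by (metis Diff_iff)
  obtain n where "L2_norm \<Omega> (\<lambda>z. f n z - g z) < e"
    using order_tendstoD(2)[OF lim e(1)] by (auto simp: eventually_sequentially)
  with e(2)[of "f n"] f[of n] show False by (simp add: range_dbar_def)
qed

lemma L2_norm_indicator:
  assumes \<Omega>: "open \<Omega>" and A: "A \<in> sets borel" "A \<subseteq> \<Omega>"
  shows "L2_norm \<Omega> (indicator A) = sqrt (measure lborel A)"
proof -
  have "integral\<^sup>L (lebesgue_on \<Omega>) (\<lambda>z. (norm (indicator A z :: complex))\<^sup>2) = integral\<^sup>L lborel (\<lambda>z. (norm (indicator A z :: complex))\<^sup>2)"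
    by (rule lebesgue_on_eq_lborel(1)[OF \<Omega>])
      (use A in \<open>auto simp: indicator_def intro!: borel_measurable_power borel_measurable_norm borel_measurable_indicator'\<close>)
  also have "\<dots> = measure lborel A"
  proof -
    have "(\<lambda>z. (norm (indicator A z :: complex))\<^sup>2) = indicator A" by (auto simp: indicator_def)
    then show ?thesis using A(1) by simp
  qed
  finally show ?thesis unfolding L2_norm_def by (simp only:)
qed

text \<open>If \<open>\<Omega>\<close> has infinite measure, the mean of a test function can be cancelled by a function of
  arbitrarily small norm, spread over a large part of \<open>\<Omega>\<close>.\<close>

lemma test_functions_in_closed_range_dbar:
  assumes \<Omega>: "open \<Omega>" and closed: "dbar_closed_range \<Omega>" and v: "v \<in> test_functions \<Omega>"
  shows "v \<in> range_dbar \<Omega>"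
proof -
  obtain r where r: "\<And>z. r < norm z \<Longrightarrow> v z = 0"
    using test_functions_bounded_support[OF v] by blast
  obtain B where B: "B \<ge> 0" "\<And>z. norm (v z) \<le> B"
    using continuous_compact_support_bounded[of v r, OF test_functions_continuous[OF v] r] by auto
  have vm: "v \<in> borel_measurable borel"
    by (rule borel_measurable_continuous_onI[OF test_functions_continuous[OF v]])
  have v0: "v z = 0" if "z \<notin> \<Omega>" for z by (rule test_functions_outside[OF v that])
  interpret v: bounded_compact_density v B r
    by unfold_locales (use vm B r in auto)
  show ?thesis
  proof (cases "emeasure lborel \<Omega> < \<infinity>")
    case True
    then show ?thesis by (intro v.in_range_dbar_finite_measure \<Omega> v0)
  next
    case False
    define A where "A n = \<Omega> \<inter> ball 0 (real n)" for n
    have As: "A n \<in> sets borel" "A n \<subseteq> \<Omega>" for n using \<Omega> by (auto simp: A_def)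
    have Afin: "emeasure lborel (A n) < \<infinity>" for n
      by (rule emeasure_bounded_finite) (auto simp: A_def intro: bounded_subset[OF bounded_ball])
    have "(\<Union>n. A n) = \<Omega>"
      using reals_Archimedean2 by (auto simp: A_def)
    moreover have "(\<lambda>n. emeasure lborel (A n)) \<longlonglongrightarrow> emeasure lborel (\<Union>n. A n)"
      using As by (intro Lim_emeasure_incseq) (auto simp: incseq_def A_def)
    ultimately have lim: "(\<lambda>n. emeasure lborel (A n)) \<longlonglongrightarrow> \<infinity>" using False by (simp add: top.not_eq_extremum[symmetric])
    have "\<exists>n. measure lborel (A n) > real (Suc k)" for k
    proof -
      have "\<forall>\<^sub>F n in sequentially. emeasure lborel (A n) > ennreal (real (Suc k))"
        by (rule order_tendstoD(1)[OF lim]) simp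
      then obtain n where "emeasure lborel (A n) > ennreal (real (Suc k))"
        by (auto simp: eventually_sequentially)
      then have "ennreal (measure lborel (A n)) > ennreal (real (Suc k))"
        using Afin[of n] by (simp add: emeasure_eq_ennreal_measure)
      then have "real (Suc k) < measure lborel (A n)"
        using ennreal_less_iff[OF of_nat_0_le_iff] by blast
      then show ?thesis by blast
    qed
    then obtain n where n: "\<And>k. measure lborel (A (n k)) > real (Suc k)" by metis
    define a where "a = integral\<^sup>L lborel v"
    define m where "m k = measure lborel (A (n k))" for k
    have m: "m k > 0" "m k \<ge> real (Suc k)" for k using n[of k] by (auto simp: m_def)
    \<comment> \<open>The correction has integral \<open>a\<close>, the mean of \<open>v\<close>,
      but L2 norm only |a| / sqrt (m k), which tends to 0 since the area \<open>m k\<close> is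
      unbounded.\<close>
    define f where "f k z = v z - (a / of_real (m k)) * indicator (A (n k)) z" for k z
    have fr: "f k \<in> range_dbar \<Omega>" for k
    proof -
      interpret f: bounded_compact_density "f k" "B + norm (a / of_real (m k))" "max r (real (n k))"
      proof
        show "f k \<in> borel_measurable borel"
          unfolding f_def[abs_def] using vm As[of "n k"]
          by (intro borel_measurable_diff borel_measurable_times borel_measurable_const borel_measurable_indicator) auto
        show "norm (f k z) \<le> B + norm (a / of_real (m k))" for z
        proof -
          have "norm (f k z) \<le> norm (v z) + norm ((a / of_real (m k)) * indicator (A (n k)) z)"
            unfolding f_def by (rule norm_triangle_ineq4)
          also have "\<dots> \<le> B + norm (a / of_real (m k))"
            using B(2)[of z] by (intro add_mono) (auto simp: indicator_def)
          finally show ?thesis .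
        qed
        show "f k z = 0" if "max r (real (n k)) < norm z" for z
          using that by (simp add: f_def r A_def)
      qed
      have ind: "(indicator (A (n k)) :: complex \<Rightarrow> complex) = (\<lambda>z. of_real (indicator (A (n k)) z))"
        by (auto simp: indicator_def)
      have ri: "integrable lborel (indicator (A (n k)) :: complex \<Rightarrow> real)"
        using As[of "n k"] Afin[of "n k"] by (intro integrable_real_indicator) auto
      have ii: "integrable lborel (indicator (A (n k)) :: complex \<Rightarrow> complex)"
        unfolding ind by (rule integrable_bounded_linear[OF bounded_linear_of_real ri])
      have "integral\<^sup>L lborel (f k) = a - (a / of_real (m k)) * integral\<^sup>L lborel (indicator (A (n k)))"
        unfolding f_def[abs_def] a_def using v.g_integrable ii by simp
      also have "integral\<^sup>L lborel (indicator (A (n k))) = (of_real (m k) :: complex)"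
        unfolding ind integral_bounded_linear[OF bounded_linear_of_real ri] using As[of "n k"] by (simp add: m_def)
      finally have "integral\<^sup>L lborel (f k) = 0" using m(1)[of k] by simp
      then show ?thesis
        using As[of "n k"] by (intro f.in_range_dbar_mean_zero \<Omega>) (auto simp: f_def v0 indicator_def)
    qed
    have "L2_norm \<Omega> (\<lambda>z. f k z - v z) = norm a / sqrt (m k)" for k
    proof -
      have "(\<lambda>z. f k z - v z) = (\<lambda>z. (- (a / of_real (m k))) * indicator (A (n k)) z)"
        by (simp add: f_def fun_eq_iff)
      then have "L2_norm \<Omega> (\<lambda>z. f k z - v z) = norm (a / of_real (m k)) * sqrt (m k)"
        by (simp only: L2_norm_cmult norm_minus_cancel L2_norm_indicator[OF \<Omega> As] m_def)
      also have "\<dots> = norm a / sqrt (m k)"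
        using m(1)[of k] by (simp add: norm_divide real_div_sqrt field_simps)
      finally show ?thesis .
    qed
    moreover have "(\<lambda>k. norm a / sqrt (m k)) \<longlonglongrightarrow> 0"
    proof (rule Lim_null_comparison)
      show "\<forall>\<^sub>F k in sequentially. norm (norm a / sqrt (m k)) \<le> norm a / sqrt (real (Suc k))"
      proof (intro always_eventually allI)
        fix k
        have "norm a / sqrt (m k) \<le> norm a / sqrt (real (Suc k))"
          using m[of k] by (intro frac_le real_sqrt_le_mono) (simp_all del: of_nat_Suc)
        moreover have "0 \<le> norm a / sqrt (m k)" using m(1)[of k] by simp
        ultimately show "norm (norm a / sqrt (m k)) \<le> norm a / sqrt (real (Suc k))"
          by (simp only: real_norm_def abs_of_nonneg)
      qed
      show "(\<lambda>k. norm a / sqrt (real (Suc k))) \<longlonglongrightarrow> 0" by real_asymp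
    qed
    ultimately have "(\<lambda>k. L2_norm \<Omega> (\<lambda>z. f k z - v z)) \<longlonglongrightarrow> 0" by simp
    then show ?thesis by (rule range_dbar_limit[OF closed fr test_functions_L2[OF \<Omega> v]])
  qed
qed

text \<open>The uniform boundedness principle, by a gliding hump: otherwise some \<open>g\<close> in the closed range would pair
  too strongly with test functions \<open>w n\<close> of norm one and tiny \<open>dbar\<close>.\<close>

lemma poincare_test_if_dbar_closed_range:
  assumes \<Omega>: "open \<Omega>" and closed: "dbar_closed_range \<Omega>"
  shows "poincare_test \<Omega>"
proof (rule ccontr)
  assume neg: "\<not> poincare_test \<Omega>"
  let ?T = "test_functions \<Omega>"
  let ?I = "\<lambda>f. integral\<^sup>L (lebesgue_on \<Omega>) f"
  \<comment> \<open>The rate 9^-n is the square of the rate 3^-n of the humps, so that the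
    comparison at the end diverges like 3^n.\<close>
  have "\<exists>w\<in>?T. L2_norm \<Omega> w = 1 \<and> L2_norm \<Omega> (dbar w) \<le> 1 / 9 ^ n" for n :: nat
  proof -
    obtain v where v: "v \<in> ?T" "L2_norm \<Omega> v > 9 ^ n * test_grad_norm \<Omega> v"
      using neg unfolding poincare_test_def by (metis linorder_not_le zero_less_numeral zero_less_power)
    have t0: "0 \<le> test_grad_norm \<Omega> v" by (simp add: test_grad_norm_def)
    then have N: "L2_norm \<Omega> v > 0" using v(2) by (meson mult_nonneg_nonneg order.strict_trans1 zero_le_numeral zero_le_power)
    let ?c = "complex_of_real (1 / L2_norm \<Omega> v)"
    have c: "norm ?c = 1 / L2_norm \<Omega> v" unfolding norm_of_real using N by simp
    have "L2_norm \<Omega> (\<lambda>z. ?c * v z) = 1" unfolding L2_norm_cmult c using N by simp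
    moreover have "L2_norm \<Omega> (dbar (\<lambda>z. ?c * v z)) \<le> 1 / 9 ^ n"
    proof -
      have "9 ^ n * L2_norm \<Omega> (dbar v) \<le> L2_norm \<Omega> v"
      proof -
        have "2 * (9 ^ n * L2_norm \<Omega> (dbar v)) < L2_norm \<Omega> v"
          using v(2) unfolding L2_norm_dbar[OF \<Omega> v(1)] by (simp add: mult.left_commute)
        moreover have "0 \<le> 9 ^ n * L2_norm \<Omega> (dbar v)" by simp
        ultimately show ?thesis by linarith
      qed
      then show ?thesis unfolding dbar_cmult[OF v(1)] L2_norm_cmult c using N by (simp add: field_simps)
    qed
    ultimately show ?thesis using test_functions_cmult[OF v(1)] by blast
  qed
  then obtain w where w: "\<And>n. w n \<in> ?T" "\<And>n. L2_norm \<Omega> (w n) = 1" "\<And>n. L2_norm \<Omega> (dbar (w n)) \<le> 1 / 9 ^ n"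
    by metis
  note wL = test_functions_L2[OF \<Omega> w(1)]
  have ww: "?I (\<lambda>z. cnj (w n z) * w n z) = 1" for n
  proof -
    have "(\<lambda>z. cnj (w n z) * w n z) = (\<lambda>z. complex_of_real ((norm (w n z))\<^sup>2))"
      by (auto simp: complex_norm_square mult.commute simp del: of_real_power)
    then have "?I (\<lambda>z. cnj (w n z) * w n z) = of_real (?I (\<lambda>z. (norm (w n z))\<^sup>2))"
      using L2_integrable[OF wL[of n]] by (simp only: integral_bounded_linear[OF bounded_linear_of_real])
    also have "?I (\<lambda>z. (norm (w n z))\<^sup>2) = 1" using L2_norm_power2[of \<Omega> "w n"] w(2)[of n] by simp
    finally show ?thesis by simp
  qed
  \<comment> \<open>The two candidates \<open>x\<close> plus or minus \<open>t\<close> times the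
    conjugate of \<open>w n\<close> have pairings with \<open>w n\<close> that differ by
    \<open>2 * t\<close>; one of them has modulus at least \<open>t\<close>.\<close>
  have step: "\<exists>y\<in>?T. L2_norm \<Omega> (\<lambda>z. y z - x z) \<le> 1 / 3 ^ n \<and> 1 / 3 ^ n \<le> norm (?I (\<lambda>z. y z * w n z))"
    if x: "x \<in> ?T" for x n
  proof -
    define t where "t = (1 / 3 ^ n :: real)"
    have t: "t > 0" by (simp add: t_def)
    define y where "y s z = x z + of_real s * cnj (w n z)" for s z
    have yT: "y s \<in> ?T" for s unfolding y_def[abs_def]
      by (intro test_functions_add test_functions_cmult test_functions_cnj x w)
    have yd: "L2_norm \<Omega> (\<lambda>z. y s z - x z) = \<bar>s\<bar>" for s
      using L2_norm_cmult[of \<Omega> "of_real s" "\<lambda>z. cnj (w n z)"] w(2)[of n] by (simp add: y_def)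
    have yI: "?I (\<lambda>z. y s z * w n z) = ?I (\<lambda>z. x z * w n z) + of_real s" for s
      using L2_mult_integrable[OF test_functions_L2[OF \<Omega> x] wL[of n]] L2_mult_integrable[OF L2_cnj[OF wL] wL, of n n] ww[of n]
      by (simp add: y_def distrib_right mult.assoc)
    let ?a = "?I (\<lambda>z. x z * w n z)"
    have "2 * t \<le> norm (?a + of_real t) + norm (?a + of_real (- t))"
      using norm_triangle_ineq4[of "?a + of_real t" "?a + of_real (- t)"] t by simp
    then have "t \<le> norm (?a + of_real t) \<or> t \<le> norm (?a + of_real (- t))" by linarith
    then have "\<exists>s. \<bar>s\<bar> = t \<and> t \<le> norm (?a + of_real s)"
      using t by (metis abs_minus_cancel abs_of_pos)
    then obtain s where "\<bar>s\<bar> = t" "t \<le> norm (?a + of_real s)" by blast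
    then show ?thesis using yT[of s] yd[of s] yI[of s] unfolding t_def by (intro bexI[of _ "y s"]) auto
  qed
  have T0: "(\<lambda>z. 0) \<in> ?T" by (rule test_functionsI[of _ "{}"]) (auto simp: smooth_on_def C_k_on_const)
  have "\<exists>x. \<forall>n. x n \<in> ?T \<and> (L2_norm \<Omega> (\<lambda>z. x (Suc n) z - x n z) \<le> 1 / 3 ^ n \<and>
      1 / 3 ^ n \<le> norm (?I (\<lambda>z. x (Suc n) z * w n z)))"
    by (rule dependent_nat_choice) (use T0 step in blast)+
  then obtain x where x: "\<And>n. x n \<in> ?T" "\<And>n. L2_norm \<Omega> (\<lambda>z. x (Suc n) z - x n z) \<le> 1 / 3 ^ n"
    "\<And>n. 1 / 3 ^ n \<le> norm (?I (\<lambda>z. x (Suc n) z * w n z))" by blast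
  note xL = test_functions_L2[OF \<Omega> x(1)]
  obtain g where g: "g \<in> L2 \<Omega>" "\<And>n. L2_norm \<Omega> (\<lambda>z. x n z - g z) \<le> (3 * 1 / 2) / 3 ^ n"
    using L2_complete[OF xL x(2)] by auto
  have "(\<lambda>n. L2_norm \<Omega> (\<lambda>z. x n z - g z)) \<longlonglongrightarrow> 0"
  proof (rule Lim_null_comparison)
    show "\<forall>\<^sub>F n in sequentially. norm (L2_norm \<Omega> (\<lambda>z. x n z - g z)) \<le> (3 * 1 / 2) / 3 ^ n" using g(2) by simp
    show "(\<lambda>n. (3 * 1 / 2) / 3 ^ n :: real) \<longlonglongrightarrow> 0" by real_asymp
  qed
  then have "g \<in> range_dbar \<Omega>"
    by (rule range_dbar_limit[OF closed test_functions_in_closed_range_dbar[OF \<Omega> closed x(1)] g(1)])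
  then obtain u where u: "u \<in> L2 \<Omega>" "has_weak_dbar \<Omega> u g" by (auto simp: range_dbar_def Dom_dbar_def)
  \<comment> \<open>All humps after the n-th change the pairing by at most half of 3^-n, so half of
    it survives in the limit \<open>g\<close>.\<close>
  have "3 ^ n \<le> 2 * L2_norm \<Omega> u" for n
  proof -
    have "norm (?I (\<lambda>z. x (Suc n) z * w n z) - ?I (\<lambda>z. g z * w n z)) = norm (?I (\<lambda>z. (x (Suc n) z - g z) * w n z))"
      using L2_mult_integrable[OF xL wL, of "Suc n" n] L2_mult_integrable[OF g(1) wL, of n] by (simp add: left_diff_distrib)
    also have "\<dots> \<le> L2_norm \<Omega> (\<lambda>z. x (Suc n) z - g z) * L2_norm \<Omega> (w n)"
      by (rule L2_Cauchy_Schwarz[OF L2_diff[OF xL g(1)] wL])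
    also have "\<dots> \<le> (1 / 2) / 3 ^ n" using g(2)[of "Suc n"] w(2)[of n] by simp
    finally have "1 / 3 ^ n - (1 / 2) / 3 ^ n \<le> norm (?I (\<lambda>z. g z * w n z))"
      using x(3)[of n] norm_triangle_ineq2[of "?I (\<lambda>z. x (Suc n) z * w n z)" "?I (\<lambda>z. g z * w n z)"] by linarith
    moreover have "norm (?I (\<lambda>z. g z * w n z)) = norm (?I (\<lambda>z. u z * dbar (w n) z))"
      using bspec[OF u(2)[unfolded has_weak_dbar_def] w(1)[of n]] by simp
    moreover have "\<dots> \<le> L2_norm \<Omega> u * (1 / 9 ^ n)"
      using L2_Cauchy_Schwarz[OF u(1) dbar_L2[OF \<Omega> w(1)[of n]]] mult_left_mono[OF w(3)[of n] L2_norm_nonneg[of \<Omega> u]] by linarith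
    ultimately have "1 / 3 ^ n - (1 / 2) / 3 ^ n \<le> L2_norm \<Omega> u * (1 / 9 ^ n)" by linarith
    moreover have "(9::real) ^ n = 3 ^ n * 3 ^ n" by (simp flip: power_mult_distrib)
    ultimately show ?thesis by (simp add: field_simps)
  qed
  moreover obtain n where "2 * L2_norm \<Omega> u < 3 ^ n" using real_arch_pow[of 3 "2 * L2_norm \<Omega> u"] by auto
  ultimately show False by (meson not_le)
qed


section \<open>Logarithmic potentials\<close>

text \<open>A quadratic remainder that is uniform in a parameter can be integrated over it, which
  differentiates potentials under the integral sign.\<close>

lemma has_derivative_quadratic_bound:
  assumes L: "bounded_linear D" and d: "d > 0"
    and bound: "\<And>h. norm h < d \<Longrightarrow> norm (f (x + h) - f x - D h) \<le> C * (norm h)\<^sup>2"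
  shows "(f has_derivative D) (at x)"
  unfolding has_derivative_at
proof (rule conjI[OF L], rule Lim_null_comparison)
  show "((\<lambda>h. \<bar>C\<bar> * norm h) \<longlongrightarrow> 0) (at 0)" by (auto intro!: tendsto_eq_intros)
  have "norm (norm (f (x + h) - f x - D h) / norm h) \<le> \<bar>C\<bar> * norm h" if "h \<noteq> 0" "dist h 0 < d" for h
  proof -
    have "norm (f (x + h) - f x - D h) \<le> \<bar>C\<bar> * (norm h)\<^sup>2"
      by (rule order_trans[OF bound mult_right_mono[OF abs_ge_self]]) (use that in auto)
    then show ?thesis using that by (simp add: divide_le_eq power2_eq_square mult.assoc)
  qed
  then show "\<forall>\<^sub>F h in at 0. norm (norm (f (x + h) - f x - D h) / norm h) \<le> \<bar>C\<bar> * norm h"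
    unfolding eventually_at using d by auto
qed

text \<open>The measure lives on an index space and is carried to the plane by \<open>Z\<close>.
  This covers a measure on the plane, with \<open>Z\<close> the identity, and the zeros of a
  polynomial counted with multiplicity.\<close>

locale log_potential = finite_measure M for M :: "'a measure" +
  fixes Z :: "'a \<Rightarrow> complex" and S :: "complex set"
  assumes Z [measurable]: "Z \<in> borel_measurable M"
    and S: "compact S" and ZS: "\<And>s. s \<in> space M \<Longrightarrow> Z s \<in> S"
begin

definition potential :: "complex \<Rightarrow> real" where
  "potential w = integral\<^sup>L M (\<lambda>s. ln (cmod (w - Z s)))"

definition inverse_moment :: "nat \<Rightarrow> complex \<Rightarrow> complex" where
  "inverse_moment n w = integral\<^sup>L M (\<lambda>s. inverse (w - Z s) ^ n)"

lemma open_complement: "open (- S)"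
  using S by (simp add: compact_imp_closed open_Compl)

text \<open>The factor 2 leaves room for a displacement of length less than \<open>d\<close>, after
  which the distance is still at least \<open>d\<close>.\<close>

lemma distance_bound:
  assumes "w \<notin> S"
  obtains d where "d > 0" "\<And>s. s \<in> space M \<Longrightarrow> 2 * d \<le> cmod (w - Z s)"
proof -
  obtain e where e: "e > 0" "ball w e \<subseteq> - S"
    using open_complement assms unfolding open_contains_ball by (metis ComplI)
  have "2 * (e / 2) \<le> cmod (w - Z s)" if "s \<in> space M" for s
    using e(2) ZS[OF that] by (auto simp: dist_norm subset_eq not_less)
  with e(1) show ?thesis using that[of "e / 2"] by simp
qed

lemma integrable_inverse_power:
  assumes "w \<notin> S"
  shows "integrable M (\<lambda>s. inverse (w - Z s) ^ n)"
proof -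
  obtain d where d: "d > 0" "\<And>s. s \<in> space M \<Longrightarrow> 2 * d \<le> cmod (w - Z s)"
    using distance_bound[OF assms] by metis
  show ?thesis
  proof (rule integrable_const_bound)
    show "AE s in M. norm (inverse (w - Z s) ^ n) \<le> inverse (2 * d) ^ n"
    proof (rule AE_I2)
      fix s assume "s \<in> space M"
      from le_imp_inverse_le[OF d(2)[OF this]] d(1)
      show "norm (inverse (w - Z s) ^ n) \<le> inverse (2 * d) ^ n"
        unfolding norm_power norm_inverse by (intro power_mono) auto
    qed
  qed measurable
qed

lemma integrable_ln:
  assumes "w \<notin> S"
  shows "integrable M (\<lambda>s. ln (cmod (w - Z s)))"
proof -
  obtain d where d: "d > 0" "\<And>s. s \<in> space M \<Longrightarrow> 2 * d \<le> cmod (w - Z s)"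
    using distance_bound[OF assms] by metis
  obtain R where R: "\<And>z. z \<in> S \<Longrightarrow> norm z \<le> R"
    using compact_imp_bounded[OF S] unfolding bounded_iff by blast
  have "\<bar>ln (cmod (w - Z s))\<bar> \<le> \<bar>ln (2 * d)\<bar> + \<bar>ln (cmod w + R)\<bar>" if s: "s \<in> space M" for s
  proof -
    have "cmod (w - Z s) \<le> cmod w + R"
      using norm_triangle_ineq4[of w "Z s"] R[OF ZS[OF s]] by linarith
    moreover note d(2)[OF s] d(1)
    ultimately have "ln (2 * d) \<le> ln (cmod (w - Z s))" "ln (cmod (w - Z s)) \<le> ln (cmod w + R)"
      by (auto intro!: ln_mono)
    then show ?thesis by linarith
  qed
  then show ?thesis
    by (intro integrable_const_bound[of _ "\<bar>ln (2 * d)\<bar> + \<bar>ln (cmod w + R)\<bar>"] AE_I2) auto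
qed

lemma inverse_moment_derivative:
  assumes w: "w \<notin> S"
  shows "(inverse_moment 1 has_field_derivative - inverse_moment 2 w) (at w)"
  unfolding has_field_derivative_def
proof -
  obtain d where d: "d > 0" "\<And>s. s \<in> space M \<Longrightarrow> 2 * d \<le> cmod (w - Z s)"
    using distance_bound[OF w] by metis
  show "(inverse_moment 1 has_derivative (\<lambda>v. - inverse_moment 2 w * v)) (at w)"
  proof (rule has_derivative_quadratic_bound[OF bounded_linear_mult_right d(1)])
    fix h :: complex assume h: "norm h < d"
    have pt: "norm (inverse (w + h - Z s) ^ 1 - inverse (w - Z s) ^ 1 - (- (inverse (w - Z s) ^ 2) * h)) \<le>
        (norm h)\<^sup>2 / (d * (2 * d)\<^sup>2)" and far: "cmod (w + h - Z s) \<ge> d" if s: "s \<in> space M" for s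
    proof -
      let ?a = "w - Z s"
      have a: "2 * d \<le> cmod ?a" by (rule d(2)[OF s])
      have "cmod ?a \<le> cmod (?a + h) + cmod h" using norm_triangle_ineq4[of "?a + h" h] by simp
      then show f: "cmod (w + h - Z s) \<ge> d" using a h by (simp add: algebra_simps)
      then have f': "cmod (?a + h) \<ge> d" by (simp add: algebra_simps)
      have nz: "?a \<noteq> 0" "?a + h \<noteq> 0" using a f' d(1) by auto
      have "inverse (?a + h) ^ 1 - inverse ?a ^ 1 - (- (inverse ?a ^ 2) * h) = h\<^sup>2 / ((?a + h) * ?a\<^sup>2)"
      proof -
        have "inverse b ^ 1 - inverse a ^ 1 - (- (inverse a ^ 2) * (b - a)) = (b - a)\<^sup>2 / (b * a\<^sup>2)"
          if "a \<noteq> 0" "b \<noteq> 0" for a b :: complex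
          using that by (simp add: field_simps power2_eq_square)
        from this[OF nz] show ?thesis by simp
      qed
      then have "norm (inverse (?a + h) ^ 1 - inverse ?a ^ 1 - (- (inverse ?a ^ 2) * h)) = (norm h)\<^sup>2 / (norm (?a + h) * (norm ?a)\<^sup>2)"
        by (simp add: norm_divide norm_mult norm_power)
      also have "\<dots> \<le> (norm h)\<^sup>2 / (d * (2 * d)\<^sup>2)"
        using f' a d(1) by (intro divide_left_mono mult_mono power_mono mult_pos_pos) auto
      finally show "norm (inverse (w + h - Z s) ^ 1 - inverse (w - Z s) ^ 1 - (- (inverse (w - Z s) ^ 2) * h)) \<le>
        (norm h)\<^sup>2 / (d * (2 * d)\<^sup>2)" by (simp add: algebra_simps)
    qed
    have i1: "integrable M (\<lambda>s. inverse (w + h - Z s) ^ 1)"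
    proof (rule integrable_const_bound)
      show "AE s in M. norm (inverse (w + h - Z s) ^ 1) \<le> inverse d"
        using far d(1) by (intro AE_I2) (auto simp: norm_inverse intro!: le_imp_inverse_le)
    qed measurable
    note i = i1 integrable_inverse_power[OF w, of 1] integrable_inverse_power[OF w, of 2]
    have "inverse_moment 1 (w + h) - inverse_moment 1 w - (- inverse_moment 2 w * h) =
        integral\<^sup>L M (\<lambda>s. inverse (w + h - Z s) ^ 1 - inverse (w - Z s) ^ 1 - (- (inverse (w - Z s) ^ 2) * h))"
      unfolding inverse_moment_def using i by simp
    also have "norm \<dots> \<le> measure M (space M) * ((norm h)\<^sup>2 / (d * (2 * d)\<^sup>2))"
    proof -
      have "norm (integral\<^sup>L M (\<lambda>s. inverse (w + h - Z s) ^ 1 - inverse (w - Z s) ^ 1 - (- (inverse (w - Z s) ^ 2) * h))) \<le>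
          integral\<^sup>L M (\<lambda>s. (norm h)\<^sup>2 / (d * (2 * d)\<^sup>2))"
        by (rule order_trans[OF integral_norm_bound integral_mono]) (use i pt in auto)
      then show ?thesis by simp
    qed
    finally show "norm (inverse_moment 1 (w + h) - inverse_moment 1 w - (- inverse_moment 2 w * h)) \<le>
        (measure M (space M) / (d * (2 * d)\<^sup>2)) * (norm h)\<^sup>2" by simp
  qed
qed

text \<open>After division by \<open>a = w - Z s\<close> only the principal logarithm at 1 + h/a is
  needed. There |h/a| is at most 1/2, and Ln (1 + u) differs from u by a quadratic term.\<close>

lemma potential_derivative:
  assumes w: "w \<notin> S"
  shows "(potential has_derivative (\<lambda>v. Re (inverse_moment 1 w * v))) (at w)"
proof -
  obtain d where d: "d > 0" "\<And>s. s \<in> space M \<Longrightarrow> 2 * d \<le> cmod (w - Z s)"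
    using distance_bound[OF w] by metis
  show ?thesis
  proof (rule has_derivative_quadratic_bound[OF _ d(1)])
    show "bounded_linear (\<lambda>v. Re (inverse_moment 1 w * v))"
      by (intro bounded_linear_compose[OF bounded_linear_Re] bounded_linear_mult_right)
    fix h :: complex assume h: "norm h < d"
    have pt: "norm (ln (cmod (w + h - Z s)) - ln (cmod (w - Z s)) - Re (inverse (w - Z s) ^ 1 * h)) \<le>
        2 * (norm h)\<^sup>2 / (2 * d)\<^sup>2" if s: "s \<in> space M" for s
    proof -
      let ?a = "w - Z s"
      define u where "u = h / ?a"
      have a: "2 * d \<le> cmod ?a" by (rule d(2)[OF s])
      then have nz: "?a \<noteq> 0" using d(1) by auto
      have u: "norm u \<le> norm h / (2 * d)"
        unfolding u_def norm_divide using a d(1) by (intro frac_le) auto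
      also have "\<dots> \<le> 1 / 2" using h d(1) by simp
      finally have u2: "norm u \<le> 1 / 2" .
      have nz1: "1 + u \<noteq> 0"
      proof
        assume "1 + u = 0"
        then have "u = - 1" by (simp add: add_eq_0_iff)
        with u2 show False by simp
      qed
      have "w + h - Z s = ?a * (1 + u)" using nz by (simp add: u_def field_simps)
      then have "ln (cmod (w + h - Z s)) = ln (cmod ?a) + ln (cmod (1 + u))"
        using nz nz1 by (simp add: norm_mult ln_mult)
      also have "ln (cmod (1 + u)) = Re (Ln (1 + u))" using nz1 by simp
      finally have "ln (cmod (w + h - Z s)) - ln (cmod ?a) - Re (inverse ?a ^ 1 * h) = Re (Ln (1 + u) - u)"
        by (simp add: u_def divide_inverse mult.commute)
      also have "norm \<dots> \<le> norm (Ln (1 + u) - u)" by (simp only: real_norm_def abs_Re_le_cmod)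
      also have "\<dots> \<le> (norm u)\<^sup>2 / (1 - norm u)" using u2 by (intro Ln_approx_linear) simp
      also have "\<dots> \<le> (norm u)\<^sup>2 / (1 / 2)" using u2 by (intro divide_left_mono) auto
      also have "\<dots> \<le> 2 * (norm h / (2 * d))\<^sup>2" using power_mono[OF u, of 2] by simp
      finally show ?thesis by (simp add: power_divide)
    qed
    have far: "cmod (w + h - Z s) \<ge> d" if s: "s \<in> space M" for s
      using norm_triangle_ineq4[of "w + h - Z s" h] d(2)[OF s] h by (simp add: algebra_simps)
    note i = integrable_ln[OF w] integrable_inverse_power[OF w, of 1]
    have iR: "integrable M (\<lambda>s. Re (inverse (w - Z s) ^ 1 * h))"
      by (rule integrable_bounded_linear[OF bounded_linear_Re]) (use i in simp)
    have meas: "(\<lambda>s. ln (cmod (w + h - Z s)) - ln (cmod (w - Z s)) - Re (inverse (w - Z s) ^ 1 * h)) \<in> borel_measurable M"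
      using borel_measurable_integrable[OF iR] by (intro borel_measurable_diff) measurable
    have i3: "integrable M (\<lambda>s. ln (cmod (w + h - Z s)) - ln (cmod (w - Z s)) - Re (inverse (w - Z s) ^ 1 * h))"
      by (rule integrable_const_bound[OF _ meas]) (use pt in \<open>intro AE_I2\<close>)
    from Bochner_Integration.integrable_add[OF Bochner_Integration.integrable_add[OF i3 i(1)] iR]
    have i4: "integrable M (\<lambda>s. ln (cmod (w + h - Z s)))" by simp
    have "potential (w + h) - potential w - Re (inverse_moment 1 w * h) =
        integral\<^sup>L M (\<lambda>s. ln (cmod (w + h - Z s)) - ln (cmod (w - Z s)) - Re (inverse (w - Z s) ^ 1 * h))"
    proof -
      have "Re (inverse_moment 1 w * h) = Re (integral\<^sup>L M (\<lambda>s. inverse (w - Z s) ^ 1 * h))"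
        unfolding inverse_moment_def by (simp only: integral_mult_left_zero)
      also have "\<dots> = integral\<^sup>L M (\<lambda>s. Re (inverse (w - Z s) ^ 1 * h))"
        by (rule integral_bounded_linear[OF bounded_linear_Re, symmetric]) (use i in simp)
      finally show ?thesis unfolding potential_def using i4 i(1) iR by simp
    qed
    also have "norm \<dots> \<le> integral\<^sup>L M (\<lambda>s. 2 * (norm h)\<^sup>2 / (2 * d)\<^sup>2)"
      by (rule order_trans[OF integral_norm_bound integral_mono]) (use i3 pt in auto)
    finally show "norm (potential (w + h) - potential w - Re (inverse_moment 1 w * h)) \<le>
        (2 * measure M (space M) / (2 * d)\<^sup>2) * (norm h)\<^sup>2" by (simp add: mult_ac)
  qed
qed

lemma inverse_moment_holomorphic: "inverse_moment 1 holomorphic_on - S"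
  using inverse_moment_derivative open_complement
  by (auto simp: holomorphic_on_open field_differentiable_def)

text \<open>The gradient is encoded by one holomorphic function, whose smoothness is
  inherited.\<close>

lemma C_k_on_potential: "C_k_on k potential (- S)"
proof -
  have "C_k_on (Suc k) potential (- S)"
  proof (rule C_k_on_SucI[OF open_complement potential_derivative])
    show "C_k_on k (\<lambda>w. Re (inverse_moment 1 w * v)) (- S)" for v
      by (rule C_k_on_bounded_linear[OF bounded_linear_Re open_complement
            C_k_on_mult[OF open_complement C_k_on_holomorphic[OF open_complement inverse_moment_holomorphic] C_k_on_const]])
  qed simp
  then show ?thesis by (rule C_k_on_Suc_D)
qed

text \<open>The second derivative in direction b is the real part of a multiple of b^2, and the
  squares of 1 and \<open>\<i>\<close> cancel.\<close>

lemma laplacian_potential: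
  assumes w: "w \<notin> S"
  shows "laplacian potential w = 0"
proof -
  have "partial_deriv b (partial_deriv b potential) w = Re (- inverse_moment 2 w * b * b)" for b
  proof -
    have "partial_deriv b (partial_deriv b potential) w = partial_deriv b (\<lambda>w. Re (inverse_moment 1 w * b)) w"
      by (rule partial_deriv_cong_open[OF open_complement]) (use w in \<open>auto simp: partial_deriv_eq[OF potential_derivative]\<close>)
    also have "\<dots> = Re (- inverse_moment 2 w * b * b)"
      by (rule partial_deriv_eq[OF bounded_linear.has_derivative[OF bounded_linear_Re has_derivative_mult_left]])
        (rule inverse_moment_derivative[OF w, unfolded has_field_derivative_def])
    finally show ?thesis .
  qed
  then show ?thesis by (simp add: laplacian_def mult.assoc)
qed

end

section \<open>Superposition with the flat exponential\<close>

lemma partial_deriv2_flat_exp_comp: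
  fixes U :: "complex \<Rightarrow> real"
  assumes S: "open S" and U: "C_k_on (Suc (Suc 0)) U S" and w: "w \<in> S"
  shows "partial_deriv b (\<lambda>w. flat_exp 0 (U w)) w = flat_exp 2 (U w) * partial_deriv b U w"
    and "partial_deriv b (partial_deriv b (\<lambda>w. flat_exp 0 (U w))) w =
      (flat_exp 4 (U w) - 2 * flat_exp 3 (U w)) * (partial_deriv b U w)\<^sup>2 +
      flat_exp 2 (U w) * partial_deriv b (partial_deriv b U) w"
proof -
  have Ud: "U differentiable (at x)" "partial_deriv b U differentiable (at x)" if "x \<in> S" for x
    using C_k_on_Suc_differentiable[OF U that] C_k_on_Suc_differentiable[OF C_k_on_Suc_partial[OF U] that] by auto
  have first: "partial_deriv b (\<lambda>w. flat_exp 0 (U w)) x = flat_exp 2 (U x) * partial_deriv b U x" if "x \<in> S" for x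
    using partial_deriv_eq[OF partial_deriv_comp_real[OF Ud(1)[OF that] flat_exp_has_derivative[of 0]]] by (simp add: numeral_2_eq_2)
  show "partial_deriv b (\<lambda>w. flat_exp 0 (U w)) w = flat_exp 2 (U w) * partial_deriv b U w" by (rule first[OF w])
  have d2: "(flat_exp 2 has_real_derivative flat_exp 4 t - 2 * flat_exp 3 t) (at t)" for t
  proof -
    have "(2::nat) + 2 = 4" "(2::nat) + 1 = 3" by simp_all
    from flat_exp_has_derivative[of 2 t, unfolded this] show ?thesis by simp
  qed
  have "partial_deriv b (partial_deriv b (\<lambda>w. flat_exp 0 (U w))) w = partial_deriv b (\<lambda>x. flat_exp 2 (U x) * partial_deriv b U x) w"
    by (rule partial_deriv_cong_open[OF S w first])
  also have "\<dots> = flat_exp 2 (U w) * partial_deriv b (partial_deriv b U) w +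
      (flat_exp 4 (U w) - 2 * flat_exp 3 (U w)) * partial_deriv b U w * partial_deriv b U w"
    by (rule partial_deriv_eq[OF has_derivative_mult[OF partial_deriv_comp_real[OF Ud(1)[OF w] d2]
            has_derivative_partial_deriv[OF Ud(2)[OF w]]]])
  finally show "partial_deriv b (partial_deriv b (\<lambda>w. flat_exp 0 (U w))) w =
      (flat_exp 4 (U w) - 2 * flat_exp 3 (U w)) * (partial_deriv b U w)\<^sup>2 +
      flat_exp 2 (U w) * partial_deriv b (partial_deriv b U) w"
    by (simp add: power2_eq_square algebra_simps)
qed

lemma laplacian_flat_exp_comp:
  fixes U :: "complex \<Rightarrow> real"
  assumes "open S" "C_k_on (Suc (Suc 0)) U S" "w \<in> S"
  shows "laplacian (\<lambda>w. flat_exp 0 (U w)) w =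
      (flat_exp 4 (U w) - 2 * flat_exp 3 (U w)) * ((partial_deriv 1 U w)\<^sup>2 + (partial_deriv \<i> U w)\<^sup>2) +
      flat_exp 2 (U w) * laplacian U w"
  unfolding laplacian_def partial_deriv2_flat_exp_comp(2)[OF assms] by (simp add: algebra_simps)

text \<open>The expression is the second derivative of \<open>flat_exp 0\<close>. Its sign is that
  of 1/t - 2 for positive t.\<close>

lemma flat_exp_convex:
  assumes "t \<le> 1 / 2"
  shows "0 \<le> flat_exp 4 t - 2 * flat_exp 3 t"
proof (cases "t \<le> 0")
  case False
  then have "2 * inverse t ^ 3 \<le> inverse t * inverse t ^ 3"
    using assms by (intro mult_right_mono) (auto simp: field_simps)
  then have "exp (- inverse t) * (2 * inverse t ^ 3) \<le> exp (- inverse t) * inverse t ^ 4"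
    by (intro mult_left_mono) (auto simp: numeral_eq_Suc)
  with False show ?thesis by (simp add: flat_exp_def)
qed (simp add: flat_exp_def)

text \<open>The estimate \<open>b'\<^sup>2 \<le> 4 b b''\<close> for \<open>b = flat_exp 0\<close>, combined with \<open>b \<le> 1\<close>.\<close>

lemma flat_exp_power2_le:
  assumes "t \<le> 3 / 8"
  shows "(flat_exp 2 t)\<^sup>2 \<le> 4 * (flat_exp 4 t - 2 * flat_exp 3 t)"
proof (cases "t \<le> 0")
  case False
  let ?e = "exp (- inverse t)"
  have e: "0 \<le> ?e" "?e \<le> 1" using False by auto
  \<comment> \<open>This inequality is where the bound 3/8 on \<open>t\<close> originates.\<close>
  have "1 \<le> 4 * (1 - 2 * t)" using assms by simp
  then have "(?e * inverse t ^ 4) * 1 \<le> (?e * inverse t ^ 4) * (4 * (1 - 2 * t))"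
    using False by (intro mult_left_mono) auto
  also have "\<dots> = 4 * (?e * inverse t ^ 4 - 2 * (?e * (inverse t ^ 4 * t)))" by (simp add: algebra_simps)
  also have "inverse t ^ 4 * t = inverse t ^ 3" using False by (simp add: numeral_eq_Suc)
  finally have "?e * inverse t ^ 4 \<le> 4 * (?e * inverse t ^ 4 - 2 * (?e * inverse t ^ 3))" by (simp only: mult_1_right)
  moreover have "(?e * inverse t ^ 2)\<^sup>2 \<le> ?e * inverse t ^ 4"
    using mult_right_mono[OF mult_left_le[OF e(2,1)], of "inverse t ^ 4"] False
    by (simp add: power2_eq_square numeral_eq_Suc mult_ac)
  ultimately have "(?e * inverse t ^ 2)\<^sup>2 \<le> 4 * (?e * inverse t ^ 4 - 2 * (?e * inverse t ^ 3))"
    by (rule order_trans[rotated])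
  with False show ?thesis by (simp only: flat_exp_def if_False)
qed (simp add: flat_exp_def)

lemma flat_exp_2_le: "flat_exp 2 t \<le> 2"
proof (cases "t \<le> 0")
  case False
  have "0 < inverse t" using False by simp
  then have "(inverse t) ^ 2 \<le> 2 * exp (inverse t)"
    using exp_lower_Taylor_quadratic[of "inverse t"] by linarith
  then have "exp (- inverse t) * inverse t ^ 2 \<le> exp (- inverse t) * (2 * exp (inverse t))"
    by (intro mult_left_mono) auto
  also have "exp (- inverse t) * (2 * exp (inverse t)) = 2" by (simp add: exp_minus)
  finally show ?thesis using False by (simp add: flat_exp_def)
qed (simp add: flat_exp_def)

lemma flat_exp_mono_0: "s \<le> t \<Longrightarrow> flat_exp 0 s \<le> flat_exp 0 t"
  by (auto simp: flat_exp_def le_imp_inverse_le)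

lemma flat_exp_mono_2:
  assumes "0 < s" "s \<le> t" "t \<le> 1 / 2"
  shows "flat_exp 2 s \<le> flat_exp 2 t"
proof (rule DERIV_nonneg_imp_nondecreasing[OF assms(2)])
  fix x assume x: "s \<le> x" "x \<le> t"
  show "\<exists>y. (flat_exp 2 has_real_derivative y) (at x) \<and> 0 \<le> y"
    using flat_exp_has_derivative[of 2 x] flat_exp_convex[of x] x assms by (intro exI conjI) auto
qed


section \<open>Logarithmic energy\<close>

text \<open>The complement of the support is a union of open null sets. By Lindelof countably many
  of them suffice, so it is null.\<close>

lemma AE_measure_support:
  fixes \<mu> :: "'a::second_countable_topology measure"
  assumes "sets \<mu> = sets borel"
  shows "AE x in \<mu>. x \<in> measure_support \<mu>"
proof -
  define F where "F = {U. open U \<and> emeasure \<mu> U = 0}"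
  obtain F' where F': "F' \<subseteq> F" "countable F'" "\<Union>F' = \<Union>F"
    using Lindelof[of F] by (auto simp: F_def)
  have "\<Union>F' \<in> null_sets \<mu>"
    using F'(1,2) assms by (intro null_sets_UN'[of F' "\<lambda>x. x", simplified]) (auto simp: F_def null_sets_def)
  then have "AE x in \<mu>. x \<notin> \<Union>F" by (metis AE_not_in F'(3))
  then show ?thesis
    by eventually_elim (auto simp: measure_support_def F_def zero_less_iff_neq_zero)
qed

text \<open>The additive form of (L - f) = f^- - f^+ + L avoids subtracting infinite quantities; it
  can be integrated term by term.\<close>

lemma e2ennreal_diff_add:
  assumes "f \<le> ereal L" "L \<ge> 0"
  shows "e2ennreal (ereal L - f) + e2ennreal f = e2ennreal (- f) + ennreal L"
proof (cases f)
  case (real r)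
  show ?thesis
  proof (cases "r \<ge> 0")
    case True
    then show ?thesis using real assms by (simp add: e2ennreal_neg ennreal_neg flip: ennreal_plus)
  next
    case False
    then have "ennreal (L - r) = ennreal (- r) + ennreal L" using assms by (simp flip: ennreal_plus)
    then show ?thesis using False real by (simp add: e2ennreal_neg ennreal_neg)
  qed
next
  case MInf
  have "e2ennreal \<infinity> = top" by (simp add: e2ennreal_infty)
  with MInf show ?thesis by simp
qed (use assms in auto)

text \<open>For a function bounded by \<open>L\<close>, the integral is computed from its nonnegative distance to \<open>L\<close>.\<close>

lemma ext_integral_eq:
  assumes M: "prob_space M" and f [measurable]: "f \<in> borel_measurable M"
    and le: "AE x in M. f x \<le> ereal L" and L: "L \<ge> 0"
  shows "ext_integral M f = ereal L - enn2ereal (\<integral>\<^sup>+x. e2ennreal (ereal L - f x) \<partial>M)"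
proof -
  interpret prob_space M by fact
  define P where "P = (\<integral>\<^sup>+x. e2ennreal (f x) \<partial>M)"
  define N where "N = (\<integral>\<^sup>+x. e2ennreal (- f x) \<partial>M)"
  define T where "T = (\<integral>\<^sup>+x. e2ennreal (ereal L - f x) \<partial>M)"
  have "T + P = (\<integral>\<^sup>+x. e2ennreal (ereal L - f x) + e2ennreal (f x) \<partial>M)"
    unfolding T_def P_def by (rule nn_integral_add[symmetric]) measurable
  also have "\<dots> = (\<integral>\<^sup>+x. e2ennreal (- f x) + ennreal L \<partial>M)"
    by (rule nn_integral_cong_AE, use le in eventually_elim) (rule e2ennreal_diff_add[OF _ L])
  also have "\<dots> = N + ennreal L"
    unfolding N_def by (subst nn_integral_add) (auto simp: emeasure_space_1)
  finally have eq: "T + P = N + ennreal L" .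
  have "P \<le> (\<integral>\<^sup>+x. ennreal L \<partial>M)"
    unfolding P_def
  proof (rule nn_integral_mono_AE, use le in eventually_elim)
    case (elim x)
    then have "e2ennreal (f x) \<le> e2ennreal (ereal L)" by (rule e2ennreal_mono)
    then show ?case by simp
  qed
  then have "P \<le> ennreal L" by (simp add: emeasure_space_1)
  then obtain p where p: "P = ennreal p" "p \<ge> 0" by (cases P) (auto simp: top_unique)
  have "enn2ereal P - enn2ereal N = ereal L - enn2ereal T"
  proof (cases N)
    case top
    then have "T = top" using eq p by (simp add: ennreal_add_eq_top)
    with top p show ?thesis by simp
  next
    case (real n)
    then have "T \<noteq> top" using eq p L by (metis add_top ennreal_add_eq_top ennreal_neq_top)
    then obtain t where t: "T = ennreal t" "t \<ge> 0" by (cases T) auto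
    have "t + p = n + L"
      using eq p t real L by (simp flip: ennreal_plus)
    then show ?thesis using p t real by (simp add: enn2ereal_ennreal)
  qed
  then show ?thesis by (simp add: ext_integral_def P_def N_def T_def)
qed

text \<open>For distances up to exp L this is the nonnegative quantity L - ln x, with value
  \<open>top\<close> at 0. Energies thereby become iterated nonnegative integrals.\<close>

definition log_defect :: "real \<Rightarrow> real \<Rightarrow> ennreal" where
  "log_defect L x = e2ennreal (ereal L - ext_ln x)"

lemma log_defect_0 [simp]: "log_defect L 0 = top"
  by (simp add: log_defect_def ext_ln_def e2ennreal_infty)

lemma log_defect_nonzero: "x \<noteq> 0 \<Longrightarrow> log_defect L x = ennreal (L - ln x)"
  by (simp add: log_defect_def ext_ln_def)

lemma ext_ln_measurable [measurable]: "ext_ln \<in> borel_measurable borel"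
  unfolding ext_ln_def[abs_def] by measurable

lemma log_defect_measurable [measurable]: "log_defect L \<in> borel_measurable borel"
  unfolding log_defect_def[abs_def] by measurable

lemma ext_ln_le: "0 \<le> x \<Longrightarrow> x \<le> y \<Longrightarrow> 0 < y \<Longrightarrow> ext_ln x \<le> ereal (ln y)"
  by (auto simp: ext_ln_def)

definition energy_defect :: "real \<Rightarrow> complex measure \<Rightarrow> ennreal" where
  "energy_defect L \<mu> = (\<integral>\<^sup>+z. \<integral>\<^sup>+w. log_defect L (cmod (z - w)) \<partial>\<mu> \<partial>\<mu>)"

text \<open>Two points of the ball have distance at most \<open>2 * R\<close>, so
  \<open>ln (2 * R)\<close> bounds the logarithm; it is nonnegative because \<open>2 * R\<close> is
  at least 1. Subtracting the defect twice, once per integration, undoes itself.\<close>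

lemma log_energy_eq:
  assumes \<mu>: "prob_space \<mu>" and s: "sets \<mu> = sets borel" and ball: "AE z in \<mu>. z \<in> ball c R" and R: "2 * R \<ge> 1"
  shows "log_energy \<mu> = ereal (ln (2 * R)) - enn2ereal (energy_defect (ln (2 * R)) \<mu>)"
proof -
  interpret prob_space \<mu> by fact
  note s [measurable_cong]
  define L where "L = ln (2 * R)"
  have L: "L \<ge> 0" using R by (simp add: L_def)
  define F where "F z = ext_integral \<mu> (\<lambda>w. ext_ln (cmod (z - w)))" for z
  define U where "U z = (\<integral>\<^sup>+w. log_defect L (cmod (z - w)) \<partial>\<mu>)" for z
  have F: "F z = ereal L - enn2ereal (U z)" if z: "z \<in> ball c R" for z
    unfolding F_def U_def log_defect_def
  proof (rule ext_integral_eq[OF \<mu> _ _ L])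
    show "AE w in \<mu>. ext_ln (cmod (z - w)) \<le> ereal L"
      using ball
    proof eventually_elim
      case (elim w)
      have "cmod (z - w) \<le> dist c z + dist c w"
        using norm_triangle_ineq4[of "z - c" "w - c"] by (simp add: dist_norm norm_minus_commute)
      with elim z have "cmod (z - w) \<le> 2 * R" by simp
      then show ?case unfolding L_def using R by (intro ext_ln_le) auto
    qed
  qed measurable
  have "log_energy \<mu> = ext_integral \<mu> F" unfolding log_energy_def F_def[abs_def] ..
  also have "\<dots> = ereal L - enn2ereal (\<integral>\<^sup>+z. e2ennreal (ereal L - F z) \<partial>\<mu>)"
  proof (rule ext_integral_eq[OF \<mu> _ _ L])
    show "F \<in> borel_measurable \<mu>" unfolding F_def[abs_def] ext_integral_def by measurable
    show "AE z in \<mu>. F z \<le> ereal L"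
      using ball by eventually_elim (auto simp: F ereal_diff_le_self)
  qed
  also have "(\<integral>\<^sup>+z. e2ennreal (ereal L - F z) \<partial>\<mu>) = (\<integral>\<^sup>+z. U z \<partial>\<mu>)"
  proof (rule nn_integral_cong_AE, use ball in eventually_elim)
    case (elim z)
    show ?case unfolding F[OF elim]
    proof (cases "U z")
      case (real u)
      then show "e2ennreal (ereal L - (ereal L - enn2ereal (U z))) = U z" by (simp add: enn2ereal_ennreal)
    next
      case top
      then show "e2ennreal (ereal L - (ereal L - enn2ereal (U z))) = U z" by (simp add: e2ennreal_infty)
    qed
  qed
  finally show ?thesis by (simp add: energy_defect_def U_def L_def)
qed

text \<open>Exponentiating turns a lower bound \<delta> for exp (L - T) into the upper bound L - ln
  \<delta> for T. An infinite defect corresponds to exponential 0 and is excluded.\<close>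

lemma ext_exp_energy_defect:
  assumes "ennreal \<delta> < ext_exp (ereal L - enn2ereal T)" "\<delta> > 0"
  shows "T \<le> ennreal (L - ln \<delta>)"
proof (cases T)
  case top
  then show ?thesis using assms by (simp add: ext_exp_def)
next
  case (real t)
  then have "ennreal \<delta> < ennreal (exp (L - t))" using assms by (simp add: ext_exp_def enn2ereal_ennreal)
  then have "\<delta> < exp (L - t)" using assms(2) by (simp add: ennreal_less_iff)
  then have "ln \<delta> < ln (exp (L - t))" using assms(2) by (subst ln_less_cancel_iff) auto
  then show ?thesis using real by (simp add: ennreal_leI)
qed

lemma ext_exp_energy_defect_ge:
  assumes "T \<le> ennreal (L - ln \<delta>)" "\<delta> > 0" "ln \<delta> \<le> L"
  shows "ennreal \<delta> \<le> ext_exp (ereal L - enn2ereal T)"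
proof (cases T)
  case top
  then show ?thesis using assms by (simp add: top_unique)
next
  case (real t)
  then have "t \<le> L - ln \<delta>" using assms by simp
  then have "exp (ln \<delta>) \<le> exp (L - t)" by simp
  then have "\<delta> \<le> exp (L - t)" using assms(2) by simp
  then show ?thesis using real by (simp add: ext_exp_def enn2ereal_ennreal ennreal_leI)
qed


section \<open>Bounded subharmonic functions from finite capacity inradius\<close>

lemma laplacian_cong_open:
  assumes "open S" "x \<in> S" "\<And>y. y \<in> S \<Longrightarrow> f y = g y"
  shows "laplacian f x = laplacian g x"
proof -
  have "partial_deriv b (partial_deriv b f) x = partial_deriv b (partial_deriv b g) x" for b
    by (rule partial_deriv_cong_open[OF assms(1,2)]) (rule partial_deriv_cong_open[OF assms(1) _ assms(3)])
  then show ?thesis by (simp add: laplacian_def)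
qed

lemma laplacian_const [simp]: "laplacian (\<lambda>x. c) z = 0"
  by (simp add: laplacian_def)

lemma laplacian_add:
  assumes S: "open S" "x \<in> S" and f: "C_k_on (Suc (Suc 0)) f S" and g: "C_k_on (Suc (Suc 0)) g S"
  shows "laplacian (\<lambda>x. f x + g x) x = laplacian f x + laplacian g x"
proof -
  have "partial_deriv b (partial_deriv b (\<lambda>x. f x + g x)) x = partial_deriv b (partial_deriv b f) x + partial_deriv b (partial_deriv b g) x" for b
  proof -
    have "partial_deriv b (partial_deriv b (\<lambda>x. f x + g x)) x = partial_deriv b (\<lambda>x. partial_deriv b f x + partial_deriv b g x) x"
      by (rule partial_deriv_cong_open[OF S], rule partial_deriv_add)
        (auto intro: C_k_on_Suc_differentiable[OF f] C_k_on_Suc_differentiable[OF g])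
    also have "\<dots> = partial_deriv b (partial_deriv b f) x + partial_deriv b (partial_deriv b g) x"
      by (rule partial_deriv_add)
        (auto intro: C_k_on_Suc_differentiable[OF C_k_on_Suc_partial[OF f] S(2)] C_k_on_Suc_differentiable[OF C_k_on_Suc_partial[OF g] S(2)])
    finally show ?thesis .
  qed
  then show ?thesis by (simp add: laplacian_def)
qed

lemma laplacian_cmult:
  fixes f :: "complex \<Rightarrow> real"
  assumes S: "open S" "x \<in> S" and f: "C_k_on (Suc (Suc 0)) f S"
  shows "laplacian (\<lambda>x. c * f x) x = c * laplacian f x"
proof -
  have "partial_deriv b (partial_deriv b (\<lambda>x. c * f x)) x = c * partial_deriv b (partial_deriv b f) x" for b
  proof -
    have "partial_deriv b (partial_deriv b (\<lambda>x. c * f x)) x = partial_deriv b (\<lambda>x. c * partial_deriv b f x) x"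
      by (rule partial_deriv_cong_open[OF S], rule partial_deriv_bounded_linear[OF bounded_linear_mult_right])
        (auto intro: C_k_on_Suc_differentiable[OF f])
    also have "\<dots> = c * partial_deriv b (partial_deriv b f) x"
      by (rule partial_deriv_bounded_linear[OF bounded_linear_mult_right])
        (auto intro: C_k_on_Suc_differentiable[OF C_k_on_Suc_partial[OF f] S(2)])
    finally show ?thesis .
  qed
  then show ?thesis by (simp add: laplacian_def algebra_simps)
qed

lemma laplacian_sum:
  assumes S: "open S" "x \<in> S" and f: "\<And>i. i \<in> I \<Longrightarrow> C_k_on (Suc (Suc 0)) (f i) S"
  shows "laplacian (\<lambda>x. \<Sum>i\<in>I. f i x) x = (\<Sum>i\<in>I. laplacian (f i) x)"
  using f
proof (induction I rule: infinite_finite_induct)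
  case (insert i I)
  then show ?case
    using laplacian_add[OF S, of "f i" "\<lambda>x. \<Sum>i\<in>I. f i x"] C_k_on_sum[OF S(1), of I "Suc (Suc 0)" f] by simp
qed simp_all

lemma laplacian_cmod_power2: "laplacian (\<lambda>w. (cmod (w - z))\<^sup>2) w = 4"
proof -
  have 1: "((\<lambda>w. (cmod (w - z))\<^sup>2) has_derivative (\<lambda>v. 2 * ((w - z) \<bullet> v))) (at w)" for w
    unfolding power2_norm_eq_inner by (auto intro!: derivative_eq_intros simp: inner_commute)
  have "partial_deriv b (partial_deriv b (\<lambda>w. (cmod (w - z))\<^sup>2)) w = 2 * (b \<bullet> b)" for b
  proof -
    have "partial_deriv b (\<lambda>w. (cmod (w - z))\<^sup>2) = (\<lambda>w. 2 * ((w - z) \<bullet> b))"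
      by (rule ext) (rule partial_deriv_eq[OF 1])
    moreover have "((\<lambda>w. 2 * ((w - z) \<bullet> b)) has_derivative (\<lambda>v. 2 * (v \<bullet> b))) (at w)"
      by (auto intro!: derivative_eq_intros)
    ultimately show ?thesis by (simp add: partial_deriv_eq)
  qed
  then show ?thesis by (simp add: laplacian_def inner_complex_def)
qed

text \<open>Frostman's truncation: restricting \<open>\<mu>\<close> to the set where its potential is at most twice the
  mean leaves at least half of the mass, and the potential of the restriction is bounded off its
  support because any point is comparable with a nearest point of the support.\<close>

lemma bounded_potential:
  assumes \<mu>: "\<mu> \<in> compact_prob_measures (ball z R - \<Omega>)" and R: "R \<ge> 1" and B: "B > 0"
    and defect: "energy_defect (ln (2 * R)) \<mu> \<le> ennreal B"
  obtains q :: "complex \<Rightarrow> real" where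
    "\<And>k. C_k_on k q \<Omega>" "\<And>w. w \<in> \<Omega> \<Longrightarrow> laplacian q w = 0"
    "\<And>w. w \<in> \<Omega> \<Longrightarrow> q w \<le> 2 * B + ln 3"
    "\<And>w. w \<in> \<Omega> \<Longrightarrow> cmod (w - z) \<le> 2 * R \<Longrightarrow> - ln (3 / 2) \<le> q w"
    "\<And>w. w \<in> \<Omega> \<Longrightarrow> 19 * R \<le> cmod (w - z) \<Longrightarrow> q w \<le> - ln 3"
proof -
  interpret prob_space \<mu> using \<mu> by (simp add: compact_prob_measures_def)
  have s [measurable_cong]: "sets \<mu> = sets borel" using \<mu> by (simp add: compact_prob_measures_def)
  have sp: "space \<mu> = UNIV" using sets_eq_imp_space_eq[OF s] by simp
  define S where "S = measure_support \<mu>"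
  have S: "compact S" "S \<subseteq> ball z R - \<Omega>" using \<mu> by (auto simp: compact_prob_measures_def S_def)
  define L where "L = ln (2 * R)"
  define U where "U w = (\<integral>\<^sup>+\<zeta>. log_defect L (cmod (w - \<zeta>)) \<partial>\<mu>)" for w
  have Um [measurable]: "U \<in> borel_measurable borel" unfolding U_def by measurable
  have UB: "(\<integral>\<^sup>+w. U w \<partial>\<mu>) \<le> ennreal B" using defect by (simp add: energy_defect_def U_def L_def)
  define X where "X = {w. U w \<le> ennreal (2 * B)} \<inter> S"
  have Uc: "{w. U w \<le> ennreal (2 * B)} \<in> sets borel" by measurable
  then have Xs: "X \<in> sets \<mu>" unfolding X_def s using S(1) by (intro sets.Int) (auto intro: borel_closed compact_imp_closed)
  define M where "M = restrict_space \<mu> X"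
  have spM: "space M = X" by (simp add: M_def space_restrict_space sp)
  interpret M: finite_measure M
    unfolding M_def using Xs by (intro finite_measure_restrict_space) (auto simp: finite_measure_axioms)
  interpret M: log_potential M "\<lambda>s. s" S
  proof
    show "(\<lambda>s. s) \<in> borel_measurable M" unfolding M_def by (rule measurable_restrict_space1[OF measurable_ident_sets[OF s]])
  qed (use S spM in \<open>auto simp: X_def\<close>)
  define \<nu> where "\<nu> = measure M (space M)"
  have \<nu>X: "\<nu> = prob X" using Xs by (simp add: \<nu>_def spM) (simp add: M_def measure_restrict_space sp)
  have \<nu>1: "\<nu> \<le> 1" "\<nu> \<ge> 0" by (simp_all add: \<nu>X)
  \<comment> \<open>Markov's inequality: the potential has mean at most \<open>B\<close>, so it
    exceeds \<open>2 * B\<close> on mass at most 1/2.\<close>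
  have \<nu>2: "\<nu> \<ge> 1 / 2"
  proof -
    define Y where "Y = {w \<in> space \<mu>. \<not> U w \<le> ennreal (2 * B)}"
    have Yeq: "Y = space \<mu> - {w. U w \<le> ennreal (2 * B)}" by (auto simp: Y_def)
    have Ys: "Y \<in> sets \<mu>" unfolding Yeq by (rule sets.compl_sets) (simp only: s Uc)
    have "ennreal (2 * B) * emeasure \<mu> Y = (\<integral>\<^sup>+w. ennreal (2 * B) * indicator Y w \<partial>\<mu>)"
      by (rule nn_integral_cmult_indicator[OF Ys, symmetric])
    also have "\<dots> \<le> (\<integral>\<^sup>+w. U w \<partial>\<mu>)"
      by (rule nn_integral_mono) (auto simp: Y_def indicator_def not_le intro: less_imp_le)
    also note UB
    finally have "ennreal (2 * B * prob Y) \<le> ennreal B"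
      using B by (simp add: emeasure_eq_measure ennreal_mult)
    then have "2 * B * prob Y \<le> B" using B by (simp add: ennreal_le_iff)
    then have Y: "prob Y \<le> 1 / 2" using B by simp
    have "AE w in \<mu>. w \<in> S" unfolding S_def by (rule AE_measure_support[OF s])
    then have "AE w in \<mu>. w \<in> X \<union> Y" by eventually_elim (auto simp: X_def Y_def sp)
    then have "prob (X \<union> Y) = 1" using Xs Ys by (subst prob_eq_1) auto
    moreover have "prob (X \<union> Y) \<le> prob X + prob Y" by (rule measure_Un_le[OF Xs Ys])
    ultimately show ?thesis using Y by (simp add: \<nu>X)
  qed
  have Xne: "X \<noteq> {}" using \<nu>2 by (auto simp: \<nu>X)
  have wS: "w \<notin> S" if "w \<in> \<Omega>" for w using that S(2) by auto
  define q where "q w = L * \<nu> + (- 1) * M.potential w" for w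
  have q_int: "q w = integral\<^sup>L M (\<lambda>\<zeta>. L - ln (cmod (w - \<zeta>)))"
    and q_integrable: "integrable M (\<lambda>\<zeta>. L - ln (cmod (w - \<zeta>)))" if w: "w \<in> \<Omega>" for w
    using M.integrable_ln[OF wS[OF w]] by (simp_all add: q_def M.potential_def \<nu>_def mult.commute)
  have avg: "q w \<le> c * \<nu>" if w: "w \<in> \<Omega>" and le: "\<And>\<zeta>. \<zeta> \<in> X \<Longrightarrow> L - ln (cmod (w - \<zeta>)) \<le> c" for w c
  proof -
    have "q w \<le> integral\<^sup>L M (\<lambda>\<zeta>. c)"
      unfolding q_int[OF w] by (rule integral_mono[OF q_integrable[OF w]]) (use le spM in auto)
    then show ?thesis by (simp add: \<nu>_def mult.commute)
  qed
  have ballX: "cmod (\<zeta> - z) < R" if "\<zeta> \<in> X" for \<zeta>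
    using that S(2) by (auto simp: X_def dist_norm norm_minus_commute)
  have pos: "0 < cmod (w - \<zeta>)" if "w \<in> \<Omega>" "\<zeta> \<in> X" for w \<zeta> using that wS by (auto simp: X_def)
  \<comment> \<open>At distance \<open>19 * R\<close> from the centre every point of
    \<open>X\<close> is at least \<open>18 * R\<close> away, which is 9 times \<open>2 * R\<close>.
    The mass at least 1/2 turns ln 9 into ln 3.\<close>
  have far: "q w \<le> - ln 3" if w: "w \<in> \<Omega>" "19 * R \<le> cmod (w - z)" for w
  proof -
    have "L - ln (cmod (w - \<zeta>)) \<le> - ln 9" if \<zeta>: "\<zeta> \<in> X" for \<zeta>
    proof -
      have "cmod (w - z) \<le> cmod (w - \<zeta>) + cmod (\<zeta> - z)" using norm_triangle_ineq[of "w - \<zeta>" "\<zeta> - z"] by simp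
      then have "9 * (2 * R) \<le> cmod (w - \<zeta>)" using ballX[OF \<zeta>] w(2) by linarith
      then have "ln (9 * (2 * R)) \<le> ln (cmod (w - \<zeta>))" using R by (intro ln_mono) auto
      moreover have "ln (9 * (2 * R)) = ln 9 + L" unfolding L_def using R by (subst ln_mult) auto
      ultimately show ?thesis by linarith
    qed
    then have "q w \<le> - ln 9 * \<nu>" by (rule avg[OF w(1)])
    also have "\<dots> \<le> - ln 9 * (1 / 2)" using \<nu>2 by (intro mult_left_mono_neg) auto
    also have "ln 9 = 2 * ln (3::real)" using ln_realpow[of 3 2] by simp
    finally show ?thesis by simp
  qed
  \<comment> \<open>Distances are at most \<open>3 * R\<close>, which is 3/2 times
    \<open>2 * R\<close>; the mass is at most 1.\<close>
  have near: "- ln (3 / 2) \<le> q w" if w: "w \<in> \<Omega>" "cmod (w - z) \<le> 2 * R" for w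
  proof -
    have "- ln (3 / 2) \<le> L - ln (cmod (w - \<zeta>))" if \<zeta>: "\<zeta> \<in> X" for \<zeta>
    proof -
      have "cmod (w - \<zeta>) \<le> cmod (w - z) + cmod (\<zeta> - z)" using norm_triangle_ineq4[of "w - z" "\<zeta> - z"] by simp
      then have "cmod (w - \<zeta>) \<le> (3 / 2) * (2 * R)" using ballX[OF \<zeta>] w(2) by linarith
      then have "ln (cmod (w - \<zeta>)) \<le> ln ((3 / 2) * (2 * R))" using pos[OF w(1) \<zeta>] R by (intro ln_mono) auto
      also have "\<dots> = ln (3 / 2) + L" using R unfolding L_def by (subst ln_mult) auto
      finally show ?thesis by simp
    qed
    then have "integral\<^sup>L M (\<lambda>\<zeta>. - ln (3 / 2)) \<le> q w"
      unfolding q_int[OF w(1)] by (intro integral_mono q_integrable[OF w(1)]) (use spM in auto)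
    then have "- ln (3 / 2) * \<nu> \<le> q w" by (simp add: \<nu>_def mult.commute)
    moreover have "- ln (3 / 2) * 1 \<le> - ln (3 / 2) * \<nu>" using \<nu>1 by (intro mult_left_mono_neg) auto
    ultimately show ?thesis by linarith
  qed
  have upper: "q w \<le> 2 * B + ln 3" if w: "w \<in> \<Omega>" for w
  proof -
    obtain d where d: "d > 0" "\<And>\<zeta>. \<zeta> \<in> X \<Longrightarrow> 2 * d \<le> cmod (w - \<zeta>)"
      using M.distance_bound[OF wS[OF w]] spM by metis
    define I where "I = (INF \<zeta>\<in>X. cmod (w - \<zeta>))"
    have bdd: "bdd_below ((\<lambda>\<zeta>. cmod (w - \<zeta>)) ` X)" by (auto intro!: bdd_belowI[of _ 0])
    have "2 * d \<le> I" unfolding I_def by (rule cINF_greatest[OF Xne]) (rule d(2))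
    then have I: "I > 0" using d(1) by linarith
    then have "I < 2 * I" by simp
    \<comment> \<open>A point of \<open>X\<close> realising the distance \<open>I\<close> up to a
      factor 2. The triangle inequality bounds its distance to any \<zeta> in \<open>X\<close> by 3
      times that of \<open>w\<close>; this is the source of \<open>ln 3\<close>.\<close>
    then obtain w' where w': "w' \<in> X" "cmod (w - w') < 2 * I"
      unfolding I_def using cINF_less_iff[OF Xne bdd] by (metis I_def)
    have pt: "ennreal (L - ln (cmod (w - \<zeta>)) - ln 3) \<le> log_defect L (cmod (w' - \<zeta>))" if \<zeta>: "\<zeta> \<in> X" for \<zeta>
    proof (cases "w' = \<zeta>")
      case False
      have "I \<le> cmod (w - \<zeta>)" unfolding I_def using \<zeta> bdd by (intro cINF_lower) auto
      then have "cmod (w' - \<zeta>) \<le> 3 * cmod (w - \<zeta>)"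
        using w'(2) norm_triangle_ineq4[of "w - \<zeta>" "w - w'"] by simp
      then have "ln (cmod (w' - \<zeta>)) \<le> ln (3 * cmod (w - \<zeta>))" using False by (intro ln_mono) auto
      also have "\<dots> = ln 3 + ln (cmod (w - \<zeta>))" using pos[OF w \<zeta>] by (subst ln_mult) auto
      finally show ?thesis using False by (simp add: log_defect_nonzero ennreal_leI)
    qed simp
    have "(\<integral>\<^sup>+\<zeta>. ennreal (L - ln (cmod (w - \<zeta>)) - ln 3) \<partial>M) \<le> (\<integral>\<^sup>+\<zeta>. log_defect L (cmod (w' - \<zeta>)) \<partial>M)"
      by (rule nn_integral_mono) (use pt spM in auto)
    also have "\<dots> = (\<integral>\<^sup>+\<zeta>. log_defect L (cmod (w' - \<zeta>)) * indicator X \<zeta> \<partial>\<mu>)"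
      unfolding M_def using Xs by (intro nn_integral_restrict_space) (simp add: sp)
    also have "\<dots> \<le> U w'" unfolding U_def by (rule nn_integral_mono) (auto simp: indicator_def)
    also have "\<dots> \<le> ennreal (2 * B)" using w'(1) by (simp add: X_def)
    finally have nn: "(\<integral>\<^sup>+\<zeta>. ennreal (L - ln (cmod (w - \<zeta>)) - ln 3) \<partial>M) \<le> ennreal (2 * B)" .
    have i: "integrable M (\<lambda>\<zeta>. L - ln (cmod (w - \<zeta>)) - ln 3)" using q_integrable[OF w] by simp
    have im: "integrable M (\<lambda>\<zeta>. max 0 (L - ln (cmod (w - \<zeta>)) - ln 3))"
      using i by (intro integrable_max) auto
    have "ennreal (integral\<^sup>L M (\<lambda>\<zeta>. max 0 (L - ln (cmod (w - \<zeta>)) - ln 3)))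
        = (\<integral>\<^sup>+\<zeta>. ennreal (max 0 (L - ln (cmod (w - \<zeta>)) - ln 3)) \<partial>M)"
      using im by (intro nn_integral_eq_integral[symmetric]) auto
    also have "\<dots> = (\<integral>\<^sup>+\<zeta>. ennreal (L - ln (cmod (w - \<zeta>)) - ln 3) \<partial>M)"
      by (intro nn_integral_cong) (simp add: max_def ennreal_neg)
    finally have "ennreal (integral\<^sup>L M (\<lambda>\<zeta>. max 0 (L - ln (cmod (w - \<zeta>)) - ln 3))) \<le> ennreal (2 * B)"
      using nn by simp
    then have "integral\<^sup>L M (\<lambda>\<zeta>. max 0 (L - ln (cmod (w - \<zeta>)) - ln 3)) \<le> 2 * B"
      using B by (simp add: ennreal_le_iff)
    moreover have "integral\<^sup>L M (\<lambda>\<zeta>. L - ln (cmod (w - \<zeta>)) - ln 3) \<le> integral\<^sup>L M (\<lambda>\<zeta>. max 0 (L - ln (cmod (w - \<zeta>)) - ln 3))"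
      using i im by (intro integral_mono) auto
    ultimately have "integral\<^sup>L M (\<lambda>\<zeta>. L - ln (cmod (w - \<zeta>)) - ln 3) \<le> 2 * B" by (rule order_trans[rotated])
    then have "q w - ln 3 * \<nu> \<le> 2 * B"
      using q_integrable[OF w] by (simp add: q_int[OF w] \<nu>_def mult.commute)
    moreover have "ln 3 * \<nu> \<le> ln 3 * 1" using \<nu>1 by (intro mult_left_mono) auto
    ultimately show ?thesis by linarith
  qed
  have \<Omega>S: "\<Omega> \<subseteq> - S" using wS by auto
  have qC: "C_k_on k q (- S)" for k
    unfolding q_def[abs_def] by (intro C_k_on_add C_k_on_cmult C_k_on_const M.C_k_on_potential M.open_complement)
  have lap: "laplacian q w = 0" if "w \<in> \<Omega>" for w
  proof -
    have w: "w \<in> - S" using that \<Omega>S by auto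
    have "laplacian (\<lambda>w. L * \<nu> + c * M.potential w) w = 0" for c
      using laplacian_add[OF M.open_complement w C_k_on_const[of _ "L * \<nu>"] C_k_on_cmult[OF M.open_complement M.C_k_on_potential]]
        laplacian_cmult[OF M.open_complement w M.C_k_on_potential] M.laplacian_potential w by simp
    from this[of "- 1"] show ?thesis unfolding q_def[abs_def] .
  qed
  show ?thesis
    by (rule that[of q]) (use C_k_on_subset[OF qC \<Omega>S] lap upper near far in auto)
qed

text \<open>The weight A = (400 R^2 + 1) / ln 2 on the potential comes from the gap ln 2 between its
  lower bound - ln (3/2) near the centre and its upper bound - ln 3 far away: weighted, the gap must
  exceed by 1 the bound 400 R^2 on the squared distance. The factor 2 B + 2 ln 3 bounds the
  potential from above with ln 3 added. After scaling the argument stays below 1/4.\<close>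

definition bump_slope :: "real \<Rightarrow> real \<Rightarrow> real" where
  "bump_slope R B = 1 / (4 * ((400 * R\<^sup>2 + 1) / ln 2 * (2 * B + 2 * ln 3)))"

text \<open>A lower bound for b'(V) times the Laplacian of V, where b = \<open>flat_exp 0\<close>, V
  is at least the slope s near the centre and has Laplacian 4 s. It depends on \<open>R\<close> and
  \<open>B\<close> alone, hence is common to all bumps.\<close>

definition bump_gain :: "real \<Rightarrow> real \<Rightarrow> real" where
  "bump_gain R B = flat_exp 2 (bump_slope R B) * (4 * bump_slope R B)"

lemma bump_slope_pos:
  assumes "B > 0" shows "bump_slope R B > 0"
proof -
  have "400 * R\<^sup>2 + 1 > 0" using zero_le_power2[of R] by linarith
  then show ?thesis
    unfolding bump_slope_def using assms by (intro divide_pos_pos mult_pos_pos) (auto intro: add_pos_pos)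
qed

lemma bump_gain_pos:
  assumes "B > 0" shows "bump_gain R B > 0"
  using bump_slope_pos[OF assms, of R] by (simp add: bump_gain_def flat_exp_def)

text \<open>With \<open>u = |w - z|\<^sup>2 + A q\<close> and \<open>A\<close> large, \<open>u\<close> is at least \<open>t0 + 1\<close> for \<open>|w - z| \<le> 2 R\<close> and at most \<open>t0\<close>
  on the annulus \<open>19 R \<le> |w - z| < 20 R\<close>, so that \<open>flat_exp 0 (s (u - t0))\<close> can be cut off there. The factor \<open>s\<close> keeps
  the argument in the range where \<open>flat_exp 0\<close> is convex.\<close>

lemma subharmonic_bump:
  assumes \<Omega>: "open \<Omega>" and \<mu>: "\<mu> \<in> compact_prob_measures (ball z R - \<Omega>)" and R: "R \<ge> 1" and B: "B > 0"
    and defect: "energy_defect (ln (2 * R)) \<mu> \<le> ennreal B"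
  obtains \<psi> :: "complex \<Rightarrow> real" where
    "\<And>k. C_k_on k \<psi> \<Omega>" "\<And>w. 0 \<le> \<psi> w \<and> \<psi> w \<le> 1" "\<And>w. w \<in> \<Omega> \<Longrightarrow> 0 \<le> laplacian \<psi> w"
    "\<And>w. w \<in> \<Omega> \<Longrightarrow> cmod (w - z) \<le> 2 * R \<Longrightarrow> bump_gain R B \<le> laplacian \<psi> w"
    "\<And>w. 20 * R \<le> cmod (w - z) \<Longrightarrow> \<psi> w = 0"
proof -
  obtain q :: "complex \<Rightarrow> real" where q: "\<And>k. C_k_on k q \<Omega>" "\<And>w. w \<in> \<Omega> \<Longrightarrow> laplacian q w = 0"
    "\<And>w. w \<in> \<Omega> \<Longrightarrow> q w \<le> 2 * B + ln 3"
    "\<And>w. w \<in> \<Omega> \<Longrightarrow> cmod (w - z) \<le> 2 * R \<Longrightarrow> - ln (3 / 2) \<le> q w"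
    "\<And>w. w \<in> \<Omega> \<Longrightarrow> 19 * R \<le> cmod (w - z) \<Longrightarrow> q w \<le> - ln 3"
    using bounded_potential[OF \<mu> R B defect] by metis
  define A where "A = (400 * R\<^sup>2 + 1) / ln 2"
  have A: "A > 0" by (simp add: A_def add_nonneg_pos)
  have A2: "A * ln 2 = 400 * R\<^sup>2 + 1" by (simp add: A_def)
  define t0 where "t0 = 400 * R\<^sup>2 - A * ln 3"
  define s where "s = bump_slope R B"
  have s: "s > 0" unfolding s_def by (rule bump_slope_pos[OF B])
  have sU: "s * (A * (2 * B + 2 * ln 3)) = 1 / 4"
  proof -
    have "A * (2 * B + 2 * ln 3) > 0" using A B by (auto intro!: mult_pos_pos add_pos_pos)
    moreover have "1 / (4 * D) * D = 1 / 4" if "D > 0" for D :: real using that by simp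
    ultimately show ?thesis unfolding s_def bump_slope_def A_def[symmetric] by blast
  qed
  define K where "K = - s * t0"
  define V where "V w = s * (cmod (w - z))\<^sup>2 + ((s * A) * q w + K)" for w
  have V: "V w = s * ((cmod (w - z))\<^sup>2 + A * q w - t0)" for w by (simp add: V_def K_def algebra_simps)
  have VC: "C_k_on k V \<Omega>" for k
    unfolding V_def[abs_def] by (intro C_k_on_add C_k_on_cmult C_k_on_const q C_k_on_cmod_power2 \<Omega>)
  have Vlap: "laplacian V w = 4 * s" if w: "w \<in> \<Omega>" for w
    unfolding V_def[abs_def]
    using laplacian_add[OF \<Omega> w C_k_on_cmult[OF \<Omega> C_k_on_cmod_power2] C_k_on_add[OF \<Omega> C_k_on_cmult[OF \<Omega> q(1)] C_k_on_const]]
      laplacian_add[OF \<Omega> w C_k_on_cmult[OF \<Omega> q(1)] C_k_on_const]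
      laplacian_cmult[OF \<Omega> w C_k_on_cmod_power2] laplacian_cmult[OF \<Omega> w q(1)] q(2)[OF w] laplacian_cmod_power2
    by simp
  \<comment> \<open>The bound 1/4 lies within the range up to 1/2 in which \<open>flat_exp 0\<close>
    is convex and \<open>flat_exp 2\<close> increases.\<close>
  have Vup: "V w \<le> 1 / 4" if w: "w \<in> \<Omega>" "cmod (w - z) < 20 * R" for w
  proof -
    have "(cmod (w - z))\<^sup>2 \<le> (20 * R)\<^sup>2" using w(2) by (intro power_mono) auto
    moreover have "A * q w \<le> A * (2 * B + ln 3)" using q(3)[OF w(1)] A by (intro mult_left_mono) auto
    ultimately have "(cmod (w - z))\<^sup>2 + A * q w - t0 \<le> A * (2 * B + 2 * ln 3)"
      by (simp add: t0_def power_mult_distrib algebra_simps)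
    then have "V w \<le> s * (A * (2 * B + 2 * ln 3))" unfolding V using s by (intro mult_left_mono) auto
    then show ?thesis by (simp add: sU)
  qed
  have Vlow: "s \<le> V w" if w: "w \<in> \<Omega>" "cmod (w - z) \<le> 2 * R" for w
  proof -
    have "A * (- ln (3 / 2)) \<le> A * q w" using q(4)[OF w] A by (intro mult_left_mono) auto
    also have "A * (- ln (3 / 2)) = A * ln 2 - A * ln 3" by (simp add: ln_div algebra_simps)
    finally have "400 * R\<^sup>2 + 1 - A * ln 3 \<le> A * q w" by (simp add: A2)
    then have "1 \<le> (cmod (w - z))\<^sup>2 + A * q w - t0" 
      using zero_le_power2[of "cmod (w - z)"] unfolding t0_def by linarith
    then have "s * 1 \<le> V w" unfolding V using s by (intro mult_left_mono) auto
    then show ?thesis by simp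
  qed
  have Vann: "V w \<le> 0" if w: "w \<in> \<Omega>" "19 * R \<le> cmod (w - z)" "cmod (w - z) < 20 * R" for w
  proof -
    have "(cmod (w - z))\<^sup>2 \<le> (20 * R)\<^sup>2" using w(3) by (intro power_mono) auto
    moreover have "A * q w \<le> A * (- ln 3)" using q(5)[OF w(1,2)] A by (intro mult_left_mono) auto
    ultimately have "(cmod (w - z))\<^sup>2 + A * q w - t0 \<le> 0" by (simp add: t0_def power_mult_distrib)
    then show ?thesis unfolding V using s by (simp add: mult_nonneg_nonpos)
  qed
  define \<psi> where "\<psi> w = (if cmod (w - z) < 20 * R then flat_exp 0 (V w) else 0)" for w
  define T1 where "T1 = \<Omega> \<inter> ball z (20 * R)"
  define T2 where "T2 = \<Omega> \<inter> - cball z (19 * R)"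
  have T: "open T1" "open T2" using \<Omega> by (auto simp: T1_def T2_def)
  have \<psi>1: "\<psi> w = flat_exp 0 (V w)" if "w \<in> T1" for w
    using that by (simp add: T1_def \<psi>_def dist_norm norm_minus_commute)
  have \<psi>2: "\<psi> w = 0" if "w \<in> T2" for w
    using that Vann[of w] by (auto simp: T2_def \<psi>_def dist_norm norm_minus_commute flat_exp_def)
  have cover: "w \<in> T1 \<or> w \<in> T2" if "w \<in> \<Omega>" for w
    using that R by (auto simp: T1_def T2_def)
  have C1: "C_k_on k (\<lambda>w. flat_exp 0 (V w)) \<Omega>" for k
    by (rule C_k_on_real_comp[OF \<Omega> VC C_k_on_flat_exp[of _ _ UNIV]]) simp
  have \<psi>C: "C_k_on k \<psi> \<Omega>" for k
  proof (rule C_k_on_local)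
    fix w assume "w \<in> \<Omega>"
    then consider "w \<in> T1" | "w \<in> T2" using cover by blast
    then show "\<exists>T. open T \<and> w \<in> T \<and> C_k_on k \<psi> T"
    proof cases
      case 1
      have "C_k_on k \<psi> T1"
        by (rule C_k_on_cong[OF T(1) \<psi>1[symmetric] C_k_on_subset[OF C1]]) (auto simp: T1_def)
      with 1 T show ?thesis by blast
    next
      case 2
      have "C_k_on k \<psi> T2"
        by (rule C_k_on_cong[OF T(2) \<psi>2[symmetric] C_k_on_const])
      with 2 T show ?thesis by blast
    qed
  qed
  have lap1: "laplacian \<psi> w \<ge> flat_exp 2 (V w) * (4 * s)" if w: "w \<in> T1" for w
  proof -
    have w': "w \<in> \<Omega>" "cmod (w - z) < 20 * R" using w by (auto simp: T1_def dist_norm norm_minus_commute)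
    have "laplacian \<psi> w = laplacian (\<lambda>w. flat_exp 0 (V w)) w"
      by (rule laplacian_cong_open[OF T(1) w \<psi>1])
    also have "\<dots> = (flat_exp 4 (V w) - 2 * flat_exp 3 (V w)) * ((partial_deriv 1 V w)\<^sup>2 + (partial_deriv \<i> V w)\<^sup>2) +
      flat_exp 2 (V w) * (4 * s)"
      unfolding laplacian_flat_exp_comp[OF \<Omega> VC w'(1)] Vlap[OF w'(1)] ..
    finally show ?thesis
      using flat_exp_convex[of "V w"] Vup[OF w'] by simp
  qed
  show ?thesis
  proof (rule that[of \<psi>])
    show "0 \<le> \<psi> w \<and> \<psi> w \<le> 1" for w by (simp add: \<psi>_def flat_exp_nonneg flat_exp_le_1)
    show "\<psi> w = 0" if "20 * R \<le> cmod (w - z)" for w using that by (simp add: \<psi>_def)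
    show "0 \<le> laplacian \<psi> w" if "w \<in> \<Omega>" for w
    proof (cases "w \<in> T1")
      case True
      have "0 \<le> flat_exp 2 (V w) * (4 * s)" using s by (intro mult_nonneg_nonneg) (auto simp: flat_exp_nonneg)
      with lap1[OF True] show ?thesis by linarith
    next
      case False
      then have "w \<in> T2" using cover that by blast
      from laplacian_cong_open[OF T(2) this \<psi>2] show ?thesis by simp
    qed
    show "bump_gain R B \<le> laplacian \<psi> w" if w: "w \<in> \<Omega>" "cmod (w - z) \<le> 2 * R" for w
    proof -
      have w20: "cmod (w - z) < 20 * R" using w(2) R by linarith
      then have "w \<in> T1" using w(1) by (simp add: T1_def dist_norm norm_minus_commute)
      moreover have "flat_exp 2 s * (4 * s) \<le> flat_exp 2 (V w) * (4 * s)"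
        using Vlow[OF w] Vup[OF w(1) w20] s by (intro mult_right_mono flat_exp_mono_2) auto
      ultimately show ?thesis using lap1[of w] by (simp add: bump_gain_def s_def)
    qed
  qed (rule \<psi>C)
qed

text \<open>Bumps have radius \<open>20 * R\<close>; the radius \<open>21 * R\<close> also captures
  all bumps that reach a disc of radius \<open>R\<close> about \<open>w\<close>. Rounding down errs
  by at most \<open>R\<close> in each coordinate, which gives the bound
  \<open>2 * R\<close>.\<close>

lemma near_lattice_points:
  assumes R: "R > 0"
  defines "z \<equiv> (\<lambda>(m, n). Complex (R * real_of_int m) (R * real_of_int n))"
  shows "{p. cmod (w - z p) < 21 * R} \<subseteq> {\<lfloor>Re w / R\<rfloor> - 21..\<lfloor>Re w / R\<rfloor> + 21} \<times> {\<lfloor>Im w / R\<rfloor> - 21..\<lfloor>Im w / R\<rfloor> + 21}"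
    and "cmod (w - z (\<lfloor>Re w / R\<rfloor>, \<lfloor>Im w / R\<rfloor>)) \<le> 2 * R"
proof -
  have near: "m \<in> {\<lfloor>x / R\<rfloor> - 21..\<lfloor>x / R\<rfloor> + 21}" if "\<bar>x - R * real_of_int m\<bar> < 21 * R" for x m
  proof -
    have "x / R < m + 21" "m - 21 < x / R" using that R by (auto simp: abs_less_iff field_simps)
    then show ?thesis by (auto simp: le_floor_iff floor_le_iff) linarith+
  qed
  show "{p. cmod (w - z p) < 21 * R} \<subseteq> {\<lfloor>Re w / R\<rfloor> - 21..\<lfloor>Re w / R\<rfloor> + 21} \<times> {\<lfloor>Im w / R\<rfloor> - 21..\<lfloor>Im w / R\<rfloor> + 21}"
  proof
    fix p assume p: "p \<in> {p. cmod (w - z p) < 21 * R}"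
    obtain m n where mn: "p = (m, n)" by force
    have "\<bar>Re w - R * real_of_int m\<bar> < 21 * R" "\<bar>Im w - R * real_of_int n\<bar> < 21 * R"
      using p abs_Re_le_cmod[of "w - z p"] abs_Im_le_cmod[of "w - z p"] by (auto simp: mn z_def)
    from near[OF this(1)] near[OF this(2)]
    show "p \<in> {\<lfloor>Re w / R\<rfloor> - 21..\<lfloor>Re w / R\<rfloor> + 21} \<times> {\<lfloor>Im w / R\<rfloor> - 21..\<lfloor>Im w / R\<rfloor> + 21}"
      by (simp add: mn)
  qed
  have fl: "\<bar>x - R * real_of_int \<lfloor>x / R\<rfloor>\<bar> \<le> R" for x
  proof -
    show ?thesis using floor_divide_lower[OF R, of x] floor_divide_upper[OF R, of x]
      by (simp add: abs_le_iff algebra_simps)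
  qed
  show "cmod (w - z (\<lfloor>Re w / R\<rfloor>, \<lfloor>Im w / R\<rfloor>)) \<le> 2 * R"
    using cmod_le[of "w - z (\<lfloor>Re w / R\<rfloor>, \<lfloor>Im w / R\<rfloor>)"] fl[of "Re w"] fl[of "Im w"] by (simp add: z_def)
qed

text \<open>A radius beyond the inradius violates its defining condition with one \<delta> for all
  centres. All discs of that radius thus carry measures with a common energy bound, and the bumps
  share one gain.\<close>

lemma bounded_subharmonic_if_capacity_inradius_finite:
  assumes \<Omega>: "open \<Omega>" and cap: "capacity_inradius \<Omega> < \<infinity>"
  shows "\<exists>(\<phi> :: complex \<Rightarrow> real) c. smooth_on \<phi> \<Omega> \<and> bounded (\<phi> ` \<Omega>) \<and> c > 0 \<and> (\<forall>z\<in>\<Omega>. laplacian \<phi> z > c)"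
proof -
  let ?A = "{R::real. R \<ge> 0 \<and> (\<forall>\<delta>::real>0. \<exists>z. log_cap (ball z R \<inter> - \<Omega>) < ennreal \<delta>)}"
  define R where "R = max 1 (enn2real (capacity_inradius \<Omega>) + 1)"
  have R: "R \<ge> 1" by (simp add: R_def)
  have "R \<notin> ?A"
  proof
    assume "R \<in> ?A"
    then have "ennreal R \<le> capacity_inradius \<Omega>" unfolding capacity_inradius_def by (rule SUP_upper)
    also have "\<dots> = ennreal (enn2real (capacity_inradius \<Omega>))" using cap by simp
    finally have "R \<le> enn2real (capacity_inradius \<Omega>)" by (simp add: ennreal_le_iff)
    then show False by (simp add: R_def)
  qed
  then obtain \<delta> where \<delta>: "\<delta> > 0" "\<And>z. ennreal \<delta> \<le> log_cap (ball z R \<inter> - \<Omega>)"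
    using R by (auto simp: not_less)
  define L where "L = ln (2 * R)"
  \<comment> \<open>A measure almost attaining the capacity has exponential energy above
    \<open>\<delta> / 2\<close>; the maximum with 1 keeps \<open>B\<close> positive.\<close>
  define B where "B = max 1 (L - ln (\<delta> / 2))"
  have B: "B > 0" by (simp add: B_def)
  have "\<exists>\<psi>::complex \<Rightarrow> real. (\<forall>k. C_k_on k \<psi> \<Omega>) \<and> (\<forall>w. 0 \<le> \<psi> w \<and> \<psi> w \<le> 1) \<and> (\<forall>w\<in>\<Omega>. 0 \<le> laplacian \<psi> w) \<and>
    (\<forall>w\<in>\<Omega>. cmod (w - z) \<le> 2 * R \<longrightarrow> bump_gain R B \<le> laplacian \<psi> w) \<and> (\<forall>w. 20 * R \<le> cmod (w - z) \<longrightarrow> \<psi> w = 0)" for z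
  proof -
    have "ennreal (\<delta> / 2) < ennreal \<delta>" using \<delta>(1) by (simp add: ennreal_less_iff)
    also note \<delta>(2)[of z]
    finally obtain \<mu> where \<mu>: "\<mu> \<in> compact_prob_measures (ball z R \<inter> - \<Omega>)" "ennreal (\<delta> / 2) < ext_exp (log_energy \<mu>)"
      unfolding log_cap_def less_SUP_iff by blast
    have \<mu>': "\<mu> \<in> compact_prob_measures (ball z R - \<Omega>)" using \<mu>(1) by (simp add: Diff_eq)
    have p: "prob_space \<mu>" "sets \<mu> = sets borel" "measure_support \<mu> \<subseteq> ball z R"
      using \<mu>(1) by (auto simp: compact_prob_measures_def)
    have "AE w in \<mu>. w \<in> ball z R"
      using AE_measure_support[OF p(2)] by eventually_elim (use p(3) in auto)
    from log_energy_eq[OF p(1,2) this] R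
    have "log_energy \<mu> = ereal L - enn2ereal (energy_defect L \<mu>)" by (simp add: L_def)
    then have "energy_defect L \<mu> \<le> ennreal (L - ln (\<delta> / 2))"
      using \<mu>(2) \<delta>(1) by (intro ext_exp_energy_defect) auto
    also have "\<dots> \<le> ennreal B" by (intro ennreal_leI) (simp add: B_def)
    finally have "energy_defect (ln (2 * R)) \<mu> \<le> ennreal B" by (simp add: L_def)
    from subharmonic_bump[OF \<Omega> \<mu>' R B this] show ?thesis by metis
  qed
  then obtain \<psi> :: "complex \<Rightarrow> complex \<Rightarrow> real" where \<psi>: "\<And>z k. C_k_on k (\<psi> z) \<Omega>" "\<And>z w. 0 \<le> \<psi> z w \<and> \<psi> z w \<le> 1"
    "\<And>z w. w \<in> \<Omega> \<Longrightarrow> 0 \<le> laplacian (\<psi> z) w"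
    "\<And>z w. w \<in> \<Omega> \<Longrightarrow> cmod (w - z) \<le> 2 * R \<Longrightarrow> bump_gain R B \<le> laplacian (\<psi> z) w"
    "\<And>z w. 20 * R \<le> cmod (w - z) \<Longrightarrow> \<psi> z w = 0" by metis
  define Z :: "int \<times> int \<Rightarrow> complex" where "Z = (\<lambda>(m, n). Complex (R * real_of_int m) (R * real_of_int n))"
  have R0: "R > 0" using R by simp
  note lat = near_lattice_points[OF R0, folded Z_def]
  \<comment> \<open>This index set contains every bump that is nonzero somewhere in the disc of
    radius \<open>R\<close> about \<open>w\<close>, so locally the sum runs over a fixed finite
    set.\<close>
  define N where "N w = {p. cmod (w - Z p) < 21 * R}" for w
  have N: "finite (N w)" "card (N w) \<le> 43 * 43" for w
  proof -
    let ?Q = "{\<lfloor>Re w / R\<rfloor> - 21..\<lfloor>Re w / R\<rfloor> + 21} \<times> {\<lfloor>Im w / R\<rfloor> - 21..\<lfloor>Im w / R\<rfloor> + 21}"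
    have sub: "N w \<subseteq> ?Q" using lat(1)[of w] by (simp add: N_def)
    show "finite (N w)" by (rule finite_subset[OF sub]) simp
    have "card (N w) \<le> card ?Q" by (rule card_mono[OF _ sub]) simp
    also have "card ?Q = 43 * 43" by (simp add: card_cartesian_product)
    finally show "card (N w) \<le> 43 * 43" .
  qed
  define \<phi> where "\<phi> w = (\<Sum>p\<in>N w. \<psi> (Z p) w)" for w
  have loc: "\<phi> w = (\<Sum>p\<in>N w0. \<psi> (Z p) w)" if w: "w \<in> ball w0 R" for w w0
  proof -
    have "\<psi> (Z p) w = 0" if "p \<notin> N w0 \<or> p \<notin> N w" for p
    proof (rule \<psi>(5))
      have "cmod (w0 - Z p) \<le> cmod (w0 - w) + cmod (w - Z p)" using norm_triangle_ineq[of "w0 - w" "w - Z p"] by simp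
      then show "20 * R \<le> cmod (w - Z p)" using that w R by (auto simp: N_def dist_norm)
    qed
    then show ?thesis unfolding \<phi>_def
      using sum.mono_neutral_cong[OF N(1)[of w0] N(1)[of w], of "\<lambda>p. \<psi> (Z p) w" "\<lambda>p. \<psi> (Z p) w"] by auto
  qed
  have smooth: "smooth_on \<phi> \<Omega>"
    unfolding smooth_on_def
  proof (intro allI C_k_on_local)
    fix k w0 assume w0: "w0 \<in> \<Omega>"
    let ?T = "\<Omega> \<inter> ball w0 R"
    have "C_k_on k (\<lambda>w. \<Sum>p\<in>N w0. \<psi> (Z p) w) ?T"
      using \<Omega> by (intro C_k_on_sum C_k_on_subset[OF \<psi>(1)]) auto
    then have "C_k_on k \<phi> ?T"
      using \<Omega> by (intro C_k_on_cong[of ?T "\<lambda>w. \<Sum>p\<in>N w0. \<psi> (Z p) w" \<phi>]) (auto simp: loc)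
    then show "\<exists>T. open T \<and> w0 \<in> T \<and> C_k_on k \<phi> T"
      using \<Omega> w0 R0 by (intro exI[of _ ?T]) auto
  qed
  have "\<bar>\<phi> w\<bar> \<le> 43 * 43" for w
  proof -
    have "\<bar>\<phi> w\<bar> \<le> (\<Sum>p\<in>N w. \<bar>\<psi> (Z p) w\<bar>)" unfolding \<phi>_def by (rule sum_abs)
    also have "\<dots> \<le> (\<Sum>p\<in>N w. 1)" 
    proof (rule sum_mono)
      show "\<bar>\<psi> (Z p) w\<bar> \<le> 1" for p using \<psi>(2)[of "Z p" w] by simp
    qed
    also have "\<dots> \<le> 43 * 43" using N(2)[of w] by simp
    finally show ?thesis .
  qed
  then have bdd: "bounded (\<phi> ` \<Omega>)" by (auto simp: bounded_iff intro!: exI[of _ "43 * 43"])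
  have lap: "laplacian \<phi> w > bump_gain R B / 2" if w: "w \<in> \<Omega>" for w
  proof -
    have T: "open (\<Omega> \<inter> ball w R)" "w \<in> \<Omega> \<inter> ball w R" using \<Omega> w R0 by auto
    define p where "p = (\<lfloor>Re w / R\<rfloor>, \<lfloor>Im w / R\<rfloor>)"
    have p: "cmod (w - Z p) \<le> 2 * R" unfolding p_def by (rule lat(2))
    then have pN: "p \<in> N w" using R0 by (simp add: N_def)
    have "bump_gain R B \<le> laplacian (\<psi> (Z p)) w" by (rule \<psi>(4)[OF w p])
    also have "\<dots> = (\<Sum>p\<in>{p}. laplacian (\<psi> (Z p)) w)" by simp
    also have "\<dots> \<le> (\<Sum>p\<in>N w. laplacian (\<psi> (Z p)) w)"
      by (rule sum_mono2[OF N(1)]) (use pN \<psi>(3)[OF w] in auto)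
    also have "\<dots> = laplacian (\<lambda>x. \<Sum>p\<in>N w. \<psi> (Z p) x) w"
      by (rule laplacian_sum[OF \<Omega> w \<psi>(1), symmetric])
    also have "\<dots> = laplacian \<phi> w"
      by (rule laplacian_cong_open[OF T]) (auto simp: loc)
    finally show ?thesis using bump_gain_pos[OF B, of R] by linarith
  qed
  show ?thesis
    using smooth bdd lap bump_gain_pos[OF B, of R] by (intro exI[of _ \<phi>] exI[of _ "bump_gain R B / 2"]) auto
qed


section \<open>A square-filling curve\<close>

text \<open>Schoenberg's curve: \<open>zig\<close> reads off the ternary digits \<open>0\<close> and \<open>2\<close>.\<close>

definition zig :: "real \<Rightarrow> real" where
  "zig t = max 0 (min 1 (1 / 2 - cos (pi * t)))"

lemma zig_bounds: "0 \<le> zig t" "zig t \<le> 1"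
  by (auto simp: zig_def)

lemma continuous_on_zig: "continuous_on S zig"
  unfolding zig_def by (intro continuous_intros)

lemma zig_add_even: "zig (2 * real m + t) = zig t"
proof -
  have "cos (pi * (2 * real m + t)) = cos (pi * t)"
  proof (induction m)
    case (Suc m)
    have "pi * (2 * real (Suc m) + t) = pi * (2 * real m + t) + 2 * pi" by (simp add: algebra_simps)
    then show ?case using Suc by (simp only: cos_periodic)
  qed simp
  then show ?thesis by (simp add: zig_def)
qed

lemma zig_digit:
  assumes "0 \<le> t" "t \<le> 1 / 3"
  shows "zig t = 0" "zig (1 - t) = 1"
proof -
  have "pi * t \<le> pi / 3" using assms(2) by (simp add: field_simps)
  then have "cos (pi / 3) \<le> cos (pi * t)"
    using assms by (intro cos_monotone_0_pi_le) (auto intro: order_trans)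
  then have c: "1 / 2 \<le> cos (pi * t)" by (simp add: cos_60)
  then show "zig t = 0" by (simp add: zig_def)
  have "cos (pi * (1 - t)) = - cos (pi * t)"
    using cos_pi_minus[of "pi * t"] by (simp add: right_diff_distrib)
  with c show "zig (1 - t) = 1" by (simp add: zig_def)
qed

text \<open>Multiplication by 3^k shifts the digits. The integer part is even, as all digits are 0
  or 2, and disappears by periodicity. The digits after the next one contribute at most 1/3, so the
  argument falls into [0, 1/3] or [2/3, 1], where \<open>zig\<close> is constant.\<close>

lemma zig_ternary:
  fixes a :: "nat \<Rightarrow> nat"
  assumes a: "\<And>j. a j \<le> 1"
  shows "zig (3 ^ k * (\<Sum>j. 2 * real (a j) / 3 ^ Suc j)) = real (a k)"
proof -
  have le: "2 * real (a j) / 3 ^ Suc j \<le> (2 / 3) * (1 / 3) ^ j" for j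
    using a[of j] by (simp add: power_one_over field_simps)
  have sg: "summable (\<lambda>j. (2 / 3) * (1 / 3 :: real) ^ j)" by (intro summable_mult summable_geometric) simp
  have "summable (\<lambda>j. 2 * real (a (j + m)) / 3 ^ Suc j)" for m
    using a by (intro summable_comparison_test'[OF sg, of 0]) (auto simp: power_one_over field_simps)
  note summ = this[of 0, unfolded add_0_right] this
  define r where "r = (\<Sum>j. 2 * real (a (j + Suc k)) / 3 ^ Suc j) / 3"
  have geo: "(\<Sum>j. (2 / 3) * (1 / 3 :: real) ^ j) = 1"
    by (subst suminf_mult) (auto simp: suminf_geometric)
  have r: "0 \<le> r" "r \<le> 1 / 3"
  proof -
    show "0 \<le> r" unfolding r_def by (intro divide_nonneg_nonneg suminf_nonneg summ) auto
    have "(\<Sum>j. 2 * real (a (j + Suc k)) / 3 ^ Suc j) \<le> (\<Sum>j. (2 / 3) * (1 / 3 :: real) ^ j)"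
      using a by (intro suminf_le summ sg) (auto simp: power_one_over field_simps)
    also note geo
    finally show "r \<le> 1 / 3" by (simp add: r_def)
  qed
  have split: "(\<Sum>j. 2 * real (a j) / 3 ^ Suc j) = (\<Sum>j. 2 * real (a (j + Suc k)) / 3 ^ Suc (j + Suc k)) + (\<Sum>j<Suc k. 2 * real (a j) / 3 ^ Suc j)"
    by (rule suminf_split_initial_segment[OF summ(1)])
  have tail: "3 ^ k * (\<Sum>j. 2 * real (a (j + Suc k)) / 3 ^ Suc (j + Suc k)) = r"
  proof -
    have "(\<Sum>j. 2 * real (a (j + Suc k)) / 3 ^ Suc (j + Suc k)) = (\<Sum>j. (1 / 3 ^ Suc k) * (2 * real (a (j + Suc k)) / 3 ^ Suc j))"
      by (rule suminf_cong) (simp add: power_add)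
    also have "\<dots> = (1 / 3 ^ Suc k) * (\<Sum>j. 2 * real (a (j + Suc k)) / 3 ^ Suc j)"
      by (rule suminf_mult[OF summ(2)])
    finally show ?thesis by (simp add: r_def)
  qed
  have head: "3 ^ k * (\<Sum>j<Suc k. 2 * real (a j) / 3 ^ Suc j) = 2 * real (\<Sum>j<k. a j * 3 ^ (k - Suc j)) + 2 * real (a k) / 3"
  proof -
    have "3 ^ k * (2 * real (a j) / 3 ^ Suc j) = 2 * real (a j * 3 ^ (k - Suc j))" if "j < k" for j
    proof -
      have "(3::real) ^ k = 3 ^ Suc j * 3 ^ (k - Suc j)" using that by (simp flip: power_add power_Suc)
      then show ?thesis by simp
    qed
    then have "(\<Sum>j<k. 3 ^ k * (2 * real (a j) / 3 ^ Suc j)) = 2 * real (\<Sum>j<k. a j * 3 ^ (k - Suc j))"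
      by (simp add: sum_distrib_left)
    then show ?thesis by (simp add: distrib_left sum_distrib_left)
  qed
  have "3 ^ k * (\<Sum>j. 2 * real (a j) / 3 ^ Suc j) = 2 * real (\<Sum>j<k. a j * 3 ^ (k - Suc j)) + (2 * real (a k) / 3 + r)"
    unfolding split distrib_left tail head by simp
  then have eq: "zig (3 ^ k * (\<Sum>j. 2 * real (a j) / 3 ^ Suc j)) = zig (2 * real (a k) / 3 + r)"
    by (simp only: zig_add_even)
  consider "a k = 0" | "a k = 1" using a[of k] by linarith
  then show ?thesis
  proof cases
    case 1
    then show ?thesis unfolding eq using zig_digit(1)[OF r] by simp
  next
    case 2
    have "2 / 3 + r = 1 - (1 / 3 - r)" by simp
    then show ?thesis unfolding eq using 2 zig_digit(2)[of "1 / 3 - r"] r by simp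
  qed
qed

text \<open>Greedy doubling keeps the remainder in [0, 1]. Counting 1/2 as digit 1 expands the end
  point 1 into ones only.\<close>

lemma binary_expansion:
  assumes "0 \<le> x" "x \<le> 1"
  obtains b :: "nat \<Rightarrow> nat" where "\<And>k. b k \<le> 1" "(\<lambda>k. real (b k) / 2 ^ Suc k) sums x"
proof -
  define d where "d r = (if 2 * r \<ge> (1::real) then 1 else 0 :: nat)" for r
  define r where "r = rec_nat x (\<lambda>_ r. 2 * r - real (d r))"
  have r0: "r 0 = x" and rS: "r (Suc n) = 2 * r n - real (d (r n))" for n by (simp_all add: r_def)
  have rb: "0 \<le> r n \<and> r n \<le> 1" for n
    by (induction n) (use assms in \<open>auto simp: r0 rS d_def\<close>)
  have sum: "(\<Sum>k<n. real (d (r k)) / 2 ^ Suc k) = x - r n / 2 ^ n" for n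
    by (induction n) (auto simp: r0 rS field_simps)
  have "(\<lambda>n. r n / 2 ^ n) \<longlonglongrightarrow> 0"
  proof (rule Lim_null_comparison)
    show "\<forall>\<^sub>F n in sequentially. norm (r n / 2 ^ n) \<le> 1 / 2 ^ n"
      using rb by (intro always_eventually allI) (auto intro!: divide_right_mono)
    show "(\<lambda>n. 1 / 2 ^ n :: real) \<longlonglongrightarrow> 0" by real_asymp
  qed
  then have "(\<lambda>n. x - r n / 2 ^ n) \<longlonglongrightarrow> x - 0" by (intro tendsto_intros)
  then have "(\<lambda>k. real (d (r k)) / 2 ^ Suc k) sums x" unfolding sums_def sum by simp
  then show ?thesis using that[of "\<lambda>k. d (r k)"] by (simp add: d_def)
qed

text \<open>Ternary digits in even positions become the binary digits of the real part, those in odd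
  positions the digits of the imaginary part.\<close>

definition square_curve :: "real \<Rightarrow> complex" where
  "square_curve t = Complex (\<Sum>k. zig (3 ^ (2 * k) * t) / 2 ^ Suc k) (\<Sum>k. zig (3 ^ (2 * k + 1) * t) / 2 ^ Suc k)"

lemma continuous_on_square_curve: "continuous_on UNIV square_curve"
proof -
  have "continuous_on UNIV (\<lambda>t. \<Sum>k. zig (c k * t) / 2 ^ Suc k)" for c :: "nat \<Rightarrow> real"
  proof (rule uniform_limit_theorem)
    show "uniform_limit UNIV (\<lambda>n t. \<Sum>k<n. zig (c k * t) / 2 ^ Suc k) (\<lambda>t. \<Sum>k. zig (c k * t) / 2 ^ Suc k) sequentially"
    proof (rule Weierstrass_m_test)
      show "norm (zig (c k * t) / 2 ^ Suc k) \<le> (1 / 2) ^ Suc k" for k t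
        using zig_bounds[of "c k * t"] by (simp add: power_one_over field_simps)
      show "summable (\<lambda>k. (1 / 2 :: real) ^ Suc k)" by (simp add: summable_geometric)
    qed
    show "\<forall>\<^sub>F n in sequentially. continuous_on UNIV (\<lambda>t. \<Sum>k<n. zig (c k * t) / 2 ^ Suc k)"
      by (intro always_eventually allI continuous_on_sum continuous_on_divide continuous_on_const
          continuous_on_compose2[OF continuous_on_zig[of UNIV]] continuous_on_mult continuous_on_id) auto
  qed auto
  then show ?thesis unfolding square_curve_def Complex_eq
    by (intro continuous_intros) auto
qed

text \<open>Interleaving the binary digits of both coordinates, doubled to ternary digits, yields a
  parameter.\<close>

lemma square_curve_onto:
  assumes "0 \<le> x" "x \<le> 1" "0 \<le> y" "y \<le> 1"
  obtains t where "0 \<le> t" "t \<le> 1" "square_curve t = Complex x y"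
proof -
  obtain b :: "nat \<Rightarrow> nat" where b: "\<And>k. b k \<le> 1" "(\<lambda>k. real (b k) / 2 ^ Suc k) sums x"
    using binary_expansion[OF assms(1,2)] by metis
  obtain c :: "nat \<Rightarrow> nat" where c: "\<And>k. c k \<le> 1" "(\<lambda>k. real (c k) / 2 ^ Suc k) sums y"
    using binary_expansion[OF assms(3,4)] by metis
  define a where "a j = (if even j then b (j div 2) else c (j div 2))" for j
  have a: "a j \<le> 1" for j using b(1) c(1) by (simp add: a_def)
  define t where "t = (\<Sum>j. 2 * real (a j) / 3 ^ Suc j)"
  have z: "zig (3 ^ k * t) = real (a k)" for k unfolding t_def by (rule zig_ternary[OF a])
  have "(\<Sum>k. zig (3 ^ (2 * k) * t) / 2 ^ Suc k) = x" "(\<Sum>k. zig (3 ^ (2 * k + 1) * t) / 2 ^ Suc k) = y"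
    unfolding z using b(2) c(2) by (auto simp: a_def sums_iff)
  then have "square_curve t = Complex x y" by (simp add: square_curve_def)
  moreover have sg: "summable (\<lambda>j. (2 / 3) * (1 / 3 :: real) ^ j)" by (intro summable_mult summable_geometric) simp
  have le: "2 * real (a j) / 3 ^ Suc j \<le> (2 / 3) * (1 / 3) ^ j" for j
    using a[of j] by (simp add: power_one_over field_simps)
  have summ: "summable (\<lambda>j. 2 * real (a j) / 3 ^ Suc j)"
    using le by (intro summable_comparison_test'[OF sg, of 0]) auto
  have "0 \<le> t" unfolding t_def by (intro suminf_nonneg summ) auto
  moreover have "t \<le> (\<Sum>j. (2 / 3) * (1 / 3 :: real) ^ j)"
    unfolding t_def by (rule suminf_le[OF le summ sg])
  then have "t \<le> 1" by (subst (asm) suminf_mult) (auto simp: suminf_geometric)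
  ultimately show ?thesis using that by blast
qed

lemma compact_in_curve:
  assumes "compact (F :: complex set)"
  obtains \<gamma> :: "real \<Rightarrow> complex" where "continuous_on UNIV \<gamma>" "\<And>z. z \<in> F \<Longrightarrow> \<exists>t. 0 \<le> t \<and> t \<le> 1 \<and> \<gamma> t = z"
proof -
  obtain r where r: "\<And>z. z \<in> F \<Longrightarrow> norm z \<le> r" "r > 0"
    using compact_imp_bounded[OF assms] unfolding bounded_pos by blast
  define \<gamma> where "\<gamma> t = of_real (2 * r) * square_curve t - Complex r r" for t
  have "\<exists>t. 0 \<le> t \<and> t \<le> 1 \<and> \<gamma> t = z" if z: "z \<in> F" for z
  proof -
    have "\<bar>Re z\<bar> \<le> r" "\<bar>Im z\<bar> \<le> r" using r(1)[OF z] abs_Re_le_cmod[of z] abs_Im_le_cmod[of z] by linarith+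
    then have "0 \<le> (Re z + r) / (2 * r)" "(Re z + r) / (2 * r) \<le> 1" "0 \<le> (Im z + r) / (2 * r)" "(Im z + r) / (2 * r) \<le> 1"
      using r(2) by (auto simp: field_simps abs_le_iff)
    from square_curve_onto[OF this]
    obtain t where t: "0 \<le> t" "t \<le> 1" "square_curve t = Complex ((Re z + r) / (2 * r)) ((Im z + r) / (2 * r))" by metis
    then have "\<gamma> t = z" using r(2) by (simp add: \<gamma>_def complex_eq_iff)
    with t show ?thesis by blast
  qed
  moreover have "continuous_on UNIV \<gamma>"
    unfolding \<gamma>_def[abs_def] by (intro continuous_intros continuous_on_square_curve)
  ultimately show ?thesis using that by blast
qed


section \<open>Capacity and small polynomials\<close>

text \<open>The curve transports the problem to the real line, where Helly's selection theorem and
  Skorohod's theorem are available.\<close>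

lemma empirical_limit:
  fixes p :: "nat \<Rightarrow> complex"
  assumes F: "compact F" and p: "\<And>i. p i \<in> F"
  obtains P :: "real measure" and N :: "nat \<Rightarrow> nat" and X :: "nat \<Rightarrow> real \<Rightarrow> complex" and Y :: "real \<Rightarrow> complex"
  where "prob_space P" "\<And>n. X n \<in> borel_measurable P" "Y \<in> borel_measurable P" "\<And>n. N n > n"
    "\<And>s. s \<in> space P \<Longrightarrow> (\<lambda>n. X n s) \<longlonglongrightarrow> Y s"
    "\<And>n f. f \<in> borel_measurable borel \<Longrightarrow> integral\<^sup>L P (\<lambda>s. f (X n s)) = (\<Sum>i<N n. f (p i)) / (real (N n) :: real)"
    "\<And>n. AE s in P. X n s \<in> F"
proof -
  obtain \<gamma> :: "real \<Rightarrow> complex" where \<gamma>: "continuous_on UNIV \<gamma>" "\<And>z. z \<in> F \<Longrightarrow> \<exists>t. 0 \<le> t \<and> t \<le> 1 \<and> \<gamma> t = z"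
    using compact_in_curve[OF F] by metis
  have [measurable]: "\<gamma> \<in> borel_measurable borel" using \<gamma>(1) by (rule borel_measurable_continuous_onI)
  have "\<exists>t. 0 \<le> t \<and> t \<le> 1 \<and> \<gamma> t = p i" for i using \<gamma>(2)[OF p] .
  then obtain t where t: "\<And>i. 0 \<le> t i" "\<And>i. t i \<le> 1" "\<And>i. \<gamma> (t i) = p i" by metis
  define Q where "Q n = measure_pmf (pmf_of_set {..<Suc n})" for n
  define \<mu> where "\<mu> n = distr (Q n) borel t" for n
  have ne: "{..<Suc n} \<noteq> {}" "finite {..<Suc n}" for n by auto
  have tm: "t \<in> measurable (Q n) borel" for n by (simp add: Q_def)
  have Qp: "prob_space (Q n)" for n unfolding Q_def by (rule prob_space_measure_pmf)
  have rd: "real_distribution (\<mu> n)" for n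
    unfolding \<mu>_def by (rule prob_space.real_distribution_distr[OF Qp tm])
  \<comment> \<open>Tightness is phrased with half-open intervals; the left end -1 keeps the
    parameter 0 inside.\<close>
  have ae: "AE x in \<mu> n. x \<in> {-1<..1}" for n
  proof -
    have "- 1 < t i" for i using t(1)[of i] by linarith
    then show ?thesis unfolding \<mu>_def using t(2) by (subst AE_distr_iff[OF tm]) auto
  qed
  have m1: "measure (\<mu> n) {-1<..1} = 1" for n
  proof -
    interpret real_distribution "\<mu> n" by (rule rd)
    show ?thesis using ae[of n] by (subst prob_eq_1) auto
  qed
  have "tight \<mu>"
    unfolding tight_def
  proof (intro conjI allI impI)
    fix \<epsilon> :: real assume "0 < \<epsilon>"
    then have "- 1 < (1::real) \<and> (\<forall>n. 1 - \<epsilon> < measure (\<mu> n) {- 1<..1})" by (simp add: m1)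
    then show "\<exists>a b. a < b \<and> (\<forall>n. 1 - \<epsilon> < measure (\<mu> n) {a<..b})" by blast
  qed (rule rd)
  then obtain r M where r: "strict_mono r" "real_distribution M" "weak_conv_m (\<mu> \<circ> id \<circ> r) M"
    using tight_imp_convergent_subsubsequence[of \<mu> id] by (auto simp: strict_mono_def)
  \<comment> \<open>Skorohod's theorem exchanges weak convergence for pointwise convergence of
    variables with the same laws, which passes through the continuous curve.\<close>
  have "\<exists>(P :: real measure) Z Z0. prob_space P \<and> (\<forall>n. Z n \<in> measurable P borel) \<and>
    (\<forall>n. distr P borel (Z n) = (\<mu> \<circ> id \<circ> r) n) \<and> Z0 \<in> measurable P lborel \<and> distr P borel Z0 = M \<and>
    (\<forall>x\<in>space P. (\<lambda>n. Z n x) \<longlonglongrightarrow> Z0 x)"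
    by (rule Skorohod[OF _ r(2,3)]) (simp add: rd)
  then obtain P :: "real measure" and Z Z0 where *: "prob_space P \<and> (\<forall>n. Z n \<in> measurable P borel) \<and>
    (\<forall>n. distr P borel (Z n) = (\<mu> \<circ> id \<circ> r) n) \<and> Z0 \<in> measurable P lborel \<and> distr P borel Z0 = M \<and>
    (\<forall>x\<in>space P. (\<lambda>n. Z n x) \<longlonglongrightarrow> Z0 x)" by blast
  then have P: "prob_space P" "\<And>n. Z n \<in> borel_measurable P"
    "\<And>n. distr P borel (Z n) = \<mu> (r n)" "Z0 \<in> borel_measurable P" "\<And>x. x \<in> space P \<Longrightarrow> (\<lambda>n. Z n x) \<longlonglongrightarrow> Z0 x"
    by auto
  note [measurable] = P(2,4)
  show ?thesis
  proof (rule that[of P "\<lambda>n s. \<gamma> (Z n s)" "\<lambda>s. \<gamma> (Z0 s)" "\<lambda>n. Suc (r n)"])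
    show "prob_space P" by (rule P(1))
    show "(\<lambda>s. \<gamma> (Z n s)) \<in> borel_measurable P" "(\<lambda>s. \<gamma> (Z0 s)) \<in> borel_measurable P" for n by measurable
    show "n < Suc (r n)" for n using seq_suble[OF r(1), of n] by simp
    show "(\<lambda>n. \<gamma> (Z n s)) \<longlonglongrightarrow> \<gamma> (Z0 s)" if "s \<in> space P" for s
      by (rule continuous_on_tendsto_compose[OF \<gamma>(1) P(5)[OF that]]) auto
    show "integral\<^sup>L P (\<lambda>s. f (\<gamma> (Z n s))) = (\<Sum>i<Suc (r n). f (p i)) / real (Suc (r n))"
      if [measurable]: "f \<in> borel_measurable borel" for n and f :: "complex \<Rightarrow> real"
    proof -
      have "integral\<^sup>L P (\<lambda>s. f (\<gamma> (Z n s))) = integral\<^sup>L (distr P borel (Z n)) (\<lambda>x. f (\<gamma> x))"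
        by (rule integral_distr[symmetric]) measurable
      also have "\<dots> = integral\<^sup>L (Q (r n)) (\<lambda>i. f (\<gamma> (t i)))"
        unfolding P(3) \<mu>_def by (rule integral_distr[OF tm]) measurable
      also have "\<dots> = (\<Sum>i<Suc (r n). f (p i)) / real (Suc (r n))"
        unfolding Q_def t(3) by (subst integral_pmf_of_set[OF ne]) (simp add: lessThan_Suc)
      finally show ?thesis .
    qed
    show "AE s in P. \<gamma> (Z n s) \<in> F" for n
    proof -
      have Fs: "{x \<in> space borel. \<gamma> x \<in> F} \<in> sets borel"
      proof -
        have "\<gamma> -` F \<inter> space borel \<in> sets borel"
          using F by (intro measurable_sets[of \<gamma> borel borel] borel_closed compact_imp_closed) measurable
        then show ?thesis by (simp add: vimage_def)
      qed
      have "AE x in \<mu> (r n). \<gamma> x \<in> F"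
        unfolding \<mu>_def using Fs p by (subst AE_distr_iff[OF tm]) (auto simp: t(3))
      then show ?thesis
        unfolding P(3)[symmetric] using Fs by (subst (asm) AE_distr_iff) auto
    qed
  qed
qed

text \<open>The kernel L - ln x is cut at height \<open>m\<close>. It becomes continuous and
  bounded, so it passes to limits of measures; as \<open>m\<close> grows it increases to the full
  kernel.\<close>

definition trunc_log :: "real \<Rightarrow> real \<Rightarrow> real \<Rightarrow> real" where
  "trunc_log L m x = L - ln (max x (exp (L - m)))"

lemma max_exp_pos: "0 < max x (exp (t::real))"
  by (simp add: less_max_iff_disj)

lemma continuous_on_trunc_log: "continuous_on S (trunc_log L m)"
  unfolding trunc_log_def using max_exp_pos by (intro continuous_intros) (metis less_irrefl)

lemma trunc_log_bounds:
  assumes "0 \<le> m" "x \<le> exp L"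
  shows "0 \<le> trunc_log L m x" "trunc_log L m x \<le> m"
proof -
  have "ln (max x (exp (L - m))) \<le> ln (exp L)"
    using assms max_exp_pos by (intro ln_mono) auto
  then show "0 \<le> trunc_log L m x" by (simp add: trunc_log_def)
  have "ln (exp (L - m)) \<le> ln (max x (exp (L - m)))" by (intro ln_mono) auto
  then show "trunc_log L m x \<le> m" by (simp add: trunc_log_def)
qed

lemma trunc_log_le: "0 < x \<Longrightarrow> trunc_log L m x \<le> L - ln x"
  by (auto simp: trunc_log_def intro!: ln_mono)

lemma trunc_log_0: "trunc_log L m 0 = m"
  by (simp add: trunc_log_def max_def)

lemma incseq_trunc_log: "incseq (\<lambda>m. ennreal (trunc_log L (real m) x))"
  unfolding trunc_log_def incseq_def by (auto intro!: ennreal_leI ln_mono max_exp_pos max.mono)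

lemma SUP_trunc_log:
  assumes "0 \<le> x"
  shows "(SUP m. ennreal (trunc_log L (real m) x)) = log_defect L x"
proof (cases "x = 0")
  case True
  have "(SUP m::nat. ennreal (real m)) = top"
    using ennreal_SUP_of_nat_eq_top by (simp add: ennreal_of_nat_eq_real_of_nat)
  with True show ?thesis by (simp add: trunc_log_0)
next
  case False
  with assms have x: "x > 0" by simp
  obtain n :: nat where n: "L - ln x \<le> real n" using real_arch_simple by blast
  have "exp (L - real n) \<le> exp (ln x)" using n by simp
  then have eq: "trunc_log L (real n) x = L - ln x" using x by (simp add: trunc_log_def max_def)
  show ?thesis
  proof (rule antisym)
    show "(SUP m. ennreal (trunc_log L (real m) x)) \<le> log_defect L x"
      using trunc_log_le[OF x] False by (auto intro!: SUP_least ennreal_leI simp: log_defect_nonzero)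
    show "log_defect L x \<le> (SUP m. ennreal (trunc_log L (real m) x))"
      using False eq by (intro SUP_upper2[of n]) (auto simp: log_defect_nonzero)
  qed
qed

text \<open>If no polynomial with zeros in \<open>F\<close> is small on \<open>F\<close>, a greedy choice yields Leja points, whose
  mutual distances are large on average; a limit of their counting measures has large energy.\<close>

lemma small_polynomial_if_log_cap_less:
  assumes F: "compact F" "F \<subseteq> ball c R" "F \<noteq> {}" and R: "2 * R \<ge> 1"
    and \<delta>: "0 < \<delta>" "\<delta> \<le> 1" and cap: "log_cap F < ennreal \<delta>"
  obtains n :: nat and q :: "nat \<Rightarrow> complex"
  where "n > 0" "\<And>i. i < n \<Longrightarrow> q i \<in> F" "\<And>z. z \<in> F \<Longrightarrow> cmod (\<Prod>i<n. z - q i) < \<delta> ^ n"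
proof (rule ccontr)
  assume neg: "\<not> thesis"
  note small = that
  have ex: "\<exists>z\<in>F. \<delta> ^ n \<le> cmod (\<Prod>i<n. z - q i)" if "\<And>i. i < n \<Longrightarrow> q i \<in> F" for n q
  proof (cases "n = 0")
    case True
    then show ?thesis using F(3) by auto
  next
    case False
    then show ?thesis using neg small[of n q] that by (metis not_less not_gr_zero)
  qed
  \<comment> \<open>The next point is one where the monic polynomial with the previous points as
    zeros is not small; the negated claim provides it at every degree.\<close>
  have "\<exists>p. \<forall>n. p n \<in> F \<and> \<delta> ^ n \<le> cmod (\<Prod>i<n. p n - p i)"
  proof (rule dependent_wellorder_choice[where P="\<lambda>p n r. r \<in> F \<and> \<delta> ^ n \<le> cmod (\<Prod>i<n. r - p i)"])
    fix n p assume "\<And>y. y < n \<Longrightarrow> p y \<in> F \<and> \<delta> ^ y \<le> cmod (\<Prod>i<y. p y - p i)"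
    then show "\<exists>r. r \<in> F \<and> \<delta> ^ n \<le> cmod (\<Prod>i<n. r - p i)" using ex[of n p] by blast
  qed simp
  then obtain p where p: "\<And>n. p n \<in> F" "\<And>n. \<delta> ^ n \<le> cmod (\<Prod>i<n. p n - p i)" by blast
  define L where "L = ln (2 * R)"
  have L0: "L \<ge> 0" and eL: "exp L = 2 * R" using R by (simp_all add: L_def)
  have dist: "cmod (a - b) \<le> exp L" if "a \<in> F" "b \<in> F" for a b
  proof -
    have "a \<in> ball c R" "b \<in> ball c R" using that F(2) by auto
    then show ?thesis using norm_triangle_ineq4[of "a - c" "b - c"] unfolding eL by (simp add: dist_norm norm_minus_commute)
  qed
  \<comment> \<open>The product bound is a bound on the sum of logarithms, and truncation only
    lowers the kernel.\<close>
  have row: "(\<Sum>i<n. trunc_log L m (cmod (p n - p i))) \<le> real n * (L - ln \<delta>)" for n m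
  proof -
    have "0 < cmod (\<Prod>i<n. p n - p i)" using p(2)[of n] \<delta>(1) by (meson less_le_trans zero_less_power)
    then have nz: "p n - p i \<noteq> 0" if "i < n" for i using that by auto
    have "(\<Sum>i<n. trunc_log L m (cmod (p n - p i))) \<le> (\<Sum>i<n. L - ln (cmod (p n - p i)))"
      using nz by (intro sum_mono trunc_log_le) auto
    also have "\<dots> = real n * L - (\<Sum>i<n. ln (cmod (p n - p i)))" by (simp add: sum_subtractf)
    also have "(\<Sum>i<n. ln (cmod (p n - p i))) = ln (cmod (\<Prod>i<n. p n - p i))"
      using nz by (subst prod_norm[symmetric], subst ln_prod) auto
    also have "real n * L - ln (cmod (\<Prod>i<n. p n - p i)) \<le> real n * L - ln (\<delta> ^ n)"
      using p(2)[of n] \<delta>(1) by (intro diff_mono ln_mono) auto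
    also have "\<dots> = real n * (L - ln \<delta>)" using \<delta>(1) by (simp add: ln_realpow algebra_simps)
    finally show ?thesis .
  qed
  define Sum where "Sum m n = (\<Sum>i<n. \<Sum>j<n. trunc_log L m (cmod (p i - p j)))" for m n
  \<comment> \<open>A new point contributes its row twice, by symmetry, and one diagonal term equal
    to the truncation height \<open>m\<close>.\<close>
  have total: "Sum m n \<le> real n * m + real n * (real n - 1) * (L - ln \<delta>)" for m :: real and n :: nat
  proof (induction n)
    case (Suc n)
    have "Sum m (Suc n) = Sum m n + 2 * (\<Sum>i<n. trunc_log L m (cmod (p n - p i))) + m"
      by (simp add: Sum_def sum.distrib trunc_log_0 norm_minus_commute[of "p n"])
    also have "\<dots> \<le> (real n * m + real n * (real n - 1) * (L - ln \<delta>)) + 2 * (real n * (L - ln \<delta>)) + m"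
      using Suc row[of m n] by linarith
    also have "\<dots> = real (Suc n) * m + real (Suc n) * (real (Suc n) - 1) * (L - ln \<delta>)"
      by (simp add: algebra_simps)
    finally show ?case .
  qed (simp add: Sum_def)
  obtain P :: "real measure" and N :: "nat \<Rightarrow> nat" and X :: "nat \<Rightarrow> real \<Rightarrow> complex" and Y :: "real \<Rightarrow> complex"
    where P: "prob_space P" "\<And>n. X n \<in> borel_measurable P" "Y \<in> borel_measurable P" "\<And>n. N n > n"
    "\<And>s. s \<in> space P \<Longrightarrow> (\<lambda>n. X n s) \<longlonglongrightarrow> Y s"
    "\<And>n f. f \<in> borel_measurable borel \<Longrightarrow> integral\<^sup>L P (\<lambda>s. f (X n s)) = (\<Sum>i<N n. f (p i)) / (real (N n) :: real)"
    "\<And>n. AE s in P. X n s \<in> F"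
  proof (rule empirical_limit[of F p, OF F(1) p(1)])
    fix P :: "real measure" and N :: "nat \<Rightarrow> nat" and X :: "nat \<Rightarrow> real \<Rightarrow> complex" and Y :: "real \<Rightarrow> complex"
    assume "prob_space P" "\<And>n. X n \<in> borel_measurable P" "Y \<in> borel_measurable P" "\<And>n. N n > n"
    "\<And>s. s \<in> space P \<Longrightarrow> (\<lambda>n. X n s) \<longlonglongrightarrow> Y s"
    "\<And>n f. f \<in> borel_measurable borel \<Longrightarrow> integral\<^sup>L P (\<lambda>s. f (X n s)) = (\<Sum>i<N n. f (p i)) / (real (N n) :: real)"
    "\<And>n. AE s in P. X n s \<in> F"
    then show ?thesis by (rule that)
  qed
  interpret P: prob_space P by (rule P(1))
  note [measurable] = P(2,3)
  have "AE s in P. \<forall>n. X n s \<in> F" using P(7) by (simp add: AE_all_countable)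
  then have good: "AE s in P. (\<forall>n. X n s \<in> F) \<and> s \<in> space P" using AE_space by eventually_elim simp
  have YF: "AE s in P. Y s \<in> F"
    using good
  proof eventually_elim
    case (elim s)
    then show ?case
      using closed_sequentially[OF compact_imp_closed[OF F(1)], of "\<lambda>n. X n s" "Y s"] P(5)[of s] by auto
  qed
  \<comment> \<open>The truncation height is fixed while the number of points grows, so that the
    diagonal share \<open>m / N\<close> vanishes. Only afterwards does the height tend to infinity,
    by monotone convergence.\<close>
  have lim: "(\<integral>\<^sup>+s. \<integral>\<^sup>+t. ennreal (trunc_log L (real m) (cmod (Y s - Y t))) \<partial>P \<partial>P) \<le> ennreal (L - ln \<delta>)" for m :: nat
  proof -
    let ?T = "trunc_log L (real m)"
    have Tm [measurable]: "?T \<in> borel_measurable borel"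
      by (rule borel_measurable_continuous_onI[OF continuous_on_trunc_log])
    have Tb: "norm (?T (cmod (a - b))) \<le> real m" "0 \<le> ?T (cmod (a - b))" if "a \<in> F" "b \<in> F" for a b
      using trunc_log_bounds[OF _ dist[OF that], of "real m"] by auto
    define I where "I n s = integral\<^sup>L P (\<lambda>t. ?T (cmod (X n s - X n t)))" for n s
    define J where "J s = integral\<^sup>L P (\<lambda>t. ?T (cmod (Y s - Y t)))" for s
    have Im [measurable]: "I n \<in> borel_measurable P" "J \<in> borel_measurable P" for n
      unfolding I_def J_def by measurable
    have IJ: "(\<lambda>n. I n s) \<longlonglongrightarrow> J s" and Ib: "norm (I n s) \<le> real m"
      if s: "(\<forall>n. X n s \<in> F) \<and> s \<in> space P" for s n
    proof -
      show "(\<lambda>n. I n s) \<longlonglongrightarrow> J s"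
        unfolding I_def J_def
      proof (rule integral_dominated_convergence[where w="\<lambda>_. real m"])
        show "AE t in P. (\<lambda>n. ?T (cmod (X n s - X n t))) \<longlonglongrightarrow> ?T (cmod (Y s - Y t))"
          using s by (intro AE_I2 continuous_on_tendsto_compose[OF continuous_on_trunc_log[of UNIV]] tendsto_intros P(5)) auto
        show "AE t in P. norm (?T (cmod (X n s - X n t))) \<le> real m" for n
          using good by eventually_elim (use s Tb(1) in blast)
      qed (use s in measurable)
      have "norm (I n s) \<le> integral\<^sup>L P (\<lambda>t. real m)"
        unfolding I_def
      proof (rule order_trans[OF integral_norm_bound integral_mono_AE])
        show "integrable P (\<lambda>t. norm (?T (cmod (X n s - X n t))))"
        proof (rule P.integrable_const_bound)
          show "AE t in P. norm (norm (?T (cmod (X n s - X n t)))) \<le> real m"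
            using good by eventually_elim (use s Tb(1) in simp)
        qed (use s in measurable)
        show "AE t in P. norm (?T (cmod (X n s - X n t))) \<le> real m"
          using good by eventually_elim (use s Tb(1) in blast)
      qed simp
      then show "norm (I n s) \<le> real m" by (simp add: P.prob_space)
    qed
    have conv: "(\<lambda>n. integral\<^sup>L P (I n)) \<longlonglongrightarrow> integral\<^sup>L P J"
    proof (rule integral_dominated_convergence[where w="\<lambda>_. real m"])
      show "AE s in P. (\<lambda>n. I n s) \<longlonglongrightarrow> J s" using good by eventually_elim (rule IJ)
      show "AE s in P. norm (I n s) \<le> real m" for n using good by eventually_elim (rule Ib)
    qed auto
    have IS: "integral\<^sup>L P (I n) = Sum (real m) (N n) / (real (N n))\<^sup>2" for n
    proof -
      have "I n s = (\<Sum>j<N n. ?T (cmod (X n s - p j))) / real (N n)" for s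
        unfolding I_def by (rule P(6)) measurable
      then have "integral\<^sup>L P (I n) = integral\<^sup>L P (\<lambda>s. (\<Sum>j<N n. ?T (cmod (X n s - p j))) / real (N n))"
        by (intro arg_cong[where f="integral\<^sup>L P"] ext)
      also have "\<dots> = (\<Sum>i<N n. (\<Sum>j<N n. ?T (cmod (p i - p j))) / real (N n)) / real (N n)"
        by (rule P(6)) measurable
      finally show ?thesis by (simp add: Sum_def sum_divide_distrib[symmetric] power2_eq_square)
    qed
    have "integral\<^sup>L P (I n) \<le> real m / real (N n) + (1 - 1 / real (N n)) * (L - ln \<delta>)" for n
    proof -
      have Np: "real (N n) > 0" using P(4)[of n] by simp
      have "integral\<^sup>L P (I n) \<le> (real (N n) * real m + real (N n) * (real (N n) - 1) * (L - ln \<delta>)) / (real (N n))\<^sup>2"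
        unfolding IS by (intro divide_right_mono total) simp
      also have "\<dots> = real m / real (N n) + (1 - 1 / real (N n)) * (L - ln \<delta>)"
        using Np by (simp add: field_simps power2_eq_square)
      finally show ?thesis .
    qed
    moreover have "(\<lambda>n. real m / real (N n) + (1 - 1 / real (N n)) * (L - ln \<delta>)) \<longlonglongrightarrow> 0 + (1 - 0) * (L - ln \<delta>)"
    proof -
      have "filterlim (\<lambda>n. real (N n)) at_top sequentially"
        by (rule filterlim_at_top_mono[OF filterlim_real_sequentially]) (auto intro!: always_eventually less_imp_le[OF P(4)])
      then show ?thesis by (intro tendsto_intros tendsto_divide_0[OF tendsto_const] filterlim_at_top_imp_at_infinity)
    qed
    ultimately have JL: "integral\<^sup>L P J \<le> L - ln \<delta>"
      using LIMSEQ_le[OF conv] by auto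
    have inner: "(\<integral>\<^sup>+t. ennreal (?T (cmod (Y s - Y t))) \<partial>P) = ennreal (J s) \<and> 0 \<le> J s \<and> norm (J s) \<le> real m"
      if s: "Y s \<in> F" for s
    proof -
      have b: "AE t in P. norm (?T (cmod (Y s - Y t))) \<le> real m" "AE t in P. 0 \<le> ?T (cmod (Y s - Y t))"
        using YF by (eventually_elim, use s Tb in blast)+
      have i: "integrable P (\<lambda>t. ?T (cmod (Y s - Y t)))"
        by (rule P.integrable_const_bound[OF b(1)]) measurable
      have "norm (J s) \<le> integral\<^sup>L P (\<lambda>t. real m)"
        unfolding J_def by (rule order_trans[OF integral_norm_bound integral_mono_AE]) (use i b in auto)
      moreover have "0 \<le> J s" unfolding J_def by (rule integral_nonneg_AE[OF b(2)])
      ultimately show ?thesis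
        unfolding J_def using nn_integral_eq_integral[OF i b(2)] by (simp add: P.prob_space)
    qed
    have "(\<integral>\<^sup>+s. \<integral>\<^sup>+t. ennreal (?T (cmod (Y s - Y t))) \<partial>P \<partial>P) = (\<integral>\<^sup>+s. ennreal (J s) \<partial>P)"
      by (rule nn_integral_cong_AE, use YF in eventually_elim) (simp add: inner)
    also have "\<dots> = ennreal (integral\<^sup>L P J)"
    proof (rule nn_integral_eq_integral)
      show "integrable P J"
        by (rule P.integrable_const_bound[of _ "real m"]) (use YF inner in \<open>auto elim: eventually_mono\<close>)
      show "AE s in P. 0 \<le> J s" using YF by eventually_elim (simp add: inner)
    qed
    also have "\<dots> \<le> ennreal (L - ln \<delta>)" by (rule ennreal_leI[OF JL])
    finally show ?thesis .
  qed
  define \<mu> where "\<mu> = distr P borel Y"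
  have \<mu>s [measurable_cong]: "sets \<mu> = sets borel" by (simp add: \<mu>_def)
  have \<mu>p: "prob_space \<mu>" unfolding \<mu>_def by (rule P.prob_space_distr[OF P(3)])
  have Fb: "F \<in> sets borel" using F(1) by (intro borel_closed compact_imp_closed)
  have \<mu>F: "AE z in \<mu>. z \<in> F" unfolding \<mu>_def using YF Fb by (subst AE_distr_iff) auto
  have supp: "measure_support \<mu> \<subseteq> F"
  proof
    fix z assume z: "z \<in> measure_support \<mu>"
    show "z \<in> F"
    proof (rule ccontr)
      assume "z \<notin> F"
      moreover have "open (- F)" using F(1) by (simp add: compact_imp_closed open_Compl)
      moreover have "emeasure \<mu> (- F) = 0"
      proof -
        have "- F = {z \<in> space \<mu>. \<not> z \<in> F}" by (auto simp: \<mu>_def)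
        then show ?thesis using \<mu>F Fb by (subst (asm) AE_iff_measurable[of "- F"]) (auto simp: \<mu>s)
      qed
      ultimately show False using z by (auto simp: measure_support_def)
    qed
  qed
  have "closed (measure_support \<mu>)"
  proof -
    have "- measure_support \<mu> = \<Union>{U. open U \<and> emeasure \<mu> U = 0}"
      by (auto simp: measure_support_def zero_less_iff_neq_zero)
    then show ?thesis by (metis (no_types, lifting) closed_def mem_Collect_eq open_Union)
  qed
  then have "compact (measure_support \<mu>)"
    using supp F(1) by (metis compact_Int_closed inf.absorb_iff2)
  then have \<mu>c: "\<mu> \<in> compact_prob_measures F"
    using supp \<mu>p \<mu>s by (simp add: compact_prob_measures_def)
  have "energy_defect L \<mu> = (\<integral>\<^sup>+s. \<integral>\<^sup>+t. log_defect L (cmod (Y s - Y t)) \<partial>P \<partial>P)"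
  proof -
    interpret \<mu>: prob_space \<mu> by (rule \<mu>p)
    have "energy_defect L \<mu> = (\<integral>\<^sup>+s. (\<integral>\<^sup>+w. log_defect L (cmod (Y s - w)) \<partial>\<mu>) \<partial>P)"
      unfolding energy_defect_def by (subst (1) \<mu>_def, subst nn_integral_distr) measurable
    also have "\<dots> = (\<integral>\<^sup>+s. \<integral>\<^sup>+t. log_defect L (cmod (Y s - Y t)) \<partial>P \<partial>P)"
      unfolding \<mu>_def by (subst nn_integral_distr) auto
    finally show ?thesis .
  qed
  also have "\<dots> = (\<integral>\<^sup>+s. (SUP m. \<integral>\<^sup>+t. ennreal (trunc_log L (real m) (cmod (Y s - Y t))) \<partial>P) \<partial>P)"
  proof (rule nn_integral_cong)
    fix s
    have "(\<integral>\<^sup>+t. log_defect L (cmod (Y s - Y t)) \<partial>P) = (\<integral>\<^sup>+t. (SUP m. ennreal (trunc_log L (real m) (cmod (Y s - Y t)))) \<partial>P)"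
      by (simp add: SUP_trunc_log)
    also have "\<dots> = (SUP m. \<integral>\<^sup>+t. ennreal (trunc_log L (real m) (cmod (Y s - Y t))) \<partial>P)"
    proof (rule nn_integral_monotone_convergence_SUP)
      show "incseq (\<lambda>m t. ennreal (trunc_log L (real m) (cmod (Y s - Y t))))"
        using incseq_trunc_log by (auto simp: incseq_def le_fun_def)
      show "(\<lambda>t. ennreal (trunc_log L (real m) (cmod (Y s - Y t)))) \<in> borel_measurable P" for m
        using borel_measurable_continuous_onI[OF continuous_on_trunc_log] by measurable
    qed
    finally show "(\<integral>\<^sup>+t. log_defect L (cmod (Y s - Y t)) \<partial>P) = (SUP m. \<integral>\<^sup>+t. ennreal (trunc_log L (real m) (cmod (Y s - Y t))) \<partial>P)" .
  qed
  also have "\<dots> = (SUP m. \<integral>\<^sup>+s. \<integral>\<^sup>+t. ennreal (trunc_log L (real m) (cmod (Y s - Y t))) \<partial>P \<partial>P)"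
  proof (rule nn_integral_monotone_convergence_SUP)
    show "incseq (\<lambda>m s. \<integral>\<^sup>+t. ennreal (trunc_log L (real m) (cmod (Y s - Y t))) \<partial>P)"
      using incseq_trunc_log by (auto simp: incseq_def le_fun_def intro!: nn_integral_mono)
    show "(\<lambda>s. \<integral>\<^sup>+t. ennreal (trunc_log L (real m) (cmod (Y s - Y t))) \<partial>P) \<in> borel_measurable P" for m
      using borel_measurable_continuous_onI[OF continuous_on_trunc_log] by measurable
  qed
  also have "\<dots> \<le> ennreal (L - ln \<delta>)" by (rule SUP_least) (rule lim)
  finally have defect: "energy_defect L \<mu> \<le> ennreal (L - ln \<delta>)" .
  have "AE z in \<mu>. z \<in> ball c R" using \<mu>F by eventually_elim (use F(2) in auto)
  from log_energy_eq[OF \<mu>p \<mu>s this R] have "log_energy \<mu> = ereal L - enn2ereal (energy_defect L \<mu>)"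
    by (simp add: L_def)
  moreover have "ln \<delta> \<le> 0" using \<delta> by simp
  ultimately have "ennreal \<delta> \<le> ext_exp (log_energy \<mu>)"
    using ext_exp_energy_defect_ge[OF defect \<delta>(1)] L0 by simp
  also have "\<dots> \<le> log_cap F" unfolding log_cap_def by (rule SUP_upper[OF \<mu>c])
  finally show False using cap by simp
qed


section \<open>The Poincare inequality bounds the capacity inradius\<close>

definition cutoff :: "complex \<Rightarrow> real \<Rightarrow> complex \<Rightarrow> real" where
  "cutoff z R w = flat_exp 0 (1 - (cmod (w - z))\<^sup>2 / R\<^sup>2)"

lemma C_k_on_cutoff: "C_k_on k (cutoff z R) UNIV"
proof -
  have "C_k_on k (\<lambda>w. 1 + (- 1 / R\<^sup>2) * (cmod (w - z))\<^sup>2) UNIV"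
    by (intro C_k_on_add C_k_on_cmult C_k_on_const C_k_on_cmod_power2 open_UNIV)
  from C_k_on_real_comp[OF open_UNIV this C_k_on_flat_exp[of k 0 UNIV]]
  show ?thesis by (simp add: cutoff_def[abs_def])
qed

lemma cutoff_bounds: "0 \<le> cutoff z R w" "cutoff z R w \<le> 1"
  by (simp_all add: cutoff_def flat_exp_nonneg flat_exp_le_1)

lemma cutoff_outside:
  assumes "R > 0" "w \<notin> cball z R"
  shows "cutoff z R w = 0"
proof -
  have "R < cmod (w - z)" using assms by (simp add: dist_norm norm_minus_commute)
  then have "R\<^sup>2 \<le> (cmod (w - z))\<^sup>2" using assms(1) by (intro power_mono) auto
  then show ?thesis using assms(1) by (simp add: cutoff_def flat_exp_def)
qed

lemma cutoff_ge:
  assumes "R > 0" "w \<in> ball z (R / 2)"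
  shows "flat_exp 0 (3 / 4) \<le> cutoff z R w"
proof -
  have "cmod (w - z) \<le> R / 2" using assms by (simp add: dist_norm norm_minus_commute)
  then have "(cmod (w - z))\<^sup>2 \<le> (R / 2)\<^sup>2" by (intro power_mono) auto
  then have "(cmod (w - z))\<^sup>2 / R\<^sup>2 \<le> 1 / 4"
    using assms(1) by (simp add: pos_divide_le_eq power_divide)
  then show ?thesis unfolding cutoff_def by (intro flat_exp_mono_0) simp
qed

text \<open>By the chain rule the squared gradient is b'^2 times 4 |w - z|^2 / R^4 with b' at most
  2, whence 16 / R^2. Multiplied by the area of the disc this is independent of
  \<open>R\<close>.\<close>

lemma cutoff_gradient:
  assumes R: "R > 0"
  shows "(partial_deriv 1 (cutoff z R) w)\<^sup>2 + (partial_deriv \<i> (cutoff z R) w)\<^sup>2 \<le> 16 / R\<^sup>2 * indicator (cball z R) w"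
proof (cases "w \<in> cball z R")
  case True
  define t where "t = 1 - (cmod (w - z))\<^sup>2 / R\<^sup>2"
  have "((\<lambda>w. 1 - c * (cmod (w - z))\<^sup>2) has_derivative (\<lambda>v. - (c * (2 * ((w - z) \<bullet> v))))) (at w)" for c
    unfolding power2_norm_eq_inner by (auto intro!: derivative_eq_intros simp: inner_commute)
  from this[of "1 / R\<^sup>2"]
  have d: "((\<lambda>w. 1 - (cmod (w - z))\<^sup>2 / R\<^sup>2) has_derivative (\<lambda>v. - (2 * ((w - z) \<bullet> v)) / R\<^sup>2)) (at w)" by simp
  have f: "(flat_exp 0 has_real_derivative flat_exp 2 t) (at t)"
    using flat_exp_has_derivative[of 0 t] by (simp add: numeral_2_eq_2)
  have p: "partial_deriv b (cutoff z R) w = flat_exp 2 t * (- (2 * ((w - z) \<bullet> b)) / R\<^sup>2)" for b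
    unfolding cutoff_def[abs_def]
    by (rule partial_deriv_eq) (rule has_derivative_compose[OF d f[unfolded has_field_derivative_def t_def], folded t_def])
  have "(w - z) \<bullet> 1 = Re (w - z)" "(w - z) \<bullet> \<i> = Im (w - z)" by (simp_all add: inner_complex_def)
  moreover have "(e * (- (2 * a) / r))\<^sup>2 + (e * (- (2 * b) / r))\<^sup>2 = e\<^sup>2 * (4 * (a\<^sup>2 + b\<^sup>2) / r\<^sup>2)" for e a b r :: real
    by (simp add: power_mult_distrib power_divide add_divide_distrib distrib_left)
  ultimately have "(partial_deriv 1 (cutoff z R) w)\<^sup>2 + (partial_deriv \<i> (cutoff z R) w)\<^sup>2 =
      (flat_exp 2 t)\<^sup>2 * (4 * (cmod (w - z))\<^sup>2 / (R\<^sup>2)\<^sup>2)"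
    unfolding p cmod_power2 by presburger
  also have "\<dots> \<le> 2\<^sup>2 * (4 * R\<^sup>2 / (R\<^sup>2)\<^sup>2)"
  proof (intro mult_mono)
    show "(flat_exp 2 t)\<^sup>2 \<le> 2\<^sup>2" by (intro power_mono flat_exp_2_le flat_exp_nonneg)
    have "(cmod (w - z))\<^sup>2 \<le> R\<^sup>2" using True by (intro power_mono) (auto simp: dist_norm norm_minus_commute)
    then show "4 * (cmod (w - z))\<^sup>2 / (R\<^sup>2)\<^sup>2 \<le> 4 * R\<^sup>2 / (R\<^sup>2)\<^sup>2" by (intro divide_right_mono) auto
  qed auto
  also have "\<dots> = 16 / R\<^sup>2" using R by (simp add: power2_eq_square)
  finally show ?thesis using True by simp
next
  case False
  have "partial_deriv b (cutoff z R) w = partial_deriv b (\<lambda>_. 0) w" for b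
    by (rule partial_deriv_cong_open[of "- cball z R"]) (use False R cutoff_outside in auto)
  then show ?thesis using False by simp
qed

text \<open>The cut-off \<open>G = flat_exp 0 ((1 + u / L) / 4)\<close> vanishes where \<open>u \<le> - L\<close>, and
  \<open>|\<nabla>G|\<^sup>2 \<le> 4 \<triangle>G\<close>. A Caccioppoli argument for the field \<open>\<eta>\<^sup>2 \<nabla>G\<close> then bounds the gradient of \<open>\<eta> G\<close>
  by that of \<open>\<eta> = cutoff z R\<close>, whose \<open>L\<^sup>2\<close> norm is scale invariant.\<close>

lemma harmonic_cutoff:
  fixes u :: "complex \<Rightarrow> real"
  assumes \<Omega>: "open \<Omega>" and R: "R > 0" and L: "L > 0" and S: "finite S"
    and u: "\<And>k. C_k_on k u (- S)" "\<And>w. w \<notin> S \<Longrightarrow> laplacian u w = 0"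
    and N: "open N" "S \<subseteq> N" "\<And>w. w \<in> N \<Longrightarrow> w \<notin> S \<Longrightarrow> u w \<le> - L"
    and cover: "cball z R - \<Omega> \<subseteq> N"
    and up: "\<And>w. w \<in> cball z R \<Longrightarrow> w \<notin> S \<Longrightarrow> u w \<le> L / 2"
    and ui: "integrable lborel (\<lambda>w. indicator (cball z R) w * \<bar>u w\<bar>)"
  obtains v where "v \<in> test_functions \<Omega>" "(test_grad_norm \<Omega> v)\<^sup>2 \<le> 2080 * pi"
    "(flat_exp 0 (3 / 4) * flat_exp 0 (1 / 8))\<^sup>2 *
      (pi * (R / 2)\<^sup>2 - 2 / L * integral\<^sup>L lborel (\<lambda>w. indicator (cball z R) w * \<bar>u w\<bar>)) \<le> (L2_norm \<Omega> v)\<^sup>2"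
proof -
  have oS: "open (- S)" using S by (simp add: finite_imp_closed open_Compl)
  \<comment> \<open>The affine rescaling sends u = - L to 0, u = - L/2 to 1/8, and u = L/2 to 3/8,
    the end of the range in which b'^2 <= 4 b'' is available.\<close>
  define U where "U w = 1 / 4 + (1 / (4 * L)) * u w" for w
  have UC: "C_k_on k U (- S)" for k
    unfolding U_def[abs_def] by (intro C_k_on_add C_k_on_cmult C_k_on_const u oS)
  have Ulap: "laplacian U w = 0" if "w \<notin> S" for w
  proof -
    have "laplacian (\<lambda>x. 1 / 4 + c * u x) w = 0" for c
      using that laplacian_add[OF oS _ C_k_on_const[of _ "1 / 4"] C_k_on_cmult[OF oS u(1)], of w]
        laplacian_cmult[OF oS _ u(1)] u(2)[OF that] by simp
    from this[of "1 / (4 * L)"] show ?thesis unfolding U_def[abs_def] .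
  qed
  have Umono: "U w \<le> (1 + c) / 4" if "u w \<le> c * L" for w c
    using that L by (simp add: U_def field_simps)
  define G where "G w = (if w \<in> S then 0 else flat_exp 0 (U w))" for w
  have Gb: "0 \<le> G w" "G w \<le> 1" for w by (simp_all add: G_def flat_exp_nonneg flat_exp_le_1)
  have GN: "G w = 0" if "w \<in> N" for w
    using that N(3)[OF that] Umono[of w "- 1"] by (auto simp: G_def flat_exp_def)
  have GC: "C_k_on k G UNIV" for k
  proof (rule C_k_on_local)
    fix x :: complex
    show "\<exists>T. open T \<and> x \<in> T \<and> C_k_on k G T"
    proof (cases "x \<in> S")
      case True
      have "C_k_on k G N" by (rule C_k_on_cong[OF N(1) _ C_k_on_const[of _ 0]]) (simp add: GN)
      with True N show ?thesis by blast
    next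
      case False
      have "C_k_on k G (- S)"
        by (rule C_k_on_cong[OF oS _ C_k_on_real_comp[OF oS UC C_k_on_flat_exp[of k 0 UNIV]]]) (auto simp: G_def)
      with False oS show ?thesis by blast
    qed
  qed
  have Glap: "(partial_deriv 1 G w)\<^sup>2 + (partial_deriv \<i> G w)\<^sup>2 \<le> 4 * laplacian G w" if w: "w \<in> cball z R" for w
  proof (cases "w \<in> S")
    case True
    then have wN: "w \<in> N" using N(2) by blast
    have "partial_deriv b G w = partial_deriv b (\<lambda>_. 0) w" for b
      by (rule partial_deriv_cong_open[OF N(1) wN GN])
    moreover have "laplacian G w = laplacian (\<lambda>_. 0) w" by (rule laplacian_cong_open[OF N(1) wN GN])
    ultimately show ?thesis by simp
  next
    case False
    then have wS: "w \<in> - S" by simp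
    let ?g = "(partial_deriv 1 U w)\<^sup>2 + (partial_deriv \<i> U w)\<^sup>2"
    have "partial_deriv b G w = flat_exp 2 (U w) * partial_deriv b U w" for b
      using partial_deriv_cong_open[OF oS wS, of G "\<lambda>w. flat_exp 0 (U w)" b] partial_deriv2_flat_exp_comp(1)[OF oS UC wS, of b]
      by (simp add: G_def)
    then have "(partial_deriv 1 G w)\<^sup>2 + (partial_deriv \<i> G w)\<^sup>2 = (flat_exp 2 (U w))\<^sup>2 * ?g"
      by (simp add: power_mult_distrib distrib_left)
    also have "\<dots> \<le> 4 * (flat_exp 4 (U w) - 2 * flat_exp 3 (U w)) * ?g"
      using Umono[of w "1 / 2"] up[OF w False] by (intro mult_right_mono flat_exp_power2_le) auto
    also have "\<dots> = 4 * laplacian (\<lambda>w. flat_exp 0 (U w)) w"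
      unfolding laplacian_flat_exp_comp[OF oS UC wS] Ulap[OF False] by simp
    also have "laplacian (\<lambda>w. flat_exp 0 (U w)) w = laplacian G w"
      by (rule laplacian_cong_open[OF oS wS]) (simp add: G_def)
    finally show ?thesis .
  qed
  let ?\<eta> = "cutoff z R"
  have diff: "?\<eta> differentiable (at w)" "G differentiable (at w)" "partial_deriv b G differentiable (at w)" for w b
    using C_k_on_Suc_differentiable[OF C_k_on_cutoff] C_k_on_Suc_differentiable[OF GC]
      C_k_on_Suc_differentiable[OF C_k_on_Suc_partial[OF GC]] by auto
  define f where "f w = ?\<eta> w * G w" for w
  have fC: "C_k_on k f UNIV" for k
    unfolding f_def[abs_def] by (intro C_k_on_mult C_k_on_cutoff GC open_UNIV)
  have f0: "f w = 0" if "w \<notin> cball z R - N" for w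
    using that cutoff_outside[OF R] GN by (auto simp: f_def)
  define v :: "complex \<Rightarrow> complex" where "v w = of_real (f w)" for w
  have vt: "v \<in> test_functions \<Omega>"
  proof (rule test_functionsI)
    show "smooth_on v UNIV"
      unfolding smooth_on_def v_def[abs_def] by (intro allI C_k_on_of_real fC open_UNIV)
    show "compact (cball z R - N)" using N(1) by (simp add: compact_diff)
    show "cball z R - N \<subseteq> \<Omega>" using cover by auto
    show "v w = 0" if "w \<notin> cball z R - N" for w using f0[OF that] by (simp add: v_def)
  qed
  define V where "V b w = (?\<eta> w)\<^sup>2 * partial_deriv b G w" for b w
  have V1: "C_k_on (Suc 0) (V b) UNIV" for b
    unfolding V_def[abs_def] power2_eq_square
    by (intro C_k_on_mult C_k_on_cutoff C_k_on_Suc_partial[OF GC] open_UNIV)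
  have far: "w \<notin> cball z R" if "norm z + R < norm w" for w
    using that norm_triangle_ineq[of "w - z" z] by (auto simp: dist_norm norm_minus_commute)
  have V0: "V b w = 0" if "norm z + R < norm w" for b w
    using cutoff_outside[OF R far[OF that]] by (simp add: V_def)
  have dV: "partial_deriv b (V b) w = (?\<eta> w)\<^sup>2 * partial_deriv b (partial_deriv b G) w
      + 2 * ?\<eta> w * partial_deriv b ?\<eta> w * partial_deriv b G w" for b w
  proof -
    have "partial_deriv b (\<lambda>w. ?\<eta> w * ?\<eta> w) w = ?\<eta> w * partial_deriv b ?\<eta> w + partial_deriv b ?\<eta> w * ?\<eta> w"
      by (rule partial_deriv_mult[OF diff(1,1)])
    moreover have "partial_deriv b (\<lambda>w. (?\<eta> w * ?\<eta> w) * partial_deriv b G w) w =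
        (?\<eta> w * ?\<eta> w) * partial_deriv b (partial_deriv b G) w + partial_deriv b (\<lambda>w. ?\<eta> w * ?\<eta> w) w * partial_deriv b G w"
      by (rule partial_deriv_mult) (intro differentiable_mult diff)+
    ultimately show ?thesis unfolding V_def[abs_def] power2_eq_square by (simp add: algebra_simps)
  qed
  have iV: "integrable lborel (partial_deriv b (V b))" for b
    using C_k_on_Suc_partial[OF V1] partial_deriv_compact_support[OF V0]
    by (intro integrable_continuous_compact_support[of _ "norm z + R"]) (auto simp: C_k_on.simps(1))
  have zero: "integral\<^sup>L lborel (partial_deriv b (V b)) = 0" for b
    by (rule integral_partial_deriv_eq_0[of "V b" "norm z + R", OF V1 V0])
  \<comment> \<open>Let h be the cut-off, a its derivative and g that of \<open>G\<close>. The
    product rule leaves 2 (h g)^2 + 2 a^2. In 16 times the divergence the Laplacian of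
    \<open>G\<close> yields at least 4 (h g)^2, and the cross term costs at most 2 (h g)^2 + 128
    a^2. Hence the coefficient 130, and 2080 = 130 times 16.\<close>
  have le: "(norm (partial_deriv 1 v w))\<^sup>2 + (norm (partial_deriv \<i> v w))\<^sup>2 \<le>
      2080 / R\<^sup>2 * indicator (cball z R) w + 16 * (partial_deriv 1 (V 1) w + partial_deriv \<i> (V \<i>) w)" for w
  proof -
    have pv: "norm (partial_deriv b v w) = \<bar>?\<eta> w * partial_deriv b G w + partial_deriv b ?\<eta> w * G w\<bar>" for b
    proof -
      have "partial_deriv b v w = of_real (partial_deriv b f w)"
        unfolding v_def[abs_def]
        by (rule partial_deriv_bounded_linear[OF bounded_linear_of_real C_k_on_Suc_differentiable[OF fC]]) simp
      moreover have "partial_deriv b f w = ?\<eta> w * partial_deriv b G w + partial_deriv b ?\<eta> w * G w"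
        unfolding f_def[abs_def] by (rule partial_deriv_mult[OF diff(1,2)])
      ultimately show ?thesis by (simp only: norm_of_real)
    qed
    define h where "h = ?\<eta> w"
    define a where "a b = partial_deriv b ?\<eta> w" for b
    define g where "g b = partial_deriv b G w" for b
    have 1: "(h * g b + a b * G w)\<^sup>2 \<le> 2 * (h * g b)\<^sup>2 + 2 * (a b)\<^sup>2" for b
    proof -
      have "(h * g b + a b * G w)\<^sup>2 \<le> 2 * (h * g b)\<^sup>2 + 2 * (a b * G w)\<^sup>2"
        using zero_le_power2[of "h * g b - a b * G w"] by (simp add: power2_eq_square algebra_simps)
      also have "(a b * G w)\<^sup>2 \<le> (a b)\<^sup>2 * 1"
        unfolding power_mult_distrib using Gb[of w] by (intro mult_left_mono) (auto simp: power_le_one)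
      finally show ?thesis by simp
    qed
    have 2: "- (2 * (h * g b)\<^sup>2) - 128 * (a b)\<^sup>2 \<le> 16 * (2 * h * a b * g b)" for b
      using zero_le_power2[of "h * g b + 8 * a b"] by (simp add: power2_eq_square algebra_simps)
    have 3: "h\<^sup>2 * ((g 1)\<^sup>2 + (g \<i>)\<^sup>2) \<le> h\<^sup>2 * (4 * laplacian G w)"
    proof (cases "w \<in> cball z R")
      case True
      then show ?thesis unfolding g_def by (intro mult_left_mono Glap) auto
    qed (simp add: h_def cutoff_outside[OF R])
    have 4: "(a 1)\<^sup>2 + (a \<i>)\<^sup>2 \<le> 16 / R\<^sup>2 * indicator (cball z R) w"
      unfolding a_def by (rule cutoff_gradient[OF R])
    have "(h * g 1 + a 1 * G w)\<^sup>2 + (h * g \<i> + a \<i> * G w)\<^sup>2 \<le>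
      130 * ((a 1)\<^sup>2 + (a \<i>)\<^sup>2) + 16 * (h\<^sup>2 * laplacian G w + 2 * h * a 1 * g 1 + 2 * h * a \<i> * g \<i>)"
      using 1[of 1] 1[of \<i>] 2[of 1] 2[of \<i>] 3 by (simp add: power_mult_distrib algebra_simps)
    also have "\<dots> \<le> 130 * (16 / R\<^sup>2 * indicator (cball z R) w) + 16 * (partial_deriv 1 (V 1) w + partial_deriv \<i> (V \<i>) w)"
    proof -
      have "130 * ((a 1)\<^sup>2 + (a \<i>)\<^sup>2) \<le> 130 * (16 / R\<^sup>2 * indicator (cball z R) w)"
        using 4 by (rule mult_left_mono) simp
      moreover have "h\<^sup>2 * laplacian G w + 2 * h * a 1 * g 1 + 2 * h * a \<i> * g \<i> =
          partial_deriv 1 (V 1) w + partial_deriv \<i> (V \<i>) w"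
        unfolding dV by (simp add: h_def a_def g_def laplacian_def algebra_simps)
      ultimately show ?thesis by simp
    qed
    finally show ?thesis by (simp add: pv h_def a_def g_def)
  qed
  have grad: "(test_grad_norm \<Omega> v)\<^sup>2 \<le> 2080 * pi"
  proof -
    have i: "integrable lborel (indicator (cball z R) :: complex \<Rightarrow> real)"
      using emeasure_bounded_finite[OF bounded_cball, of z R] by (intro integrable_real_indicator) auto
    have m: "measure lborel (cball z R) = pi * R\<^sup>2"
      using R by (simp add: content_cball unit_ball_vol_2)
    have "(test_grad_norm \<Omega> v)\<^sup>2 \<le> integral\<^sup>L lborel (\<lambda>w. 2080 / R\<^sup>2 * indicator (cball z R) w
        + 16 * (partial_deriv 1 (V 1) w + partial_deriv \<i> (V \<i>) w))"
      unfolding test_grad_norm_power2[OF \<Omega> vt]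
      by (intro integral_mono le Bochner_Integration.integrable_add integrable_mult_right test_functions_power2_integrable[OF vt] i iV)
    also have "\<dots> = 2080 / R\<^sup>2 * (pi * R\<^sup>2)"
      using i iV zero m by simp
    finally show ?thesis using R by simp
  qed
  let ?k = "flat_exp 0 (3 / 4) * flat_exp 0 (1 / 8)"
  let ?I = "\<lambda>w. indicator (cball z R) w * \<bar>u w\<bar>"
  have L2: "?k\<^sup>2 * (pi * (R / 2)\<^sup>2 - 2 / L * integral\<^sup>L lborel ?I) \<le> (L2_norm \<Omega> v)\<^sup>2"
  proof -
    have i: "integrable lborel (indicator (ball z (R / 2)) :: complex \<Rightarrow> real)"
      using emeasure_bounded_finite[OF bounded_ball, of z "R / 2"] by (intro integrable_real_indicator) auto
    have m: "measure lborel (ball z (R / 2)) = pi * (R / 2)\<^sup>2"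
      using R by (simp add: content_ball unit_ball_vol_2)
    \<comment> \<open>Where \<open>u\<close> is at least - L/2 both factors of \<open>f\<close> are
      bounded below. Elsewhere 2 |u| / L exceeds 1, so the left side is nonpositive: Chebyshev's
      inequality in pointwise form.\<close>
    have pt: "?k\<^sup>2 * (indicator (ball z (R / 2)) w - 2 / L * ?I w) \<le> (norm (v w))\<^sup>2" if w: "w \<notin> S" for w
    proof (cases "w \<in> ball z (R / 2) \<and> - (1 / 2) * L \<le> u w")
      case True
      then have "U w \<ge> 1 / 8" using L by (simp add: U_def field_simps)
      then have "flat_exp 0 (1 / 8) \<le> G w" using w by (simp add: G_def flat_exp_mono_0)
      then have "?k \<le> f w"
        unfolding f_def using True R cutoff_ge[OF R] by (intro mult_mono flat_exp_nonneg cutoff_bounds) auto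
      then have "?k\<^sup>2 \<le> (norm (v w))\<^sup>2"
        by (intro power_mono mult_nonneg_nonneg flat_exp_nonneg) (auto simp: v_def)
      moreover have "?k\<^sup>2 * (indicator (ball z (R / 2)) w - 2 / L * ?I w) \<le> ?k\<^sup>2 * 1"
        using True L by (intro mult_left_mono) (auto simp: indicator_def)
      ultimately show ?thesis by simp
    next
      case False
      have "indicator (ball z (R / 2)) w - 2 / L * ?I w \<le> 0"
      proof (cases "w \<in> ball z (R / 2)")
        case True
        then have "w \<in> cball z R" using R by (auto simp: mem_ball mem_cball)
        moreover have "L \<le> 2 * \<bar>u w\<bar>" using True False by simp
        ultimately show ?thesis using True L by (simp add: pos_le_divide_eq)
      qed (use L in simp)
      then have "?k\<^sup>2 * (indicator (ball z (R / 2)) w - 2 / L * ?I w) \<le> 0"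
        by (intro mult_nonneg_nonpos) auto
      then show ?thesis by (rule order_trans) simp
    qed
    have le: "integral\<^sup>L lborel (\<lambda>w. ?k\<^sup>2 * (indicator (ball z (R / 2)) w - 2 / L * ?I w)) \<le> integral\<^sup>L lborel (\<lambda>w. (norm (v w))\<^sup>2)"
    proof (rule integral_mono_AE)
      have "AE w in lborel. w \<notin> S" using S by (intro AE_not_in finite_imp_null_set_lborel)
      then show "AE w in lborel. ?k\<^sup>2 * (indicator (ball z (R / 2)) w - 2 / L * ?I w) \<le> (norm (v w))\<^sup>2"
        by eventually_elim (rule pt)
    qed (intro integrable_mult_right Bochner_Integration.integrable_diff i ui test_functions_power2_integrable[OF vt])+
    have eq: "integral\<^sup>L lborel (\<lambda>w. ?k\<^sup>2 * (indicator (ball z (R / 2)) w - 2 / L * ?I w)) =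
        ?k\<^sup>2 * (pi * (R / 2)\<^sup>2 - 2 / L * integral\<^sup>L lborel ?I)"
      using i ui m by (simp only: integral_mult_right_zero Bochner_Integration.integral_diff[OF i integrable_mult_right[OF ui]]) simp
    have "(L2_norm \<Omega> v)\<^sup>2 = integral\<^sup>L lborel (\<lambda>w. (norm (v w))\<^sup>2)"
      by (rule L2_norm_power2_lborel[OF \<Omega> test_functions_continuous[OF vt] test_functions_outside[OF vt]])
    with le eq show ?thesis by (simp only:)
  qed
  show ?thesis by (rule that[OF vt grad L2])
qed

text \<open>A bound for the integral of |ln |w - q|| over a disc of radius \<open>R\<close> that is
  the same for all \<open>q\<close> in the disc, so that \<open>L\<close> can be chosen in terms of
  \<open>R\<close> before the polynomial is known.\<close>

definition log_mass :: "real \<Rightarrow> real" where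
  "log_mass R = integral\<^sup>L lborel (\<lambda>y::complex. indicator (ball 0 (2 * R + 1)) y * inverse (norm y)) + 2 * R * (pi * R\<^sup>2)"

text \<open>The inequality ln x <= x - 1 is applied to x and to 1/x. At 0 both sides vanish, since
  \<open>ln 0\<close> and \<open>inverse 0\<close> are 0.\<close>

lemma abs_ln_le: "0 \<le> x \<Longrightarrow> \<bar>ln x\<bar> \<le> inverse x + (x::real)"
proof (cases "x = 0")
  case False
  assume "0 \<le> x"
  with False have x: "x > 0" by simp
  then have "ln x \<le> x - 1" "ln (inverse x) \<le> inverse x - 1" by (intro ln_le_minus_one; simp)+
  moreover have "ln (inverse x) = - ln x" "0 < inverse x" using x by (simp_all add: ln_inverse)
  ultimately show ?thesis using x by linarith
qed simp

lemma integral_abs_ln: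
  fixes q z :: complex
  assumes R: "R > 0" and q: "q \<in> cball z R"
  shows "integrable lborel (\<lambda>w. indicator (cball z R) w * \<bar>ln (cmod (w - q))\<bar>)" (is "integrable _ ?f")
    and "integral\<^sup>L lborel (\<lambda>w. indicator (cball z R) w * \<bar>ln (cmod (w - q))\<bar>) \<le> log_mass R"
proof -
  define k :: "complex \<Rightarrow> real" where "k y = indicator (ball 0 (2 * R + 1)) y * inverse (norm y)" for y
  have k: "integrable lborel (\<lambda>w. k (w + - q))" "integral\<^sup>L lborel (\<lambda>w. k (w + - q)) = integral\<^sup>L lborel k"
    using integrable_lborel_shift[of k "- q"] integrable_inverse_norm[of "2 * R + 1"] by (simp_all add: k_def[abs_def])
  have i: "integrable lborel (indicator (cball z R) :: complex \<Rightarrow> real)"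
    using emeasure_bounded_finite[OF bounded_cball, of z R] by (intro integrable_real_indicator) auto
  have le: "norm (?f w) \<le> k (w + - q) + 2 * R * indicator (cball z R) w" for w
  proof (cases "w \<in> cball z R")
    case True
    have "cmod (w - q) \<le> 2 * R"
      using True q norm_triangle_ineq4[of "w - z" "q - z"] by (auto simp: dist_norm norm_minus_commute)
    then show ?thesis using True abs_ln_le[of "cmod (w - q)"] by (simp add: k_def)
  qed (use R in \<open>simp add: k_def\<close>)
  have le': "?f w \<le> k (w + - q) + 2 * R * indicator (cball z R) w" for w
    using le[of w] by (rule order_trans[rotated]) simp
  have g: "integrable lborel (\<lambda>w. k (w + - q) + 2 * R * indicator (cball z R) w)"
    by (intro Bochner_Integration.integrable_add k(1) integrable_mult_right i)
  show int: "integrable lborel ?f"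
  proof (rule Bochner_Integration.integrable_bound[OF g])
    show "AE w in lborel. norm (?f w) \<le> norm (k (w + - q) + 2 * R * indicator (cball z R) w)"
      by (intro AE_I2 order_trans[OF le]) simp
    show "?f \<in> borel_measurable lborel"
      unfolding measurable_lborel1 by (intro borel_measurable_times borel_measurable_indicator) (simp, measurable)
  qed
  have "integral\<^sup>L lborel ?f \<le> integral\<^sup>L lborel (\<lambda>w. k (w + - q) + 2 * R * indicator (cball z R) w)"
    by (intro integral_mono int g le')
  also have "\<dots> = log_mass R"
    using R k i by (simp add: log_mass_def k_def[abs_def] content_cball unit_ball_vol_2)
  finally show "integral\<^sup>L lborel ?f \<le> log_mass R" .
qed

lemma log_cap_mono: "E \<subseteq> F \<Longrightarrow> log_cap E \<le> log_cap F"
  unfolding log_cap_def by (rule SUP_subset_mono) (auto simp: compact_prob_measures_def)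

text \<open>The harmonic function is u = (ln |p|) / n for a monic polynomial p of degree n. It is
  below - L near the obstacle and at most ln (2 R) <= L/2 on the disc. As an average of logarithms
  it satisfies estimates independent of n, a degree over which there is no control.\<close>

lemma small_capacity_test_function:
  assumes \<Omega>: "open \<Omega>" and R: "R \<ge> 1" and L: "L > 0" "2 * ln (2 * R) \<le> L"
    and cap: "log_cap (ball z (2 * R) \<inter> - \<Omega>) < ennreal (exp (- L))"
  obtains v where "v \<in> test_functions \<Omega>" "(test_grad_norm \<Omega> v)\<^sup>2 \<le> 2080 * pi"
    "(flat_exp 0 (3 / 4) * flat_exp 0 (1 / 8))\<^sup>2 * (pi * (R / 2)\<^sup>2 - 2 / L * log_mass R) \<le> (L2_norm \<Omega> v)\<^sup>2"
proof -
  define F where "F = cball z R - \<Omega>"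
  have F: "compact F" unfolding F_def using \<Omega> by (simp add: compact_diff)
  have Fb: "F \<subseteq> ball z (2 * R) \<inter> - \<Omega>" using R by (auto simp: F_def)
  have R0: "R > 0" using R by simp
  obtain n :: nat and q where q: "n > 0" "\<And>i. i < n \<Longrightarrow> q i \<in> cball z R"
    "\<And>w. w \<in> F \<Longrightarrow> cmod (\<Prod>i<n. w - q i) < exp (- L) ^ n"
  proof (cases "F = {}")
    \<comment> \<open>Without an obstacle any monic polynomial with zeros in the disc will
      do.\<close>
    case True
    then show ?thesis using that[of 1 "\<lambda>_. z"] R by auto
  next
    case False
    have "log_cap F < ennreal (exp (- L))" using log_cap_mono[OF Fb] cap by (rule order.strict_trans1)
    then obtain n :: nat and q where "n > 0" "\<And>i. i < n \<Longrightarrow> q i \<in> F" "\<And>z. z \<in> F \<Longrightarrow> cmod (\<Prod>i<n. z - q i) < exp (- L) ^ n"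
      using small_polynomial_if_log_cap_less[OF F _ False, of z "2 * R" "exp (- L)"] Fb R L by auto
    then show ?thesis using that[of n q] by (auto simp: F_def)
  qed
  define S where "S = q ` {..<n}"
  have S: "finite S" by (simp add: S_def)
  \<comment> \<open>The uniform measure on indices, rather than on the set of zeros, counts
    multiplicities.\<close>
  define M where "M = (uniform_count_measure {..<n} :: nat measure)"
  interpret M: log_potential M q S
  proof -
    interpret prob_space M unfolding M_def using q(1) by (intro prob_space_uniform_count_measure) auto
    show "log_potential M q S"
    proof
      show "q \<in> borel_measurable M"
        unfolding M_def by (subst measurable_cong_sets[OF sets_uniform_count_measure_count_space refl]) simp
      show "compact S" using S by (rule finite_imp_compact)
      show "q s \<in> S" if "s \<in> space M" for s
        using that by (simp add: M_def S_def space_uniform_count_measure)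
    qed
  qed
  define u where "u w = (\<Sum>i<n. ln (cmod (w - q i))) / n" for w
  have uM: "M.potential = u"
    by (rule ext) (simp add: M.potential_def u_def, simp add: M_def integral_uniform_count_measure)
  have avg: "(\<Sum>i<n. t i) / n \<le> c" if "\<And>i. i < n \<Longrightarrow> t i \<le> c" for t :: "nat \<Rightarrow> real" and c
    using sum_bounded_above[of "{..<n}" t c] that q(1) by (simp add: pos_divide_le_eq mult.commute)
  define N where "N = {w. cmod (\<Prod>i<n. w - q i) < exp (- L) ^ n}"
  let ?I = "\<lambda>w. indicator (cball z R) w * \<bar>u w\<bar>"
  let ?J = "\<lambda>w. (\<Sum>i<n. indicator (cball z R) w * \<bar>ln (cmod (w - q i))\<bar>) / n"
  have J: "integrable lborel ?J"
    using integral_abs_ln(1)[OF R0 q(2)] by (intro integrable_divide_zero Bochner_Integration.integrable_sum) auto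
  have IJ: "?I w \<le> ?J w" for w
  proof -
    have "\<bar>u w\<bar> \<le> (\<Sum>i<n. \<bar>ln (cmod (w - q i))\<bar>) / n"
      unfolding u_def abs_divide by (simp add: divide_right_mono sum_abs)
    then show ?thesis by (simp add: indicator_def)
  qed
  have I: "integrable lborel ?I"
  proof (rule Bochner_Integration.integrable_bound[OF J])
    show "?I \<in> borel_measurable lborel"
      unfolding u_def measurable_lborel1 by (intro borel_measurable_times borel_measurable_indicator) (simp, measurable)
    show "AE w in lborel. norm (?I w) \<le> norm (?J w)"
      using IJ by (intro AE_I2) (auto simp: abs_mult intro: order_trans[OF _ abs_ge_self])
  qed
  have "integral\<^sup>L lborel ?I \<le> integral\<^sup>L lborel ?J" by (intro integral_mono I J IJ)
  also have "\<dots> = (\<Sum>i<n. integral\<^sup>L lborel (\<lambda>w. indicator (cball z R) w * \<bar>ln (cmod (w - q i))\<bar>)) / n"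
    using integral_abs_ln(1)[OF R0 q(2)]
    by (subst integral_divide_zero, subst Bochner_Integration.integral_sum) auto
  also have "\<dots> \<le> log_mass R" by (intro avg integral_abs_ln(2) R0 q(2))
  finally have IK: "integral\<^sup>L lborel ?I \<le> log_mass R" .
  obtain v where v: "v \<in> test_functions \<Omega>" "(test_grad_norm \<Omega> v)\<^sup>2 \<le> 2080 * pi"
    "(flat_exp 0 (3 / 4) * flat_exp 0 (1 / 8))\<^sup>2 * (pi * (R / 2)\<^sup>2 - 2 / L * integral\<^sup>L lborel ?I) \<le> (L2_norm \<Omega> v)\<^sup>2"
  proof (rule harmonic_cutoff[OF \<Omega> R0 L(1) S])
    show "C_k_on k u (- S)" for k using M.C_k_on_potential by (simp add: uM)
    show "laplacian u w = 0" if "w \<notin> S" for w using M.laplacian_potential[OF that] by (simp add: uM)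
    show "open N" unfolding N_def by (intro open_Collect_less continuous_intros)
    show "S \<subseteq> N"
    proof
      fix w assume "w \<in> S"
      then have "(\<Prod>i<n. w - q i) = 0" by (auto simp: S_def)
      then have "cmod (\<Prod>i<n. w - q i) = 0" by (simp only: norm_zero)
      then show "w \<in> N" unfolding N_def mem_Collect_eq by (simp only: zero_less_power exp_gt_zero)
    qed
    show "u w \<le> - L" if "w \<in> N" "w \<notin> S" for w
    proof -
      have nz: "w - q i \<noteq> 0" if "i < n" for i using that \<open>w \<notin> S\<close> by (auto simp: S_def)
      have "(\<Sum>i<n. ln (cmod (w - q i))) = ln (cmod (\<Prod>i<n. w - q i))"
        using nz by (subst prod_norm[symmetric], subst ln_prod) auto
      also have "\<dots> \<le> ln (exp (- L) ^ n)"
        using that(1) nz by (intro ln_mono) (auto simp: N_def)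
      also have "\<dots> = n * (- L)" by (subst ln_realpow) auto
      finally show ?thesis using q(1) by (simp add: u_def pos_divide_le_eq mult.commute)
    qed
    show "cball z R - \<Omega> \<subseteq> N" using q(3) by (auto simp: N_def F_def)
    show "u w \<le> L / 2" if "w \<in> cball z R" "w \<notin> S" for w
      unfolding u_def
    proof (rule avg)
      fix i assume i: "i < n"
      have "cmod (w - q i) \<le> 2 * R"
        using that(1) q(2)[OF i] norm_triangle_ineq4[of "w - z" "q i - z"] by (auto simp: dist_norm norm_minus_commute)
      moreover have "0 < cmod (w - q i)" using that(2) i by (auto simp: S_def)
      ultimately have "ln (cmod (w - q i)) \<le> ln (2 * R)" by (intro ln_mono) auto
      then show "ln (cmod (w - q i)) \<le> L / 2" using L(2) by simp
    qed
    show "integrable lborel ?I" by (rule I)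
  qed
  show ?thesis
  proof (rule that[OF v(1,2)])
    have "2 / L * integral\<^sup>L lborel ?I \<le> 2 / L * log_mass R" using IK L(1) by (intro mult_left_mono) auto
    then have "(flat_exp 0 (3 / 4) * flat_exp 0 (1 / 8))\<^sup>2 * (pi * (R / 2)\<^sup>2 - 2 / L * log_mass R) \<le>
      (flat_exp 0 (3 / 4) * flat_exp 0 (1 / 8))\<^sup>2 * (pi * (R / 2)\<^sup>2 - 2 / L * integral\<^sup>L lborel ?I)"
      by (intro mult_left_mono) auto
    then show "(flat_exp 0 (3 / 4) * flat_exp 0 (1 / 8))\<^sup>2 * (pi * (R / 2)\<^sup>2 - 2 / L * log_mass R) \<le> (L2_norm \<Omega> v)\<^sup>2"
      using v(3) by linarith
  qed
qed

text \<open>With discs of nearly negligible obstacle at every scale, the gradient norms stay below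
  an absolute constant while the squared L2 norms grow like R^2.\<close>

lemma capacity_inradius_finite_if_poincare_test:
  assumes \<Omega>: "open \<Omega>" and poincare: "poincare_test \<Omega>"
  shows "capacity_inradius \<Omega> < \<infinity>"
proof (rule ccontr)
  assume "\<not> capacity_inradius \<Omega> < \<infinity>"
  then have inf: "capacity_inradius \<Omega> = \<infinity>" by (metis infinity_ennreal_def top.not_eq_extremum)
  obtain C where C: "C > 0" "\<And>v. v \<in> test_functions \<Omega> \<Longrightarrow> L2_norm \<Omega> v \<le> C * test_grad_norm \<Omega> v"
    using poincare by (auto simp: poincare_test_def)
  define k where "k = (flat_exp 0 (3 / 4) * flat_exp 0 (1 / 8))\<^sup>2"
  have k: "k > 0" by (simp add: k_def flat_exp_def)
  \<comment> \<open>Chosen so that \<open>k * R\<close> exceeds 8 times 2080 times C^2 by exactly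
    \<open>k\<close>, contradicting the bound that the Poincare inequality gives.\<close>
  define R where "R = 1 + 8 * (C\<^sup>2 * 2080 / k)"
  have R: "R \<ge> 1" using k by (simp add: R_def)
  \<comment> \<open>The last summand brings the loss \<open>2 / L * log_mass R\<close> below 1/8,
    which half of the main term, at least \<pi> R / 8, absorbs.\<close>
  define L where "L = 1 + 2 * ln (2 * R) + 16 * \<bar>log_mass R\<bar>"
  have lnR: "ln (2 * R) \<ge> 0" using R by simp
  have L: "L > 0" "2 * ln (2 * R) \<le> L" using lnR by (simp_all add: L_def)
  have "ennreal (2 * R) < capacity_inradius \<Omega>" by (simp add: inf)
  then obtain R' where R': "\<And>\<delta>::real. \<delta> > 0 \<Longrightarrow> \<exists>z. log_cap (ball z R' \<inter> - \<Omega>) < ennreal \<delta>" "ennreal (2 * R) < ennreal R'"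
    unfolding capacity_inradius_def less_SUP_iff by auto
  obtain z where z: "log_cap (ball z R' \<inter> - \<Omega>) < ennreal (exp (- L))" using R'(1)[of "exp (- L)"] by auto
  have "2 * R \<le> R'" using R'(2) R by (simp add: ennreal_less_iff)
  then have "log_cap (ball z (2 * R) \<inter> - \<Omega>) \<le> log_cap (ball z R' \<inter> - \<Omega>)" by (intro log_cap_mono) auto
  then have "log_cap (ball z (2 * R) \<inter> - \<Omega>) < ennreal (exp (- L))" using z by (rule order.strict_trans1)
  then obtain v where v: "v \<in> test_functions \<Omega>" "(test_grad_norm \<Omega> v)\<^sup>2 \<le> 2080 * pi"
    "k * (pi * (R / 2)\<^sup>2 - 2 / L * log_mass R) \<le> (L2_norm \<Omega> v)\<^sup>2"
    unfolding k_def using small_capacity_test_function[OF \<Omega> R L] by metis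
  have "(L2_norm \<Omega> v)\<^sup>2 \<le> (C * test_grad_norm \<Omega> v)\<^sup>2"
    using C(2)[OF v(1)] by (intro power_mono) (auto simp: L2_norm_def)
  also have "\<dots> \<le> C\<^sup>2 * (2080 * pi)" unfolding power_mult_distrib using v(2) by (intro mult_left_mono) auto
  finally have 1: "k * (pi * (R / 2)\<^sup>2 - 2 / L * log_mass R) \<le> C\<^sup>2 * (2080 * pi)" using v(3) by linarith
  have "2 / L * log_mass R \<le> 1 / 8"
  proof -
    have "16 * log_mass R \<le> L" unfolding L_def using lnR by linarith
    then show ?thesis using L(1) by (simp add: pos_divide_le_eq)
  qed
  also have "1 / 8 \<le> pi * R / 8" using R pi_gt3 mult_mono[of 1 pi 1 R] by simp
  also have "pi * R / 8 \<le> pi * (R / 2)\<^sup>2 - pi * R / 8"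
    using mult_left_mono[of 1 R "pi * R"] R by (simp add: power2_eq_square)
  finally have "pi * R / 8 \<le> pi * (R / 2)\<^sup>2 - 2 / L * log_mass R" by simp
  then have "k * (pi * R / 8) \<le> k * (pi * (R / 2)\<^sup>2 - 2 / L * log_mass R)" using k by (intro mult_left_mono) auto
  also note 1
  finally have "k * R \<le> 8 * (C\<^sup>2 * 2080)" by (simp add: field_simps)
  moreover have "k * R = k + 8 * (C\<^sup>2 * 2080)" using k by (simp add: R_def distrib_left)
  ultimately show False using k by simp
qed

theorem theorem1p3:
  fixes \<Omega> :: "complex set"
  assumes "open \<Omega>"
  shows "(dbar_closed_range \<Omega> \<longleftrightarrow> poincare_dirichlet \<Omega>) \<and>
         (poincare_dirichlet \<Omega> \<longleftrightarrow> capacity_inradius \<Omega> < \<infinity>) \<and>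
         (capacity_inradius \<Omega> < \<infinity> \<longleftrightarrow>
           (\<exists>(\<phi> :: complex \<Rightarrow> real) c. smooth_on \<phi> \<Omega> \<and> bounded (\<phi> ` \<Omega>) \<and> c > 0 \<and>
              (\<forall>z\<in>\<Omega>. laplacian \<phi> z > c)))"
  using poincare_dirichlet_iff_test[OF assms] dbar_closed_range_if_poincare_test[OF assms]
    poincare_test_if_dbar_closed_range[OF assms] capacity_inradius_finite_if_poincare_test[OF assms]
    bounded_subharmonic_if_capacity_inradius_finite[OF assms] poincare_test_if_bounded_subharmonic[OF assms]
  by metis

end
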